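(* Consider the infinite-horizon ($T=\infty$), time-invariant linear-quadratic game with $N$ decision makers described in the context, and let $F^i$, $(G^i_n)_{n\in\mathbb{N}_0}$, $H^i$, $\mathcal{D},(\mathcal{G}^p_n)_{n\in\mathbb{N}_0},\mathcal{H}^p,\mathcal{A},(\mathcal{G}^X_n)_{n\in\mathbb{N}_0},\mathcal{H}^X,\mathcal{C}$ be the constants defined there from the problem data. With $X_t=(x_t^i)_{i\in[0,N]}$ and $W_t=(w_t^i)_{i\in[0,N]}$, assume: (1) (i) $A^0$ is stable and $(A^i,B^i)$ is stabilizable for all $i\in[1,N]$; (ii) $X_0,W_0,W_1,\dots,\xi_0,\xi_1,\dots$ are mutually independent and have finite second-order moments; (iii) $(W_t)_{t\in\mathbb{N}_0}$ and $(\xi_t)_{t\in\mathbb{N}_0}$ are each independent and identically distributed. (2) For any $\hat X_0$, the infinite system of linear equations $$\hat{y}_{t} = \mathcal{D} \hat{X}_{t} + \sum_{n\in\mathbb{N}_0} \mathcal{G}_n^{p} \hat{y}_{t+n} +\mathcal{H}^p +E[\xi_0],\qquad \hat{X}_{t+1} = \mathcal{A} \hat{X}_{t} + \sum_{n\in\mathbb{N}_0} \mathcal{G}_n^X \hat{y}_{t+n} + \mathcal{H}^X+ \mathcal{C} \hat{y}_{t} + E[W_0],\qquad t\in\mathbb{N}_0,$$ has a unique solution $(\hat y_t)_{t\in\mathbb{N}_0}$, which is necessarily of the form $\hat y_t=a_t\hat X_0+b_t$, $t\in\mathbb{N}_0$, with $a_t,b_t$ not depending on $\hat X_0$; and $(a_t)_{t\in\mathbb{N}_0}$,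 $(b_t)_{t\in\mathbb{N}_0}$ are uniformly bounded. Put $\mathcal{G}^{p}:=\sum_{n\in\mathbb{N}_0} \mathcal{G}_n^{p} a_n$, $\check{\mathcal{H}}^p := \sum_{n\in\mathbb{N}_0} \mathcal{G}_n^{p} b_n + \mathcal{H}^p$, $\mathcal{G}^{X}:=\sum_{n\in\mathbb{N}_0} \mathcal{G}_n^{X} a_n$, $\check{\mathcal{H}}^X := \sum_{n\in\mathbb{N}_0} \mathcal{G}_n^{X} b_n + \mathcal{H}^X$, and let $(\bar y_t)_{t\in[0,\infty)}$ be generated by, for $t\in\mathbb{N}_0$, $$\bar{y}_t = \mathcal{D} \bar{X}_t + \mathcal{G}^{p} E[\bar{X}_t|\bar{Y}_{t-1}] + \check{\mathcal{H}}^p +\bar{\xi}_t,\qquad \bar{X}_{t+1} = \mathcal{A} \bar{X}_t + \mathcal{G}^X E[\bar{X}_t|\bar{Y}_{t-1}] + \check{\mathcal{H}}^X+ \mathcal{C} \bar{y}_t + \bar{W}_t,$$ where $\bar Y_{t-1}=(\bar y_k)_{k\in[0,t)}$ and $(\bar X_0,(\bar\xi_t)_{t\in\mathbb{N}_0},(\bar W_t)_{t\in\mathbb{N}_0})$ has the same distribution as $(X_0,(\xi_t)_{t\in\mathbb{N}_0},(W_t)_{t\in\mathbb{N}_0})$. Let $\hat{\bar X}_{t|t-1}(\cdot)$ denote the state estimator, i.e. the measurable map taking $\bar Y_{t-1}$ to $E[\bar X_t|\bar Y_{t-1}]$ for this recursion. If $\sup_{t\in[0,\infty)}E[|\bar y_t|^2]<\infty$,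 then there exists an SEBEU (subjective equilibrium under beliefs of exogenous uncertainty) in pure strategies $s\in\mathbb{S}$, defined by $$s_t^i(I_t^i,Y_{t-1}) =F^i x_t^i+G^i\, \hat{\bar{X}}_{t|t-1}(Y_{t-1}) + \check{H}^i, \qquad i\in[1,N],\ t\in\mathbb{N}_0,$$ where $G^i:=\sum_{n\in\mathbb{N}_0} G_n^i a_n$ and $\check{H}^i:=\sum_{n\in\mathbb{N}_0} G_n^i b_n + H^i$.
   Context: Notation. $\mathbb{N}_0=\{0,1,\dots\}$, $[1,N]=\{1,\dots,N\}$, $[0,N]=\{0,\dots,N\}$, $[0,\infty)=\mathbb{N}_0$ for time indices, $[0,t)=\{0,\dots,t-1\}$; $|x|_Q^2=x'Qx$; $'$ is transpose; $A\succ0$, $A\succeq0$ mean positive (semi)definite; $\mathcal{P}(\cdot)$ is the set of Borel probability measures. A matrix is stable in the discrete-time sense. All vectors are columns. A solution of an infinite linear system is a sequence for which all series involved converge and all equations hold. Game. There are $N\in\mathbb{N}$ decision makers DM$^1,\dots,$DM$^N$. DM$^i$ has state $x_t^i\in\mathbb{R}^{n_x^i}$, control $u_t^i\in\mathbb{R}^{n_u^i}$, disturbance $w_t^i\in\mathbb{R}^{n_x^i}$; environment variables are $y_t\in\mathbb{Y}=\mathbb{R}^{n_y}$, with $\xi_t\in\mathbb{R}^{n_y}$; the environment dynamics has state $x_t^0$ and disturbance $w_t^0$ in $\mathbb{R}^{n_x^0}$. For $t\in\mathbb{N}_0$, $$x_{t+1}^i=A^ix_t^i+B^iu_t^i+C^iy_t+w_t^i,\quad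 i\in[1,N],$$ $$x_{t+1}^0=A^0x_t^0+\sum_{i\in[1,N]}(B^{1,i}u_t^i+B^{2,i}x_t^i)+w_t^0,\qquad y_t=Dx_t^0+\sum_{i\in[1,N]}(E^{1,i}u_t^i+E^{2,i}x_t^i)+\xi_t,$$ with possibly random initial states $x_0^i$, $i\in[0,N]$, and given constant matrices of appropriate dimensions. DM$^i$ has stage cost $$c^i(x^i,u^i,y)=|x^i|^2_{Q^i}+|u^i|^2_{R^i}+2y'(K^iu^i+L^ix^i),\quad Q^i\succ0,\ R^i\succ0,$$ no terminal cost, and discount factor $\beta^i\in[0,1)$. Strategies. At time $t$ DM$^i$ has access to $(I_t^i,Y_{t-1})$, where $I_t^i=((x_k^i)_{k\in[0,t]},(u_k^i)_{k\in[0,t)})$ and $Y_{t-1}=(y_k)_{k\in[0,t)}$. A pure strategy $s^i=(s_t^i)_{t\in\mathbb{N}_0}$ of DM$^i$ is a collection of measurable maps giving $u_t^i=s_t^i(I_t^i,Y_{t-1})$; $\mathbb{S}^i$ is the set of these, $\mathbb{S}=\mathbb{S}^1\times\cdots\times\mathbb{S}^N$. Subjective cost. For $s^i\in\mathbb{S}^i$ and a deterministic sequence $\bar Z=(\bar z_t)_{t\in\mathbb{N}_0}\in\mathbb{Y}^{[0,\infty)}$, $$J^i(s^i,\bar Z)=E\Big[\sum_{t\in\mathbb{N}_0}(\beta^i)^tc^i(x_t^i,u_t^i,\bar z_t)\Big],$$ where $x_{t+1}^i=A^ix_t^i+B^iu_t^i+C^i\bar z_t+w_t^i$ and $u_t^i=s_t^i(I_t^i,(\bar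 z_k)_{k\in[0,t)})$. For $\zeta\in\mathcal{P}(\mathbb{Y}^{[0,\infty)})$, $E^{\zeta}[J^i(s^i,\cdot)]$ is the expectation of $J^i(s^i,\cdot)$ when the sequence has law $\zeta$ (i.e. the environment variables are an exogenous sequence with law $\zeta$, independent of all other primitive random variables). SEBEU. A joint strategy $s=(s^1,\dots,s^N)\in\mathbb{S}$ is a subjective equilibrium under beliefs of exogenous uncertainty (SEBEU) in pure strategies if there exist beliefs $\zeta^1,\dots,\zeta^N\in\mathcal{P}(\mathbb{Y}^{[0,\infty)})$ with (i) $E^{\zeta^i}[J^i(s^i,\cdot)]\le E^{\zeta^i}[J^i(\tilde s^i,\cdot)]$ for all $i\in[1,N]$, $\tilde s^i\in\mathbb{S}^i$; and (ii) $\zeta^i=\zeta_s$ for all $i\in[1,N]$, where $\zeta_s$ is the law of $(y_t)_{t\in\mathbb{N}_0}$ generated endogenously by the game dynamics when all DMs use $s$. Optimal-response constants. For each $i$ (superscript $i$ omitted on the right-hand sides), let $M\succeq0$ be the unique positive semidefinite solution of $$M=Q+\beta A'(M-\beta MBS^{-1}B'M)A,\qquad S=R+\beta B'MB,$$ (which exists since $(A,B)$ is stabilizable and $Q\succ0$), and $$F^i=-\beta S^{-1}B'MA,\qquad G_0^i=-S^{-1}(K'+\beta B'MC),$$ $$G_n^i=-\beta S^{-1}B'(\beta(A+BF)')^{n-1}\big((F'K'+L')+\beta(A+BF)'MC\big),\ n\ge1,$$ $$H^i=-\beta S^{-1}B'(I-\beta(A+BF)')^{-1}M\,E[w_0].$$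 Aggregate constants (with respect to $X_t=(x_t^0,x_t^1,\dots,x_t^N)$ stacked as a column): $\mathcal{D}=[D,\ E^{1,1}F^1+E^{2,1},\dots,E^{1,N}F^N+E^{2,N}]$; $\mathcal{G}^p_n=\sum_jE^{1,j}G_n^j$; $\mathcal{H}^p=\sum_jE^{1,j}H^j$; $\mathcal{A}$ has first block row $[A^0,\ B^{1,1}F^1+B^{2,1},\dots,B^{1,N}F^N+B^{2,N}]$ and, for $j\in[1,N]$, the block row of $x^j$ has only nonzero block $A^j+B^jF^j$ in the column of $x^j$; $\mathcal{G}^X_n$ is the column stack of $\sum_jB^{1,j}G_n^j,\ B^1G_n^1,\dots,B^NG_n^N$; $\mathcal{H}^X$ is the column stack of $\sum_jB^{1,j}H^j,\ B^1H^1,\dots,B^NH^N$; $\mathcal{C}$ is the column stack of $0,C^1,\dots,C^N$. (Sums over $j\in[1,N]$.) *)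

theory Defs
  imports
    "HOL-Probability.Probability"
    "Jordan_Normal_Form.Matrix"
    "Jordan_Normal_Form.Char_Poly"
    "Jordan_Normal_Form.Gauss_Jordan_Elimination"
begin

hide_type (open) Finite_Cartesian_Product.vec
hide_const (open) Finite_Cartesian_Product.vec
unbundle no vec_syntax
unbundle no inner_syntax


section \<open>Vectors and matrices of variable dimension\<close>

text \<open>The dimensions depend on the decision maker, so vectors and matrices are those of
  \<^theory>\<open>Jordan_Normal_Form.Matrix\<close>. These types carry neither a topology nor a
  \<open>\<sigma>\<close>-algebra; limits, series, and expectations are taken componentwise, and the Borel
  \<open>\<sigma>\<close>-algebra on the space of vectors of dimension \<open>n\<close> is generated by the
  coordinates.\<close>

definition vec_borel :: "nat \<Rightarrow> real vec measure" where
  "vec_borel n =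
     vimage_algebra (carrier_vec n) (\<lambda>v. \<lambda>k\<in>{..<n}. v $ k) (\<Pi>\<^sub>M k\<in>{..<n}. borel)"

definition seq_borel :: "nat set \<Rightarrow> nat \<Rightarrow> (nat \<Rightarrow> real vec) measure" where
  "seq_borel T n = (\<Pi>\<^sub>M t\<in>T. vec_borel n)"

definition vec_sum :: "nat \<Rightarrow> ('i \<Rightarrow> real vec) \<Rightarrow> 'i set \<Rightarrow> real vec" where
  "vec_sum n f I = vec n (\<lambda>k. \<Sum>i\<in>I. f i $ k)"

definition mat_sum :: "nat \<Rightarrow> nat \<Rightarrow> ('i \<Rightarrow> real mat) \<Rightarrow> 'i set \<Rightarrow> real mat" where
  "mat_sum nr nc f I = mat nr nc (\<lambda>kl. \<Sum>i\<in>I. f i $$ kl)"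

definition vec_summable :: "nat \<Rightarrow> (nat \<Rightarrow> real vec) \<Rightarrow> bool" where
  "vec_summable n f \<longleftrightarrow> (\<forall>k<n. summable (\<lambda>m. f m $ k))"

definition vec_suminf :: "nat \<Rightarrow> (nat \<Rightarrow> real vec) \<Rightarrow> real vec" where
  "vec_suminf n f = vec n (\<lambda>k. \<Sum>m. f m $ k)"

definition mat_suminf :: "nat \<Rightarrow> nat \<Rightarrow> (nat \<Rightarrow> real mat) \<Rightarrow> real mat" where
  "mat_suminf nr nc f = mat nr nc (\<lambda>kl. \<Sum>m. f m $$ kl)"

primrec vec_stack :: "(nat \<Rightarrow> real vec) \<Rightarrow> nat \<Rightarrow> real vec" where
  "vec_stack f 0 = f 0"
| "vec_stack f (Suc n) = vec_stack f n @\<^sub>v f (Suc n)"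

primrec col_stack :: "(nat \<Rightarrow> real mat) \<Rightarrow> nat \<Rightarrow> real mat" where
  "col_stack f 0 = f 0"
| "col_stack f (Suc n) = col_stack f n @\<^sub>r f (Suc n)"

definition row_stack :: "(nat \<Rightarrow> real mat) \<Rightarrow> nat \<Rightarrow> real mat" where
  "row_stack f n = (col_stack (\<lambda>i. (f i)\<^sup>T) n)\<^sup>T"

text \<open>Unspecified for singular matrices; \<open>S\<close> and \<open>I - \<beta>(A + BF)'\<close> below are
  invertible under the standing assumptions.\<close>

definition mat_inv :: "real mat \<Rightarrow> real mat" where
  "mat_inv A = the (mat_inverse A)"

definition quad_form :: "real mat \<Rightarrow> real vec \<Rightarrow> real" where
  "quad_form Q x = x \<bullet> (Q *\<^sub>v x)"

definition pos_def :: "nat \<Rightarrow> real mat \<Rightarrow> bool" where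
  "pos_def n A \<longleftrightarrow> A \<in> carrier_mat n n \<and> A\<^sup>T = A \<and>
     (\<forall>v\<in>carrier_vec n. v \<noteq> 0\<^sub>v n \<longrightarrow> quad_form A v > 0)"

definition pos_semidef :: "nat \<Rightarrow> real mat \<Rightarrow> bool" where
  "pos_semidef n A \<longleftrightarrow> A \<in> carrier_mat n n \<and> A\<^sup>T = A \<and>
     (\<forall>v\<in>carrier_vec n. quad_form A v \<ge> 0)"

definition schur_stable :: "real mat \<Rightarrow> bool" where
  "schur_stable A \<longleftrightarrow> (\<forall>e. eigenvalue (map_mat complex_of_real A) e \<longrightarrow> cmod e < 1)"

definition stabilizable :: "real mat \<Rightarrow> real mat \<Rightarrow> bool" where
  "stabilizable A B \<longleftrightarrow> (\<exists>F\<in>carrier_mat (dim_col B) (dim_col A). schur_stable (A + B * F))"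


section \<open>Expectations\<close>

definition vec_mean :: "'w measure \<Rightarrow> nat \<Rightarrow> ('w \<Rightarrow> real vec) \<Rightarrow> real vec" where
  "vec_mean M n X = vec n (\<lambda>k. \<integral>\<omega>. X \<omega> $ k \<partial>M)"

definition vec_cond_exp ::
  "'w measure \<Rightarrow> 'w measure \<Rightarrow> nat \<Rightarrow> ('w \<Rightarrow> real vec) \<Rightarrow> 'w \<Rightarrow> real vec" where
  "vec_cond_exp M F n X \<omega> = vec n (\<lambda>k. real_cond_exp M F (\<lambda>\<omega>. X \<omega> $ k) \<omega>)"

text \<open>Costs are not bounded and may have infinite expectation, so the expectation is taken in
  the extended reals rather than by the Bochner integral, which would give a strategy of infinite
  cost the value 0. If both parts are infinite, the value is \<open>\<infinity> - \<infinity> = \<infinity>\<close>.\<close>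

definition ereal_expectation :: "'w measure \<Rightarrow> ('w \<Rightarrow> ereal) \<Rightarrow> ereal" where
  "ereal_expectation M f =
     enn2ereal (\<integral>\<^sup>+\<omega>. e2ennreal (f \<omega>) \<partial>M) - enn2ereal (\<integral>\<^sup>+\<omega>. e2ennreal (- f \<omega>) \<partial>M)"


section \<open>The game\<close>

text \<open>The environment dynamics has index 0 in \<open>dimx\<close> and \<open>Amat\<close>; the decision
  makers have indices 1 to \<open>nDM\<close>. The fields \<open>B1mat\<close>, \<open>B2mat\<close>,
  \<open>E1mat\<close>, \<open>E2mat\<close> are the matrices $B^{1,i}$, $B^{2,i}$, $E^{1,i}$, $E^{2,i}$,
  and \<open>disc\<close> is the discount factor.\<close>

record lq_game =
  nDM :: nat
  dimx :: "nat \<Rightarrow> nat"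
  dimu :: "nat \<Rightarrow> nat"
  dimy :: nat
  Amat :: "nat \<Rightarrow> real mat"
  Bmat :: "nat \<Rightarrow> real mat"
  Cmat :: "nat \<Rightarrow> real mat"
  B1mat :: "nat \<Rightarrow> real mat"
  B2mat :: "nat \<Rightarrow> real mat"
  Dmat :: "real mat"
  E1mat :: "nat \<Rightarrow> real mat"
  E2mat :: "nat \<Rightarrow> real mat"
  Qmat :: "nat \<Rightarrow> real mat"
  Rmat :: "nat \<Rightarrow> real mat"
  Kmat :: "nat \<Rightarrow> real mat"
  Lmat :: "nat \<Rightarrow> real mat"
  disc :: "nat \<Rightarrow> real"

definition lq_game_data :: "lq_game \<Rightarrow> bool" where
  "lq_game_data g \<longleftrightarrow>
     1 \<le> nDM g \<and>
     Amat g 0 \<in> carrier_mat (dimx g 0) (dimx g 0) \<and>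
     Dmat g \<in> carrier_mat (dimy g) (dimx g 0) \<and>
     (\<forall>i\<in>{1..nDM g}.
        Amat g i \<in> carrier_mat (dimx g i) (dimx g i) \<and>
        Bmat g i \<in> carrier_mat (dimx g i) (dimu g i) \<and>
        Cmat g i \<in> carrier_mat (dimx g i) (dimy g) \<and>
        B1mat g i \<in> carrier_mat (dimx g 0) (dimu g i) \<and>
        B2mat g i \<in> carrier_mat (dimx g 0) (dimx g i) \<and>
        E1mat g i \<in> carrier_mat (dimy g) (dimu g i) \<and>
        E2mat g i \<in> carrier_mat (dimy g) (dimx g i) \<and>
        pos_def (dimx g i) (Qmat g i) \<and>
        pos_def (dimu g i) (Rmat g i) \<and>
        Kmat g i \<in> carrier_mat (dimy g) (dimu g i) \<and>
        Lmat g i \<in> carrier_mat (dimy g) (dimx g i) \<and>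
        0 \<le> disc g i \<and> disc g i < 1)"

definition dimX :: "lq_game \<Rightarrow> nat" where
  "dimX g = (\<Sum>i\<in>{0..nDM g}. dimx g i)"

text \<open>The primitive random variables: \<open>init_x p i\<close> is $x_0^i$, \<open>dist_w p t i\<close> is
  $w_t^i$, and \<open>obs_xi p t\<close> is $\xi_t$.\<close>

record 'w primitives =
  prob_sp :: "'w measure"
  init_x :: "nat \<Rightarrow> 'w \<Rightarrow> real vec"
  dist_w :: "nat \<Rightarrow> nat \<Rightarrow> 'w \<Rightarrow> real vec"
  obs_xi :: "nat \<Rightarrow> 'w \<Rightarrow> real vec"

definition primitive_data :: "lq_game \<Rightarrow> 'w primitives \<Rightarrow> bool" where
  "primitive_data g p \<longleftrightarrow>
     prob_space (prob_sp p) \<and>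
     (\<forall>i\<in>{0..nDM g}. init_x p i \<in> prob_sp p \<rightarrow>\<^sub>M vec_borel (dimx g i)) \<and>
     (\<forall>t. \<forall>i\<in>{0..nDM g}. dist_w p t i \<in> prob_sp p \<rightarrow>\<^sub>M vec_borel (dimx g i)) \<and>
     (\<forall>t. obs_xi p t \<in> prob_sp p \<rightarrow>\<^sub>M vec_borel (dimy g))"

definition init_X :: "lq_game \<Rightarrow> 'w primitives \<Rightarrow> 'w \<Rightarrow> real vec" where
  "init_X g p \<omega> = vec_stack (\<lambda>i. init_x p i \<omega>) (nDM g)"

definition dist_W :: "lq_game \<Rightarrow> 'w primitives \<Rightarrow> nat \<Rightarrow> 'w \<Rightarrow> real vec" where
  "dist_W g p t \<omega> = vec_stack (\<lambda>i. dist_w p t i \<omega>) (nDM g)"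

datatype source = Init | Dist nat | Obs nat

text \<open>The variables $X_0, W_0, W_1, \dots, \xi_0, \xi_1, \dots$ form one independent family; the
  components of $X_0$, or of one $W_t$, may be dependent.\<close>

definition primitives_independent :: "lq_game \<Rightarrow> 'w primitives \<Rightarrow> bool" where
  "primitives_independent g p \<longleftrightarrow>
     prob_space.indep_vars (prob_sp p)
       (\<lambda>r. case r of Init \<Rightarrow> vec_borel (dimX g) | Dist t \<Rightarrow> vec_borel (dimX g)
                    | Obs t \<Rightarrow> vec_borel (dimy g))
       (\<lambda>r. case r of Init \<Rightarrow> init_X g p | Dist t \<Rightarrow> dist_W g p t | Obs t \<Rightarrow> obs_xi p t)
       UNIV"

definition finite_second_moment :: "'w measure \<Rightarrow> nat \<Rightarrow> ('w \<Rightarrow> real vec) \<Rightarrow> bool" where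
  "finite_second_moment M n X \<longleftrightarrow> (\<forall>k<n. integrable M (\<lambda>\<omega>. (X \<omega> $ k)\<^sup>2))"

definition primitives_second_moments :: "lq_game \<Rightarrow> 'w primitives \<Rightarrow> bool" where
  "primitives_second_moments g p \<longleftrightarrow>
     finite_second_moment (prob_sp p) (dimX g) (init_X g p) \<and>
     (\<forall>t. finite_second_moment (prob_sp p) (dimX g) (dist_W g p t)) \<and>
     (\<forall>t. finite_second_moment (prob_sp p) (dimy g) (obs_xi p t))"

text \<open>Together with \<^const>\<open>primitives_independent\<close>, this makes $(W_t)_t$ and $(\xi_t)_t$
  independent and identically distributed.\<close>

definition primitives_identically_distributed :: "lq_game \<Rightarrow> 'w primitives \<Rightarrow> bool" where
  "primitives_identically_distributed g p \<longleftrightarrow>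
     (\<forall>t. distr (prob_sp p) (vec_borel (dimX g)) (dist_W g p t) =
          distr (prob_sp p) (vec_borel (dimX g)) (dist_W g p 0)) \<and>
     (\<forall>t. distr (prob_sp p) (vec_borel (dimy g)) (obs_xi p t) =
          distr (prob_sp p) (vec_borel (dimy g)) (obs_xi p 0))"

definition mean_w :: "lq_game \<Rightarrow> 'w primitives \<Rightarrow> nat \<Rightarrow> real vec" where
  "mean_w g p i = vec_mean (prob_sp p) (dimx g i) (dist_w p 0 i)"

definition mean_W :: "lq_game \<Rightarrow> 'w primitives \<Rightarrow> real vec" where
  "mean_W g p = vec_mean (prob_sp p) (dimX g) (dist_W g p 0)"

definition mean_xi :: "lq_game \<Rightarrow> 'w primitives \<Rightarrow> real vec" where
  "mean_xi g p = vec_mean (prob_sp p) (dimy g) (obs_xi p 0)"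


section \<open>Strategies and costs\<close>

text \<open>A strategy maps a time \<open>t\<close> and the histories of the own state up to \<open>t\<close>, of the
  own control before \<open>t\<close>, and of the environment variable before \<open>t\<close> to a control. The
  histories are elements of product spaces, i.e. \<^const>\<open>undefined\<close> outside their time
  range.\<close>

type_synonym strategy =
  "nat \<Rightarrow> (nat \<Rightarrow> real vec) \<Rightarrow> (nat \<Rightarrow> real vec) \<Rightarrow> (nat \<Rightarrow> real vec) \<Rightarrow> real vec"

definition strategies :: "lq_game \<Rightarrow> nat \<Rightarrow> strategy set" where
  "strategies g i = {s. \<forall>t. (\<lambda>(x, u, y). s t x u y) \<in>
     seq_borel {..t} (dimx g i) \<Otimes>\<^sub>M seq_borel {..<t} (dimu g i) \<Otimes>\<^sub>M seq_borel {..<t} (dimy g)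
     \<rightarrow>\<^sub>M vec_borel (dimu g i)}"

lemma vec_sum_fundef_cong [fundef_cong]:
  "n = n' \<Longrightarrow> I = I' \<Longrightarrow> (\<And>i. i \<in> I' \<Longrightarrow> f i = f' i) \<Longrightarrow> vec_sum n f I = vec_sum n' f' I'"
  by (simp add: vec_sum_def)

lemma restrict_fundef_cong [fundef_cong]:
  "I = I' \<Longrightarrow> (\<And>i. i \<in> I' \<Longrightarrow> f i = f' i) \<Longrightarrow> restrict f I = restrict f' I'"
  by (auto simp: restrict_def)

text \<open>The state and control of decision maker \<open>i\<close> who uses \<open>s\<close> against an exogenous
  sequence \<open>z\<close>, for realizations \<open>x0\<close>, \<open>w\<close> of its own initial state and
  disturbances.\<close>

function subj_x :: "lq_game \<Rightarrow> nat \<Rightarrow> strategy \<Rightarrow> real vec \<Rightarrow> (nat \<Rightarrow> real vec) \<Rightarrow> (nat \<Rightarrow> real vec)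
    \<Rightarrow> nat \<Rightarrow> real vec"
  and subj_u :: "lq_game \<Rightarrow> nat \<Rightarrow> strategy \<Rightarrow> real vec \<Rightarrow> (nat \<Rightarrow> real vec) \<Rightarrow> (nat \<Rightarrow> real vec)
    \<Rightarrow> nat \<Rightarrow> real vec"
where
  "subj_x g i s x0 w z 0 = x0"
| "subj_x g i s x0 w z (Suc t) =
     Amat g i *\<^sub>v subj_x g i s x0 w z t + Bmat g i *\<^sub>v subj_u g i s x0 w z t
     + Cmat g i *\<^sub>v z t + w t"
| "subj_u g i s x0 w z t =
     s t (\<lambda>k\<in>{..t}. subj_x g i s x0 w z k) (\<lambda>k\<in>{..<t}. subj_u g i s x0 w z k) (\<lambda>k\<in>{..<t}. z k)"
  by pat_completeness auto
termination
  by (relation "Wellfounded.measure (case_sum (\<lambda>(g, i, s, x0, w, z, t). 2 * t)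
                                  (\<lambda>(g, i, s, x0, w, z, t). 2 * t + 1))") auto

definition stage_cost :: "lq_game \<Rightarrow> nat \<Rightarrow> real vec \<Rightarrow> real vec \<Rightarrow> real vec \<Rightarrow> real" where
  "stage_cost g i x u y =
     quad_form (Qmat g i) x + quad_form (Rmat g i) u
     + 2 * (y \<bullet> (Kmat g i *\<^sub>v u + Lmat g i *\<^sub>v x))"

text \<open>The \<open>limsup\<close> of the partial sums is the sum of the series whenever the latter exists
  in the extended reals.\<close>

definition subj_cost :: "lq_game \<Rightarrow> 'w primitives \<Rightarrow> nat \<Rightarrow> strategy \<Rightarrow> (nat \<Rightarrow> real vec) \<Rightarrow> ereal"
where
  "subj_cost g p i s z = ereal_expectation (prob_sp p) (\<lambda>\<omega>. limsup (\<lambda>T. ereal (\<Sum>t<T.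
     disc g i ^ t * stage_cost g i
       (subj_x g i s (init_x p i \<omega>) (\<lambda>t. dist_w p t i \<omega>) z t)
       (subj_u g i s (init_x p i \<omega>) (\<lambda>t. dist_w p t i \<omega>) z t)
       (z t))))"

text \<open>The joint play under the joint strategy \<open>s\<close>, for realizations \<open>x0\<close>, \<open>w\<close>,
  \<open>\<xi>\<close> of the primitive random variables; \<open>game_x g s x0 w \<xi> 0\<close> is the state of the
  environment dynamics.\<close>

function game_x :: "lq_game \<Rightarrow> (nat \<Rightarrow> strategy) \<Rightarrow> (nat \<Rightarrow> real vec) \<Rightarrow> (nat \<Rightarrow> nat \<Rightarrow> real vec)
    \<Rightarrow> (nat \<Rightarrow> real vec) \<Rightarrow> nat \<Rightarrow> nat \<Rightarrow> real vec"
  and game_u :: "lq_game \<Rightarrow> (nat \<Rightarrow> strategy) \<Rightarrow> (nat \<Rightarrow> real vec) \<Rightarrow> (nat \<Rightarrow> nat \<Rightarrow> real vec)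
    \<Rightarrow> (nat \<Rightarrow> real vec) \<Rightarrow> nat \<Rightarrow> nat \<Rightarrow> real vec"
  and game_y :: "lq_game \<Rightarrow> (nat \<Rightarrow> strategy) \<Rightarrow> (nat \<Rightarrow> real vec) \<Rightarrow> (nat \<Rightarrow> nat \<Rightarrow> real vec)
    \<Rightarrow> (nat \<Rightarrow> real vec) \<Rightarrow> nat \<Rightarrow> real vec"
where
  "game_x g s x0 w \<xi> i 0 = x0 i"
| "game_x g s x0 w \<xi> i (Suc t) =
     (if i = 0 then
        Amat g 0 *\<^sub>v game_x g s x0 w \<xi> 0 t
        + vec_sum (dimx g 0) (\<lambda>j. B1mat g j *\<^sub>v game_u g s x0 w \<xi> j t
                               + B2mat g j *\<^sub>v game_x g s x0 w \<xi> j t) {1..nDM g}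
        + w t 0
      else
        Amat g i *\<^sub>v game_x g s x0 w \<xi> i t + Bmat g i *\<^sub>v game_u g s x0 w \<xi> i t
        + Cmat g i *\<^sub>v game_y g s x0 w \<xi> t + w t i)"
| "game_u g s x0 w \<xi> i t =
     s i t (\<lambda>k\<in>{..t}. game_x g s x0 w \<xi> i k) (\<lambda>k\<in>{..<t}. game_u g s x0 w \<xi> i k)
       (\<lambda>k\<in>{..<t}. game_y g s x0 w \<xi> k)"
| "game_y g s x0 w \<xi> t =
     Dmat g *\<^sub>v game_x g s x0 w \<xi> 0 t
     + vec_sum (dimy g) (\<lambda>j. E1mat g j *\<^sub>v game_u g s x0 w \<xi> j t
                           + E2mat g j *\<^sub>v game_x g s x0 w \<xi> j t) {1..nDM g}
     + \<xi> t"
  by pat_completeness auto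
termination
  by (relation "Wellfounded.measure (case_sum (\<lambda>(g, s, x0, w, \<xi>, i, t). 3 * t)
                        (case_sum (\<lambda>(g, s, x0, w, \<xi>, i, t). 3 * t + 1)
                                  (\<lambda>(g, s, x0, w, \<xi>, t). 3 * t + 2)))") auto

definition play_law :: "lq_game \<Rightarrow> 'w primitives \<Rightarrow> (nat \<Rightarrow> strategy) \<Rightarrow> (nat \<Rightarrow> real vec) measure"
where
  "play_law g p s = distr (prob_sp p) (seq_borel UNIV (dimy g))
     (\<lambda>\<omega> t. game_y g s (\<lambda>i. init_x p i \<omega>) (\<lambda>t i. dist_w p t i \<omega>) (\<lambda>t. obs_xi p t \<omega>) t)"

definition beliefs :: "lq_game \<Rightarrow> (nat \<Rightarrow> real vec) measure set" where
  "beliefs g = {\<zeta>. prob_space \<zeta> \<and> sets \<zeta> = sets (seq_borel UNIV (dimy g))}"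

definition sebeu :: "lq_game \<Rightarrow> 'w primitives \<Rightarrow> (nat \<Rightarrow> strategy) \<Rightarrow> bool" where
  "sebeu g p s \<longleftrightarrow>
     (\<forall>i\<in>{1..nDM g}. s i \<in> strategies g i) \<and>
     (\<exists>\<zeta>. (\<forall>i\<in>{1..nDM g}. \<zeta> i \<in> beliefs g) \<and>
          (\<forall>i\<in>{1..nDM g}. \<forall>s'\<in>strategies g i.
             ereal_expectation (\<zeta> i) (subj_cost g p i (s i))
             \<le> ereal_expectation (\<zeta> i) (subj_cost g p i s')) \<and>
          (\<forall>i\<in>{1..nDM g}. \<zeta> i = play_law g p s))"


section \<open>Optimal-response constants\<close>

definition ric_S :: "lq_game \<Rightarrow> nat \<Rightarrow> real mat \<Rightarrow> real mat" where
  "ric_S g i M = Rmat g i + disc g i \<cdot>\<^sub>m ((Bmat g i)\<^sup>T * M * Bmat g i)"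

text \<open>For \<open>(A, B)\<close> stabilizable and \<open>Q\<close> positive definite, the equation has exactly one
  positive semidefinite solution, so the definite description is proper.\<close>

definition ric_M :: "lq_game \<Rightarrow> nat \<Rightarrow> real mat" where
  "ric_M g i = (THE M. pos_semidef (dimx g i) M \<and>
     M = Qmat g i + disc g i \<cdot>\<^sub>m ((Amat g i)\<^sup>T *
           (M - disc g i \<cdot>\<^sub>m (M * Bmat g i * mat_inv (ric_S g i M) * (Bmat g i)\<^sup>T * M)) * Amat g i))"

definition opt_Sinv :: "lq_game \<Rightarrow> nat \<Rightarrow> real mat" where
  "opt_Sinv g i = mat_inv (ric_S g i (ric_M g i))"

definition opt_F :: "lq_game \<Rightarrow> nat \<Rightarrow> real mat" where
  "opt_F g i = - disc g i \<cdot>\<^sub>m (opt_Sinv g i * (Bmat g i)\<^sup>T * ric_M g i * Amat g i)"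

definition opt_Acl :: "lq_game \<Rightarrow> nat \<Rightarrow> real mat" where
  "opt_Acl g i = Amat g i + Bmat g i * opt_F g i"

definition opt_G :: "lq_game \<Rightarrow> nat \<Rightarrow> nat \<Rightarrow> real mat" where
  "opt_G g i n =
     (if n = 0 then
        - (opt_Sinv g i * ((Kmat g i)\<^sup>T + disc g i \<cdot>\<^sub>m ((Bmat g i)\<^sup>T * ric_M g i * Cmat g i)))
      else
        - disc g i \<cdot>\<^sub>m (opt_Sinv g i * (Bmat g i)\<^sup>T
          * (disc g i \<cdot>\<^sub>m (opt_Acl g i)\<^sup>T) ^\<^sub>m (n - 1)
          * (((opt_F g i)\<^sup>T * (Kmat g i)\<^sup>T + (Lmat g i)\<^sup>T)
             + disc g i \<cdot>\<^sub>m ((opt_Acl g i)\<^sup>T * ric_M g i * Cmat g i))))"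

definition opt_H :: "lq_game \<Rightarrow> 'w primitives \<Rightarrow> nat \<Rightarrow> real vec" where
  "opt_H g p i =
     (- disc g i \<cdot>\<^sub>m (opt_Sinv g i * (Bmat g i)\<^sup>T
        * mat_inv (1\<^sub>m (dimx g i) - disc g i \<cdot>\<^sub>m (opt_Acl g i)\<^sup>T) * ric_M g i)) *\<^sub>v mean_w g p i"


section \<open>Aggregate constants\<close>

definition agg_D :: "lq_game \<Rightarrow> real mat" where
  "agg_D g = row_stack (\<lambda>j. if j = 0 then Dmat g else E1mat g j * opt_F g j + E2mat g j) (nDM g)"

definition agg_Gp :: "lq_game \<Rightarrow> nat \<Rightarrow> real mat" where
  "agg_Gp g n = mat_sum (dimy g) (dimy g) (\<lambda>j. E1mat g j * opt_G g j n) {1..nDM g}"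

definition agg_Hp :: "lq_game \<Rightarrow> 'w primitives \<Rightarrow> real vec" where
  "agg_Hp g p = vec_sum (dimy g) (\<lambda>j. E1mat g j *\<^sub>v opt_H g p j) {1..nDM g}"

definition agg_A :: "lq_game \<Rightarrow> real mat" where
  "agg_A g = col_stack (\<lambda>i. row_stack (\<lambda>j.
     if i = 0 then (if j = 0 then Amat g 0 else B1mat g j * opt_F g j + B2mat g j)
     else if j = i then Amat g i + Bmat g i * opt_F g i
     else 0\<^sub>m (dimx g i) (dimx g j)) (nDM g)) (nDM g)"

definition agg_GX :: "lq_game \<Rightarrow> nat \<Rightarrow> real mat" where
  "agg_GX g n = col_stack (\<lambda>i.
     if i = 0 then mat_sum (dimx g 0) (dimy g) (\<lambda>j. B1mat g j * opt_G g j n) {1..nDM g}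
     else Bmat g i * opt_G g i n) (nDM g)"

definition agg_HX :: "lq_game \<Rightarrow> 'w primitives \<Rightarrow> real vec" where
  "agg_HX g p = vec_stack (\<lambda>i.
     if i = 0 then vec_sum (dimx g 0) (\<lambda>j. B1mat g j *\<^sub>v opt_H g p j) {1..nDM g}
     else Bmat g i *\<^sub>v opt_H g p i) (nDM g)"

definition agg_C :: "lq_game \<Rightarrow> real mat" where
  "agg_C g = col_stack (\<lambda>i. if i = 0 then 0\<^sub>m (dimx g 0) (dimy g) else Cmat g i) (nDM g)"


section \<open>The infinite linear system and the constants derived from its solution\<close>

definition lin_sys_solution ::
  "lq_game \<Rightarrow> 'w primitives \<Rightarrow> real vec \<Rightarrow> (nat \<Rightarrow> real vec) \<Rightarrow> bool" where
  "lin_sys_solution g p X0 y \<longleftrightarrow>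
     (\<forall>t. y t \<in> carrier_vec (dimy g)) \<and>
     (\<exists>X. X 0 = X0 \<and> (\<forall>t. X t \<in> carrier_vec (dimX g)) \<and>
       (\<forall>t.
          vec_summable (dimy g) (\<lambda>n. agg_Gp g n *\<^sub>v y (t + n)) \<and>
          vec_summable (dimX g) (\<lambda>n. agg_GX g n *\<^sub>v y (t + n)) \<and>
          y t = agg_D g *\<^sub>v X t + vec_suminf (dimy g) (\<lambda>n. agg_Gp g n *\<^sub>v y (t + n))
                + agg_Hp g p + mean_xi g p \<and>
          X (Suc t) = agg_A g *\<^sub>v X t + vec_suminf (dimX g) (\<lambda>n. agg_GX g n *\<^sub>v y (t + n))
                + agg_HX g p + agg_C g *\<^sub>v y t + mean_W g p))"

definition lim_Gp :: "lq_game \<Rightarrow> (nat \<Rightarrow> real mat) \<Rightarrow> real mat" where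
  "lim_Gp g a = mat_suminf (dimy g) (dimX g) (\<lambda>n. agg_Gp g n * a n)"

definition lim_Hp :: "lq_game \<Rightarrow> 'w primitives \<Rightarrow> (nat \<Rightarrow> real vec) \<Rightarrow> real vec" where
  "lim_Hp g p b = vec_suminf (dimy g) (\<lambda>n. agg_Gp g n *\<^sub>v b n) + agg_Hp g p"

definition lim_GX :: "lq_game \<Rightarrow> (nat \<Rightarrow> real mat) \<Rightarrow> real mat" where
  "lim_GX g a = mat_suminf (dimX g) (dimX g) (\<lambda>n. agg_GX g n * a n)"

definition lim_HX :: "lq_game \<Rightarrow> 'w primitives \<Rightarrow> (nat \<Rightarrow> real vec) \<Rightarrow> real vec" where
  "lim_HX g p b = vec_suminf (dimX g) (\<lambda>n. agg_GX g n *\<^sub>v b n) + agg_HX g p"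

definition lim_G :: "lq_game \<Rightarrow> nat \<Rightarrow> (nat \<Rightarrow> real mat) \<Rightarrow> real mat" where
  "lim_G g i a = mat_suminf (dimu g i) (dimX g) (\<lambda>n. opt_G g i n * a n)"

definition lim_H :: "lq_game \<Rightarrow> 'w primitives \<Rightarrow> nat \<Rightarrow> (nat \<Rightarrow> real vec) \<Rightarrow> real vec" where
  "lim_H g p i b = vec_suminf (dimu g i) (\<lambda>n. opt_G g i n *\<^sub>v b n) + opt_H g p i"


section \<open>The auxiliary process and its state estimator\<close>

definition past_sigma ::
  "lq_game \<Rightarrow> 'v measure \<Rightarrow> (nat \<Rightarrow> 'v \<Rightarrow> real vec) \<Rightarrow> nat \<Rightarrow> 'v measure" where
  "past_sigma g P ybar t =
     vimage_algebra (space P) (\<lambda>\<omega>. \<lambda>k\<in>{..<t}. ybar k \<omega>) (seq_borel {..<t} (dimy g))"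

definition cond_state :: "lq_game \<Rightarrow> 'v measure \<Rightarrow> (nat \<Rightarrow> 'v \<Rightarrow> real vec) \<Rightarrow> (nat \<Rightarrow> 'v \<Rightarrow> real vec)
    \<Rightarrow> nat \<Rightarrow> 'v \<Rightarrow> real vec" where
  "cond_state g P Xbar ybar t = vec_cond_exp P (past_sigma g P ybar t) (dimX g) (Xbar t)"

text \<open>The noise of the auxiliary process may live on another probability space \<open>P\<close>; the
  recursion is required almost surely because it involves conditional expectations.\<close>

definition aux_process :: "lq_game \<Rightarrow> 'w primitives \<Rightarrow> (nat \<Rightarrow> real mat) \<Rightarrow> (nat \<Rightarrow> real vec)
    \<Rightarrow> 'v measure \<Rightarrow> (nat \<Rightarrow> 'v \<Rightarrow> real vec) \<Rightarrow> (nat \<Rightarrow> 'v \<Rightarrow> real vec)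
    \<Rightarrow> (nat \<Rightarrow> 'v \<Rightarrow> real vec) \<Rightarrow> (nat \<Rightarrow> 'v \<Rightarrow> real vec) \<Rightarrow> bool" where
  "aux_process g p a b P Xbar ybar xibar Wbar \<longleftrightarrow>
     prob_space P \<and>
     (\<forall>t. Xbar t \<in> P \<rightarrow>\<^sub>M vec_borel (dimX g)) \<and>
     (\<forall>t. ybar t \<in> P \<rightarrow>\<^sub>M vec_borel (dimy g)) \<and>
     (\<forall>t. xibar t \<in> P \<rightarrow>\<^sub>M vec_borel (dimy g)) \<and>
     (\<forall>t. Wbar t \<in> P \<rightarrow>\<^sub>M vec_borel (dimX g)) \<and>
     distr P (vec_borel (dimX g) \<Otimes>\<^sub>M seq_borel UNIV (dimy g) \<Otimes>\<^sub>M seq_borel UNIV (dimX g))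
       (\<lambda>\<omega>. (Xbar 0 \<omega>, \<lambda>t. xibar t \<omega>, \<lambda>t. Wbar t \<omega>)) =
     distr (prob_sp p) (vec_borel (dimX g) \<Otimes>\<^sub>M seq_borel UNIV (dimy g) \<Otimes>\<^sub>M seq_borel UNIV (dimX g))
       (\<lambda>\<omega>. (init_X g p \<omega>, \<lambda>t. obs_xi p t \<omega>, \<lambda>t. dist_W g p t \<omega>)) \<and>
     (\<forall>t. AE \<omega> in P.
        ybar t \<omega> = agg_D g *\<^sub>v Xbar t \<omega> + lim_Gp g a *\<^sub>v cond_state g P Xbar ybar t \<omega>
                    + lim_Hp g p b + xibar t \<omega>) \<and>
     (\<forall>t. AE \<omega> in P.
        Xbar (Suc t) \<omega> = agg_A g *\<^sub>v Xbar t \<omega> + lim_GX g a *\<^sub>v cond_state g P Xbar ybar t \<omega>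
                    + lim_HX g p b + agg_C g *\<^sub>v ybar t \<omega> + Wbar t \<omega>)"

definition state_estimator :: "lq_game \<Rightarrow> 'v measure \<Rightarrow> (nat \<Rightarrow> 'v \<Rightarrow> real vec)
    \<Rightarrow> (nat \<Rightarrow> 'v \<Rightarrow> real vec) \<Rightarrow> (nat \<Rightarrow> (nat \<Rightarrow> real vec) \<Rightarrow> real vec) \<Rightarrow> bool" where
  "state_estimator g P Xbar ybar est \<longleftrightarrow>
     (\<forall>t. est t \<in> seq_borel {..<t} (dimy g) \<rightarrow>\<^sub>M vec_borel (dimX g) \<and>
          (AE \<omega> in P. est t (\<lambda>k\<in>{..<t}. ybar k \<omega>) = cond_state g P Xbar ybar t \<omega>))"

end

theory Submission
  imports
    Defs
    "Jordan_Normal_Form.Spectral_Radius"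
begin

text \<open>Fix a decision maker and a belief \<open>\<zeta>\<close>, under which the environment variables \<open>z\<close> are an
  exogenous sequence that is independent of the own noise. For every control \<open>u\<close> with states \<open>x\<close>, the
  Riccati solution \<open>M\<close> completes the squares of the cost over \<open>T\<close> periods pathwise: with
  \<open>v\<^sub>j = u\<^sub>j - F x\<^sub>j\<close>,
  \[ \sum_{j<T} \beta^j c_j + \beta^T x_T'Mx_T = \chi + \sum_{j<T} \beta^j (v_j'Sv_j + 2 v_j'g_j), \]
  where $\chi$ and the gradients $g_j$ depend only on the initial state, \<open>z\<close> and the disturbances
  (\<open>finite_horizon_completion\<close>). The gradient $g_j$ looks into the future. But $v_j$ is a function of
  the observed past, so under the expectation $g_j$ may be replaced by its forecast, which is $-S r_j$ for the
  optimal response $r_j$ over the remaining periods (\<open>gradient_forecast\<close>). Hence the expected cost is a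
  constant plus the sum of the $\beta^j E|v_j - r_j|_S^2$ minus $\beta^T E[x_T'Mx_T]$, and the
  control with $v_j = r_j$ is optimal up to the terminal term.

  The candidate uses the response over the infinite horizon instead,
  $v_j = \sum_n G_n \hat y_{j+n} + H$ for the forecasts $\hat y_{j+n}$. The gains $G_n$ decay like
  $\beta^{n/2}$, because $x'Mx$ dominates the discounted cost of the closed loop (\<open>Pb_pow_bound\<close>). So the
  error of the candidate over the horizon \<open>T\<close> is of order $T\beta^T$ (\<open>response_error\<close>,
  \<open>finite_horizon_optimality\<close>), and a competitor of finite cost has
  $\beta^T E[x_T'Mx_T] \to 0$. Letting $T \to \infty$ shows that the candidate is optimal
  (\<open>candidate_optimal\<close>).

  It remains to see that the forecasts under the equilibrium belief are $\hat y_{t+n} = a_n \hat x_t + b_n$, where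
  $\hat x_t$ is the estimate of the aggregate state, so that the candidate is the given strategy. Here
  uniqueness of the solution of the infinite linear system enters: the solution is time consistent, and
  therefore it is generated forward in time by the auxiliary recursion with all noise replaced by its mean
  (\<open>forward_recursion\<close>). Substituting the feedbacks into the game shows that the auxiliary process is the
  play of the game under the candidates (\<open>ybar_eq_play_of\<close>), so its law is the equilibrium belief. Finally,
  conditional means of the process obey that forward recursion, started at the estimate
  (\<open>event_mean_est_path\<close>, \<open>forecast_AE\<close>).

  The costs take values in the extended reals. Since $Q$ and $R$ are positive definite, adding a multiple of
  $|z_t|^2$ makes the stage costs nonnegative; the bound on the second moments of the auxiliary process makes the
  total of these additions a finite constant that is the same for all strategies (\<open>expected_cost\<close>).\<close>

section \<open>Vectors, matrices and quadratic forms\<close>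

text \<open>The distributive laws with dimensions in place of carriers, so that the simplifier can discharge
  the side conditions.\<close>

lemma add_sprod: "dim_vec u = dim_vec (w :: real vec) \<Longrightarrow> dim_vec v = dim_vec w \<Longrightarrow>
    (u + v) \<bullet> w = u \<bullet> w + v \<bullet> w"
  by (rule add_scalar_prod_distrib[where n = "dim_vec w"]) (auto intro: carrier_vecI)

lemma sprod_add: "dim_vec v = dim_vec (u :: real vec) \<Longrightarrow> dim_vec w = dim_vec u \<Longrightarrow>
    u \<bullet> (v + w) = u \<bullet> v + u \<bullet> w"
  by (rule scalar_prod_add_distrib[where n = "dim_vec u"]) (auto intro: carrier_vecI)

lemma diff_sprod: "dim_vec u = dim_vec (w :: real vec) \<Longrightarrow> dim_vec v = dim_vec w \<Longrightarrow>
    (u - v) \<bullet> w = u \<bullet> w - v \<bullet> w"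
  by (rule minus_scalar_prod_distrib[where n = "dim_vec w"]) (auto intro: carrier_vecI)

lemma sprod_diff: "dim_vec v = dim_vec (u :: real vec) \<Longrightarrow> dim_vec w = dim_vec u \<Longrightarrow>
    u \<bullet> (v - w) = u \<bullet> v - u \<bullet> w"
  by (rule scalar_prod_minus_distrib[where n = "dim_vec u"]) (auto intro: carrier_vecI)

lemma smult_sprod: "dim_vec u = dim_vec (v :: real vec) \<Longrightarrow> (c \<cdot>\<^sub>v u) \<bullet> v = c * (u \<bullet> v)"
  by simp

lemma sprod_smult: "dim_vec u = dim_vec (v :: real vec) \<Longrightarrow> u \<bullet> (c \<cdot>\<^sub>v v) = c * (u \<bullet> v)"
  by simp

lemma sprod_comm: "dim_vec u = dim_vec (v :: real vec) \<Longrightarrow> u \<bullet> v = v \<bullet> u"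
  by (rule comm_scalar_prod[where n = "dim_vec v"]) (auto intro: carrier_vecI)

lemma mult_mat_add: "dim_vec x = dim_col (A :: real mat) \<Longrightarrow> dim_vec y = dim_col A \<Longrightarrow>
    A *\<^sub>v (x + y) = A *\<^sub>v x + A *\<^sub>v y"
  by (rule mult_add_distrib_mat_vec[where nr = "dim_row A" and nc = "dim_col A"])
    (auto intro: carrier_vecI)

lemma mult_mat_diff: "dim_vec x = dim_col (A :: real mat) \<Longrightarrow> dim_vec y = dim_col A \<Longrightarrow>
    A *\<^sub>v (x - y) = A *\<^sub>v x - A *\<^sub>v y"
  by (rule mult_minus_distrib_mat_vec[where nr = "dim_row A" and nc = "dim_col A"])
    (auto intro: carrier_vecI)

lemma mult_mat_smult: "dim_vec x = dim_col (A :: real mat) \<Longrightarrow> A *\<^sub>v (c \<cdot>\<^sub>v x) = c \<cdot>\<^sub>v (A *\<^sub>v x)"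
  by (rule mult_mat_vec[where nr = "dim_row A" and nc = "dim_col A"]) (auto intro: carrier_vecI)

lemma add_mat_mult: "dim_row A = dim_row (B :: real mat) \<Longrightarrow> dim_col A = dim_col B \<Longrightarrow>
    dim_vec x = dim_col B \<Longrightarrow> (A + B) *\<^sub>v x = A *\<^sub>v x + B *\<^sub>v x"
  by (rule add_mult_distrib_mat_vec[where nr = "dim_row B" and nc = "dim_col B"])
    (auto intro: carrier_vecI)

lemma diff_mat_mult: "dim_row A = dim_row (B :: real mat) \<Longrightarrow> dim_col A = dim_col B \<Longrightarrow>
    dim_vec x = dim_col B \<Longrightarrow> (A - B) *\<^sub>v x = A *\<^sub>v x - B *\<^sub>v x"
  by (rule minus_mult_distrib_mat_vec[where nr = "dim_row B" and nc = "dim_col B"])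
    (auto intro: carrier_vecI)

lemma uminus_mat_mult: "dim_vec x = dim_col (A :: real mat) \<Longrightarrow> (- A) *\<^sub>v x = - (A *\<^sub>v x)"
  by simp

lemma smult_mat_mult: "dim_vec x = dim_col (A :: real mat) \<Longrightarrow> (c \<cdot>\<^sub>m A) *\<^sub>v x = c \<cdot>\<^sub>v (A *\<^sub>v x)"
  by (rule eq_vecI) (auto simp: scalar_prod_def sum_distrib_left mult.assoc)

lemma mat_mult_mult: "dim_col A = dim_row (B :: real mat) \<Longrightarrow> dim_vec x = dim_col B \<Longrightarrow>
    (A * B) *\<^sub>v x = A *\<^sub>v (B *\<^sub>v x)"
  by (rule assoc_mult_mat_vec[where ?n\<^sub>1.0 = "dim_row A" and ?n\<^sub>2.0 = "dim_row B" and ?n\<^sub>3.0 = "dim_col B"])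
    (auto intro: carrier_vecI)

lemma transpose_sprod: "dim_vec y = dim_row (A :: real mat) \<Longrightarrow> dim_vec x = dim_col A \<Longrightarrow>
    (A\<^sup>T *\<^sub>v y) \<bullet> x = y \<bullet> (A *\<^sub>v x)"
  by (rule transpose_vec_mult_scalar[where nr = "dim_row A" and nc = "dim_col A"])
    (auto intro: carrier_vecI)

lemma sprod_transpose: "dim_vec y = dim_row (A :: real mat) \<Longrightarrow> dim_vec x = dim_col A \<Longrightarrow>
    x \<bullet> (A\<^sup>T *\<^sub>v y) = (A *\<^sub>v x) \<bullet> y"
  using transpose_sprod[of y A x] sprod_comm[of x "A\<^sup>T *\<^sub>v y"] sprod_comm[of y "A *\<^sub>v x"] by simp

lemmas linear_simps = add_sprod sprod_add diff_sprod sprod_diff smult_sprod sprod_smult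
  mult_mat_add mult_mat_diff mult_mat_smult add_mat_mult diff_mat_mult smult_mat_mult mat_mult_mult

lemma symmetric_sprod:
  assumes "(A :: real mat)\<^sup>T = A" "dim_row A = n" "dim_vec x = n" "dim_vec y = n"
  shows "x \<bullet> (A *\<^sub>v y) = y \<bullet> (A *\<^sub>v x)"
proof -
  have c: "dim_col A = n" using assms by (metis index_transpose_mat(3))
  have "x \<bullet> (A *\<^sub>v y) = x \<bullet> (A\<^sup>T *\<^sub>v y)" using assms by simp
  also have "\<dots> = (A *\<^sub>v x) \<bullet> y" using assms c by (intro sprod_transpose) auto
  finally show ?thesis using assms by (simp add: sprod_comm[of y])
qed

lemma sprod_self_nonneg [simp]: "(x :: real vec) \<bullet> x \<ge> 0"
  by (simp add: scalar_prod_def sum_nonneg)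

lemma sprod_self_eq: "(x :: real vec) \<bullet> x = (\<Sum>k<dim_vec x. (x $ k)\<^sup>2)"
  by (simp add: scalar_prod_def power2_eq_square atLeast0LessThan)

lemma square_index_le_sprod_self: "k < dim_vec x \<Longrightarrow> (x $ k)\<^sup>2 \<le> (x :: real vec) \<bullet> x"
  unfolding sprod_self_eq by (rule member_le_sum) auto

lemma abs_sprod_le:
  assumes "dim_vec x = dim_vec (y :: real vec)"
  shows "2 * \<bar>x \<bullet> y\<bar> \<le> x \<bullet> x + y \<bullet> y"
proof -
  have "(x + y) \<bullet> (x + y) \<ge> 0" "(x - y) \<bullet> (x - y) \<ge> 0" by simp_all
  then show ?thesis using assms sprod_comm[of x y] by (simp add: linear_simps)
qed

lemma sprod_add_self_le:
  assumes "dim_vec x = dim_vec (y :: real vec)"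
  shows "(x + y) \<bullet> (x + y) \<le> 2 * (x \<bullet> x) + 2 * (y \<bullet> y)"
proof -
  have "(x - y) \<bullet> (x - y) \<ge> 0" by simp
  then show ?thesis using assms sprod_comm[of x y] by (simp add: linear_simps)
qed

lemma quad_form_nonneg: "pos_semidef n A \<Longrightarrow> dim_vec v = n \<Longrightarrow> quad_form A v \<ge> 0"
  by (auto simp: pos_semidef_def intro: carrier_vecI)

lemma quad_form_add:
  assumes "(A :: real mat)\<^sup>T = A" "A \<in> carrier_mat n n" "dim_vec x = n" "dim_vec y = n"
  shows "quad_form A (x + y) = quad_form A x + 2 * (x \<bullet> (A *\<^sub>v y)) + quad_form A y"
  using assms symmetric_sprod[of A n y x] by (auto simp: quad_form_def linear_simps)

lemma quad_form_smult:
  assumes "A \<in> carrier_mat n n" "dim_vec x = n"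
  shows "quad_form A (c \<cdot>\<^sub>v x) = c\<^sup>2 * quad_form A x"
  using assms by (auto simp: quad_form_def linear_simps power2_eq_square)

lemma pos_def_imp_semidef: "pos_def n A \<Longrightarrow> pos_semidef n A"
proof -
  assume A: "pos_def n A"
  have "quad_form A v \<ge> 0" if "v \<in> carrier_vec n" for v
  proof (cases "v = 0\<^sub>v n")
    case True then show ?thesis using A by (auto simp: quad_form_def pos_def_def)
  next
    case False then show ?thesis using A that unfolding pos_def_def by fastforce
  qed
  then show ?thesis using A by (auto simp: pos_def_def pos_semidef_def)
qed

text \<open>Injectivity is the form in which invertibility is established below, both for positive definite
  matrices and for the resolvent of the closed loop.\<close>

lemma injective_mat_inv:
  assumes A: "A \<in> carrier_mat n n"
    and inj: "\<And>v. v \<in> carrier_vec n \<Longrightarrow> A *\<^sub>v v = 0\<^sub>v n \<Longrightarrow> v = 0\<^sub>v n"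
  shows "mat_inv A \<in> carrier_mat n n" "A * mat_inv A = 1\<^sub>m n" "mat_inv A * A = 1\<^sub>m n"
proof -
  have "det A \<noteq> 0" using inj det_0_iff_vec_prod_zero_field[OF A] by blast
  then have "A \<in> Units (ring_mat TYPE(real) n ())" by (rule det_non_zero_imp_unit[OF A])
  then obtain B where "mat_inverse A = Some B"
    using mat_inverse(1)[OF A, of "()"] by (cases "mat_inverse A") auto
  then show "mat_inv A \<in> carrier_mat n n" "A * mat_inv A = 1\<^sub>m n" "mat_inv A * A = 1\<^sub>m n"
    using mat_inverse(2)[OF A] by (auto simp: mat_inv_def)
qed

lemma pos_def_inv:
  assumes "pos_def n A"
  shows "mat_inv A \<in> carrier_mat n n" "A * mat_inv A = 1\<^sub>m n" "mat_inv A * A = 1\<^sub>m n"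
proof -
  have A: "A \<in> carrier_mat n n" using assms by (simp add: pos_def_def)
  have inj: "v = 0\<^sub>v n" if "v \<in> carrier_vec n" "A *\<^sub>v v = 0\<^sub>v n" for v
  proof (rule ccontr)
    assume "v \<noteq> 0\<^sub>v n"
    then have "quad_form A v > 0" using assms that by (auto simp: pos_def_def)
    then show False using that by (auto simp: quad_form_def)
  qed
  note inv = injective_mat_inv[OF A inj]
  show "mat_inv A \<in> carrier_mat n n" "A * mat_inv A = 1\<^sub>m n" "mat_inv A * A = 1\<^sub>m n"
    by (rule inv; assumption)+
qed

text \<open>With $v = A^{-1} e_k$ one has $x_k = v'Ax$, so
  nonnegativity of the form at $x - (x_k/s) v$, $s = v'Av$, bounds $x_k^2$ by $s\, x'Ax$.\<close>

lemma pos_def_coercive: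
  assumes "pos_def n A"
  obtains c where "c > 0" "\<And>x. dim_vec x = n \<Longrightarrow> x \<bullet> x \<le> c * quad_form A x"
proof -
  have A: "A \<in> carrier_mat n n" "A\<^sup>T = A" using assms by (auto simp: pos_def_def)
  note semi = pos_def_imp_semidef[OF assms]
  define v where "v k = mat_inv A *\<^sub>v unit_vec n k" for k
  have dv: "dim_vec (v k) = n" for k using pos_def_inv[OF assms] by (auto simp: v_def)
  have Av: "A *\<^sub>v v k = unit_vec n k" for k
    using pos_def_inv[OF assms] A by (simp add: v_def mat_mult_mult[symmetric])
  define s where "s k = quad_form A (v k)" for k
  have bound: "(x $ k)\<^sup>2 \<le> s k * quad_form A x" if k: "k < n" and x: "dim_vec x = n" for x k
  proof -
    have "v k \<noteq> 0\<^sub>v n"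
    proof
      assume "v k = 0\<^sub>v n"
      moreover have "A *\<^sub>v 0\<^sub>v n = 0\<^sub>v n" using A by (auto intro!: eq_vecI)
      ultimately have "(unit_vec n k :: real vec) = 0\<^sub>v n" using Av[of k] by simp
      then have "(unit_vec n k :: real vec) $ k = 0\<^sub>v n $ k" by (rule arg_cong)
      then show False using k by simp
    qed
    then have s: "s k > 0" using assms dv[of k] by (auto simp: s_def pos_def_def intro: carrier_vecI)
    have xv: "x \<bullet> (A *\<^sub>v v k) = x $ k" using Av k x by simp
    define r where "r = - (x $ k / s k)"
    have "0 \<le> quad_form A (x + r \<cdot>\<^sub>v v k)"
      using quad_form_nonneg[OF semi] x dv[of k] by simp
    also have "\<dots> = quad_form A x + 2 * r * x $ k + r\<^sup>2 * s k"
      using A x dv[of k] xv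
      by (simp add: quad_form_add[of A n] quad_form_smult[of A n] linear_simps s_def)
    also have "\<dots> = quad_form A x - (x $ k)\<^sup>2 / s k"
      using s by (simp add: r_def power2_eq_square)
    finally show ?thesis using s by (simp add: field_simps)
  qed
  define c where "c = 1 + (\<Sum>k<n. s k)"
  have s0: "s k \<ge> 0" for k using quad_form_nonneg[OF semi dv[of k]] by (simp add: s_def)
  then have "c > 0" by (simp add: c_def sum_nonneg add_pos_nonneg)
  moreover have "x \<bullet> x \<le> c * quad_form A x" if x: "dim_vec x = n" for x
  proof -
    have q: "quad_form A x \<ge> 0" using quad_form_nonneg[OF semi x] .
    have "x \<bullet> x \<le> (\<Sum>k<n. s k * quad_form A x)"
      using bound x by (auto simp: sprod_self_eq intro!: sum_mono)
    also have "\<dots> \<le> c * quad_form A x" using q by (simp add: c_def sum_distrib_right[symmetric] algebra_simps)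
    finally show ?thesis .
  qed
  ultimately show ?thesis using that by blast
qed

text \<open>Cauchy-Schwarz in each row; the constant is the square of the Frobenius norm.\<close>

lemma mult_mat_vec_sq_le:
  assumes "dim_vec x = dim_col (A :: real mat)"
  shows "(A *\<^sub>v x) \<bullet> (A *\<^sub>v x) \<le> (\<Sum>k<dim_row A. \<Sum>l<dim_col A. (A $$ (k, l))\<^sup>2) * (x \<bullet> x)"
proof -
  have "((A *\<^sub>v x) $ k)\<^sup>2 \<le> (\<Sum>l<dim_col A. (A $$ (k, l))\<^sup>2) * (x \<bullet> x)" if "k < dim_row A" for k
  proof -
    have "(A *\<^sub>v x) $ k = (\<Sum>l<dim_col A. A $$ (k, l) * x $ l)"
      using that assms by (simp add: scalar_prod_def atLeast0LessThan)
    then show ?thesis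
      using Cauchy_Schwarz_ineq_sum[of "\<lambda>l. A $$ (k, l)" "\<lambda>l. x $ l" "{..<dim_col A}"] assms
      by (simp add: sprod_self_eq)
  qed
  then have "(\<Sum>k<dim_row A. ((A *\<^sub>v x) $ k)\<^sup>2) \<le> (\<Sum>k<dim_row A. (\<Sum>l<dim_col A. (A $$ (k, l))\<^sup>2) * (x \<bullet> x))"
    by (intro sum_mono) auto
  then show ?thesis by (simp add: sprod_self_eq[of "A *\<^sub>v x"] sum_distrib_right)
qed

lemma mult_mat_vec_sq_bound:
  obtains c where "c \<ge> 0" "\<And>x. dim_vec x = dim_col (A :: real mat) \<Longrightarrow> (A *\<^sub>v x) \<bullet> (A *\<^sub>v x) \<le> c * (x \<bullet> x)"
  using mult_mat_vec_sq_le[of _ A]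
  by (metis (no_types, lifting) sum_nonneg zero_le_power2)

lemma quad_form_bound:
  assumes "A \<in> carrier_mat n n"
  obtains c where "c \<ge> 0" "\<And>x. dim_vec x = n \<Longrightarrow> \<bar>quad_form A x\<bar> \<le> c * (x \<bullet> x)"
proof -
  obtain c where c: "c \<ge> 0" "\<And>x. dim_vec x = n \<Longrightarrow> (A *\<^sub>v x) \<bullet> (A *\<^sub>v x) \<le> c * (x \<bullet> x)"
    using mult_mat_vec_sq_bound[of A] assms by auto
  have "\<bar>quad_form A x\<bar> \<le> (1 + c) * (x \<bullet> x)" if "dim_vec x = n" for x
    using c(2)[OF that] abs_sprod_le[of x "A *\<^sub>v x"] that assms sprod_self_nonneg[of x]
      mult_nonneg_nonneg[OF c(1) sprod_self_nonneg[of x]]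
    by (simp add: quad_form_def algebra_simps del: sprod_self_nonneg)
  then show ?thesis using that[of "1 + c"] c(1) by auto
qed

text \<open>By polarization of the two forms.\<close>

lemma symmetric_mat_eqI:
  assumes A: "A \<in> carrier_mat n n" "A\<^sup>T = A" and B: "B \<in> carrier_mat n n" "B\<^sup>T = B"
    and eq: "\<And>x. x \<in> carrier_vec n \<Longrightarrow> quad_form A x = quad_form B x"
  shows "A = B"
proof (rule eq_matI)
  fix i j assume "i < dim_row B" "j < dim_col B"
  then have ij: "i < n" "j < n" using B by auto
  let ?x = "unit_vec n i :: real vec" and ?y = "unit_vec n j :: real vec"
  have entry: "?x \<bullet> (C *\<^sub>v ?y) = C $$ (i, j)" if "C \<in> carrier_mat n n" for C :: "real mat"
    using that ij by auto
  have "?x \<bullet> (A *\<^sub>v ?y) = ?x \<bullet> (B *\<^sub>v ?y)"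
    using eq[of "?x + ?y"] eq[of ?x] eq[of ?y] quad_form_add[OF A(2,1), of ?x ?y]
      quad_form_add[OF B(2,1), of ?x ?y] by simp
  then show "A $$ (i, j) = B $$ (i, j)" using A B by (simp add: entry)
qed (use assms in auto)

section \<open>The discounted Riccati equation\<close>

lemma quad_form_zero: "A \<in> carrier_mat n n \<Longrightarrow> quad_form A (0\<^sub>v n) = 0"
  unfolding quad_form_def by (rule scalar_prod_left_zero, rule carrier_vecI) simp

lemma diff_self_vec: "dim_vec (v :: real vec) = n \<Longrightarrow> v - v = 0\<^sub>v n"
  by (rule eq_vecI) auto

lemma unit_vec_sprod_mult:
  "A \<in> carrier_mat n n \<Longrightarrow> i < n \<Longrightarrow> j < n \<Longrightarrow>
    unit_vec n i \<bullet> (A *\<^sub>v unit_vec n j) = (A :: real mat) $$ (i, j)"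
  by auto

lemma symmetric_matI:
  assumes A: "A \<in> carrier_mat n n"
    and sym: "\<And>x y :: real vec. x \<in> carrier_vec n \<Longrightarrow> y \<in> carrier_vec n \<Longrightarrow> x \<bullet> (A *\<^sub>v y) = y \<bullet> (A *\<^sub>v x)"
  shows "A\<^sup>T = A"
proof (rule eq_matI)
  fix i j assume "i < dim_row A" "j < dim_col A"
  then have ij: "i < n" "j < n" using A by auto
  have "unit_vec n j \<bullet> (A *\<^sub>v unit_vec n i) = A $$ (j, i)"
    "unit_vec n i \<bullet> (A *\<^sub>v unit_vec n j) = A $$ (i, j)" using A ij by auto
  then show "A\<^sup>T $$ (i, j) = A $$ (i, j)" using sym[of "unit_vec n j" "unit_vec n i"] A ij by simp
qed (use A in auto)

text \<open>Stability puts the spectral radius of the complexified matrix below 1, and then the Jordan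
  normal form bounds the powers.\<close>

lemma schur_stable_bounded_powers:
  assumes A: "A \<in> carrier_mat n n" and stable: "schur_stable A"
  obtains c where "c \<ge> 0" "\<And>k x. dim_vec x = n \<Longrightarrow> (A ^\<^sub>m k *\<^sub>v x) \<bullet> (A ^\<^sub>m k *\<^sub>v x) \<le> c * (x \<bullet> x)"
proof -
  have "\<exists>b. \<forall>k. norm_bound (A ^\<^sub>m k) b"
  proof (cases "n = 0")
    case True
    then show ?thesis using A by (auto simp: norm_bound_def)
  next
    case False
    let ?C = "map_mat complex_of_real A"
    have C: "?C \<in> carrier_mat n n" using A by simp
    have "spectral_radius ?C \<in> norm ` spectrum ?C"
      using spectral_radius_mem_max(1)[OF C] False by simp
    then have "spectral_radius ?C < 1"
      using stable by (auto simp: schur_stable_def spectrum_def)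
    moreover obtain as where "char_poly ?C = (\<Prod>a\<leftarrow>as. [:- a, 1:])"
      using char_poly_factorized[OF C] by auto
    ultimately obtain b where b: "norm_bound (?C ^\<^sub>m k) b" for k
      using spectral_radius_jnf_norm_bound_less_1[OF C] jordan_nf_exists[OF C] by metis
    have "map_mat complex_of_real (A ^\<^sub>m k) = ?C ^\<^sub>m k" for k
      using of_real_hom.mat_hom_pow[OF A] by metis
    then have "norm_bound (A ^\<^sub>m k) b" for k
      using b[of k] unfolding norm_bound_def
      by (metis index_map_mat norm_of_real real_norm_def)
    then show ?thesis by blast
  qed
  then obtain b where b: "norm_bound (A ^\<^sub>m k) b" for k by blast
  define c where "c = (\<Sum>i<n. \<Sum>j<n. b\<^sup>2)"
  have Ak: "dim_row (A ^\<^sub>m k) = n" "dim_col (A ^\<^sub>m k) = n" for k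
    using A by (auto dest: pow_carrier_mat[of A n k])
  have "(A ^\<^sub>m k *\<^sub>v x) \<bullet> (A ^\<^sub>m k *\<^sub>v x) \<le> c * (x \<bullet> x)" if x: "dim_vec x = n" for k x
  proof -
    have "(\<Sum>i<n. \<Sum>j<n. ((A ^\<^sub>m k) $$ (i, j))\<^sup>2) \<le> c"
    proof (unfold c_def, intro sum_mono)
      fix i j assume "i \<in> {..<n}" "j \<in> {..<n}"
      then have "\<bar>(A ^\<^sub>m k) $$ (i, j)\<bar> \<le> b" using b[of k] Ak by (auto simp: norm_bound_def)
      then show "((A ^\<^sub>m k) $$ (i, j))\<^sup>2 \<le> b\<^sup>2" by (simp add: abs_le_square_iff[symmetric])
    qed
    then have "(\<Sum>i<n. \<Sum>j<n. ((A ^\<^sub>m k) $$ (i, j))\<^sup>2) * (x \<bullet> x) \<le> c * (x \<bullet> x)"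
      by (rule mult_right_mono) simp
    then show ?thesis using mult_mat_vec_sq_le[of x "A ^\<^sub>m k"] x Ak by simp
  qed
  moreover have "c \<ge> 0" by (auto simp: c_def intro!: sum_nonneg)
  ultimately show ?thesis using that by blast
qed

locale regulator =
  fixes n m :: nat and A B Q R :: "real mat" and \<beta> :: real
  assumes A [simp]: "A \<in> carrier_mat n n" and B [simp]: "B \<in> carrier_mat n m"
    and Q: "pos_def n Q" and R: "pos_def m R"
    and beta: "0 \<le> \<beta>" "\<beta> < 1"
begin

lemma dims [simp]: "dim_row A = n" "dim_col A = n" "dim_row B = n" "dim_col B = m"
  "dim_row Q = n" "dim_col Q = n" "dim_row R = m" "dim_col R = m"
  using A B Q R by (auto simp: pos_def_def simp del: A B)

lemma QR_carrier [simp]: "Q \<in> carrier_mat n n" "R \<in> carrier_mat m m"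
  using Q R by (auto simp: pos_def_def)

definition S_of :: "real mat \<Rightarrow> real mat" where
  "S_of M = R + \<beta> \<cdot>\<^sub>m (B\<^sup>T * M * B)"

definition gain :: "real mat \<Rightarrow> real mat" where
  "gain M = - \<beta> \<cdot>\<^sub>m (mat_inv (S_of M) * B\<^sup>T * M * A)"

definition ric :: "real mat \<Rightarrow> real mat" where
  "ric M = Q + \<beta> \<cdot>\<^sub>m (A\<^sup>T * (M - \<beta> \<cdot>\<^sub>m (M * B * mat_inv (S_of M) * B\<^sup>T * M)) * A)"

definition cost_to_go :: "real mat \<Rightarrow> real vec \<Rightarrow> real vec \<Rightarrow> real" where
  "cost_to_go M x u = quad_form Q x + quad_form R u + \<beta> * quad_form M (A *\<^sub>v x + B *\<^sub>v u)"

lemma psd_dims: "pos_semidef n M \<Longrightarrow> dim_row M = n \<and> dim_col M = n \<and> M\<^sup>T = M \<and> M \<in> carrier_mat n n"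
  by (auto simp: pos_semidef_def)

lemma S_of_dims [simp]: "dim_row M = n \<Longrightarrow> dim_col M = n \<Longrightarrow> dim_row (S_of M) = m"
  "dim_row M = n \<Longrightarrow> dim_col M = n \<Longrightarrow> dim_col (S_of M) = m"
  by (auto simp: S_of_def)

lemma S_of_mult:
  assumes "dim_row M = n" "dim_col M = n" "dim_vec u = m"
  shows "S_of M *\<^sub>v u = R *\<^sub>v u + \<beta> \<cdot>\<^sub>v (B\<^sup>T *\<^sub>v (M *\<^sub>v (B *\<^sub>v u)))"
  using assms by (simp add: S_of_def linear_simps)

lemma S_of_quad:
  assumes "pos_semidef n M" "dim_vec u = m"
  shows "quad_form (S_of M) u = quad_form R u + \<beta> * quad_form M (B *\<^sub>v u)"
  using assms psd_dims[OF assms(1)]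
  by (simp add: quad_form_def S_of_mult linear_simps sprod_transpose)

lemma S_of_pos_def:
  assumes M: "pos_semidef n M"
  shows "pos_def m (S_of M)"
  unfolding pos_def_def
proof (intro conjI ballI impI)
  have Mn: "dim_row M = n" "dim_col M = n" "M\<^sup>T = M" using psd_dims[OF M] by auto
  show c: "S_of M \<in> carrier_mat m m" using Mn by auto
  show "(S_of M)\<^sup>T = S_of M"
  proof (rule symmetric_matI[OF c])
    fix x y :: "real vec" assume "x \<in> carrier_vec m" "y \<in> carrier_vec m"
    then have xy: "dim_vec x = m" "dim_vec y = m" by auto
    have R': "R\<^sup>T = R" using R by (simp add: pos_def_def)
    have "x \<bullet> (S_of M *\<^sub>v y) = x \<bullet> (R *\<^sub>v y) + \<beta> * ((B *\<^sub>v x) \<bullet> (M *\<^sub>v (B *\<^sub>v y)))" if "dim_vec x = m" "dim_vec y = m" for x y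
      using Mn that by (simp add: S_of_mult linear_simps sprod_transpose)
    then show "x \<bullet> (S_of M *\<^sub>v y) = y \<bullet> (S_of M *\<^sub>v x)"
      using xy Mn symmetric_sprod[OF Mn(3), of n "B *\<^sub>v x" "B *\<^sub>v y"] symmetric_sprod[OF R', of m x y]
      by simp
  qed
  fix u :: "real vec" assume u: "u \<in> carrier_vec m" "u \<noteq> 0\<^sub>v m"
  then have "quad_form R u > 0" using R by (auto simp: pos_def_def)
  moreover have "quad_form M (B *\<^sub>v u) \<ge> 0" using quad_form_nonneg[OF M] by simp
  ultimately show "quad_form (S_of M) u > 0"
    using S_of_quad[OF M, of u] u beta by (simp add: add_pos_nonneg)
qed

lemma Sinv:
  assumes M: "pos_semidef n M"
  shows "dim_row (mat_inv (S_of M)) = m" "dim_col (mat_inv (S_of M)) = m"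
    "dim_vec v = m \<Longrightarrow> S_of M *\<^sub>v (mat_inv (S_of M) *\<^sub>v v) = v"
  using pos_def_inv[OF S_of_pos_def[OF M]] psd_dims[OF M]
  by (auto simp: mat_mult_mult[symmetric] intro!: one_mult_mat_vec carrier_vecI)

lemma gain_dims [simp]:
  "pos_semidef n M \<Longrightarrow> dim_row (gain M) = m" "dim_col (gain M) = n"
  by (auto simp: gain_def Sinv)

lemma gain_mult:
  assumes M: "pos_semidef n M" and x: "dim_vec x = n"
  shows "gain M *\<^sub>v x = (- \<beta>) \<cdot>\<^sub>v (mat_inv (S_of M) *\<^sub>v (B\<^sup>T *\<^sub>v (M *\<^sub>v (A *\<^sub>v x))))"
  using psd_dims[OF M] Sinv[OF M] x by (simp add: gain_def linear_simps)

lemma S_gain: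
  assumes M: "pos_semidef n M" and x: "dim_vec x = n"
  shows "S_of M *\<^sub>v (gain M *\<^sub>v x) = (- \<beta>) \<cdot>\<^sub>v (B\<^sup>T *\<^sub>v (M *\<^sub>v (A *\<^sub>v x)))"
  using psd_dims[OF M] Sinv[OF M] x by (simp add: gain_mult[OF M x] linear_simps)

lemma ric_dims [simp]: "dim_row (ric M) = n" "dim_col (ric M) = n"
  by (auto simp: ric_def)

lemma ric_mult:
  assumes M: "pos_semidef n M" and x: "dim_vec x = n"
  shows "ric M *\<^sub>v x = Q *\<^sub>v x + \<beta> \<cdot>\<^sub>v (A\<^sup>T *\<^sub>v (M *\<^sub>v (A *\<^sub>v x)))
    + \<beta> \<cdot>\<^sub>v (A\<^sup>T *\<^sub>v (M *\<^sub>v (B *\<^sub>v (gain M *\<^sub>v x))))"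
  using psd_dims[OF M] Sinv[OF M] x
  by (simp add: gain_mult[OF M x] ric_def linear_simps)
    (rule eq_vecI; simp add: linear_simps algebra_simps)

text \<open>The bilinear form of the Riccati map, from which both its symmetry and the completion of the
  square follow.\<close>

lemma ric_bilinear:
  assumes M: "pos_semidef n M" and x: "dim_vec x = n" and y: "dim_vec y = n"
  shows "y \<bullet> (ric M *\<^sub>v x) = y \<bullet> (Q *\<^sub>v x) + \<beta> * ((A *\<^sub>v y) \<bullet> (M *\<^sub>v (A *\<^sub>v x)))
    - (gain M *\<^sub>v y) \<bullet> (S_of M *\<^sub>v (gain M *\<^sub>v x))"
proof -
  note Mn = psd_dims[OF M]
  have "(A *\<^sub>v y) \<bullet> (M *\<^sub>v (B *\<^sub>v (gain M *\<^sub>v x))) = (B\<^sup>T *\<^sub>v (M *\<^sub>v (A *\<^sub>v y))) \<bullet> (gain M *\<^sub>v x)"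
    using Mn x y M symmetric_sprod[of M n "A *\<^sub>v y" "B *\<^sub>v (gain M *\<^sub>v x)"]
    by (simp add: transpose_sprod sprod_comm[of "B *\<^sub>v (gain M *\<^sub>v x)"])
  then have "\<beta> * ((A *\<^sub>v y) \<bullet> (M *\<^sub>v (B *\<^sub>v (gain M *\<^sub>v x)))) = - ((S_of M *\<^sub>v (gain M *\<^sub>v y)) \<bullet> (gain M *\<^sub>v x))"
    using Mn M y x by (simp add: S_gain[OF M y] linear_simps)
  also have "(S_of M *\<^sub>v (gain M *\<^sub>v y)) \<bullet> (gain M *\<^sub>v x) = (gain M *\<^sub>v x) \<bullet> (S_of M *\<^sub>v (gain M *\<^sub>v y))"
    by (rule sprod_comm) (use Mn M in auto)
  also have "\<dots> = (gain M *\<^sub>v y) \<bullet> (S_of M *\<^sub>v (gain M *\<^sub>v x))"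
    by (rule symmetric_sprod[where n = m]) (use S_of_pos_def[OF M] Mn M in \<open>auto simp: pos_def_def\<close>)
  finally show ?thesis
    using Mn x y M by (simp add: ric_mult[OF M x] linear_simps sprod_transpose)
qed

text \<open>Completing the square in the control: minimizing the cost-to-go over \<open>u\<close> gives the
  Riccati map, attained at the linear feedback.\<close>

lemma cost_to_go_eq:
  assumes M: "pos_semidef n M" and x: "dim_vec x = n" and u: "dim_vec u = m"
  shows "cost_to_go M x u = quad_form (ric M) x + quad_form (S_of M) (u - gain M *\<^sub>v x)"
proof -
  note Mn = psd_dims[OF M]
  have S: "(S_of M)\<^sup>T = S_of M" "dim_row (S_of M) = m" "dim_col (S_of M) = m"
    using S_of_pos_def[OF M] Mn by (auto simp: pos_def_def)
  have 1: "u \<bullet> (S_of M *\<^sub>v (gain M *\<^sub>v x)) = - \<beta> * ((B *\<^sub>v u) \<bullet> (M *\<^sub>v (A *\<^sub>v x)))"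
    using Mn M x u by (simp add: S_gain[OF M x] linear_simps sprod_transpose)
  have 2: "(gain M *\<^sub>v x) \<bullet> (S_of M *\<^sub>v u) = u \<bullet> (S_of M *\<^sub>v (gain M *\<^sub>v x))"
    by (rule symmetric_sprod[where n = m]) (use S M x u in auto)
  have 3: "(A *\<^sub>v x) \<bullet> (M *\<^sub>v (B *\<^sub>v u)) = (B *\<^sub>v u) \<bullet> (M *\<^sub>v (A *\<^sub>v x))"
    by (rule symmetric_sprod[where n = n]) (use Mn x u in auto)
  have "quad_form (S_of M) (u - gain M *\<^sub>v x) = quad_form (S_of M) u
      - 2 * (u \<bullet> (S_of M *\<^sub>v (gain M *\<^sub>v x))) + quad_form (S_of M) (gain M *\<^sub>v x)"
    using S M x u 2 by (simp add: quad_form_def linear_simps)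
  moreover have "quad_form M (A *\<^sub>v x + B *\<^sub>v u)
      = quad_form M (A *\<^sub>v x) + 2 * ((B *\<^sub>v u) \<bullet> (M *\<^sub>v (A *\<^sub>v x))) + quad_form M (B *\<^sub>v u)"
    using Mn x u 3 by (simp add: quad_form_def linear_simps)
  ultimately show ?thesis
    using S_of_quad[OF M u] ric_bilinear[OF M x x] 1
    by (simp add: cost_to_go_def quad_form_def[of "ric M"] quad_form_def[of Q]
      quad_form_def[of M "A *\<^sub>v x"] quad_form_def[of "S_of M" "gain M *\<^sub>v x"] algebra_simps)
qed

lemma ric_le_cost_to_go:
  assumes M: "pos_semidef n M" and x: "dim_vec x = n" and u: "dim_vec u = m"
  shows "quad_form (ric M) x \<le> cost_to_go M x u"
  using cost_to_go_eq[OF assms] quad_form_nonneg[OF pos_def_imp_semidef[OF S_of_pos_def[OF M]], of "u - gain M *\<^sub>v x"] M x u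
  by simp

lemma ric_eq_cost_to_go:
  assumes M: "pos_semidef n M" and x: "dim_vec x = n"
  shows "quad_form (ric M) x = cost_to_go M x (gain M *\<^sub>v x)"
proof -
  have "gain M *\<^sub>v x - gain M *\<^sub>v x = 0\<^sub>v m" using M by (intro diff_self_vec) simp
  moreover have "quad_form (S_of M) (0\<^sub>v m) = 0"
    by (rule quad_form_zero) (use S_of_pos_def[OF M] in \<open>simp add: pos_def_def\<close>)
  ultimately have "quad_form (S_of M) (gain M *\<^sub>v x - gain M *\<^sub>v x) = 0"
    by (rule ssubst)
  then show ?thesis using cost_to_go_eq[OF M x, of "gain M *\<^sub>v x"] M x by simp
qed

lemma stage_nonneg: "dim_vec x = n \<Longrightarrow> dim_vec u = m \<Longrightarrow> 0 \<le> quad_form Q x + quad_form R u"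
  using quad_form_nonneg[OF pos_def_imp_semidef[OF Q]] quad_form_nonneg[OF pos_def_imp_semidef[OF R]] by simp

lemma ric_psd:
  assumes M: "pos_semidef n M"
  shows "pos_semidef n (ric M)"
  unfolding pos_semidef_def
proof (intro conjI ballI)
  note Mn = psd_dims[OF M]
  have S: "(S_of M)\<^sup>T = S_of M" "dim_row (S_of M) = m"
    using S_of_pos_def[OF M] Mn by (auto simp: pos_def_def)
  show c: "ric M \<in> carrier_mat n n" by auto
  show "(ric M)\<^sup>T = ric M"
  proof (rule symmetric_matI[OF c])
    fix x y :: "real vec" assume "x \<in> carrier_vec n" "y \<in> carrier_vec n"
    then have xy: "dim_vec x = n" "dim_vec y = n" by auto
    show "x \<bullet> (ric M *\<^sub>v y) = y \<bullet> (ric M *\<^sub>v x)"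
      using Q ric_bilinear[OF M xy] ric_bilinear[OF M xy(2,1)] xy Mn M
        symmetric_sprod[of M n "A *\<^sub>v x" "A *\<^sub>v y"] symmetric_sprod[of Q n x y]
        symmetric_sprod[OF S, of "gain M *\<^sub>v x" "gain M *\<^sub>v y"]
      by (simp add: pos_def_def)
  qed
  fix x :: "real vec" assume "x \<in> carrier_vec n"
  then have x: "dim_vec x = n" by auto
  show "quad_form (ric M) x \<ge> 0"
    unfolding ric_eq_cost_to_go[OF M x] cost_to_go_def
    using stage_nonneg[OF x, of "gain M *\<^sub>v x"] M beta(1)
      quad_form_nonneg[OF M, of "A *\<^sub>v x + B *\<^sub>v (gain M *\<^sub>v x)"] by simp
qed

text \<open>A minimum of costs-to-go, each of which increases with the terminal cost, increases with it.\<close>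

lemma ric_mono:
  assumes M: "pos_semidef n M" and M': "pos_semidef n M'"
    and le: "\<And>x. dim_vec x = n \<Longrightarrow> quad_form M x \<le> quad_form M' x" and x: "dim_vec x = n"
  shows "quad_form (ric M) x \<le> quad_form (ric M') x"
proof -
  have "quad_form (ric M) x \<le> cost_to_go M x (gain M' *\<^sub>v x)"
    using ric_le_cost_to_go[OF M x] M' by simp
  also have "\<dots> \<le> cost_to_go M' x (gain M' *\<^sub>v x)"
    using le beta M' x by (auto simp: cost_to_go_def intro!: mult_left_mono)
  finally show ?thesis using ric_eq_cost_to_go[OF M' x] by simp
qed

subsection \<open>Closed-loop decay and uniqueness\<close>

definition closed_loop :: "real mat \<Rightarrow> real mat" where
  "closed_loop M = A + B * gain M"

lemma closed_loop_dims [simp]: "dim_row (closed_loop M) = n" "dim_col (closed_loop M) = n"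
  by (auto simp: closed_loop_def)

lemma closed_loop_pow_dims [simp]: "dim_row (closed_loop M ^\<^sub>m k) = n" "dim_col (closed_loop M ^\<^sub>m k) = n"
  by (auto simp: pow_mat_dim)

lemma closed_loop_mult: "pos_semidef n M \<Longrightarrow> dim_vec x = n \<Longrightarrow>
    closed_loop M *\<^sub>v x = A *\<^sub>v x + B *\<^sub>v (gain M *\<^sub>v x)"
  by (simp add: closed_loop_def linear_simps)

lemma closed_loop_pow_Suc: "dim_vec x = n \<Longrightarrow>
    closed_loop M ^\<^sub>m Suc k *\<^sub>v x = closed_loop M ^\<^sub>m k *\<^sub>v (closed_loop M *\<^sub>v x)"
  by (simp add: linear_simps)

text \<open>For a solution $M$ of the Riccati equation, $x'Mx$ is the cost of the closed loop, so it
  dominates every partial sum of the state costs.\<close>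

lemma closed_loop_cost_le:
  assumes M: "pos_semidef n M" "ric M = M" and x: "dim_vec x = n"
  shows "(\<Sum>j<k. \<beta>^j * quad_form Q (closed_loop M ^\<^sub>m j *\<^sub>v x)) \<le> quad_form M x"
  using x
proof (induction k arbitrary: x)
  case 0
  then show ?case using quad_form_nonneg[OF M(1)] by simp
next
  case (Suc k)
  have "(\<Sum>j<Suc k. \<beta>^j * quad_form Q (closed_loop M ^\<^sub>m j *\<^sub>v x)) = quad_form Q x
      + \<beta> * (\<Sum>j<k. \<beta>^j * quad_form Q (closed_loop M ^\<^sub>m j *\<^sub>v (closed_loop M *\<^sub>v x)))"
    unfolding sum.lessThan_Suc_shift
    using Suc.prems by (auto simp: linear_simps sum_distrib_left mult.assoc)
  also have "\<dots> \<le> quad_form Q x + \<beta> * quad_form M (closed_loop M *\<^sub>v x)"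
    using Suc.IH[of "closed_loop M *\<^sub>v x"] beta by (auto intro: mult_left_mono)
  also have "\<dots> \<le> quad_form M x"
    using ric_eq_cost_to_go[OF M(1) Suc.prems] M Suc.prems
      quad_form_nonneg[OF pos_def_imp_semidef[OF R], of "gain M *\<^sub>v x"]
    by (simp add: cost_to_go_def closed_loop_mult)
  finally show ?case .
qed

text \<open>Coercivity of \<open>Q\<close> turns the bound on the cost into a bound on the discounted states, from which the gains
  inherit their rate of decay.\<close>

lemma closed_loop_bound:
  assumes M: "pos_semidef n M" "ric M = M"
  obtains c where "c \<ge> 0"
    "\<And>k x. dim_vec x = n \<Longrightarrow> \<beta>^k * ((closed_loop M ^\<^sub>m k *\<^sub>v x) \<bullet> (closed_loop M ^\<^sub>m k *\<^sub>v x)) \<le> c * (x \<bullet> x)"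
proof -
  obtain cq where cq: "cq > 0" "\<And>x. dim_vec x = n \<Longrightarrow> x \<bullet> x \<le> cq * quad_form Q x"
    using pos_def_coercive[OF Q] by blast
  obtain cm where cm: "cm \<ge> 0" "\<And>x. dim_vec x = n \<Longrightarrow> \<bar>quad_form M x\<bar> \<le> cm * (x \<bullet> x)"
    using quad_form_bound[of M n] psd_dims[OF M(1)] by blast
  have "\<beta>^k * ((closed_loop M ^\<^sub>m k *\<^sub>v x) \<bullet> (closed_loop M ^\<^sub>m k *\<^sub>v x)) \<le> cq * cm * (x \<bullet> x)"
    if x: "dim_vec x = n" for k x
  proof -
    have q0: "0 \<le> \<beta>^j * quad_form Q (closed_loop M ^\<^sub>m j *\<^sub>v x)" for j
      using quad_form_nonneg[OF pos_def_imp_semidef[OF Q]] beta by simp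
    have "\<beta>^k * ((closed_loop M ^\<^sub>m k *\<^sub>v x) \<bullet> (closed_loop M ^\<^sub>m k *\<^sub>v x))
        \<le> \<beta>^k * (cq * quad_form Q (closed_loop M ^\<^sub>m k *\<^sub>v x))"
      using cq beta by (intro mult_left_mono) auto
    also have "\<dots> = cq * (\<beta>^k * quad_form Q (closed_loop M ^\<^sub>m k *\<^sub>v x))" by simp
    also have "\<dots> \<le> cq * (\<Sum>j<Suc k. \<beta>^j * quad_form Q (closed_loop M ^\<^sub>m j *\<^sub>v x))"
      using cq q0 by (intro mult_left_mono member_le_sum[of k]) auto
    also have "\<dots> \<le> cq * quad_form M x"
      using closed_loop_cost_le[OF M x, of "Suc k"] cq by (intro mult_left_mono) auto
    also have "\<dots> \<le> cq * (cm * (x \<bullet> x))" using cm(2)[OF x] cq by (intro mult_left_mono) auto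
    finally show ?thesis by simp
  qed
  then show ?thesis using that[of "cq * cm"] cq cm by simp
qed

lemma closed_loop_decay:
  assumes M: "pos_semidef n M" "ric M = M" and x: "dim_vec x = n"
  shows "(\<lambda>k. \<beta>^k * ((closed_loop M ^\<^sub>m k *\<^sub>v x) \<bullet> (closed_loop M ^\<^sub>m k *\<^sub>v x))) \<longlonglongrightarrow> 0"
proof -
  obtain cq where cq: "cq > 0" "\<And>x. dim_vec x = n \<Longrightarrow> x \<bullet> x \<le> cq * quad_form Q x"
    using pos_def_coercive[OF Q] by blast
  have q0: "0 \<le> \<beta>^j * quad_form Q (closed_loop M ^\<^sub>m j *\<^sub>v x)" for j
    using quad_form_nonneg[OF pos_def_imp_semidef[OF Q]] beta by simp
  have "summable (\<lambda>j. \<beta>^j * quad_form Q (closed_loop M ^\<^sub>m j *\<^sub>v x))"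
    using closed_loop_cost_le[OF M x] q0 by (intro summableI_nonneg_bounded) auto
  then have "(\<lambda>j. cq * (\<beta>^j * quad_form Q (closed_loop M ^\<^sub>m j *\<^sub>v x))) \<longlonglongrightarrow> cq * 0"
    by (intro tendsto_mult_left summable_LIMSEQ_zero)
  then have upper: "(\<lambda>j. cq * (\<beta>^j * quad_form Q (closed_loop M ^\<^sub>m j *\<^sub>v x))) \<longlonglongrightarrow> 0"
    by (simp only: mult_zero_right)
  have ev: "\<forall>\<^sub>F k in sequentially. 0 \<le> \<beta>^k * ((closed_loop M ^\<^sub>m k *\<^sub>v x) \<bullet> (closed_loop M ^\<^sub>m k *\<^sub>v x))"
    using beta by simp
  have "\<beta>^k * ((closed_loop M ^\<^sub>m k *\<^sub>v x) \<bullet> (closed_loop M ^\<^sub>m k *\<^sub>v x))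
      \<le> cq * (\<beta>^k * quad_form Q (closed_loop M ^\<^sub>m k *\<^sub>v x))" for k
    using mult_left_mono[OF cq(2)[of "closed_loop M ^\<^sub>m k *\<^sub>v x"], of "\<beta>^k"] beta
    by (simp add: mult.left_commute)
  then show ?thesis
    by (intro tendsto_sandwich[OF ev always_eventually tendsto_const upper] allI)
qed

text \<open>Playing the feedback of \<open>N\<close> for one period against the terminal cost \<open>M\<close> shows that the
  difference of the two forms at \<open>x\<close> is at most \<open>\<beta>\<close> times the difference at the next state. Along the
  closed loop of \<open>N\<close> the discounted difference vanishes.\<close>

lemma ric_fixpoint_le:
  assumes M: "pos_semidef n M" "ric M = M" and N: "pos_semidef n N" "ric N = N"
    and x: "dim_vec x = n"
  shows "quad_form M x \<le> quad_form N x"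
proof -
  have step: "quad_form M x - quad_form N x \<le> \<beta>^k *
    (quad_form M (closed_loop N ^\<^sub>m k *\<^sub>v x) - quad_form N (closed_loop N ^\<^sub>m k *\<^sub>v x))" if "dim_vec x = n" for k x
    using that
  proof (induction k arbitrary: x)
    case 0
    have "closed_loop N ^\<^sub>m 0 *\<^sub>v x = x" using 0 by (auto intro: one_mult_mat_vec carrier_vecI)
    then show ?case by simp
  next
    case (Suc k)
    let ?y = "closed_loop N *\<^sub>v x"
    have "quad_form M x - quad_form N x \<le> cost_to_go M x (gain N *\<^sub>v x) - cost_to_go N x (gain N *\<^sub>v x)"
      using ric_le_cost_to_go[OF M(1) Suc.prems, of "gain N *\<^sub>v x"] ric_eq_cost_to_go[OF N(1) Suc.prems]
        M N by simp
    also have "\<dots> = \<beta> * (quad_form M ?y - quad_form N ?y)"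
      using closed_loop_mult[OF N(1) Suc.prems] by (simp add: cost_to_go_def algebra_simps)
    also have "\<dots> \<le> \<beta> * (\<beta>^k * (quad_form M (closed_loop N ^\<^sub>m k *\<^sub>v ?y) - quad_form N (closed_loop N ^\<^sub>m k *\<^sub>v ?y)))"
      using Suc.IH[of ?y] beta by (intro mult_left_mono) auto
    finally show ?case using closed_loop_pow_Suc[OF Suc.prems, of N k] by (simp add: mult.assoc)
  qed
  obtain cm where cm: "cm \<ge> 0" "\<And>x. dim_vec x = n \<Longrightarrow> \<bar>quad_form M x\<bar> \<le> cm * (x \<bullet> x)"
    using quad_form_bound[of M n] psd_dims[OF M(1)] by blast
  let ?z = "\<lambda>k. closed_loop N ^\<^sub>m k *\<^sub>v x"
  have "quad_form M x - quad_form N x \<le> cm * (\<beta>^k * (?z k \<bullet> ?z k))" for k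
  proof -
    have "quad_form M x - quad_form N x \<le> \<beta>^k * (quad_form M (?z k) - quad_form N (?z k))"
      by (rule step[OF x])
    also have "\<dots> \<le> \<beta>^k * (cm * (?z k \<bullet> ?z k))"
    proof (rule mult_left_mono)
      show "quad_form M (?z k) - quad_form N (?z k) \<le> cm * (?z k \<bullet> ?z k)"
        using cm(2)[of "?z k"] quad_form_nonneg[OF N(1), of "?z k"] by simp
    qed (use beta in auto)
    finally show ?thesis by (simp add: mult.left_commute)
  qed
  moreover have "(\<lambda>k. cm * (\<beta>^k * (?z k \<bullet> ?z k))) \<longlonglongrightarrow> cm * 0"
    by (intro tendsto_mult_left closed_loop_decay[OF N x])
  ultimately have "quad_form M x - quad_form N x \<le> cm * 0"
    by (intro LIMSEQ_le_const) auto
  then show ?thesis by simp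
qed

lemma ric_fixpoint_unique:
  assumes M: "pos_semidef n M" "ric M = M" and N: "pos_semidef n N" "ric N = N"
  shows "M = N"
proof -
  have "quad_form M x = quad_form N x" if "x \<in> carrier_vec n" for x
    using ric_fixpoint_le[OF M N] ric_fixpoint_le[OF N M] that by (simp add: antisym)
  moreover have "M \<in> carrier_mat n n" "M\<^sup>T = M" "N \<in> carrier_mat n n" "N\<^sup>T = N"
    using psd_dims[OF M(1)] psd_dims[OF N(1)] by blast+
  ultimately show ?thesis by (metis (no_types) symmetric_mat_eqI)
qed

subsection \<open>Existence by value iteration\<close>

text \<open>The minimal cost over finitely many periods without terminal cost.\<close>

primrec val_it :: "nat \<Rightarrow> real mat" where
  "val_it 0 = 0\<^sub>m n n"
| "val_it (Suc k) = ric (val_it k)"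

lemma zero_quad: "dim_vec x = n \<Longrightarrow> quad_form (0\<^sub>m n n) x = 0"
  by (auto simp: quad_form_def scalar_prod_def)

lemma val_it_psd: "pos_semidef n (val_it k)"
proof (induction k)
  case 0
  show ?case by (auto simp: pos_semidef_def zero_quad)
qed (simp add: ric_psd)

lemma val_it_mono: "dim_vec x = n \<Longrightarrow> quad_form (val_it k) x \<le> quad_form (val_it (Suc k)) x"
proof (induction k arbitrary: x)
  case 0
  then show ?case using quad_form_nonneg[OF val_it_psd[of 1]] by (simp add: zero_quad)
next
  case (Suc k)
  then show ?case
    using ric_mono[OF val_it_psd[of k] val_it_psd[of "Suc k"]] by simp
qed

text \<open>A stabilizing feedback is a competitor in each minimization. Its states stay bounded, so
  discounting makes its total cost finite.\<close>

lemma val_it_bound: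
  assumes stab: "stabilizable A B"
  obtains c where "c \<ge> 0" "\<And>k x. dim_vec x = n \<Longrightarrow> quad_form (val_it k) x \<le> c * (x \<bullet> x)"
proof -
  obtain G where G: "G \<in> carrier_mat m n" and st: "schur_stable (A + B * G)"
    using stab by (auto simp: stabilizable_def)
  define P where "P = A + B * G"
  have P [simp]: "P \<in> carrier_mat n n" "dim_row P = n" "dim_col P = n" using G by (auto simp: P_def)
  have Pk [simp]: "dim_row (P ^\<^sub>m k) = n" "dim_col (P ^\<^sub>m k) = n" for k by (auto simp: pow_mat_dim)
  obtain c1 where c1: "c1 \<ge> 0" "\<And>k x. dim_vec x = n \<Longrightarrow> (P ^\<^sub>m k *\<^sub>v x) \<bullet> (P ^\<^sub>m k *\<^sub>v x) \<le> c1 * (x \<bullet> x)"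
    using schur_stable_bounded_powers[of P n] st by (auto simp: P_def[symmetric])
  obtain cq where cq: "cq \<ge> 0" "\<And>x. dim_vec x = n \<Longrightarrow> \<bar>quad_form Q x\<bar> \<le> cq * (x \<bullet> x)"
    using quad_form_bound[of Q n] by auto
  obtain cr where cr: "cr \<ge> 0" "\<And>x. dim_vec x = m \<Longrightarrow> \<bar>quad_form R x\<bar> \<le> cr * (x \<bullet> x)"
    using quad_form_bound[of R m] by auto
  obtain cg where cg: "cg \<ge> 0" "\<And>x. dim_vec x = n \<Longrightarrow> (G *\<^sub>v x) \<bullet> (G *\<^sub>v x) \<le> cg * (x \<bullet> x)"
    using mult_mat_vec_sq_bound[of G] G by auto
  define cs where "cs = cq + cr * cg"
  have cs: "quad_form Q x + quad_form R (G *\<^sub>v x) \<le> cs * (x \<bullet> x)" if "dim_vec x = n" for x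
    using cq(2)[OF that] cr(2)[of "G *\<^sub>v x"] G mult_left_mono[OF cg(2)[OF that] cr(1)]
    by (simp add: cs_def algebra_simps)
  have "quad_form (val_it k) x \<le> (\<Sum>j<k. \<beta>^j * (cs * ((P ^\<^sub>m j *\<^sub>v x) \<bullet> (P ^\<^sub>m j *\<^sub>v x))))"
    if "dim_vec x = n" for k x
    using that
  proof (induction k arbitrary: x)
    case 0
    then show ?case by (simp add: zero_quad)
  next
    case (Suc k)
    have PG: "P *\<^sub>v x = A *\<^sub>v x + B *\<^sub>v (G *\<^sub>v x)"
      using G Suc.prems by (simp add: P_def linear_simps)
    have "quad_form (val_it (Suc k)) x \<le> quad_form Q x + quad_form R (G *\<^sub>v x) + \<beta> * quad_form (val_it k) (P *\<^sub>v x)"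
      using ric_le_cost_to_go[OF val_it_psd Suc.prems, of "G *\<^sub>v x"] G PG by (simp add: cost_to_go_def)
    also have "\<dots> \<le> cs * (x \<bullet> x) + \<beta> * (\<Sum>j<k. \<beta>^j * (cs * ((P ^\<^sub>m j *\<^sub>v (P *\<^sub>v x)) \<bullet> (P ^\<^sub>m j *\<^sub>v (P *\<^sub>v x)))))"
      using cs[OF Suc.prems] Suc.IH[of "P *\<^sub>v x"] beta by (intro add_mono mult_left_mono) auto
    also have "\<dots> = (\<Sum>j<Suc k. \<beta>^j * (cs * ((P ^\<^sub>m j *\<^sub>v x) \<bullet> (P ^\<^sub>m j *\<^sub>v x))))"
      unfolding sum.lessThan_Suc_shift
      using Suc.prems by (auto simp: linear_simps sum_distrib_left mult.assoc)
    finally show ?case .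
  qed
  also have "(\<Sum>j<k. \<beta>^j * (cs * ((P ^\<^sub>m j *\<^sub>v x) \<bullet> (P ^\<^sub>m j *\<^sub>v x)))) \<le> (cs * c1 / (1 - \<beta>)) * (x \<bullet> x)"
    if x: "dim_vec x = n" for k x
  proof -
    have cs0: "cs \<ge> 0" using cq cr cg by (simp add: cs_def)
    have "(\<Sum>j<k. \<beta>^j * (cs * ((P ^\<^sub>m j *\<^sub>v x) \<bullet> (P ^\<^sub>m j *\<^sub>v x)))) \<le> (\<Sum>j<k. \<beta>^j * (cs * (c1 * (x \<bullet> x))))"
      using c1(2)[OF x] beta cs0 by (intro sum_mono mult_left_mono) auto
    also have "\<dots> = (\<Sum>j<k. \<beta>^j) * (cs * c1 * (x \<bullet> x))" by (simp add: sum_distrib_right mult.assoc)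
    also have "\<dots> \<le> 1 / (1 - \<beta>) * (cs * c1 * (x \<bullet> x))"
    proof (rule mult_right_mono)
      have "(\<Sum>j<k. \<beta>^j) \<le> (\<Sum>j. \<beta>^j)" using beta by (intro sum_le_suminf summable_geometric) auto
      then show "(\<Sum>j<k. \<beta>^j) \<le> 1 / (1 - \<beta>)" using beta by (simp add: suminf_geometric)
    qed (use cs0 c1 in simp)
    finally show ?thesis by simp
  qed
  finally have "\<And>k x. dim_vec x = n \<Longrightarrow> quad_form (val_it k) x \<le> (cs * c1 / (1 - \<beta>)) * (x \<bullet> x)" by blast
  then show ?thesis using that[of "cs * c1 / (1 - \<beta>)"] cq cr cg c1 beta by (simp add: cs_def)
qed

lemma quad_form_le_abs_entries:
  assumes "D \<in> carrier_mat n n" "dim_vec y = n"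
  shows "\<bar>quad_form D y\<bar> \<le> (\<Sum>i<n. \<Sum>j<n. \<bar>D $$ (i, j)\<bar>) * (y \<bullet> y)"
proof -
  have yy: "\<bar>y $ i * y $ j\<bar> \<le> y \<bullet> y" if "i < n" "j < n" for i j
  proof -
    have "0 \<le> (\<bar>y $ i\<bar> - \<bar>y $ j\<bar>)\<^sup>2" by simp
    then have "2 * \<bar>y $ i * y $ j\<bar> \<le> (y $ i)\<^sup>2 + (y $ j)\<^sup>2"
      by (simp add: power2_diff abs_mult)
    then show ?thesis
      using square_index_le_sprod_self[of i y] square_index_le_sprod_self[of j y] that assms by simp
  qed
  have "quad_form D y = (\<Sum>i<n. \<Sum>j<n. D $$ (i, j) * (y $ i * y $ j))"
    using assms by (simp add: quad_form_def scalar_prod_def atLeast0LessThan sum_distrib_left mult_ac)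
  also have "\<bar>\<dots>\<bar> \<le> (\<Sum>i<n. \<Sum>j<n. \<bar>D $$ (i, j) * (y $ i * y $ j)\<bar>)"
    by (rule order_trans[OF sum_abs]) (auto intro!: sum_mono sum_abs)
  also have "\<dots> \<le> (\<Sum>i<n. \<Sum>j<n. \<bar>D $$ (i, j)\<bar> * (y \<bullet> y))"
    unfolding abs_mult[of "D $$ _"] using yy by (intro sum_mono mult_left_mono) auto
  finally show ?thesis by (simp add: sum_distrib_right)
qed

text \<open>The value iterates increase and are bounded by the cost of a stabilizing feedback, so they
  converge. The limit is a fixed point because the minimizing controls of the iterates stay
  bounded, so that against them the limit costs asymptotically no more than the iterates.\<close>

lemma ric_fixpoint_exists:
  assumes stab: "stabilizable A B"
  shows "\<exists>M. pos_semidef n M \<and> ric M = M"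
proof -
  obtain c where c: "c \<ge> 0" "\<And>k x. dim_vec x = n \<Longrightarrow> quad_form (val_it k) x \<le> c * (x \<bullet> x)"
    using val_it_bound[OF stab] by blast
  have sym: "(val_it k)\<^sup>T = val_it k" and vc [simp]: "val_it k \<in> carrier_mat n n"
    "dim_row (val_it k) = n" "dim_col (val_it k) = n" for k
    using psd_dims[OF val_it_psd] by auto
  have inc: "incseq (\<lambda>k. quad_form (val_it k) x)" if "dim_vec x = n" for x
    using val_it_mono[OF that] by (rule incseq_SucI)
  have conv: "convergent (\<lambda>k. quad_form (val_it k) x)" if x: "dim_vec x = n" for x
  proof -
    have "bdd_above (range (\<lambda>k. quad_form (val_it k) x))" using c(2)[OF x] by (auto simp: bdd_above_def)
    then show ?thesis using LIMSEQ_incseq_SUP[OF _ inc[OF x]] by (auto simp: convergent_def)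
  qed
  define M where "M = mat n n (\<lambda>(i, j). lim (\<lambda>k. val_it k $$ (i, j)))"
  have Mc [simp]: "M \<in> carrier_mat n n" "dim_row M = n" "dim_col M = n" by (auto simp: M_def)
  have entry: "(\<lambda>k. val_it k $$ (i, j)) \<longlonglongrightarrow> M $$ (i, j)" if "i < n" "j < n" for i j
  proof -
    let ?x = "unit_vec n i :: real vec" and ?y = "unit_vec n j :: real vec"
    have eq: "val_it k $$ (i, j) = (quad_form (val_it k) (?x + ?y) - quad_form (val_it k) ?x - quad_form (val_it k) ?y) * (1/2)" for k
      using quad_form_add[OF sym vc(1), of ?x ?y k] unit_vec_sprod_mult[OF vc(1) that, of k] by simp
    have "convergent (\<lambda>k. (quad_form (val_it k) (?x + ?y) - quad_form (val_it k) ?x - quad_form (val_it k) ?y) * (1/2))"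
      by (intro convergent_mult convergent_diff conv convergent_const) auto
    then have "convergent (\<lambda>k. val_it k $$ (i, j))" by (simp only: eq)
    then show ?thesis using that by (simp add: M_def convergent_LIMSEQ_iff)
  qed
  have lim: "(\<lambda>k. quad_form (val_it k) x) \<longlonglongrightarrow> quad_form M x" if x: "dim_vec x = n" for x
  proof -
    have "quad_form N x = (\<Sum>i<n. \<Sum>j<n. x $ i * (N $$ (i, j) * x $ j))" if "N \<in> carrier_mat n n" for N
      using that x by (simp add: quad_form_def scalar_prod_def atLeast0LessThan sum_distrib_left)
    then show ?thesis by (simp) (intro tendsto_sum tendsto_mult entry tendsto_const, auto)
  qed
  have le: "quad_form (val_it k) x \<le> quad_form M x" if "dim_vec x = n" for k x
    using incseq_le[OF inc[OF that] lim[OF that]] by simp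
  have M: "pos_semidef n M"
    unfolding pos_semidef_def
  proof (intro conjI ballI)
    show "M\<^sup>T = M"
    proof (rule eq_matI)
      fix i j assume "i < dim_row M" "j < dim_col M"
      then have ij: "i < n" "j < n" by auto
      have "val_it k $$ (j, i) = val_it k $$ (i, j)" for k
        using ij sym[of k] index_transpose_mat(1)[of i "val_it k" j] by simp
      then show "M\<^sup>T $$ (i, j) = M $$ (i, j)" using ij by (simp add: M_def)
    qed auto
    fix v :: "real vec" assume "v \<in> carrier_vec n"
    then have v: "dim_vec v = n" by auto
    show "quad_form M v \<ge> 0"
      using le[OF v, of 0] by (simp add: zero_quad v)
  qed simp
  have "quad_form (ric M) x = quad_form M x" if "x \<in> carrier_vec n" for x
  proof (rule antisym)
    have x: "dim_vec x = n" using that by simp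
    show "quad_form M x \<le> quad_form (ric M) x"
    proof (rule LIMSEQ_le_const2[OF lim[OF x]])
      have "quad_form (val_it (Suc k)) x \<le> quad_form (ric M) x" for k
        using ric_mono[OF val_it_psd M le x] by simp
      then show "\<exists>N. \<forall>k\<ge>N. quad_form (val_it k) x \<le> quad_form (ric M) x"
        by (intro exI[of _ 1]) (metis One_nat_def Suc_le_D)
    qed
    define u where "u k = gain (val_it k) *\<^sub>v x" for k
    define y where "y k = A *\<^sub>v x + B *\<^sub>v u k" for k
    have du [simp]: "dim_vec (u k) = m" "dim_vec (y k) = n" for k
      using val_it_psd by (auto simp: u_def y_def)
    obtain cr where cr: "cr > 0" "\<And>v. dim_vec v = m \<Longrightarrow> v \<bullet> v \<le> cr * quad_form R v"
      using pos_def_coercive[OF R] by blast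
    obtain cb where cb: "cb \<ge> 0" "\<And>v. dim_vec v = m \<Longrightarrow> (B *\<^sub>v v) \<bullet> (B *\<^sub>v v) \<le> cb * (v \<bullet> v)"
      using mult_mat_vec_sq_bound[of B] by auto
    define C where "C = 2 * ((A *\<^sub>v x) \<bullet> (A *\<^sub>v x)) + 2 * (cb * (cr * (c * (x \<bullet> x))))"
    have yC: "y k \<bullet> y k \<le> C" for k
    proof -
      have "quad_form R (u k) \<le> quad_form (val_it (Suc k)) x"
        using ric_eq_cost_to_go[OF val_it_psd x, of k] beta(1) du(2)[of k]
          quad_form_nonneg[OF pos_def_imp_semidef[OF Q] x] quad_form_nonneg[OF val_it_psd, of "y k" k]
        by (simp add: cost_to_go_def u_def[symmetric] y_def[symmetric])
      also have "\<dots> \<le> c * (x \<bullet> x)" by (rule c(2)[OF x])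
      finally have "u k \<bullet> u k \<le> cr * (c * (x \<bullet> x))"
        using cr(2)[OF du(1)] cr(1) by (meson mult_left_mono order.strict_implies_order order_trans)
      then have "(B *\<^sub>v u k) \<bullet> (B *\<^sub>v u k) \<le> cb * (cr * (c * (x \<bullet> x)))"
        using cb(2)[OF du(1)] cb(1) by (meson mult_left_mono order_trans)
      then show ?thesis
        using sprod_add_self_le[of "A *\<^sub>v x" "B *\<^sub>v u k"] by (simp add: y_def C_def)
    qed
    define e where "e k = (\<Sum>i<n. \<Sum>j<n. \<bar>(M - val_it k) $$ (i, j)\<bar>)" for k
    have e0: "e k \<ge> 0" for k by (auto simp: e_def intro!: sum_nonneg)
    have "(\<lambda>k. \<Sum>i<n. \<Sum>j<n. \<bar>M $$ (i, j) - val_it k $$ (i, j)\<bar>) \<longlonglongrightarrow> (\<Sum>i<n. \<Sum>j<n. \<bar>M $$ (i, j) - M $$ (i, j)\<bar>)"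
      by (intro tendsto_sum tendsto_rabs tendsto_diff tendsto_const entry) auto
    then have e: "e \<longlonglongrightarrow> 0" unfolding e_def by simp
    have "quad_form (ric M) x \<le> quad_form (val_it (Suc k)) x + \<beta> * (e k * C)" for k
    proof -
      have "quad_form (ric M) x \<le> cost_to_go M x (u k)" using ric_le_cost_to_go[OF M x] by simp
      also have "\<dots> = cost_to_go (val_it k) x (u k) + \<beta> * quad_form (M - val_it k) (y k)"
        by (simp add: cost_to_go_def y_def[symmetric] quad_form_def[of "M - val_it k"]
          quad_form_def[of M "y k"] quad_form_def[of "val_it k" "y k"] linear_simps algebra_simps)
      also have "cost_to_go (val_it k) x (u k) = quad_form (val_it (Suc k)) x"
        using ric_eq_cost_to_go[OF val_it_psd x] by (simp add: u_def)
      also have "quad_form (M - val_it k) (y k) \<le> e k * (y k \<bullet> y k)"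
        using quad_form_le_abs_entries[of "M - val_it k" "y k"]
        by (simp add: e_def minus_carrier_mat)
      also have "\<dots> \<le> e k * C" using yC e0 by (rule mult_left_mono)
      finally show ?thesis using beta by (simp add: mult_left_mono)
    qed
    moreover have "(\<lambda>k. quad_form (val_it (Suc k)) x + \<beta> * (e k * C)) \<longlonglongrightarrow> quad_form M x + \<beta> * (0 * C)"
      by (intro tendsto_intros e LIMSEQ_Suc[OF lim[OF x]])
    ultimately show "quad_form (ric M) x \<le> quad_form M x"
      by (intro LIMSEQ_le_const) auto
  qed
  moreover have "ric M \<in> carrier_mat n n" "(ric M)\<^sup>T = ric M" "M \<in> carrier_mat n n" "M\<^sup>T = M"
    using psd_dims[OF ric_psd[OF M]] psd_dims[OF M] by blast+
  ultimately have "ric M = M"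
    by (metis (no_types) symmetric_mat_eqI)
  then show ?thesis using M by blast
qed

end

section \<open>Completion of squares over a finite horizon\<close>

text \<open>An exogenous sequence enters the dynamics through \<open>C\<close> and the cost through \<open>K\<close> and
  \<open>L\<close>.\<close>

locale lq_response = regulator +
  fixes d :: nat and C K L M :: "real mat"
  assumes C: "C \<in> carrier_mat n d" and K: "K \<in> carrier_mat d m" and L: "L \<in> carrier_mat d n"
    and M: "pos_semidef n M" and fixpoint: "ric M = M"
begin

lemma dims2 [simp]: "dim_row C = n" "dim_col C = d" "dim_row K = d" "dim_col K = m"
  "dim_row L = d" "dim_col L = n" "dim_row M = n" "dim_col M = n"
  using C K L psd_dims[OF M] by auto

abbreviation F where "F \<equiv> gain M"
abbreviation S where "S \<equiv> S_of M"
abbreviation P where "P \<equiv> closed_loop M"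

lemma dims3 [simp]: "dim_row F = m" "dim_col F = n" "dim_row S = m" "dim_col S = m"
  "dim_row (mat_inv S) = m" "dim_col (mat_inv S) = m"
  using Sinv[OF M] M by auto

lemma M_sym: "dim_vec x = n \<Longrightarrow> dim_vec y = n \<Longrightarrow> x \<bullet> (M *\<^sub>v y) = y \<bullet> (M *\<^sub>v x)"
  using symmetric_sprod[of M n x y] psd_dims[OF M] by simp

definition stage :: "real vec \<Rightarrow> real vec \<Rightarrow> real vec \<Rightarrow> real" where
  "stage x u y = quad_form Q x + quad_form R u + 2 * (y \<bullet> (K *\<^sub>v u + L *\<^sub>v x))"

text \<open>The linear part of the value function with \<open>k\<close> periods to go. It depends on the
  future of the exogenous data \<open>z\<close> and \<open>w\<close>, so it is not adapted; it is only used inside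
  expectations.\<close>

primrec costate :: "(nat \<Rightarrow> real vec) \<Rightarrow> (nat \<Rightarrow> real vec) \<Rightarrow> nat \<Rightarrow> nat \<Rightarrow> real vec" where
  "costate z w 0 t = 0\<^sub>v n"
| "costate z w (Suc k) t = F\<^sup>T *\<^sub>v (K\<^sup>T *\<^sub>v z t) + L\<^sup>T *\<^sub>v z t
    + \<beta> \<cdot>\<^sub>v (P\<^sup>T *\<^sub>v (M *\<^sub>v (C *\<^sub>v z t + w t) + costate z w k (Suc t)))"

text \<open>Half the derivative of the cost over the remaining \<open>Suc k\<close> periods with respect to the control,
  at the feedback control.\<close>

definition gradient :: "(nat \<Rightarrow> real vec) \<Rightarrow> (nat \<Rightarrow> real vec) \<Rightarrow> nat \<Rightarrow> nat \<Rightarrow> real vec" where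
  "gradient z w k t = K\<^sup>T *\<^sub>v z t + \<beta> \<cdot>\<^sub>v (B\<^sup>T *\<^sub>v (M *\<^sub>v (C *\<^sub>v z t + w t) + costate z w k (Suc t)))"

definition exo_cost :: "(nat \<Rightarrow> real vec) \<Rightarrow> (nat \<Rightarrow> real vec) \<Rightarrow> nat \<Rightarrow> nat \<Rightarrow> real" where
  "exo_cost z w k t = quad_form M (C *\<^sub>v z t + w t) + 2 * ((C *\<^sub>v z t + w t) \<bullet> costate z w k (Suc t))"

lemma costate_dim [simp]: "dim_vec (costate z w k t) = n"
  by (cases k) auto

lemma gradient_dim [simp]: "dim_vec (gradient z w k t) = m"
  by (auto simp: gradient_def)

text \<open>Completion of the square for a value function with a linear part: the Riccati equation reproduces
  the quadratic part and the recursion of the costate the linear part. What is left over is a square and a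
  cross term in the deviation from the feedback, and a term that the control does not affect.\<close>

lemma one_step_completion:
  assumes x: "dim_vec x = n" and u: "dim_vec u = m" and z: "dim_vec (z t) = d" and w: "dim_vec (w t) = n"
  defines "x' \<equiv> A *\<^sub>v x + B *\<^sub>v u + C *\<^sub>v z t + w t"
  shows "stage x u (z t) + \<beta> * (quad_form M x' + 2 * (x' \<bullet> costate z w k (Suc t)))
    = quad_form M x + 2 * (x \<bullet> costate z w (Suc k) t)
      + quad_form S (u - F *\<^sub>v x) + 2 * ((u - F *\<^sub>v x) \<bullet> gradient z w k t) + \<beta> * exo_cost z w k t"
proof -
  define v where "v = u - F *\<^sub>v x"
  have v: "dim_vec v = m" by (simp add: v_def u)
  have u_eq: "u = F *\<^sub>v x + v" unfolding v_def by (rule eq_vecI) (use u x in auto)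
  define e where "e = C *\<^sub>v z t + w t"
  have e: "dim_vec e = n" by (simp add: e_def w)
  define q where "q = A *\<^sub>v x + B *\<^sub>v u"
  have q: "dim_vec q = n" by (simp add: q_def)
  have x': "x' = q + e" unfolding x'_def q_def e_def by (rule eq_vecI) (use w in auto)
  define \<psi> where "\<psi> = M *\<^sub>v e + costate z w k (Suc t)"
  have psi: "dim_vec \<psi> = n" by (simp add: \<psi>_def)
  have q_eq: "q = P *\<^sub>v x + B *\<^sub>v v"
    unfolding q_def u_eq closed_loop_mult[OF M x] using x v
    by (simp add: linear_simps) (rule eq_vecI; simp)
  have square: "quad_form Q x + quad_form R u + \<beta> * quad_form M q = quad_form M x + quad_form S v"
    using cost_to_go_eq[OF M x u] fixpoint by (simp add: cost_to_go_def q_def v_def)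
  have "quad_form M x' + 2 * (x' \<bullet> costate z w k (Suc t)) = quad_form M q + 2 * (q \<bullet> \<psi>) + exo_cost z w k t"
    using q e M_sym[OF q e]
    by (simp add: x' exo_cost_def e_def[symmetric] \<psi>_def quad_form_def linear_simps)
  moreover have "x \<bullet> costate z w (Suc k) t = (z t \<bullet> (K *\<^sub>v (F *\<^sub>v x))) + z t \<bullet> (L *\<^sub>v x) + \<beta> * ((P *\<^sub>v x) \<bullet> \<psi>)"
    using x z psi
    by (simp add: e_def[symmetric] \<psi>_def[symmetric] linear_simps sprod_transpose sprod_comm[of _ "z t"])
  moreover have "v \<bullet> gradient z w k t = z t \<bullet> (K *\<^sub>v v) + \<beta> * ((B *\<^sub>v v) \<bullet> \<psi>)"
    using v z psi
    by (simp add: gradient_def e_def[symmetric] \<psi>_def[symmetric] linear_simps sprod_transpose sprod_comm[of _ "z t"])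
  moreover have "q \<bullet> \<psi> = (P *\<^sub>v x) \<bullet> \<psi> + (B *\<^sub>v v) \<bullet> \<psi>"
    unfolding q_eq using psi by (simp add: linear_simps)
  moreover have "z t \<bullet> (K *\<^sub>v u + L *\<^sub>v x) = z t \<bullet> (K *\<^sub>v (F *\<^sub>v x)) + z t \<bullet> (K *\<^sub>v v) + z t \<bullet> (L *\<^sub>v x)"
    unfolding u_eq using x v z by (simp add: linear_simps)
  ultimately show ?thesis
    using square unfolding v_def[symmetric] by (simp add: stage_def algebra_simps)
qed

lemma finite_horizon_completion:
  assumes dims: "\<And>j. dim_vec (z j) = d" "\<And>j. dim_vec (w j) = n" "\<And>j. dim_vec (u j) = m" "dim_vec (x t) = n"
    and dyn: "\<And>j. x (Suc j) = A *\<^sub>v x j + B *\<^sub>v u j + C *\<^sub>v z j + w j"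
  shows "(\<Sum>j<k. \<beta>^j * stage (x (t + j)) (u (t + j)) (z (t + j))) + \<beta>^k * quad_form M (x (t + k))
    = quad_form M (x t) + 2 * (x t \<bullet> costate z w k t)
      + (\<Sum>j<k. \<beta>^j * (quad_form S (u (t + j) - F *\<^sub>v x (t + j))
          + 2 * ((u (t + j) - F *\<^sub>v x (t + j)) \<bullet> gradient z w (k - Suc j) (t + j))
          + \<beta> * exo_cost z w (k - Suc j) (t + j)))"
  using dims(4)
proof (induction k arbitrary: t)
  case 0
  have "x t \<bullet> 0\<^sub>v n = 0" using 0 by (intro scalar_prod_right_zero carrier_vecI) auto
  then show ?case by simp
next
  case (Suc k)
  have x': "dim_vec (x (Suc t)) = n" using dyn[of t] dims by simp
  let ?f = "\<lambda>j. stage (x j) (u j) (z j)"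
  let ?h = "\<lambda>j i. quad_form S (u j - F *\<^sub>v x j) + 2 * ((u j - F *\<^sub>v x j) \<bullet> gradient z w i j) + \<beta> * exo_cost z w i j"
  have "(\<Sum>j<Suc k. \<beta>^j * ?f (t + j)) + \<beta>^Suc k * quad_form M (x (t + Suc k))
     = ?f t + \<beta> * ((\<Sum>j<k. \<beta>^j * ?f (Suc t + j)) + \<beta>^k * quad_form M (x (Suc t + k)))"
    unfolding sum.lessThan_Suc_shift by (simp add: algebra_simps sum_distrib_left)
  also have "\<dots> = ?f t + \<beta> * (quad_form M (x (Suc t)) + 2 * (x (Suc t) \<bullet> costate z w k (Suc t)))
      + \<beta> * (\<Sum>j<k. \<beta>^j * ?h (Suc t + j) (k - Suc j))"
    unfolding Suc.IH[OF x'] by (simp add: algebra_simps)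
  also have "?f t + \<beta> * (quad_form M (x (Suc t)) + 2 * (x (Suc t) \<bullet> costate z w k (Suc t)))
     = quad_form M (x t) + 2 * (x t \<bullet> costate z w (Suc k) t) + ?h t k"
    unfolding dyn[of t] by (subst one_step_completion) (use dims Suc.prems in auto)
  also have "\<beta> * (\<Sum>j<k. \<beta>^j * ?h (Suc t + j) (k - Suc j)) = (\<Sum>j<k. \<beta>^Suc j * ?h (t + Suc j) (Suc k - Suc (Suc j)))"
    by (simp add: sum_distrib_left mult.assoc)
  finally show ?case unfolding sum.lessThan_Suc_shift by (simp del: costate.simps)
qed

text \<open>Two controls that face the same exogenous data share the initial and exogenous terms.\<close>

lemma finite_horizon_comparison:
  assumes dims: "\<And>j. dim_vec (z j) = d" "\<And>j. dim_vec (w j) = n"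
    and "\<And>j. dim_vec (u j) = m" "\<And>j. dim_vec (u' j) = m" "dim_vec (x 0) = n" "x' 0 = x 0"
    and "\<And>j. x (Suc j) = A *\<^sub>v x j + B *\<^sub>v u j + C *\<^sub>v z j + w j"
    and "\<And>j. x' (Suc j) = A *\<^sub>v x' j + B *\<^sub>v u' j + C *\<^sub>v z j + w j"
  shows "(\<Sum>j<k. \<beta>^j * stage (x' j) (u' j) (z j)) + \<beta>^k * quad_form M (x' k)
      - (\<Sum>j<k. \<beta>^j * (quad_form S (u' j - F *\<^sub>v x' j)
          + 2 * ((u' j - F *\<^sub>v x' j) \<bullet> gradient z w (k - Suc j) j)))
    = (\<Sum>j<k. \<beta>^j * stage (x j) (u j) (z j)) + \<beta>^k * quad_form M (x k)
      - (\<Sum>j<k. \<beta>^j * (quad_form S (u j - F *\<^sub>v x j)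
          + 2 * ((u j - F *\<^sub>v x j) \<bullet> gradient z w (k - Suc j) j)))"
  using finite_horizon_completion[of z w u x 0 k] finite_horizon_completion[of z w u' x' 0 k] assms
  by (simp add: sum.distrib distrib_left)

section \<open>Gains of the optimal response\<close>

text \<open>The rate at which the gains decay.\<close>

definition \<theta> :: real where "\<theta> = sqrt \<beta>"

lemma theta: "0 \<le> \<theta>" "\<theta> < 1" "\<theta>\<^sup>2 = \<beta>" "\<beta> \<le> \<theta>"
proof -
  show 1: "0 \<le> \<theta>" "\<theta> < 1" "\<theta>\<^sup>2 = \<beta>" using beta by (auto simp: \<theta>_def)
  have "\<theta> * \<theta> \<le> \<theta> * 1" using 1 by (intro mult_left_mono) auto
  then show "\<beta> \<le> \<theta>" using 1 by (simp add: power2_eq_square)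
qed

text \<open>The adjoint of the discounted closed loop, which propagates the costate.\<close>

definition Pb :: "real mat" where "Pb = \<beta> \<cdot>\<^sub>m P\<^sup>T"

lemma Pb_dims [simp]: "dim_row Pb = n" "dim_col Pb = n" "dim_row (Pb ^\<^sub>m k) = n" "dim_col (Pb ^\<^sub>m k) = n"
  by (auto simp: Pb_def pow_mat_dim)

declare pow_mat_dim(2) [simp del]

lemma Pb_carrier [simp]: "Pb \<in> carrier_mat n n"
  by (auto simp: Pb_def)

lemma Pb_mult: "dim_vec x = n \<Longrightarrow> Pb *\<^sub>v x = \<beta> \<cdot>\<^sub>v (P\<^sup>T *\<^sub>v x)"
  by (simp add: Pb_def linear_simps)

lemma Pb_pow_mult: "dim_vec x = n \<Longrightarrow> Pb ^\<^sub>m Suc k *\<^sub>v x = Pb ^\<^sub>m k *\<^sub>v (Pb *\<^sub>v x)"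
  by (simp add: linear_simps)

lemma Pb_pow_commute: "dim_vec x = n \<Longrightarrow> Pb *\<^sub>v (Pb ^\<^sub>m k *\<^sub>v x) = Pb ^\<^sub>m k *\<^sub>v (Pb *\<^sub>v x)"
proof (induction k arbitrary: x)
  case 0
  have one: "1\<^sub>m n *\<^sub>v v = v" if "dim_vec v = n" for v :: "real vec"
    using that by (intro one_mult_mat_vec carrier_vecI)
  show ?case using 0 one by simp
next
  case (Suc k)
  then show ?case by (simp add: linear_simps)
qed

lemma Pb_pow_0 [simp]: "dim_vec x = n \<Longrightarrow> Pb ^\<^sub>m 0 *\<^sub>v x = x"
  by (simp, intro one_mult_mat_vec carrier_vecI)

lemma Pb_pow_sprod:
  assumes "dim_vec x = n" "dim_vec y = n"
  shows "x \<bullet> (Pb ^\<^sub>m k *\<^sub>v y) = \<beta>^k * ((P ^\<^sub>m k *\<^sub>v x) \<bullet> y)"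
  using assms
proof (induction k arbitrary: x y)
  case 0
  have "P ^\<^sub>m 0 *\<^sub>v x = x" using 0 by (simp, intro one_mult_mat_vec carrier_vecI)
  then show ?case using 0 by (simp del: pow_mat.simps)
next
  case (Suc k)
  have "x \<bullet> (Pb ^\<^sub>m Suc k *\<^sub>v y) = x \<bullet> (Pb *\<^sub>v (Pb ^\<^sub>m k *\<^sub>v y))"
    using Suc.prems by (simp only: Pb_pow_mult Pb_pow_commute)
  also have "\<dots> = \<beta> * ((P *\<^sub>v x) \<bullet> (Pb ^\<^sub>m k *\<^sub>v y))"
    using Suc.prems by (simp add: Pb_mult linear_simps sprod_transpose)
  also have "\<dots> = \<beta> * (\<beta>^k * ((P ^\<^sub>m k *\<^sub>v (P *\<^sub>v x)) \<bullet> y))"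
    using Suc.IH[of "P *\<^sub>v x" y] Suc.prems by simp
  finally show ?case using Suc.prems closed_loop_pow_Suc[of x M k] by (simp del: pow_mat.simps)
qed

text \<open>The discounted closed loop decays at rate $\sqrt\beta$, because a multiple of $x'Mx$ bounds
  $\beta^k$ times the squared norm of the state after \<open>k\<close> undiscounted steps.\<close>

lemma Pb_pow_bound:
  obtains c where "c \<ge> 0" "\<And>k. norm_bound (Pb ^\<^sub>m k) (c * \<theta>^k)"
proof -
  obtain c where c: "c \<ge> 0"
    "\<And>k x. dim_vec x = n \<Longrightarrow> \<beta>^k * ((P ^\<^sub>m k *\<^sub>v x) \<bullet> (P ^\<^sub>m k *\<^sub>v x)) \<le> c * (x \<bullet> x)"
    using closed_loop_bound[OF M fixpoint] by blast
  have "norm_bound (Pb ^\<^sub>m k) (sqrt c * \<theta>^k)" for k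
  proof (rule norm_boundI)
    fix i j assume "i < dim_row (Pb ^\<^sub>m k)" "j < dim_col (Pb ^\<^sub>m k)"
    then have ij: "i < n" "j < n" by auto
    let ?x = "unit_vec n i :: real vec" and ?y = "unit_vec n j :: real vec"
    have "(Pb ^\<^sub>m k) $$ (i, j) = ?x \<bullet> (Pb ^\<^sub>m k *\<^sub>v ?y)"
      using unit_vec_sprod_mult[OF pow_carrier_mat[OF Pb_carrier] ij] by simp
    also have "\<dots> = \<beta>^k * (P ^\<^sub>m k *\<^sub>v ?x) $ j" using ij by (subst Pb_pow_sprod) auto
    finally have "((Pb ^\<^sub>m k) $$ (i, j))\<^sup>2 = \<beta>^k * (\<beta>^k * ((P ^\<^sub>m k *\<^sub>v ?x) $ j)\<^sup>2)"
      by (simp add: power2_eq_square)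
    also have "\<dots> \<le> \<beta>^k * (\<beta>^k * ((P ^\<^sub>m k *\<^sub>v ?x) \<bullet> (P ^\<^sub>m k *\<^sub>v ?x)))"
      using beta ij by (intro mult_left_mono square_index_le_sprod_self) auto
    also have "\<dots> \<le> \<beta>^k * (c * (?x \<bullet> ?x))" using beta by (intro mult_left_mono c) auto
    also have "\<dots> = (sqrt c * \<theta>^k)\<^sup>2"
    proof -
      have "(\<theta>^k)\<^sup>2 = \<beta>^k" by (metis power_mult mult.commute theta(3))
      then show ?thesis using ij c(1) by (simp add: power_mult_distrib)
    qed
    finally show "norm ((Pb ^\<^sub>m k) $$ (i, j)) \<le> sqrt c * \<theta>^k"
      using c(1) theta by (simp add: abs_le_square_iff[symmetric] abs_mult)
  qed
  then show ?thesis using that[of "sqrt c"] c(1) by simp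
qed

lemma tendsto_theta: "(\<lambda>k. c * \<theta>^k) \<longlonglongrightarrow> 0"
  using tendsto_mult_right_zero[OF LIMSEQ_power_zero[of \<theta>]] theta by simp

text \<open>A vector that the discounted closed loop fixes is fixed by all its powers, which tend to zero.\<close>

lemma resolvent:
  "mat_inv (1\<^sub>m n - Pb) \<in> carrier_mat n n" "(1\<^sub>m n - Pb) * mat_inv (1\<^sub>m n - Pb) = 1\<^sub>m n"
proof -
  have inj: "v = 0\<^sub>v n" if "v \<in> carrier_vec n" "(1\<^sub>m n - Pb) *\<^sub>v v = 0\<^sub>v n" for v
  proof -
    have dv: "dim_vec v = n" using that by simp
    have "(1\<^sub>m n - Pb) *\<^sub>v v = v - Pb *\<^sub>v v" using that dv by (simp add: linear_simps)
    then have diff: "v - Pb *\<^sub>v v = 0\<^sub>v n" using that by simp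
    have fix1: "Pb *\<^sub>v v = v"
    proof (rule eq_vecI)
      fix i assume "i < dim_vec v"
      then show "(Pb *\<^sub>v v) $ i = v $ i" using arg_cong[OF diff, of "\<lambda>u. u $ i"] dv by simp
    qed (simp add: dv)
    have fixk: "Pb ^\<^sub>m k *\<^sub>v v = v" for k
    proof (induction k)
      case 0 show ?case using dv by (rule Pb_pow_0)
    next
      case (Suc k) then show ?case using Pb_pow_mult[OF dv] fix1 by simp
    qed
    obtain c where c: "c \<ge> 0" "\<And>k. norm_bound (Pb ^\<^sub>m k) (c * \<theta>^k)" using Pb_pow_bound by blast
    show ?thesis
    proof (rule eq_vecI)
      fix i assume "i < dim_vec (0\<^sub>v n :: real vec)"
      then have i: "i < n" by simp
      define s where "s = (\<Sum>j<n. \<bar>v $ j\<bar>)"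
      have "\<bar>v $ i\<bar> \<le> s * c * \<theta>^k" for k
      proof -
        have "\<bar>v $ i\<bar> = \<bar>\<Sum>j<n. (Pb ^\<^sub>m k) $$ (i, j) * v $ j\<bar>"
          by (subst fixk[symmetric, of k]) (use i dv in \<open>simp add: scalar_prod_def atLeast0LessThan\<close>)
        also have "\<dots> \<le> (\<Sum>j<n. \<bar>(Pb ^\<^sub>m k) $$ (i, j)\<bar> * \<bar>v $ j\<bar>)"
          by (rule order_trans[OF sum_abs]) (simp add: abs_mult)
        also have "\<dots> \<le> (\<Sum>j<n. (c * \<theta>^k) * \<bar>v $ j\<bar>)"
          using c(2)[of k] i by (intro sum_mono mult_right_mono) (auto simp: norm_bound_def)
        also have "\<dots> = s * c * \<theta>^k" unfolding s_def sum_distrib_left[symmetric] by simp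
        finally show ?thesis .
      qed
      then have "\<bar>v $ i\<bar> \<le> 0" using tendsto_theta[of "s * c"] by (intro LIMSEQ_le_const) auto
      then show "v $ i = 0\<^sub>v n $ i" using i by simp
    qed (use dv in simp)
  qed
  have c: "1\<^sub>m n - Pb \<in> carrier_mat n n" by (simp add: minus_carrier_mat)
  show "mat_inv (1\<^sub>m n - Pb) \<in> carrier_mat n n" "(1\<^sub>m n - Pb) * mat_inv (1\<^sub>m n - Pb) = 1\<^sub>m n"
    using injective_mat_inv[OF c inj] by blast+
qed

text \<open>The matrix by which the exogenous variable of the current period enters the costate.\<close>

definition \<Gamma> :: "real mat" where "\<Gamma> = (F\<^sup>T * K\<^sup>T + L\<^sup>T) + \<beta> \<cdot>\<^sub>m (P\<^sup>T * M * C)"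

definition gain_G :: "nat \<Rightarrow> real mat" where
  "gain_G i = (if i = 0 then - (mat_inv S * (K\<^sup>T + \<beta> \<cdot>\<^sub>m (B\<^sup>T * M * C)))
     else - \<beta> \<cdot>\<^sub>m (mat_inv S * B\<^sup>T * Pb ^\<^sub>m (i - 1) * \<Gamma>))"

definition gain_H :: "real vec \<Rightarrow> real vec" where
  "gain_H v = (- \<beta> \<cdot>\<^sub>m (mat_inv S * B\<^sup>T * mat_inv (1\<^sub>m n - Pb) * M)) *\<^sub>v v"

text \<open>The common left factor of the gains \<open>G\<^sub>n\<close>, \<open>n \<ge> 1\<close>, and of \<open>H\<close>.\<close>

definition gain_factor :: "real mat" where "gain_factor = - \<beta> \<cdot>\<^sub>m (mat_inv S * B\<^sup>T)"

lemma gain_dims2 [simp]: "dim_row \<Gamma> = n" "dim_col \<Gamma> = d" "dim_row (gain_G i) = m" "dim_col (gain_G i) = d"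
  "dim_vec (gain_H v) = m" "dim_row gain_factor = m" "dim_col gain_factor = n"
  by (auto simp: \<Gamma>_def gain_G_def gain_H_def gain_factor_def)

lemma gain_factor_mult: "dim_vec x = n \<Longrightarrow> gain_factor *\<^sub>v x = (- \<beta>) \<cdot>\<^sub>v (mat_inv S *\<^sub>v (B\<^sup>T *\<^sub>v x))"
  by (simp add: gain_factor_def linear_simps)

lemma gain_G_Suc: "gain_G (Suc i) = gain_factor * (Pb ^\<^sub>m i * \<Gamma>)"
proof -
  have c: "mat_inv S * B\<^sup>T \<in> carrier_mat m n" "Pb ^\<^sub>m i \<in> carrier_mat n n" "\<Gamma> \<in> carrier_mat n d"
    by auto
  have "mat_inv S * B\<^sup>T * Pb ^\<^sub>m i * \<Gamma> = mat_inv S * B\<^sup>T * (Pb ^\<^sub>m i * \<Gamma>)"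
    by (rule assoc_mult_mat[OF c])
  then show ?thesis
    using mult_smult_assoc_mat[OF c(1) mult_carrier_mat[OF c(2,3)], of "- \<beta>"]
    by (simp add: gain_G_def gain_factor_def)
qed

lemma gain_G_bound:
  obtains c where "c \<ge> 0" "\<And>i. norm_bound (gain_G i) (c * \<theta>^i)"
proof -
  obtain cp where cp: "cp \<ge> 0" "\<And>k. norm_bound (Pb ^\<^sub>m k) (cp * \<theta>^k)" using Pb_pow_bound by blast
  have ex: "\<exists>b\<ge>0. norm_bound X b" for X :: "real mat"
  proof -
    obtain b where "norm_bound X b" using norm_bound_max[of X] by blast
    then have "norm_bound X \<bar>b\<bar>" by (fastforce simp: norm_bound_def)
    then show ?thesis by (intro exI[of _ "\<bar>b\<bar>"]) auto
  qed
  obtain c0 where c0: "c0 \<ge> 0" "norm_bound (gain_G 0) c0" using ex by blast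
  obtain cs where cs: "cs \<ge> 0" "norm_bound (mat_inv S * B\<^sup>T) cs" using ex by blast
  obtain cg where cg: "cg \<ge> 0" "norm_bound \<Gamma> cg" using ex by blast
  have gain_factor: "norm_bound gain_factor (\<beta> * cs)"
    using cs beta by (auto simp: norm_bound_def gain_factor_def abs_mult intro!: mult_left_mono)
  define c where "c = c0 + cs * (cp * cg * n) * n"
  have c: "c \<ge> 0" "c0 \<le> c" "cs * (cp * cg * n) * n \<le> c" using c0 cs cp cg by (auto simp: c_def)
  have "norm_bound (gain_G i) (c * \<theta>^i)" for i
  proof (cases i)
    case 0
    have "norm_bound (gain_G 0) c" using c0(2) c(2) unfolding norm_bound_def by (meson order_trans)
    then show ?thesis using 0 by simp
  next
    case (Suc k)
    have "norm_bound (Pb ^\<^sub>m k * \<Gamma>) (cp * \<theta>^k * cg * of_nat n)"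
      by (rule norm_bound_mult[OF _ _ cp(2) cg(2)]) auto
    then have "norm_bound (gain_factor * (Pb ^\<^sub>m k * \<Gamma>)) (\<beta> * cs * (cp * \<theta>^k * cg * of_nat n) * of_nat n)"
      by (intro norm_bound_mult[OF _ _ gain_factor]) auto
    moreover have "\<beta> * cs * (cp * \<theta>^k * cg * of_nat n) * of_nat n \<le> c * \<theta>^Suc k"
    proof -
      have "\<beta> * cs * (cp * \<theta>^k * cg * of_nat n) * of_nat n = (\<beta> * \<theta>^k) * (cs * (cp * cg * n) * n)" by simp
      also have "\<dots> \<le> (\<theta> * \<theta>^k) * c"
        using c theta cs cp cg beta by (intro mult_mono) auto
      finally show ?thesis by (simp add: mult.commute)
    qed
    ultimately show ?thesis unfolding Suc gain_G_Suc norm_bound_def by (meson order_trans)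
  qed
  then show ?thesis using that c(1) by blast
qed

text \<open>The costate of data with constant disturbance \<open>v\<close> splits into a discounted sum over
  \<open>z\<close> and a telescoping remainder around the fixed point \<open>h\<close> of
  \<open>h = M v + \<beta>P'h\<close>.\<close>

primrec zsum :: "(nat \<Rightarrow> real vec) \<Rightarrow> nat \<Rightarrow> nat \<Rightarrow> real vec" where
  "zsum z 0 t = 0\<^sub>v n"
| "zsum z (Suc k) t = \<Gamma> *\<^sub>v z t + Pb *\<^sub>v zsum z k (Suc t)"

lemma zsum_dim [simp]: "dim_vec (zsum z k t) = n"
  by (cases k) auto

lemma mult_zsum:
  assumes "dim_col X = n" "\<And>j. dim_vec (z j) = d" "i < dim_row X"
  shows "(X *\<^sub>v zsum z k t) $ i = (\<Sum>j<k. (X *\<^sub>v (Pb ^\<^sub>m j *\<^sub>v (\<Gamma> *\<^sub>v z (t + j)))) $ i)"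
  using assms
proof (induction k arbitrary: X t)
  case 0
  then show ?case by (auto simp: scalar_prod_def)
next
  case (Suc k)
  have "(X *\<^sub>v zsum z (Suc k) t) $ i = (X *\<^sub>v (\<Gamma> *\<^sub>v z t)) $ i + ((X * Pb) *\<^sub>v zsum z k (Suc t)) $ i"
    using Suc.prems by (simp add: linear_simps del: index_mult_mat_vec)
  also have "((X * Pb) *\<^sub>v zsum z k (Suc t)) $ i
      = (\<Sum>j<k. ((X * Pb) *\<^sub>v (Pb ^\<^sub>m j *\<^sub>v (\<Gamma> *\<^sub>v z (Suc t + j)))) $ i)"
    using Suc.prems by (intro Suc.IH) auto
  also have "\<dots> = (\<Sum>j<k. (X *\<^sub>v (Pb ^\<^sub>m Suc j *\<^sub>v (\<Gamma> *\<^sub>v z (t + Suc j)))) $ i)"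
  proof (rule sum.cong[OF refl])
    fix j
    have g: "dim_vec (\<Gamma> *\<^sub>v z (t + Suc j)) = n" by simp
    have "(X * Pb) *\<^sub>v (Pb ^\<^sub>m j *\<^sub>v (\<Gamma> *\<^sub>v z (t + Suc j))) = X *\<^sub>v (Pb ^\<^sub>m Suc j *\<^sub>v (\<Gamma> *\<^sub>v z (t + Suc j)))"
      unfolding Pb_pow_mult[OF g] using Suc.prems by (simp add: mat_mult_mult Pb_pow_commute)
    then show "((X * Pb) *\<^sub>v (Pb ^\<^sub>m j *\<^sub>v (\<Gamma> *\<^sub>v z (Suc t + j)))) $ i
        = (X *\<^sub>v (Pb ^\<^sub>m Suc j *\<^sub>v (\<Gamma> *\<^sub>v z (t + Suc j)))) $ i" by simp
  qed
  finally show ?case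
    unfolding sum.lessThan_Suc_shift using Pb_pow_0[of "\<Gamma> *\<^sub>v z t"] by (simp del: pow_mat.simps)
qed

lemma costate_const:
  assumes z: "\<And>j. dim_vec (z j) = d" and v: "dim_vec v = n"
    and h: "dim_vec h = n" "h = M *\<^sub>v v + Pb *\<^sub>v h"
  shows "costate z (\<lambda>_. v) k t = zsum z k t + (Pb *\<^sub>v h - Pb ^\<^sub>m Suc k *\<^sub>v h)"
proof (induction k arbitrary: t)
  case 0
  have "Pb *\<^sub>v h - Pb ^\<^sub>m Suc 0 *\<^sub>v h = 0\<^sub>v n"
    unfolding Pb_pow_mult[OF h(1)] by (subst Pb_pow_0) (auto intro: diff_self_vec)
  then show ?case by simp
next
  case (Suc k)
  have Ph: "dim_vec (Pb *\<^sub>v h) = n" by simp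
  have "costate z (\<lambda>_. v) (Suc k) t = \<Gamma> *\<^sub>v z t + Pb *\<^sub>v (M *\<^sub>v v) + Pb *\<^sub>v costate z (\<lambda>_. v) k (Suc t)"
    using z[of t] v
    by (simp add: \<Gamma>_def Pb_mult linear_simps) (rule eq_vecI; simp add: algebra_simps)
  also have "Pb *\<^sub>v costate z (\<lambda>_. v) k (Suc t)
      = Pb *\<^sub>v zsum z k (Suc t) + (Pb *\<^sub>v (Pb *\<^sub>v h) - Pb ^\<^sub>m Suc (Suc k) *\<^sub>v h)"
    unfolding Suc.IH Pb_pow_mult[OF h(1)] Pb_pow_mult[OF Ph]
    by (simp add: mult_mat_add mult_mat_diff Pb_pow_commute)
  also have "\<Gamma> *\<^sub>v z t + Pb *\<^sub>v (M *\<^sub>v v) + (Pb *\<^sub>v zsum z k (Suc t) + (Pb *\<^sub>v (Pb *\<^sub>v h) - Pb ^\<^sub>m Suc (Suc k) *\<^sub>v h))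
      = zsum z (Suc k) t + (Pb *\<^sub>v (M *\<^sub>v v) + Pb *\<^sub>v (Pb *\<^sub>v h) - Pb ^\<^sub>m Suc (Suc k) *\<^sub>v h)"
    by (rule eq_vecI) (auto simp: algebra_simps simp del: pow_mat.simps)
  also have "Pb *\<^sub>v (M *\<^sub>v v) + Pb *\<^sub>v (Pb *\<^sub>v h) = Pb *\<^sub>v (M *\<^sub>v v + Pb *\<^sub>v h)"
    by (simp add: mult_mat_add)
  also have "M *\<^sub>v v + Pb *\<^sub>v h = h" by (rule h(2)[symmetric])
  finally show ?case .
qed

text \<open>The minimizing deviation from the feedback in the first of \<open>Suc k\<close> periods, when the exogenous sequence
  is known in advance and the disturbance is the constant \<open>v\<close>.\<close>

definition finite_response :: "(nat \<Rightarrow> real vec) \<Rightarrow> real vec \<Rightarrow> nat \<Rightarrow> real vec" where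
  "finite_response z v k = - (mat_inv S *\<^sub>v gradient z (\<lambda>_. v) k 0)"

lemma finite_response_dim [simp]: "dim_vec (finite_response z v k) = m"
  by (simp add: finite_response_def)

lemma S_finite_response: "S *\<^sub>v finite_response z v k = - gradient z (\<lambda>_. v) k 0"
proof -
  have eq: "finite_response z v k = (- 1) \<cdot>\<^sub>v (mat_inv S *\<^sub>v gradient z (\<lambda>_. v) k 0)"
    by (rule eq_vecI) (auto simp: finite_response_def)
  show ?thesis
    unfolding eq by (rule eq_vecI) (simp_all add: mult_mat_smult Sinv(3)[OF M] del: index_mult_mat_vec)
qed

text \<open>The finite-horizon response differs from the infinite-horizon one by the tail of the gain
  series and a remainder of order $\theta^{k+1}$.\<close>

lemma finite_response_tail:
  assumes v: "dim_vec v = n"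
  obtains c \<rho> where "c \<ge> 0" "\<And>k i. i < m \<Longrightarrow> \<bar>\<rho> k i\<bar> \<le> c * \<theta>^Suc k"
    "\<And>z k i. (\<And>j. dim_vec (z j) = d) \<Longrightarrow> i < m \<Longrightarrow>
      finite_response z v k $ i = (\<Sum>j<Suc k. (gain_G j *\<^sub>v z j) $ i) + gain_H v $ i - \<rho> k i"
proof -
  define h where "h = mat_inv (1\<^sub>m n - Pb) *\<^sub>v (M *\<^sub>v v)"
  have W: "dim_row (mat_inv (1\<^sub>m n - Pb)) = n" "dim_col (mat_inv (1\<^sub>m n - Pb)) = n"
    using resolvent(1) by auto
  have h: "dim_vec h = n" using W by (simp add: h_def)
  have "(1\<^sub>m n - Pb) *\<^sub>v h = ((1\<^sub>m n - Pb) * mat_inv (1\<^sub>m n - Pb)) *\<^sub>v (M *\<^sub>v v)"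
    unfolding h_def using W by (subst mat_mult_mult) auto
  also have "\<dots> = M *\<^sub>v v" unfolding resolvent(2) by (intro one_mult_mat_vec carrier_vecI) simp
  finally have "(1\<^sub>m n - Pb) *\<^sub>v h = M *\<^sub>v v" .
  moreover have "(1\<^sub>m n - Pb) *\<^sub>v h = h - Pb *\<^sub>v h"
    using one_mult_mat_vec[OF carrier_vecI[OF h]] h by (simp add: diff_mat_mult)
  ultimately have diff: "h - Pb *\<^sub>v h = M *\<^sub>v v" by simp
  have hfix: "h = M *\<^sub>v v + Pb *\<^sub>v h"
    unfolding diff[symmetric] by (rule eq_vecI) (auto simp: h)
  have H: "gain_H v = gain_factor *\<^sub>v h"
    unfolding gain_H_def h_def using W v by (simp add: gain_factor_mult linear_simps)
  define \<rho> where "\<rho> k i = (gain_factor *\<^sub>v (Pb ^\<^sub>m Suc k *\<^sub>v h)) $ i" for k i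
  obtain cp where cp: "cp \<ge> 0" "\<And>k. norm_bound (Pb ^\<^sub>m k) (cp * \<theta>^k)" using Pb_pow_bound by blast
  obtain b where b: "norm_bound gain_factor b" using norm_bound_max[of gain_factor] by blast
  define c where "c = (\<Sum>l<n. \<Sum>j<n. \<bar>b\<bar> * cp * \<bar>h $ j\<bar>)"
  have "\<bar>\<rho> k i\<bar> \<le> c * \<theta>^Suc k" if "i < m" for k i
  proof -
    have "(gain_factor *\<^sub>v (Pb ^\<^sub>m Suc k *\<^sub>v h)) $ i = (\<Sum>l<n. gain_factor $$ (i, l) * (\<Sum>j<n. (Pb ^\<^sub>m Suc k) $$ (l, j) * h $ j))"
      using that h by (simp add: scalar_prod_def atLeast0LessThan del: pow_mat.simps)
    then have "\<rho> k i = (\<Sum>l<n. \<Sum>j<n. gain_factor $$ (i, l) * ((Pb ^\<^sub>m Suc k) $$ (l, j) * h $ j))"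
      by (simp only: \<rho>_def sum_distrib_left)
    also have "\<bar>\<dots>\<bar> \<le> (\<Sum>l<n. \<Sum>j<n. \<bar>gain_factor $$ (i, l) * ((Pb ^\<^sub>m Suc k) $$ (l, j) * h $ j)\<bar>)"
      by (rule order_trans[OF sum_abs]) (auto intro!: sum_mono sum_abs)
    also have "\<dots> \<le> (\<Sum>l<n. \<Sum>j<n. \<bar>b\<bar> * (cp * \<theta>^Suc k * \<bar>h $ j\<bar>))"
    proof (intro sum_mono)
      fix l j assume "l \<in> {..<n}" "j \<in> {..<n}"
      then have 1: "\<bar>gain_factor $$ (i, l)\<bar> \<le> \<bar>b\<bar>" and 2: "\<bar>(Pb ^\<^sub>m Suc k) $$ (l, j)\<bar> \<le> cp * \<theta>^Suc k"
        using b cp(2)[of "Suc k"] that by (fastforce simp: norm_bound_def simp del: pow_mat.simps)+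
      show "\<bar>gain_factor $$ (i, l) * ((Pb ^\<^sub>m Suc k) $$ (l, j) * h $ j)\<bar> \<le> \<bar>b\<bar> * (cp * \<theta>^Suc k * \<bar>h $ j\<bar>)"
        unfolding abs_mult using 1 2 by (intro mult_mono mult_right_mono) auto
    qed
    also have "\<dots> = c * \<theta>^Suc k" by (simp add: c_def sum_distrib_left sum_distrib_right mult_ac)
    finally show ?thesis .
  qed
  moreover have "finite_response z v k $ i = (\<Sum>j<Suc k. (gain_G j *\<^sub>v z j) $ i) + gain_H v $ i - \<rho> k i"
    if z: "\<And>j. dim_vec (z j) = d" and i: "i < m" for z k i
  proof -
    have cs: "M *\<^sub>v v + costate z (\<lambda>_. v) k 1 = zsum z k 1 + (h - Pb ^\<^sub>m Suc k *\<^sub>v h)"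
      unfolding costate_const[OF z v h hfix]
      by (subst (2) hfix) (rule eq_vecI; simp del: pow_mat.simps index_mult_mat_vec)
    have "finite_response z v k = gain_G 0 *\<^sub>v z 0 + gain_factor *\<^sub>v (M *\<^sub>v v + costate z (\<lambda>_. v) k 1)"
      unfolding finite_response_def gradient_def using z[of 0] v
      by (simp add: gain_G_def gain_factor_mult linear_simps uminus_mat_mult del: costate.simps)
        (rule eq_vecI; simp add: algebra_simps)
    also have "\<dots> = gain_G 0 *\<^sub>v z 0 + (gain_factor *\<^sub>v zsum z k 1 + (gain_factor *\<^sub>v h - gain_factor *\<^sub>v (Pb ^\<^sub>m Suc k *\<^sub>v h)))"
      unfolding cs using h by (simp add: mult_mat_add mult_mat_diff del: pow_mat.simps)
    finally have "finite_response z v k $ i = (gain_G 0 *\<^sub>v z 0) $ i + (gain_factor *\<^sub>v zsum z k 1) $ i + gain_H v $ i - \<rho> k i"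
      using i by (simp add: H \<rho>_def del: pow_mat.simps index_mult_mat_vec)
    also have "(gain_factor *\<^sub>v zsum z k 1) $ i = (\<Sum>j<k. (gain_G (Suc j) *\<^sub>v z (Suc j)) $ i)"
      using mult_zsum[of gain_factor z i k 1] z i by (simp add: gain_G_Suc mat_mult_mult del: index_mult_mat_vec)
    finally show ?thesis unfolding sum.lessThan_Suc_shift by simp
  qed
  moreover have "c \<ge> 0" unfolding c_def using cp(1) by (intro sum_nonneg mult_nonneg_nonneg) auto
  ultimately show ?thesis using that by blast
qed

end

section \<open>Measurability of vectors, sequences and plays\<close>

text \<open>As rewrite rules these would loop: the right-hand sides contain the same functions at earlier times, without a
  pattern that stops the unfolding.\<close>

declare subj_u.simps [simp del] game_u.simps [simp del] game_y.simps [simp del]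

lemma space_vec_borel [simp]: "space (vec_borel n) = carrier_vec n"
  by (simp add: vec_borel_def)

lemma measurable_vecI:
  assumes "\<And>x. x \<in> space N \<Longrightarrow> dim_vec (f x) = n"
    and "\<And>k. k < n \<Longrightarrow> (\<lambda>x. f x $ k) \<in> borel_measurable N"
  shows "f \<in> N \<rightarrow>\<^sub>M vec_borel n"
  unfolding vec_borel_def
  by (rule measurable_vimage_algebra2) (use assms in \<open>auto intro!: measurable_restrict carrier_vecI\<close>)

lemma measurable_vec_index:
  assumes f: "f \<in> N \<rightarrow>\<^sub>M vec_borel n" and k: "k < n"
  shows "(\<lambda>x. f x $ k) \<in> borel_measurable N"
proof -
  have "(\<lambda>v. \<lambda>k\<in>{..<n}. v $ k :: real) \<in> vec_borel n \<rightarrow>\<^sub>M (\<Pi>\<^sub>M k\<in>{..<n}. borel)"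
    unfolding vec_borel_def by (rule measurable_vimage_algebra1) (auto simp: space_PiM)
  from measurable_compose[OF measurable_compose[OF f this] measurable_component_singleton[of k]]
  show ?thesis using k by simp
qed

lemma measurable_vec_dim: "f \<in> N \<rightarrow>\<^sub>M vec_borel n \<Longrightarrow> x \<in> space N \<Longrightarrow> dim_vec (f x) = n"
  using measurable_space[of f N "vec_borel n" x] by simp

lemma measurable_vec_const: "dim_vec v = n \<Longrightarrow> (\<lambda>_. v) \<in> N \<rightarrow>\<^sub>M vec_borel n"
  by (rule measurable_vecI) auto

lemma measurable_vec_add:
  assumes "f \<in> N \<rightarrow>\<^sub>M vec_borel n" "g \<in> N \<rightarrow>\<^sub>M vec_borel n"
  shows "(\<lambda>x. f x + g x) \<in> N \<rightarrow>\<^sub>M vec_borel n"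
proof (rule measurable_vecI)
  fix k assume k: "k < n"
  have "(\<lambda>x. f x $ k + g x $ k) \<in> borel_measurable N"
    using assms k by (intro borel_measurable_add measurable_vec_index)
  then show "(\<lambda>x. (f x + g x) $ k) \<in> borel_measurable N"
    by (rule measurable_cong[THEN iffD1, rotated]) (use assms k in \<open>simp add: measurable_vec_dim\<close>)
qed (use assms in \<open>simp add: measurable_vec_dim\<close>)

lemma measurable_vec_minus:
  assumes "f \<in> N \<rightarrow>\<^sub>M vec_borel n" "g \<in> N \<rightarrow>\<^sub>M vec_borel n"
  shows "(\<lambda>x. f x - g x) \<in> N \<rightarrow>\<^sub>M vec_borel n"
proof (rule measurable_vecI)
  fix k assume k: "k < n"
  have "(\<lambda>x. f x $ k - g x $ k) \<in> borel_measurable N"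
    using assms k by (intro borel_measurable_diff measurable_vec_index)
  then show "(\<lambda>x. (f x - g x) $ k) \<in> borel_measurable N"
    by (rule measurable_cong[THEN iffD1, rotated]) (use assms k in \<open>simp add: measurable_vec_dim\<close>)
qed (use assms in \<open>simp add: measurable_vec_dim\<close>)

lemma measurable_mult_mat_vec:
  assumes A: "A \<in> carrier_mat n' n" and f: "f \<in> N \<rightarrow>\<^sub>M vec_borel n"
  shows "(\<lambda>x. A *\<^sub>v f x) \<in> N \<rightarrow>\<^sub>M vec_borel n'"
proof (rule measurable_vecI)
  fix k assume k: "k < n'"
  have "(\<lambda>x. \<Sum>l<n. A $$ (k, l) * f x $ l) \<in> borel_measurable N"
    using f by (intro borel_measurable_sum borel_measurable_times measurable_vec_index) auto
  then show "(\<lambda>x. (A *\<^sub>v f x) $ k) \<in> borel_measurable N"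
    by (rule measurable_cong[THEN iffD1, rotated])
      (use A f k in \<open>simp add: measurable_vec_dim scalar_prod_def atLeast0LessThan\<close>)
qed (use A in simp)

lemma measurable_vec_sum:
  assumes "\<And>i. i \<in> I \<Longrightarrow> f i \<in> N \<rightarrow>\<^sub>M vec_borel n"
  shows "(\<lambda>x. vec_sum n (\<lambda>i. f i x) I) \<in> N \<rightarrow>\<^sub>M vec_borel n"
proof (rule measurable_vecI)
  fix k assume "k < n"
  then show "(\<lambda>x. vec_sum n (\<lambda>i. f i x) I $ k) \<in> borel_measurable N"
    using assms by (simp add: vec_sum_def) (intro borel_measurable_sum measurable_vec_index, auto)
qed (simp add: vec_sum_def)

lemma measurable_sprod:
  assumes "f \<in> N \<rightarrow>\<^sub>M vec_borel n" "g \<in> N \<rightarrow>\<^sub>M vec_borel n"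
  shows "(\<lambda>x. f x \<bullet> g x) \<in> borel_measurable N"
proof -
  have "(\<lambda>x. \<Sum>k<n. f x $ k * g x $ k) \<in> borel_measurable N"
    using assms by (intro borel_measurable_sum borel_measurable_times measurable_vec_index) auto
  then show ?thesis
    by (rule measurable_cong[THEN iffD1, rotated])
      (use assms in \<open>simp add: measurable_vec_dim scalar_prod_def atLeast0LessThan\<close>)
qed

lemma measurable_quad_form:
  assumes "A \<in> carrier_mat n n" "f \<in> N \<rightarrow>\<^sub>M vec_borel n"
  shows "(\<lambda>x. quad_form A (f x)) \<in> borel_measurable N"
  unfolding quad_form_def by (rule measurable_sprod[OF assms(2) measurable_mult_mat_vec[OF assms]])

lemma space_seq_borel: "space (seq_borel T n) = (\<Pi>\<^sub>E t\<in>T. carrier_vec n)"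
  by (simp add: seq_borel_def space_PiM)

lemma measurable_seq_restrict:
  "(\<And>t. t \<in> T \<Longrightarrow> f t \<in> N \<rightarrow>\<^sub>M vec_borel n) \<Longrightarrow> (\<lambda>x. \<lambda>t\<in>T. f t x) \<in> N \<rightarrow>\<^sub>M seq_borel T n"
  unfolding seq_borel_def by (rule measurable_restrict)

lemma measurable_seq_UNIV:
  "(\<And>t. f t \<in> N \<rightarrow>\<^sub>M vec_borel n) \<Longrightarrow> (\<lambda>x t. f t x) \<in> N \<rightarrow>\<^sub>M seq_borel UNIV n"
  using measurable_seq_restrict[of UNIV f N n] by (simp add: restrict_UNIV)

lemma measurable_seq_component: "t \<in> T \<Longrightarrow> (\<lambda>z. z t) \<in> seq_borel T n \<rightarrow>\<^sub>M vec_borel n"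
  unfolding seq_borel_def by (rule measurable_component_singleton)

lemma seq_borel_dim: "z \<in> space (seq_borel UNIV n) \<Longrightarrow> dim_vec (z t) = n"
  using measurable_vec_dim[OF measurable_seq_component[of t UNIV n], of z] by simp

lemma game_dims:
  assumes "lq_game_data g"
  shows "Amat g 0 \<in> carrier_mat (dimx g 0) (dimx g 0)" "Dmat g \<in> carrier_mat (dimy g) (dimx g 0)"
    "i \<in> {1..nDM g} \<Longrightarrow> Amat g i \<in> carrier_mat (dimx g i) (dimx g i)"
    "i \<in> {1..nDM g} \<Longrightarrow> Bmat g i \<in> carrier_mat (dimx g i) (dimu g i)"
    "i \<in> {1..nDM g} \<Longrightarrow> Cmat g i \<in> carrier_mat (dimx g i) (dimy g)"
    "i \<in> {1..nDM g} \<Longrightarrow> B1mat g i \<in> carrier_mat (dimx g 0) (dimu g i)"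
    "i \<in> {1..nDM g} \<Longrightarrow> B2mat g i \<in> carrier_mat (dimx g 0) (dimx g i)"
    "i \<in> {1..nDM g} \<Longrightarrow> E1mat g i \<in> carrier_mat (dimy g) (dimu g i)"
    "i \<in> {1..nDM g} \<Longrightarrow> E2mat g i \<in> carrier_mat (dimy g) (dimx g i)"
    "i \<in> {1..nDM g} \<Longrightarrow> pos_def (dimx g i) (Qmat g i)"
    "i \<in> {1..nDM g} \<Longrightarrow> pos_def (dimu g i) (Rmat g i)"
    "i \<in> {1..nDM g} \<Longrightarrow> Kmat g i \<in> carrier_mat (dimy g) (dimu g i)"
    "i \<in> {1..nDM g} \<Longrightarrow> Lmat g i \<in> carrier_mat (dimy g) (dimx g i)"
    "i \<in> {1..nDM g} \<Longrightarrow> 0 \<le> disc g i" "i \<in> {1..nDM g} \<Longrightarrow> disc g i < 1"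
  using assms by (simp_all add: lq_game_data_def)

lemma measurable_strategy:
  assumes s: "s \<in> strategies g i"
    and x: "\<And>k. k \<le> t \<Longrightarrow> X k \<in> N \<rightarrow>\<^sub>M vec_borel (dimx g i)"
    and u: "\<And>k. k < t \<Longrightarrow> U k \<in> N \<rightarrow>\<^sub>M vec_borel (dimu g i)"
    and y: "\<And>k. k < t \<Longrightarrow> Y k \<in> N \<rightarrow>\<^sub>M vec_borel (dimy g)"
  shows "(\<lambda>\<omega>. s t (\<lambda>k\<in>{..t}. X k \<omega>) (\<lambda>k\<in>{..<t}. U k \<omega>) (\<lambda>k\<in>{..<t}. Y k \<omega>)) \<in> N \<rightarrow>\<^sub>M vec_borel (dimu g i)"
proof -
  have f: "(\<lambda>(x, u, y). s t x u y) \<in> seq_borel {..t} (dimx g i) \<Otimes>\<^sub>M seq_borel {..<t} (dimu g i)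
      \<Otimes>\<^sub>M seq_borel {..<t} (dimy g) \<rightarrow>\<^sub>M vec_borel (dimu g i)"
    using s by (simp add: strategies_def)
  have "(\<lambda>\<omega>. (\<lambda>k\<in>{..t}. X k \<omega>, \<lambda>k\<in>{..<t}. U k \<omega>, \<lambda>k\<in>{..<t}. Y k \<omega>)) \<in>
      N \<rightarrow>\<^sub>M seq_borel {..t} (dimx g i) \<Otimes>\<^sub>M seq_borel {..<t} (dimu g i) \<Otimes>\<^sub>M seq_borel {..<t} (dimy g)"
    using x u y by (intro measurable_Pair measurable_seq_restrict) auto
  from measurable_compose[OF this f] show ?thesis by simp
qed

lemma measurable_subj:
  assumes g: "lq_game_data g" and i: "i \<in> {1..nDM g}" and s: "s \<in> strategies g i"
    and x0: "X0 \<in> N \<rightarrow>\<^sub>M vec_borel (dimx g i)"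
    and w: "\<And>t. W t \<in> N \<rightarrow>\<^sub>M vec_borel (dimx g i)"
    and z: "\<And>t. Z t \<in> N \<rightarrow>\<^sub>M vec_borel (dimy g)"
  shows "(\<lambda>\<omega>. subj_x g i s (X0 \<omega>) (\<lambda>t. W t \<omega>) (\<lambda>t. Z t \<omega>) t) \<in> N \<rightarrow>\<^sub>M vec_borel (dimx g i)"
    "(\<lambda>\<omega>. subj_u g i s (X0 \<omega>) (\<lambda>t. W t \<omega>) (\<lambda>t. Z t \<omega>) t) \<in> N \<rightarrow>\<^sub>M vec_borel (dimu g i)"
proof -
  let ?x = "\<lambda>t \<omega>. subj_x g i s (X0 \<omega>) (\<lambda>t. W t \<omega>) (\<lambda>t. Z t \<omega>) t"
  let ?u = "\<lambda>t \<omega>. subj_u g i s (X0 \<omega>) (\<lambda>t. W t \<omega>) (\<lambda>t. Z t \<omega>) t"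
  have u: "?u t \<in> N \<rightarrow>\<^sub>M vec_borel (dimu g i)"
    if "\<forall>k\<le>t. ?x k \<in> N \<rightarrow>\<^sub>M vec_borel (dimx g i)" "\<forall>k<t. ?u k \<in> N \<rightarrow>\<^sub>M vec_borel (dimu g i)" for t
    unfolding subj_u.simps[of _ _ _ _ _ _ t] using that z by (intro measurable_strategy[OF s]) auto
  have "(\<forall>k\<le>t. ?x k \<in> N \<rightarrow>\<^sub>M vec_borel (dimx g i)) \<and> (\<forall>k\<le>t. ?u k \<in> N \<rightarrow>\<^sub>M vec_borel (dimu g i))" for t
  proof (induction t)
    case 0
    then show ?case using u[of 0] x0 by simp
  next
    case (Suc t)
    have xS: "?x (Suc t) \<in> N \<rightarrow>\<^sub>M vec_borel (dimx g i)"
      unfolding subj_x.simps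
      using Suc by (intro measurable_vec_add measurable_mult_mat_vec[OF game_dims(3)[OF g i]]
          measurable_mult_mat_vec[OF game_dims(4)[OF g i]] measurable_mult_mat_vec[OF game_dims(5)[OF g i]] w z)
        auto
    have X: "\<forall>k\<le>Suc t. ?x k \<in> N \<rightarrow>\<^sub>M vec_borel (dimx g i)"
      using Suc xS by (auto simp only: le_Suc_eq)
    moreover have "?u (Suc t) \<in> N \<rightarrow>\<^sub>M vec_borel (dimu g i)"
      using u[OF X] Suc by (auto simp only: less_Suc_eq_le)
    ultimately show ?case using Suc by (auto simp only: le_Suc_eq)
  qed
  then show "?x t \<in> N \<rightarrow>\<^sub>M vec_borel (dimx g i)" "?u t \<in> N \<rightarrow>\<^sub>M vec_borel (dimu g i)" by blast+
qed

text \<open>Plays are nonanticipating: what happens at \<open>t\<close> depends on the data before \<open>t\<close> only.\<close>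

lemma subj_cong:
  assumes "\<And>k. k < t \<Longrightarrow> w k = w' k" "\<And>k. k < t \<Longrightarrow> z k = z' k"
  shows "subj_x g i s x0 w z t = subj_x g i s x0 w' z' t"
    "subj_u g i s x0 w z t = subj_u g i s x0 w' z' t"
proof -
  have u: "subj_u g i s x0 w z t = subj_u g i s x0 w' z' t"
    if "\<forall>k\<le>t. subj_x g i s x0 w z k = subj_x g i s x0 w' z' k"
      "\<forall>k<t. subj_u g i s x0 w z k = subj_u g i s x0 w' z' k" "\<forall>k<t. z k = z' k" for t
  proof -
    have "(\<lambda>k\<in>{..t}. subj_x g i s x0 w z k) = (\<lambda>k\<in>{..t}. subj_x g i s x0 w' z' k)"
      "(\<lambda>k\<in>{..<t}. subj_u g i s x0 w z k) = (\<lambda>k\<in>{..<t}. subj_u g i s x0 w' z' k)"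
      "(\<lambda>k\<in>{..<t}. z k) = (\<lambda>k\<in>{..<t}. z' k)"
      using that by (intro restrict_ext; simp)+
    then show ?thesis unfolding subj_u.simps[of _ _ _ _ _ _ t] by (simp only:)
  qed
  have "(\<forall>k\<le>t. subj_x g i s x0 w z k = subj_x g i s x0 w' z' k)
      \<and> (\<forall>k\<le>t. subj_u g i s x0 w z k = subj_u g i s x0 w' z' k)"
    using assms
  proof (induction t)
    case 0
    then show ?case using u[of 0] by simp
  next
    case (Suc t)
    have IH: "(\<forall>k\<le>t. subj_x g i s x0 w z k = subj_x g i s x0 w' z' k)
      \<and> (\<forall>k\<le>t. subj_u g i s x0 w z k = subj_u g i s x0 w' z' k)"
      using Suc.prems by (intro Suc.IH) auto
    then have "subj_x g i s x0 w z (Suc t) = subj_x g i s x0 w' z' (Suc t)"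
      using Suc.prems by simp
    then have X: "\<forall>k\<le>Suc t. subj_x g i s x0 w z k = subj_x g i s x0 w' z' k"
      using IH by (auto simp only: le_Suc_eq)
    have "subj_u g i s x0 w z (Suc t) = subj_u g i s x0 w' z' (Suc t)"
      using X IH Suc.prems by (intro u) (auto simp only: less_Suc_eq_le)
    then show ?case using X IH by (auto simp only: le_Suc_eq)
  qed
  then show "subj_x g i s x0 w z t = subj_x g i s x0 w' z' t"
    "subj_u g i s x0 w z t = subj_u g i s x0 w' z' t" by blast+
qed

lemma measurable_game:
  assumes g: "lq_game_data g" and s: "\<And>i. i \<in> {1..nDM g} \<Longrightarrow> s i \<in> strategies g i"
    and x0: "\<And>i. i \<le> nDM g \<Longrightarrow> X0 i \<in> N \<rightarrow>\<^sub>M vec_borel (dimx g i)"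
    and w: "\<And>t i. i \<le> nDM g \<Longrightarrow> W t i \<in> N \<rightarrow>\<^sub>M vec_borel (dimx g i)"
    and \<xi>: "\<And>t. \<Xi> t \<in> N \<rightarrow>\<^sub>M vec_borel (dimy g)"
  defines "gx \<equiv> \<lambda>i t \<omega>. game_x g s (\<lambda>i. X0 i \<omega>) (\<lambda>t i. W t i \<omega>) (\<lambda>t. \<Xi> t \<omega>) i t"
    and "gu \<equiv> \<lambda>i t \<omega>. game_u g s (\<lambda>i. X0 i \<omega>) (\<lambda>t i. W t i \<omega>) (\<lambda>t. \<Xi> t \<omega>) i t"
    and "gy \<equiv> \<lambda>t \<omega>. game_y g s (\<lambda>i. X0 i \<omega>) (\<lambda>t i. W t i \<omega>) (\<lambda>t. \<Xi> t \<omega>) t"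
  shows "i \<le> nDM g \<Longrightarrow> gx i t \<in> N \<rightarrow>\<^sub>M vec_borel (dimx g i)"
    "i \<in> {1..nDM g} \<Longrightarrow> gu i t \<in> N \<rightarrow>\<^sub>M vec_borel (dimu g i)"
    "gy t \<in> N \<rightarrow>\<^sub>M vec_borel (dimy g)"
proof -
  define PX where "PX t \<longleftrightarrow> (\<forall>k\<le>t. \<forall>i\<le>nDM g. gx i k \<in> N \<rightarrow>\<^sub>M vec_borel (dimx g i))" for t
  define PU where "PU t \<longleftrightarrow> (\<forall>k<t. \<forall>i\<in>{1..nDM g}. gu i k \<in> N \<rightarrow>\<^sub>M vec_borel (dimu g i))" for t
  define PY where "PY t \<longleftrightarrow> (\<forall>k<t. gy k \<in> N \<rightarrow>\<^sub>M vec_borel (dimy g))" for t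
  have u: "gu i t \<in> N \<rightarrow>\<^sub>M vec_borel (dimu g i)" if "PX t" "PU t" "PY t" "i \<in> {1..nDM g}" for t i
    unfolding gu_def game_u.simps[of _ _ _ _ _ _ t]
    by (rule measurable_strategy[OF s]) (use that in \<open>auto simp: PX_def PU_def PY_def gx_def gu_def gy_def\<close>)
  have y: "gy t \<in> N \<rightarrow>\<^sub>M vec_borel (dimy g)" if "PX t" "PU (Suc t)" for t
    unfolding gy_def game_y.simps
    using that
    by (intro measurable_vec_add measurable_vec_sum measurable_mult_mat_vec[OF game_dims(2)[OF g]]
        measurable_mult_mat_vec[OF game_dims(8)[OF g]] measurable_mult_mat_vec[OF game_dims(9)[OF g]] \<xi>)
      (auto simp: PX_def PU_def gx_def gu_def)
  have x: "gx i (Suc t) \<in> N \<rightarrow>\<^sub>M vec_borel (dimx g i)" if "PX t" "PU (Suc t)" "PY (Suc t)" "i \<le> nDM g" for t i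
  proof (cases "i = 0")
    case True
    show ?thesis
      unfolding gx_def game_x.simps if_P[OF True] unfolding True
      using that
      by (intro measurable_vec_add measurable_vec_sum measurable_mult_mat_vec[OF game_dims(1)[OF g]]
          measurable_mult_mat_vec[OF game_dims(6)[OF g]] measurable_mult_mat_vec[OF game_dims(7)[OF g]] w)
        (auto simp: PX_def PU_def gx_def gu_def)
  next
    case False
    then have i: "i \<in> {1..nDM g}" using that by auto
    show ?thesis
      unfolding gx_def game_x.simps if_not_P[OF False]
      using that i
      by (intro measurable_vec_add measurable_mult_mat_vec[OF game_dims(3)[OF g i]]
          measurable_mult_mat_vec[OF game_dims(4)[OF g i]] measurable_mult_mat_vec[OF game_dims(5)[OF g i]] w)
        (auto simp: PX_def PU_def PY_def gx_def gu_def gy_def)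
  qed
  have all: "PX t \<and> PU (Suc t) \<and> PY (Suc t)" for t
  proof (induction t)
    case 0
    have X: "PX 0" using x0 by (simp add: PX_def gx_def)
    have U: "PU (Suc 0)" using u[OF X] by (simp add: PU_def PY_def)
    show ?case using X U y[OF X U] by (simp add: PY_def)
  next
    case (Suc t)
    then have X: "PX (Suc t)" using x[of t] by (auto simp: PX_def le_Suc_eq)
    have U: "PU (Suc (Suc t))" using u[OF X] Suc by (auto simp: PU_def less_Suc_eq[of _ "Suc t"])
    show ?case using X U y[OF X U] Suc by (auto simp: PY_def less_Suc_eq[of _ "Suc t"])
  qed
  show "i \<le> nDM g \<Longrightarrow> gx i t \<in> N \<rightarrow>\<^sub>M vec_borel (dimx g i)"
    "i \<in> {1..nDM g} \<Longrightarrow> gu i t \<in> N \<rightarrow>\<^sub>M vec_borel (dimu g i)"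
    "gy t \<in> N \<rightarrow>\<^sub>M vec_borel (dimy g)"
    using all[of t] by (auto simp: PX_def PU_def PY_def)
qed

lemma game_cong:
  assumes x0: "\<And>i. i \<le> nDM g \<Longrightarrow> x0 i = x0' i"
    and w: "\<And>k i. k < t \<Longrightarrow> i \<le> nDM g \<Longrightarrow> w k i = w' k i"
    and \<xi>: "\<And>k. k \<le> t \<Longrightarrow> \<xi> k = \<xi>' k"
  shows "game_y g s x0 w \<xi> t = game_y g s x0' w' \<xi>' t"
proof -
  let ?x = "game_x g s x0 w \<xi>" and ?x' = "game_x g s x0' w' \<xi>'"
  let ?u = "game_u g s x0 w \<xi>" and ?u' = "game_u g s x0' w' \<xi>'"
  let ?y = "game_y g s x0 w \<xi>" and ?y' = "game_y g s x0' w' \<xi>'"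
  have u: "?u i k = ?u' i k"
    if "\<forall>l\<le>k. ?x i l = ?x' i l" "\<forall>l<k. ?u i l = ?u' i l" "\<forall>l<k. ?y l = ?y' l" for i k
  proof -
    have "(\<lambda>l\<in>{..k}. ?x i l) = (\<lambda>l\<in>{..k}. ?x' i l)" "(\<lambda>l\<in>{..<k}. ?u i l) = (\<lambda>l\<in>{..<k}. ?u' i l)"
      "(\<lambda>l\<in>{..<k}. ?y l) = (\<lambda>l\<in>{..<k}. ?y' l)"
      using that by (intro restrict_ext; simp)+
    then show ?thesis unfolding game_u.simps[of _ _ _ _ _ _ k] by (simp only:)
  qed
  have y: "?y k = ?y' k" if "\<forall>i\<le>nDM g. ?x i k = ?x' i k" "\<forall>i\<in>{1..nDM g}. ?u i k = ?u' i k" "k \<le> t" for k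
  proof -
    have "vec_sum (dimy g) (\<lambda>j. E1mat g j *\<^sub>v ?u j k + E2mat g j *\<^sub>v ?x j k) {1..nDM g}
        = vec_sum (dimy g) (\<lambda>j. E1mat g j *\<^sub>v ?u' j k + E2mat g j *\<^sub>v ?x' j k) {1..nDM g}"
      using that by (intro vec_sum_fundef_cong) auto
    then show ?thesis unfolding game_y.simps[of _ _ _ _ _ k] using that \<xi>[of k] by simp
  qed
  have x: "?x i (Suc k) = ?x' i (Suc k)"
    if "\<forall>i\<le>nDM g. ?x i k = ?x' i k" "\<forall>i\<in>{1..nDM g}. ?u i k = ?u' i k" "?y k = ?y' k" "k < t" "i \<le> nDM g" for i k
  proof -
    have "vec_sum (dimx g 0) (\<lambda>j. B1mat g j *\<^sub>v ?u j k + B2mat g j *\<^sub>v ?x j k) {1..nDM g}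
        = vec_sum (dimx g 0) (\<lambda>j. B1mat g j *\<^sub>v ?u' j k + B2mat g j *\<^sub>v ?x' j k) {1..nDM g}"
      using that by (intro vec_sum_fundef_cong) auto
    moreover have "i \<noteq> 0 \<Longrightarrow> ?u i k = ?u' i k" using that by auto
    ultimately show ?thesis
      unfolding game_x.simps using that w[of k] by simp
  qed
  have "k \<le> t \<longrightarrow> (\<forall>l\<le>k. (\<forall>i\<le>nDM g. ?x i l = ?x' i l) \<and> (\<forall>i\<in>{1..nDM g}. ?u i l = ?u' i l) \<and> ?y l = ?y' l)" for k
  proof (induction k)
    case 0
    have X: "\<forall>i\<le>nDM g. ?x i 0 = ?x' i 0" using x0 by simp
    have U: "\<forall>i\<in>{1..nDM g}. ?u i 0 = ?u' i 0" using X by (intro ballI u) auto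
    show ?case using X U y[OF X U] by auto
  next
    case (Suc k)
    show ?case
    proof
      assume k: "Suc k \<le> t"
      with Suc have IH: "\<forall>l\<le>k. (\<forall>i\<le>nDM g. ?x i l = ?x' i l) \<and> (\<forall>i\<in>{1..nDM g}. ?u i l = ?u' i l) \<and> ?y l = ?y' l"
        by simp
      have X: "\<forall>i\<le>nDM g. ?x i (Suc k) = ?x' i (Suc k)" using IH k by (intro allI impI x) auto
      have U: "\<forall>i\<in>{1..nDM g}. ?u i (Suc k) = ?u' i (Suc k)"
        using X IH by (intro ballI u) (auto simp only: le_Suc_eq less_Suc_eq_le atLeastAtMost_iff)
      show "\<forall>l\<le>Suc k. (\<forall>i\<le>nDM g. ?x i l = ?x' i l) \<and> (\<forall>i\<in>{1..nDM g}. ?u i l = ?u' i l) \<and> ?y l = ?y' l"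
        using X U y[OF X U k] IH by (auto simp only: le_Suc_eq)
    qed
  qed
  then show ?thesis by blast
qed

section \<open>Stacked vectors and matrices\<close>

definition slice :: "(nat \<Rightarrow> nat) \<Rightarrow> nat \<Rightarrow> real vec \<Rightarrow> real vec" where
  "slice d i v = vec (d i) (\<lambda>k. v $ ((\<Sum>j<i. d j) + k))"

lemma slice_dim [simp]: "dim_vec (slice d i v) = d i"
  by (simp add: slice_def)

lemma vec_stack_dim:
  "(\<And>i. i \<le> n \<Longrightarrow> dim_vec (f i) = d i) \<Longrightarrow> dim_vec (vec_stack f n) = (\<Sum>i<Suc n. d i)"
  by (induction n) auto

lemma slice_bound:
  assumes "i \<le> n" "k < d i"
  shows "(\<Sum>j<i. d j) + k < (\<Sum>j<Suc n. d j :: nat)"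
proof -
  have "(\<Sum>j<i. d j) + k < (\<Sum>j<Suc i. d j)" using assms by simp
  also have "\<dots> \<le> (\<Sum>j<Suc n. d j)" using assms by (intro sum_mono2) auto
  finally show ?thesis .
qed

lemma slice_vec_stack:
  assumes "\<And>i. i \<le> n \<Longrightarrow> dim_vec (f i) = d i" "i \<le> n"
  shows "slice d i (vec_stack f n) = f i"
  using assms
proof (induction n)
  case 0
  then show ?case by (intro eq_vecI) (auto simp: slice_def)
next
  case (Suc n)
  have dn: "dim_vec (vec_stack f n) = (\<Sum>j<Suc n. d j)" using Suc.prems by (intro vec_stack_dim) auto
  show ?case
  proof (cases "i = Suc n")
    case True
    show ?thesis
      unfolding True using Suc.prems(1)[of "Suc n"] dn by (intro eq_vecI) (auto simp: slice_def)
  next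
    case False
    then have i: "i \<le> n" using Suc.prems by simp
    have "slice d i (vec_stack f (Suc n)) = slice d i (vec_stack f n)"
    proof (rule eq_vecI)
      fix k assume "k < dim_vec (slice d i (vec_stack f n))"
      then have k: "k < d i" by simp
      show "slice d i (vec_stack f (Suc n)) $ k = slice d i (vec_stack f n) $ k"
        using k slice_bound[of i n k d] i dn by (simp add: slice_def)
    qed simp
    then show ?thesis using Suc.IH Suc.prems i by simp
  qed
qed

lemma stack_index_cases:
  "p < (\<Sum>j<Suc n. d j) \<Longrightarrow> \<exists>i k. i \<le> n \<and> k < d i \<and> p = (\<Sum>j<i. d j) + (k :: nat)"
proof (induction n)
  case 0
  then show ?case by (intro exI[of _ 0] exI[of _ p]) auto
next
  case (Suc n)
  show ?case
  proof (cases "p < (\<Sum>j<Suc n. d j)")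
    case True
    then show ?thesis using Suc.IH by (meson le_SucI)
  next
    case False
    then show ?thesis using Suc.prems
      by (intro exI[of _ "Suc n"] exI[of _ "p - (\<Sum>j<Suc n. d j)"]) auto
  qed
qed

lemma slice_eqI:
  assumes v: "dim_vec v = (\<Sum>j<Suc n. d j)" and w: "dim_vec w = (\<Sum>j<Suc n. d j)"
    and eq: "\<And>i. i \<le> n \<Longrightarrow> slice d i v = slice d i w"
  shows "v = w"
proof (rule eq_vecI)
  fix p assume p: "p < dim_vec w"
  then obtain i k where ik: "i \<le> n" "k < d i" "p = (\<Sum>j<i. d j) + k"
    using stack_index_cases[of p d n] p w by auto
  have "slice d i v $ k = slice d i w $ k" using eq[OF ik(1)] by simp
  then show "v $ p = w $ p" using ik by (simp add: slice_def)
qed (use v w in simp)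

lemma slice_add:
  assumes "dim_vec v = (\<Sum>j<Suc n. d j)" "dim_vec w = (\<Sum>j<Suc n. d j)" "i \<le> n"
  shows "slice d i (v + w) = slice d i v + slice d i w"
proof (rule eq_vecI)
  fix k assume "k < dim_vec (slice d i v + slice d i w)"
  then have "k < d i" by simp
  then show "slice d i (v + w) $ k = (slice d i v + slice d i w) $ k"
    using slice_bound[of i n k d] assms by (simp add: slice_def)
qed simp

lemma vec_stack_slice:
  assumes "dim_vec v = (\<Sum>j<Suc n. d j)"
  shows "vec_stack (\<lambda>i. slice d i v) n = v"
  by (rule slice_eqI[where n = n and d = d])
    (use assms in \<open>simp_all add: vec_stack_dim slice_vec_stack del: sum.lessThan_Suc\<close>)

lemma sprod_vec_stack:
  "(\<And>i. i \<le> n \<Longrightarrow> dim_vec (f i) = dim_vec (g i)) \<Longrightarrow>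
    vec_stack f n \<bullet> vec_stack g n = (\<Sum>i<Suc n. f i \<bullet> g i)"
proof (induction n)
  case (Suc n)
  have "dim_vec (vec_stack f n) = dim_vec (vec_stack g n)"
    using vec_stack_dim[of n f "\<lambda>i. dim_vec (g i)"] vec_stack_dim[of n g "\<lambda>i. dim_vec (g i)"] Suc.prems by simp
  then show ?case
    using Suc by (simp, subst scalar_prod_append[OF carrier_vecI carrier_vecI carrier_vecI carrier_vecI]) auto
qed simp

lemma col_stack_dims:
  "(\<And>i. i \<le> n \<Longrightarrow> f i \<in> carrier_mat (d i) c) \<Longrightarrow> col_stack f n \<in> carrier_mat (\<Sum>i<Suc n. d i) c"
proof (induction n)
  case (Suc n)
  then show ?case using carrier_append_rows[of "col_stack f n" "\<Sum>i<Suc n. d i" c "f (Suc n)" "d (Suc n)"] by auto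
qed simp

lemma col_stack_mult:
  assumes "\<And>i. i \<le> n \<Longrightarrow> f i \<in> carrier_mat (d i) c" "dim_vec x = c"
  shows "col_stack f n *\<^sub>v x = vec_stack (\<lambda>i. f i *\<^sub>v x) n"
  using assms
proof (induction n)
  case (Suc n)
  have "col_stack f n \<in> carrier_mat (\<Sum>i<Suc n. d i) c" using Suc.prems by (intro col_stack_dims) auto
  from mat_mult_append[OF this, of "f (Suc n)" "d (Suc n)" x] show ?case
    using Suc by (auto intro: carrier_vecI)
qed simp

lemma slice_col_stack_mult:
  assumes "\<And>i. i \<le> n \<Longrightarrow> f i \<in> carrier_mat (d i) c" "dim_vec x = c" "i \<le> n"
  shows "slice d i (col_stack f n *\<^sub>v x) = f i *\<^sub>v x"
proof -
  have "col_stack f n *\<^sub>v x = vec_stack (\<lambda>i. f i *\<^sub>v x) n"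
    by (rule col_stack_mult[where d = d]) (use assms in auto)
  moreover have "dim_vec (f j *\<^sub>v x) = d j" if "j \<le> n" for j
    using assms(1)[OF that] by simp
  ultimately show ?thesis using assms(3) by (simp add: slice_vec_stack)
qed

lemma row_stack_dims:
  assumes "\<And>i. i \<le> n \<Longrightarrow> f i \<in> carrier_mat r (d i)"
  shows "row_stack f n \<in> carrier_mat r (\<Sum>i<Suc n. d i)"
proof -
  have "col_stack (\<lambda>i. (f i)\<^sup>T) n \<in> carrier_mat (\<Sum>i<Suc n. d i) r"
    by (rule col_stack_dims) (use assms in auto)
  then show ?thesis by (simp add: row_stack_def)
qed

text \<open>Reduced to column stacks by transposition.\<close>

lemma row_stack_mult:
  assumes f: "\<And>i. i \<le> n \<Longrightarrow> f i \<in> carrier_mat r (d i)" and x: "\<And>i. i \<le> n \<Longrightarrow> dim_vec (x i) = d i"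
  shows "row_stack f n *\<^sub>v vec_stack x n = vec_sum r (\<lambda>i. f i *\<^sub>v x i) {..n}"
proof (rule eq_vecI)
  let ?h = "col_stack (\<lambda>i. (f i)\<^sup>T) n"
  have h: "?h \<in> carrier_mat (\<Sum>i<Suc n. d i) r" by (rule col_stack_dims) (use f in auto)
  have X: "dim_vec (vec_stack x n) = (\<Sum>i<Suc n. d i)" using x by (rule vec_stack_dim)
  fix k assume "k < dim_vec (vec_sum r (\<lambda>i. f i *\<^sub>v x i) {..n})"
  then have k: "k < r" by (simp add: vec_sum_def)
  let ?e = "unit_vec r k :: real vec"
  have "(row_stack f n *\<^sub>v vec_stack x n) $ k = (?h\<^sup>T *\<^sub>v vec_stack x n) \<bullet> ?e"
    unfolding row_stack_def by (subst scalar_prod_right_unit[OF k]) (use h in auto)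
  also have "\<dots> = vec_stack x n \<bullet> (?h *\<^sub>v ?e)" using h X by (intro transpose_sprod) auto
  also have "?h *\<^sub>v ?e = vec_stack (\<lambda>i. (f i)\<^sup>T *\<^sub>v ?e) n"
    by (rule col_stack_mult[where d = d]) (use f in auto)
  also have "vec_stack x n \<bullet> \<dots> = (\<Sum>i<Suc n. x i \<bullet> ((f i)\<^sup>T *\<^sub>v ?e))"
    by (rule sprod_vec_stack) (use f x in \<open>simp, metis carrier_matD(2)\<close>)
  also have "\<dots> = (\<Sum>i<Suc n. (f i *\<^sub>v x i) $ k)"
  proof (rule sum.cong[OF refl])
    fix i assume "i \<in> {..<Suc n}"
    then have fi: "f i \<in> carrier_mat r (d i)" "dim_vec (x i) = d i" using f x by auto
    then have "x i \<bullet> ((f i)\<^sup>T *\<^sub>v ?e) = (f i *\<^sub>v x i) \<bullet> ?e" by (intro sprod_transpose) auto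
    also have "\<dots> = (f i *\<^sub>v x i) $ k" by (subst scalar_prod_right_unit[OF k]) (use fi in auto)
    finally show "x i \<bullet> ((f i)\<^sup>T *\<^sub>v ?e) = (f i *\<^sub>v x i) $ k" .
  qed
  finally show "(row_stack f n *\<^sub>v vec_stack x n) $ k = vec_sum r (\<lambda>i. f i *\<^sub>v x i) {..n} $ k"
    using k by (simp add: vec_sum_def lessThan_Suc_atMost)
qed (use row_stack_dims[of n f r d, OF f] in \<open>simp add: vec_sum_def\<close>)

lemma measurable_slice:
  assumes f: "f \<in> N \<rightarrow>\<^sub>M vec_borel (\<Sum>j<Suc n. d j)" and i: "i \<le> n"
  shows "(\<lambda>x. slice d i (f x)) \<in> N \<rightarrow>\<^sub>M vec_borel (d i)"
proof (rule measurable_vecI)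
  fix k assume k: "k < d i"
  have "(\<lambda>x. f x $ ((\<Sum>j<i. d j) + k)) \<in> borel_measurable N"
    by (rule measurable_vec_index[OF f slice_bound[of i n k d, OF i k]])
  then show "(\<lambda>x. slice d i (f x) $ k) \<in> borel_measurable N" using k by (simp add: slice_def)
qed simp

section \<open>Series of gain matrices\<close>

definition abs_summable_mat :: "nat \<Rightarrow> nat \<Rightarrow> (nat \<Rightarrow> real mat) \<Rightarrow> bool" where
  "abs_summable_mat nr nc X \<longleftrightarrow> (\<forall>i. X i \<in> carrier_mat nr nc) \<and>
     (\<forall>k<nr. \<forall>l<nc. summable (\<lambda>i. \<bar>X i $$ (k, l)\<bar>))"

lemma abs_summable_mat_geometric:
  assumes "\<And>i. X i \<in> carrier_mat nr nc" "\<And>i. norm_bound (X i) (c * r^i)" "0 \<le> r" "r < 1"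
  shows "abs_summable_mat nr nc X"
  unfolding abs_summable_mat_def
proof (intro conjI allI impI)
  fix k l assume kl: "k < nr" "l < nc"
  show "summable (\<lambda>i. \<bar>X i $$ (k, l)\<bar>)"
  proof (rule summable_comparison_test')
    show "summable (\<lambda>i. c * r^i)" using assms by (intro summable_mult summable_geometric) auto
    show "norm \<bar>X i $$ (k, l)\<bar> \<le> c * r^i" if "i \<ge> 0" for i
      using assms(1)[of i] assms(2)[of i] kl by (auto simp: norm_bound_def)
  qed
qed (use assms in auto)

lemma abs_summable_mat_left_mult:
  assumes E: "E \<in> carrier_mat nr' nr" and X: "abs_summable_mat nr nc X"
  shows "abs_summable_mat nr' nc (\<lambda>i. E * X i)"
  unfolding abs_summable_mat_def
proof (intro conjI allI impI)
  have Xc: "X i \<in> carrier_mat nr nc" for i using X by (auto simp: abs_summable_mat_def)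
  then show "E * X i \<in> carrier_mat nr' nc" for i using E by auto
  fix k l assume kl: "k < nr'" "l < nc"
  show "summable (\<lambda>i. \<bar>(E * X i) $$ (k, l)\<bar>)"
  proof (rule summable_comparison_test')
    show "summable (\<lambda>i. \<Sum>j<nr. \<bar>E $$ (k, j)\<bar> * \<bar>X i $$ (j, l)\<bar>)"
      using X kl by (intro summable_sum summable_mult) (auto simp: abs_summable_mat_def)
    fix i :: nat
    have "(E * X i) $$ (k, l) = (\<Sum>j<nr. E $$ (k, j) * X i $$ (j, l))"
      using E Xc[of i] kl by (simp add: scalar_prod_def atLeast0LessThan)
    then show "norm \<bar>(E * X i) $$ (k, l)\<bar> \<le> (\<Sum>j<nr. \<bar>E $$ (k, j)\<bar> * \<bar>X i $$ (j, l)\<bar>)"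
      by (simp add: abs_mult[symmetric] sum_abs)
  qed
qed

lemma abs_summable_mat_sum:
  assumes "finite J" "\<And>j. j \<in> J \<Longrightarrow> abs_summable_mat nr nc (X j)"
  shows "abs_summable_mat nr nc (\<lambda>i. mat_sum nr nc (\<lambda>j. X j i) J)"
  unfolding abs_summable_mat_def
proof (intro conjI allI impI)
  fix k l assume kl: "k < nr" "l < nc"
  show "summable (\<lambda>i. \<bar>mat_sum nr nc (\<lambda>j. X j i) J $$ (k, l)\<bar>)"
  proof (rule summable_comparison_test')
    show "summable (\<lambda>i. \<Sum>j\<in>J. \<bar>X j i $$ (k, l)\<bar>)"
      using assms kl by (intro summable_sum) (auto simp: abs_summable_mat_def)
    show "norm \<bar>mat_sum nr nc (\<lambda>j. X j i) J $$ (k, l)\<bar> \<le> (\<Sum>j\<in>J. \<bar>X j i $$ (k, l)\<bar>)" if "i \<ge> 0" for i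
      using kl by (simp add: mat_sum_def sum_abs)
  qed
qed (simp add: mat_sum_def)

lemma abs_summable_mat_col_stack:
  assumes X: "\<And>i. i \<le> n \<Longrightarrow> abs_summable_mat (d i) nc (X i)"
  shows "abs_summable_mat (\<Sum>i<Suc n. d i) nc (\<lambda>m. col_stack (\<lambda>i. X i m) n)"
  unfolding abs_summable_mat_def
proof (intro conjI allI impI)
  have Xc: "X i m \<in> carrier_mat (d i) nc" if "i \<le> n" for i m
    using X[OF that] by (auto simp: abs_summable_mat_def)
  show c: "col_stack (\<lambda>i. X i m) n \<in> carrier_mat (\<Sum>i<Suc n. d i) nc" for m
    using Xc by (intro col_stack_dims) auto
  fix p l assume p: "p < (\<Sum>i<Suc n. d i)" and l: "l < nc"
  let ?e = "unit_vec nc l :: real vec"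
  obtain i k where ik: "i \<le> n" "k < d i" "p = (\<Sum>j<i. d j) + k"
    using stack_index_cases[of p d n] p by auto
  have "col_stack (\<lambda>i. X i m) n $$ (p, l) = X i m $$ (k, l)" for m
  proof -
    have "col_stack (\<lambda>i. X i m) n $$ (p, l) = (col_stack (\<lambda>i. X i m) n *\<^sub>v ?e) $ p"
      using c[of m] p l by auto
    also have "\<dots> = slice d i (col_stack (\<lambda>i. X i m) n *\<^sub>v ?e) $ k"
      using ik by (simp add: slice_def)
    also have "\<dots> = (X i m *\<^sub>v ?e) $ k"
      using Xc ik by (subst slice_col_stack_mult[where c = nc]) auto
    finally show ?thesis using Xc[OF ik(1), of m] ik l by auto
  qed
  then show "summable (\<lambda>m. \<bar>col_stack (\<lambda>i. X i m) n $$ (p, l)\<bar>)"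
    using X[OF ik(1)] ik l by (auto simp: abs_summable_mat_def)
qed

lemma abs_summable_mat_mult_bounded:
  assumes X: "abs_summable_mat nr nc X" and v: "\<And>i. dim_vec (v i) = nc" "\<And>i l. l < nc \<Longrightarrow> \<bar>v i $ l\<bar> \<le> c"
    and k: "k < nr"
  shows "summable (\<lambda>i. (X i *\<^sub>v v i) $ k)"
proof (rule summable_comparison_test')
  show "summable (\<lambda>i. \<Sum>l<nc. \<bar>X i $$ (k, l)\<bar> * c)"
    using X k by (intro summable_sum summable_mult2) (auto simp: abs_summable_mat_def)
  fix i :: nat
  have Xi: "X i \<in> carrier_mat nr nc" using X by (auto simp: abs_summable_mat_def)
  have "(X i *\<^sub>v v i) $ k = (\<Sum>l<nc. X i $$ (k, l) * v i $ l)"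
    using Xi v k by (simp add: scalar_prod_def atLeast0LessThan)
  then have "\<bar>(X i *\<^sub>v v i) $ k\<bar> \<le> (\<Sum>l<nc. \<bar>X i $$ (k, l)\<bar> * \<bar>v i $ l\<bar>)"
    by (simp add: abs_mult[symmetric] sum_abs)
  also have "\<dots> \<le> (\<Sum>l<nc. \<bar>X i $$ (k, l)\<bar> * c)" using v by (intro sum_mono mult_left_mono) auto
  finally show "norm ((X i *\<^sub>v v i) $ k) \<le> (\<Sum>l<nc. \<bar>X i $$ (k, l)\<bar> * c)" by simp
qed

text \<open>Applied to the affine family $a_n e + b_n$ of bounded vectors, a summable family of
  matrices may be summed before or after the application.\<close>

lemma suminf_affine:
  assumes X: "abs_summable_mat nr ny X"
    and a: "\<And>i. a i \<in> carrier_mat ny nx" "\<And>i k l. k < ny \<Longrightarrow> l < nx \<Longrightarrow> \<bar>a i $$ (k, l)\<bar> \<le> ca"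
    and b: "\<And>i. b i \<in> carrier_vec ny" "\<And>i k. k < ny \<Longrightarrow> \<bar>b i $ k\<bar> \<le> cb"
    and e: "dim_vec e = nx" and k: "k < nr"
  shows "summable (\<lambda>i. (X i *\<^sub>v (a i *\<^sub>v e + b i)) $ k)"
    "(mat_suminf nr nx (\<lambda>i. X i * a i) *\<^sub>v e + vec_suminf nr (\<lambda>i. X i *\<^sub>v b i)) $ k
      = (\<Sum>i. (X i *\<^sub>v (a i *\<^sub>v e + b i)) $ k)"
proof -
  have Xc: "X i \<in> carrier_mat nr ny" for i using X by (auto simp: abs_summable_mat_def)
  have col: "(X i * a i) $$ (k, l) = (X i *\<^sub>v col (a i) l) $ k" if "l < nx" for i l
    using Xc[of i] a(1)[of i] k that by simp
  have sa: "summable (\<lambda>i. (X i * a i) $$ (k, l))" if "l < nx" for l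
  proof -
    have "\<bar>col (a i) l $ j\<bar> \<le> ca" if "j < ny" for i j
      using a(1)[of i] a(2)[of j l i] that \<open>l < nx\<close> by simp
    then show ?thesis
      unfolding col[OF that] using a(1) by (intro abs_summable_mat_mult_bounded[OF X _ _ k]) auto
  qed
  have sb: "summable (\<lambda>i. (X i *\<^sub>v b i) $ k)"
    using b by (intro abs_summable_mat_mult_bounded[OF X _ _ k]) auto
  have tm: "(X i *\<^sub>v (a i *\<^sub>v e + b i)) $ k = (\<Sum>l<nx. (X i * a i) $$ (k, l) * e $ l) + (X i *\<^sub>v b i) $ k" for i
  proof -
    have "X i *\<^sub>v (a i *\<^sub>v e + b i) = (X i * a i) *\<^sub>v e + X i *\<^sub>v b i"
      using Xc[of i] a(1)[of i] b(1)[of i] e by (auto simp: linear_simps)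
    moreover have "((X i * a i) *\<^sub>v e) $ k = (\<Sum>l<nx. (X i * a i) $$ (k, l) * e $ l)"
      using Xc[of i] a(1)[of i] e k by (simp add: scalar_prod_def[of _ e] atLeast0LessThan)
    ultimately show ?thesis using Xc[of i] k by (simp del: index_mult_mat_vec)
  qed
  have s1: "summable (\<lambda>i. \<Sum>l<nx. (X i * a i) $$ (k, l) * e $ l)"
    using sa by (intro summable_sum summable_mult2) auto
  show "summable (\<lambda>i. (X i *\<^sub>v (a i *\<^sub>v e + b i)) $ k)"
    unfolding tm by (intro summable_add s1 sb)
  have "(\<Sum>i. (X i *\<^sub>v (a i *\<^sub>v e + b i)) $ k)
      = (\<Sum>i. \<Sum>l<nx. (X i * a i) $$ (k, l) * e $ l) + (\<Sum>i. (X i *\<^sub>v b i) $ k)"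
    unfolding tm by (rule suminf_add[OF s1 sb, symmetric])
  also have "(\<Sum>i. \<Sum>l<nx. (X i * a i) $$ (k, l) * e $ l) = (\<Sum>l<nx. (\<Sum>i. (X i * a i) $$ (k, l)) * e $ l)"
    using sa by (subst suminf_sum) (auto intro!: sum.cong suminf_mult2[symmetric] summable_mult2)
  finally show "(mat_suminf nr nx (\<lambda>i. X i * a i) *\<^sub>v e + vec_suminf nr (\<lambda>i. X i *\<^sub>v b i)) $ k
      = (\<Sum>i. (X i *\<^sub>v (a i *\<^sub>v e + b i)) $ k)"
    using k e by (simp add: mat_suminf_def vec_suminf_def scalar_prod_def atLeast0LessThan)
qed

section \<open>The optimal-response constants of the game\<close>

lemma game_regulator:
  assumes "lq_game_data g" "i \<in> {1..nDM g}"
  shows "regulator (dimx g i) (dimu g i) (Amat g i) (Bmat g i) (Qmat g i) (Rmat g i) (disc g i)"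
  using game_dims[OF assms(1)] assms(2) by unfold_locales auto

text \<open>Existence and uniqueness of the Riccati solution make the definite description of \<open>ric_M\<close>
  proper.\<close>

lemma game_lq_response:
  assumes g: "lq_game_data g" and i: "i \<in> {1..nDM g}" and st: "stabilizable (Amat g i) (Bmat g i)"
  shows "lq_response (dimx g i) (dimu g i) (Amat g i) (Bmat g i) (Qmat g i) (Rmat g i) (disc g i)
    (dimy g) (Cmat g i) (Kmat g i) (Lmat g i) (ric_M g i)"
proof -
  interpret regulator "dimx g i" "dimu g i" "Amat g i" "Bmat g i" "Qmat g i" "Rmat g i" "disc g i"
    by (rule game_regulator[OF g i])
  have ex: "\<exists>!M. pos_semidef (dimx g i) M \<and> ric M = M"
    using ric_fixpoint_exists[OF st] ric_fixpoint_unique by blast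
  have "ric_M g i = (THE M. pos_semidef (dimx g i) M \<and> ric M = M)"
    unfolding ric_M_def ric_def S_of_def ric_S_def by (intro arg_cong[of _ _ The] ext) auto
  then have "pos_semidef (dimx g i) (ric_M g i) \<and> ric (ric_M g i) = ric_M g i"
    using theI'[OF ex] by simp
  then show ?thesis
    using game_dims[OF g] i by unfold_locales auto
qed

lemma opt_eq_gain:
  assumes g: "lq_game_data g" and i: "i \<in> {1..nDM g}" and st: "stabilizable (Amat g i) (Bmat g i)"
  shows "opt_F g i = regulator.gain (Amat g i) (Bmat g i) (Rmat g i) (disc g i) (ric_M g i)"
    "opt_G g i k = lq_response.gain_G (Amat g i) (Bmat g i) (Rmat g i) (disc g i)
       (Cmat g i) (Kmat g i) (Lmat g i) (ric_M g i) k"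
    "opt_H g p i = lq_response.gain_H (dimx g i) (Amat g i) (Bmat g i) (Rmat g i) (disc g i) (ric_M g i) (mean_w g p i)"
proof -
  interpret lq_response "dimx g i" "dimu g i" "Amat g i" "Bmat g i" "Qmat g i" "Rmat g i" "disc g i"
    "dimy g" "Cmat g i" "Kmat g i" "Lmat g i" "ric_M g i" by (rule game_lq_response[OF assms])
  have Sinv: "opt_Sinv g i = mat_inv S" by (simp add: opt_Sinv_def ric_S_def S_of_def)
  show F: "opt_F g i = F" by (simp add: opt_F_def gain_def Sinv)
  have P: "opt_Acl g i = P" by (simp add: opt_Acl_def closed_loop_def F)
  show "opt_G g i k = gain_G k" by (simp add: opt_G_def gain_G_def Sinv F P Pb_def \<Gamma>_def)
  show "opt_H g p i = gain_H (mean_w g p i)" by (simp add: opt_H_def gain_H_def Sinv P Pb_def)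
qed

lemma mult_vec_suminf:
  assumes E: "E \<in> carrier_mat nr' nr" and v: "\<And>i. dim_vec (v i) = nr"
    and s: "\<And>l. l < nr \<Longrightarrow> summable (\<lambda>i. v i $ l)" and k: "k < nr'"
  shows "(\<lambda>i. (E *\<^sub>v v i) $ k) sums (E *\<^sub>v vec_suminf nr v) $ k"
proof -
  have "(\<lambda>i. \<Sum>l<nr. E $$ (k, l) * v i $ l) sums (\<Sum>l<nr. E $$ (k, l) * (\<Sum>i. v i $ l))"
    using s by (intro sums_sum sums_mult summable_sums) auto
  then show ?thesis
    using E v k by (simp add: scalar_prod_def atLeast0LessThan vec_suminf_def)
qed

lemma mat_sum_mult:
  assumes "\<And>j. j \<in> J \<Longrightarrow> f j \<in> carrier_mat nr nc" "dim_vec v = nc"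
  shows "mat_sum nr nc f J *\<^sub>v v = vec_sum nr (\<lambda>j. f j *\<^sub>v v) J"
proof (rule eq_vecI)
  fix k assume "k < dim_vec (vec_sum nr (\<lambda>j. f j *\<^sub>v v) J)"
  then have k: "k < nr" by (simp add: vec_sum_def)
  have "(f j *\<^sub>v v) $ k = (\<Sum>l<nc. f j $$ (k, l) * v $ l)" if "j \<in> J" for j
    using assms(1)[OF that] assms(2) k by (simp add: scalar_prod_def atLeast0LessThan)
  then show "(mat_sum nr nc f J *\<^sub>v v) $ k = vec_sum nr (\<lambda>j. f j *\<^sub>v v) J $ k"
    using k assms(2) by (simp add: mat_sum_def vec_sum_def scalar_prod_def atLeast0LessThan
      sum_distrib_right sum.swap[of _ J])
qed (simp_all add: mat_sum_def vec_sum_def)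

locale sebeu_setting =
  fixes g :: lq_game and p :: "'w primitives"
    and a :: "nat \<Rightarrow> real mat" and b :: "nat \<Rightarrow> real vec"
    and P :: "'v measure"
    and Xbar ybar xibar Wbar :: "nat \<Rightarrow> 'v \<Rightarrow> real vec"
    and est :: "nat \<Rightarrow> (nat \<Rightarrow> real vec) \<Rightarrow> real vec"
  assumes game: "lq_game_data g"
    and prims: "primitive_data g p"
    and stabilizable: "\<forall>i\<in>{1..nDM g}. stabilizable (Amat g i) (Bmat g i)"
    and indep: "primitives_independent g p"
    and moments: "primitives_second_moments g p"
    and ident: "primitives_identically_distributed g p"
    and a_dim: "\<forall>t. a t \<in> carrier_mat (dimy g) (dimX g)"
    and b_dim: "\<forall>t. b t \<in> carrier_vec (dimy g)"
    and sys_unique: "\<forall>X0\<in>carrier_vec (dimX g). \<exists>!y. lin_sys_solution g p X0 y"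
    and sys_affine: "\<forall>X0\<in>carrier_vec (dimX g). \<forall>y. lin_sys_solution g p X0 y \<longrightarrow> (\<forall>t. y t = a t *\<^sub>v X0 + b t)"
    and a_bounded: "\<exists>c. \<forall>t. \<forall>k<dimy g. \<forall>l<dimX g. \<bar>a t $$ (k, l)\<bar> \<le> c"
    and b_bounded: "\<exists>c. \<forall>t. \<forall>k<dimy g. \<bar>b t $ k\<bar> \<le> c"
    and aux: "aux_process g p a b P Xbar ybar xibar Wbar"
    and estimator: "state_estimator g P Xbar ybar est"
    and y_bounded: "(SUP t. \<integral>\<^sup>+\<omega>. ennreal (ybar t \<omega> \<bullet> ybar t \<omega>) \<partial>P) < \<infinity>"
begin

abbreviation nd where "nd \<equiv> nDM g"
abbreviation sl where "sl \<equiv> slice (dimx g)"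

lemma dimX_eq: "dimX g = (\<Sum>j<Suc nd. dimx g j)"
  by (simp add: dimX_def atLeast0AtMost lessThan_Suc_atMost del: sum.lessThan_Suc)

lemma dm_response: "i \<in> {1..nd} \<Longrightarrow> lq_response (dimx g i) (dimu g i) (Amat g i) (Bmat g i) (Qmat g i) (Rmat g i) (disc g i)
    (dimy g) (Cmat g i) (Kmat g i) (Lmat g i) (ric_M g i)"
  using game_lq_response[OF game] stabilizable by blast

lemma dm_gains:
  assumes "i \<in> {1..nd}"
  shows "opt_F g i = regulator.gain (Amat g i) (Bmat g i) (Rmat g i) (disc g i) (ric_M g i)"
    "opt_G g i k = lq_response.gain_G (Amat g i) (Bmat g i) (Rmat g i) (disc g i)
       (Cmat g i) (Kmat g i) (Lmat g i) (ric_M g i) k"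
    "opt_H g p i = lq_response.gain_H (dimx g i) (Amat g i) (Bmat g i) (Rmat g i) (disc g i) (ric_M g i) (mean_w g p i)"
  using opt_eq_gain[OF game assms] stabilizable assms by blast+

lemma opt_carrier:
  assumes i: "i \<in> {1..nd}"
  shows "opt_F g i \<in> carrier_mat (dimu g i) (dimx g i)" "opt_G g i k \<in> carrier_mat (dimu g i) (dimy g)"
    "dim_vec (opt_H g p i) = dimu g i"
proof -
  interpret lq_response "dimx g i" "dimu g i" "Amat g i" "Bmat g i" "Qmat g i" "Rmat g i" "disc g i"
    "dimy g" "Cmat g i" "Kmat g i" "Lmat g i" "ric_M g i" by (rule dm_response[OF i])
  show "opt_F g i \<in> carrier_mat (dimu g i) (dimx g i)" "opt_G g i k \<in> carrier_mat (dimu g i) (dimy g)"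
    "dim_vec (opt_H g p i) = dimu g i"
    unfolding dm_gains[OF i] by auto
qed

lemma opt_G_summable:
  assumes i: "i \<in> {1..nd}"
  shows "abs_summable_mat (dimu g i) (dimy g) (opt_G g i)"
proof -
  interpret lq_response "dimx g i" "dimu g i" "Amat g i" "Bmat g i" "Qmat g i" "Rmat g i" "disc g i"
    "dimy g" "Cmat g i" "Kmat g i" "Lmat g i" "ric_M g i" by (rule dm_response[OF i])
  obtain c where "c \<ge> 0" "\<And>k. norm_bound (gain_G k) (c * \<theta>^k)" using gain_G_bound by blast
  then show ?thesis
    using opt_carrier(2)[OF i] theta
    by (intro abs_summable_mat_geometric[of _ _ _ c \<theta>]) (auto simp: dm_gains[OF i])
qed

lemma mult_opt_F_carrier:
  assumes "i \<in> {1..nd}"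
  shows "Bmat g i * opt_F g i \<in> carrier_mat (dimx g i) (dimx g i)"
    "B1mat g i * opt_F g i \<in> carrier_mat (dimx g 0) (dimx g i)"
    "E1mat g i * opt_F g i \<in> carrier_mat (dimy g) (dimx g i)"
  using mult_carrier_mat[OF _ opt_carrier(1)[OF assms]] game_dims(4,6,8)[OF game assms] by blast+

lemma agg_carrier:
  "agg_D g \<in> carrier_mat (dimy g) (dimX g)" "agg_A g \<in> carrier_mat (dimX g) (dimX g)"
  "agg_C g \<in> carrier_mat (dimX g) (dimy g)"
  unfolding agg_D_def agg_A_def agg_C_def dimX_eq
    apply (rule row_stack_dims)
    subgoal using mult_opt_F_carrier(3) game_dims(2,9)[OF game] by (auto intro!: add_carrier_mat)
   apply (rule col_stack_dims, rule row_stack_dims)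
  subgoal using mult_opt_F_carrier(1,2) game_dims(1,3,7)[OF game] by (auto intro!: add_carrier_mat)
  apply (rule col_stack_dims)
  subgoal using game_dims(5)[OF game] by auto
  done

lemma lim_dims [simp]:
  "dim_row (lim_Gp g a) = dimy g" "dim_col (lim_Gp g a) = dimX g" "dim_vec (lim_Hp g p b) = dimy g"
  "dim_row (lim_GX g a) = dimX g" "dim_col (lim_GX g a) = dimX g"
  "dim_row (lim_G g i a) = dimu g i" "dim_col (lim_G g i a) = dimX g"
  "dim_row (agg_D g) = dimy g" "dim_col (agg_D g) = dimX g"
  "dim_row (agg_A g) = dimX g" "dim_col (agg_A g) = dimX g" "dim_row (agg_C g) = dimX g" "dim_col (agg_C g) = dimy g"
  using agg_carrier by (auto simp: lim_Gp_def lim_GX_def lim_G_def lim_Hp_def mat_suminf_def agg_Hp_def vec_sum_def)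

text \<open>The solution of the linear system from the aggregate state \<open>e\<close>, that is, the forecast of the
  environment variables \<open>n\<close> periods ahead at the estimate \<open>e\<close>.\<close>

definition yhat :: "real vec \<Rightarrow> nat \<Rightarrow> real vec" where
  "yhat e n = a n *\<^sub>v e + b n"

lemma yhat_dim [simp]: "dim_vec (yhat e n) = dimy g"
  using b_dim by (simp add: yhat_def)

text \<open>The part of the optimal control that does not depend on the own state, for an estimate
  \<open>e\<close> of the aggregate state.\<close>

definition resp :: "nat \<Rightarrow> real vec \<Rightarrow> real vec" where
  "resp i e = lim_G g i a *\<^sub>v e + lim_H g p i b"

lemma resp_dim [simp]: "i \<in> {1..nd} \<Longrightarrow> dim_vec (resp i e) = dimu g i"
  using opt_carrier(3) by (simp add: resp_def lim_H_def)

lemma yhat_series: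
  assumes X: "abs_summable_mat nr (dimy g) X" and e: "dim_vec e = dimX g"
  shows "k < nr \<Longrightarrow> summable (\<lambda>n. (X n *\<^sub>v yhat e n) $ k)"
    "mat_suminf nr (dimX g) (\<lambda>n. X n * a n) *\<^sub>v e + vec_suminf nr (\<lambda>n. X n *\<^sub>v b n)
      = vec_suminf nr (\<lambda>n. X n *\<^sub>v yhat e n)"
proof -
  obtain ca where ca: "\<And>i k l. k < dimy g \<Longrightarrow> l < dimX g \<Longrightarrow> \<bar>a i $$ (k, l)\<bar> \<le> ca" using a_bounded by blast
  obtain cb where cb: "\<And>i k. k < dimy g \<Longrightarrow> \<bar>b i $ k\<bar> \<le> cb" using b_bounded by blast
  have a: "a i \<in> carrier_mat (dimy g) (dimX g)" and b: "b i \<in> carrier_vec (dimy g)" for i using a_dim b_dim by auto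
  note aff = suminf_affine[where a = a and b = b, OF X a ca b cb e]
  show "k < nr \<Longrightarrow> summable (\<lambda>n. (X n *\<^sub>v yhat e n) $ k)"
    "mat_suminf nr (dimX g) (\<lambda>n. X n * a n) *\<^sub>v e + vec_suminf nr (\<lambda>n. X n *\<^sub>v b n)
      = vec_suminf nr (\<lambda>n. X n *\<^sub>v yhat e n)" for k
    unfolding yhat_def using aff(1)
    by (blast, intro eq_vecI)
      (subst aff(2), simp_all add: vec_suminf_def mat_suminf_def del: index_mult_mat_vec)
qed

lemma resp_eq:
  assumes i: "i \<in> {1..nd}" and e: "dim_vec e = dimX g"
  shows "resp i e = vec_suminf (dimu g i) (\<lambda>n. opt_G g i n *\<^sub>v yhat e n) + opt_H g p i"
  unfolding yhat_series(2)[OF opt_G_summable[OF i] e, symmetric] resp_def lim_G_def lim_H_def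
  by (rule eq_vecI) (use opt_carrier(3)[OF i] in \<open>simp_all add: vec_suminf_def mat_suminf_def\<close>)

lemma mult_resp:
  assumes i: "i \<in> {1..nd}" and e: "dim_vec e = dimX g" and E: "E \<in> carrier_mat nr (dimu g i)" and k: "k < nr"
  shows "(\<lambda>n. ((E * opt_G g i n) *\<^sub>v yhat e n) $ k) sums ((E *\<^sub>v resp i e) $ k - (E *\<^sub>v opt_H g p i) $ k)"
proof -
  have G: "opt_G g i n \<in> carrier_mat (dimu g i) (dimy g)" for n using opt_carrier(2)[OF i] .
  have "E *\<^sub>v resp i e = E *\<^sub>v vec_suminf (dimu g i) (\<lambda>n. opt_G g i n *\<^sub>v yhat e n) + E *\<^sub>v opt_H g p i"
    unfolding resp_eq[OF i e] using E opt_carrier(3)[OF i] by (intro mult_mat_add) (auto simp: vec_suminf_def)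
  then have "(E *\<^sub>v resp i e) $ k - (E *\<^sub>v opt_H g p i) $ k
      = (E *\<^sub>v vec_suminf (dimu g i) (\<lambda>n. opt_G g i n *\<^sub>v yhat e n)) $ k"
    using E k by (simp del: index_mult_mat_vec)
  moreover have "(\<lambda>n. (E *\<^sub>v (opt_G g i n *\<^sub>v yhat e n)) $ k)
      sums (E *\<^sub>v vec_suminf (dimu g i) (\<lambda>n. opt_G g i n *\<^sub>v yhat e n)) $ k"
    by (rule mult_vec_suminf[OF E _ _ k]) (use G yhat_series(1)[OF opt_G_summable[OF i] e] in \<open>auto simp del: index_mult_mat_vec\<close>)
  moreover have "(E * opt_G g i n) *\<^sub>v yhat e n = E *\<^sub>v (opt_G g i n *\<^sub>v yhat e n)" for n
    using E G[of n] by (intro mat_mult_mult) auto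
  ultimately show ?thesis by (simp del: index_mult_mat_vec)
qed

text \<open>Matrices may be moved inside the gain series, so the aggregate constants act on an estimate as the
  responses of the decision makers do.\<close>

lemma sum_mult_resp:
  assumes e: "dim_vec e = dimX g" and E: "\<And>j. j \<in> {1..nd} \<Longrightarrow> E j \<in> carrier_mat nr (dimu g j)"
  shows "vec_suminf nr (\<lambda>n. mat_sum nr (dimy g) (\<lambda>j. E j * opt_G g j n) {1..nd} *\<^sub>v yhat e n)
      + vec_sum nr (\<lambda>j. E j *\<^sub>v opt_H g p j) {1..nd} = vec_sum nr (\<lambda>j. E j *\<^sub>v resp j e) {1..nd}"
proof (rule eq_vecI)
  fix k assume "k < dim_vec (vec_sum nr (\<lambda>j. E j *\<^sub>v resp j e) {1..nd})"
  then have k: "k < nr" by (simp add: vec_sum_def)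
  have "(\<lambda>n. \<Sum>j\<in>{1..nd}. ((E j * opt_G g j n) *\<^sub>v yhat e n) $ k)
      sums (\<Sum>j\<in>{1..nd}. ((E j *\<^sub>v resp j e) $ k - (E j *\<^sub>v opt_H g p j) $ k))"
    by (intro sums_sum mult_resp[where nr = nr] e E k)
  moreover have "(mat_sum nr (dimy g) (\<lambda>j. E j * opt_G g j n) {1..nd} *\<^sub>v yhat e n) $ k
      = (\<Sum>j\<in>{1..nd}. ((E j * opt_G g j n) *\<^sub>v yhat e n) $ k)" for n
    using k by (subst mat_sum_mult) (use E opt_carrier(2) in \<open>auto simp: vec_sum_def simp del: index_mult_mat_vec intro!: mult_carrier_mat\<close>)
  ultimately have "(\<Sum>n. (mat_sum nr (dimy g) (\<lambda>j. E j * opt_G g j n) {1..nd} *\<^sub>v yhat e n) $ k)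
      = (\<Sum>j\<in>{1..nd}. ((E j *\<^sub>v resp j e) $ k - (E j *\<^sub>v opt_H g p j) $ k))"
    by (simp only: sums_iff)
  then show "(vec_suminf nr (\<lambda>n. mat_sum nr (dimy g) (\<lambda>j. E j * opt_G g j n) {1..nd} *\<^sub>v yhat e n)
      + vec_sum nr (\<lambda>j. E j *\<^sub>v opt_H g p j) {1..nd}) $ k = vec_sum nr (\<lambda>j. E j *\<^sub>v resp j e) {1..nd} $ k"
    using k by (simp add: vec_suminf_def vec_sum_def sum_subtractf del: index_mult_mat_vec)
qed (simp_all add: vec_sum_def)

lemma agg_Gp_summable: "abs_summable_mat (dimy g) (dimy g) (agg_Gp g)"
  unfolding agg_Gp_def[abs_def]
  by (intro abs_summable_mat_sum abs_summable_mat_left_mult[OF _ opt_G_summable] game_dims(8)[OF game]) auto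

lemma agg_GX_block_summable:
  assumes "i \<le> nd"
  shows "abs_summable_mat (dimx g i) (dimy g) (\<lambda>n. if i = 0
    then mat_sum (dimx g 0) (dimy g) (\<lambda>j. B1mat g j * opt_G g j n) {1..nd} else Bmat g i * opt_G g i n)"
proof (cases "i = 0")
  case True
  show ?thesis unfolding if_P[OF True] unfolding True
    by (intro abs_summable_mat_sum abs_summable_mat_left_mult[OF _ opt_G_summable] game_dims(6)[OF game]) auto
next
  case False
  then show ?thesis using assms
    by (simp only: if_False) (intro abs_summable_mat_left_mult[OF game_dims(4)[OF game] opt_G_summable], auto)
qed

lemma agg_GX_summable: "abs_summable_mat (dimX g) (dimy g) (agg_GX g)"
  unfolding agg_GX_def[abs_def] dimX_eq
  using agg_GX_block_summable by (intro abs_summable_mat_col_stack) auto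

lemma lim_Gp_mult:
  assumes e: "dim_vec e = dimX g"
  shows "lim_Gp g a *\<^sub>v e + lim_Hp g p b = vec_suminf (dimy g) (\<lambda>n. agg_Gp g n *\<^sub>v yhat e n) + agg_Hp g p"
    "lim_Gp g a *\<^sub>v e + lim_Hp g p b = vec_sum (dimy g) (\<lambda>j. E1mat g j *\<^sub>v resp j e) {1..nd}"
proof -
  show 1: "lim_Gp g a *\<^sub>v e + lim_Hp g p b = vec_suminf (dimy g) (\<lambda>n. agg_Gp g n *\<^sub>v yhat e n) + agg_Hp g p"
    unfolding yhat_series(2)[OF agg_Gp_summable e, symmetric] lim_Gp_def lim_Hp_def
    by (rule eq_vecI) (simp_all add: vec_suminf_def mat_suminf_def agg_Hp_def vec_sum_def)
  show "lim_Gp g a *\<^sub>v e + lim_Hp g p b = vec_sum (dimy g) (\<lambda>j. E1mat g j *\<^sub>v resp j e) {1..nd}"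
    unfolding 1 agg_Gp_def agg_Hp_def by (rule sum_mult_resp[OF e game_dims(8)[OF game]])
qed

lemma agg_HX_dim: "dim_vec (agg_HX g p) = dimX g"
  unfolding agg_HX_def dimX_eq
  by (rule vec_stack_dim) (use carrier_matD(1)[OF game_dims(4)[OF game]] in \<open>auto simp: vec_sum_def\<close>)

lemma lim_HX_dim [simp]: "dim_vec (lim_HX g p b) = dimX g"
  by (simp add: lim_HX_def agg_HX_dim)

lemma lim_GX_mult:
  assumes e: "dim_vec e = dimX g"
  shows "lim_GX g a *\<^sub>v e + lim_HX g p b = vec_suminf (dimX g) (\<lambda>n. agg_GX g n *\<^sub>v yhat e n) + agg_HX g p"
  unfolding yhat_series(2)[OF agg_GX_summable e, symmetric] lim_GX_def lim_HX_def
  by (rule eq_vecI) (simp_all add: vec_suminf_def mat_suminf_def agg_HX_dim)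

lemma slice_lim_GX_mult:
  assumes e: "dim_vec e = dimX g" and i: "i \<le> nd"
  shows "sl i (lim_GX g a *\<^sub>v e + lim_HX g p b) =
    (if i = 0 then vec_sum (dimx g 0) (\<lambda>j. B1mat g j *\<^sub>v resp j e) {1..nd} else Bmat g i *\<^sub>v resp i e)"
proof -
  have B: "Bmat g j \<in> carrier_mat (dimx g j) (dimu g j)" if "j \<in> {1..nd}" for j using game_dims(4)[OF game that] .
  let ?blk = "\<lambda>i n. if i = 0 then mat_sum (dimx g 0) (dimy g) (\<lambda>j. B1mat g j * opt_G g j n) {1..nd} else Bmat g i * opt_G g i n"
  have blk: "?blk j n \<in> carrier_mat (dimx g j) (dimy g)" if "j \<le> nd" for j n
    using agg_GX_block_summable[OF that] by (auto simp: abs_summable_mat_def)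
  have H: "sl i (agg_HX g p) = (if i = 0 then vec_sum (dimx g 0) (\<lambda>j. B1mat g j *\<^sub>v opt_H g p j) {1..nd} else Bmat g i *\<^sub>v opt_H g p i)"
    unfolding agg_HX_def by (rule slice_vec_stack) (use i carrier_matD(1)[OF B] in \<open>auto simp: vec_sum_def\<close>)
  have G: "sl i (vec_suminf (dimX g) (\<lambda>n. agg_GX g n *\<^sub>v yhat e n)) = vec_suminf (dimx g i) (\<lambda>n. ?blk i n *\<^sub>v yhat e n)"
  proof (rule eq_vecI)
    fix k assume "k < dim_vec (vec_suminf (dimx g i) (\<lambda>n. ?blk i n *\<^sub>v yhat e n))"
    then have k: "k < dimx g i" by (simp add: vec_suminf_def)
    have "(agg_GX g n *\<^sub>v yhat e n) $ ((\<Sum>j<i. dimx g j) + k) = (?blk i n *\<^sub>v yhat e n) $ k" for n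
    proof -
      have "sl i (agg_GX g n *\<^sub>v yhat e n) = ?blk i n *\<^sub>v yhat e n"
        unfolding agg_GX_def by (rule slice_col_stack_mult[OF blk _ i]) auto
      then have "sl i (agg_GX g n *\<^sub>v yhat e n) $ k = (?blk i n *\<^sub>v yhat e n) $ k" by (rule arg_cong)
      then show ?thesis using k by (simp only: slice_def index_vec)
    qed
    then show "sl i (vec_suminf (dimX g) (\<lambda>n. agg_GX g n *\<^sub>v yhat e n)) $ k = vec_suminf (dimx g i) (\<lambda>n. ?blk i n *\<^sub>v yhat e n) $ k"
      using k slice_bound[of i nd k "dimx g", OF i k] by (simp add: slice_def vec_suminf_def dimX_eq del: index_mult_mat_vec sum.lessThan_Suc)
  qed (simp add: vec_suminf_def)
  have sum: "sl i (lim_GX g a *\<^sub>v e + lim_HX g p b) = vec_suminf (dimx g i) (\<lambda>n. ?blk i n *\<^sub>v yhat e n) + sl i (agg_HX g p)"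
    unfolding lim_GX_mult[OF e] G[symmetric]
    by (rule slice_add[where n = nd]) (use i agg_HX_dim in \<open>auto simp: dimX_eq[symmetric] vec_suminf_def simp del: sum.lessThan_Suc\<close>)
  show ?thesis
  proof (cases "i = 0")
    case True
    show ?thesis
      unfolding sum H if_P[OF True] unfolding True by (rule sum_mult_resp[OF e game_dims(6)[OF game]])
  next
    case False
    then have i': "i \<in> {1..nd}" using i by simp
    have "vec_suminf (dimx g i) (\<lambda>n. (Bmat g i * opt_G g i n) *\<^sub>v yhat e n) + Bmat g i *\<^sub>v opt_H g p i = Bmat g i *\<^sub>v resp i e"
    proof (rule eq_vecI)
      fix k assume "k < dim_vec (Bmat g i *\<^sub>v resp i e)"
      then have k: "k < dimx g i" using B[OF i'] by simp
      show "(vec_suminf (dimx g i) (\<lambda>n. (Bmat g i * opt_G g i n) *\<^sub>v yhat e n) + Bmat g i *\<^sub>v opt_H g p i) $ k = (Bmat g i *\<^sub>v resp i e) $ k"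
        using mult_resp[OF i' e B[OF i'] k] k B[OF i'] by (simp add: vec_suminf_def sums_iff del: index_mult_mat_vec)
    qed (use B[OF i'] in simp)
    then show ?thesis unfolding sum H if_not_P[OF False] .
  qed
qed

section \<open>Consistency of the linear system\<close>

text \<open>The auxiliary recursion for a known aggregate state, with the noise at its mean.\<close>

definition step_y :: "real vec \<Rightarrow> real vec" where
  "step_y x = agg_D g *\<^sub>v x + lim_Gp g a *\<^sub>v x + lim_Hp g p b + mean_xi g p"

definition step_x :: "real vec \<Rightarrow> real vec" where
  "step_x x = agg_A g *\<^sub>v x + lim_GX g a *\<^sub>v x + lim_HX g p b + agg_C g *\<^sub>v step_y x + mean_W g p"

text \<open>Uniqueness makes the solution time consistent: its shift by \<open>t\<close> is the solution from
  the state reached at \<open>t\<close>. Hence the anticipative series collapse to the constants of the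
  auxiliary recursion, and the solution is generated forward in time.\<close>

lemma forward_recursion:
  assumes e: "e \<in> carrier_vec (dimX g)"
  shows "(step_x ^^ n) e \<in> carrier_vec (dimX g)" "step_y ((step_x ^^ n) e) = yhat e n"
proof -
  obtain y where sol: "lin_sys_solution g p e y" using sys_unique e by blast
  then obtain X where X: "X 0 = e" "\<And>t. X t \<in> carrier_vec (dimX g)"
    and eqs: "\<And>t. vec_summable (dimy g) (\<lambda>n. agg_Gp g n *\<^sub>v y (t + n)) \<and>
          vec_summable (dimX g) (\<lambda>n. agg_GX g n *\<^sub>v y (t + n)) \<and>
          y t = agg_D g *\<^sub>v X t + vec_suminf (dimy g) (\<lambda>n. agg_Gp g n *\<^sub>v y (t + n)) + agg_Hp g p + mean_xi g p \<and>
          X (Suc t) = agg_A g *\<^sub>v X t + vec_suminf (dimX g) (\<lambda>n. agg_GX g n *\<^sub>v y (t + n))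
                + agg_HX g p + agg_C g *\<^sub>v y t + mean_W g p"
    and y: "\<And>t. y t \<in> carrier_vec (dimy g)"
    unfolding lin_sys_solution_def by blast
  have shift: "y (t + n) = yhat (X t) n" for t n
  proof -
    have "lin_sys_solution g p (X t) (\<lambda>n. y (t + n))"
      unfolding lin_sys_solution_def
    proof (intro conjI exI[of _ "\<lambda>n. X (t + n)"] allI)
      fix s
      show "vec_summable (dimy g) (\<lambda>n. agg_Gp g n *\<^sub>v y (t + (s + n)))"
        "vec_summable (dimX g) (\<lambda>n. agg_GX g n *\<^sub>v y (t + (s + n)))"
        "y (t + s) = agg_D g *\<^sub>v X (t + s) + vec_suminf (dimy g) (\<lambda>n. agg_Gp g n *\<^sub>v y (t + (s + n))) + agg_Hp g p + mean_xi g p"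
        "X (t + Suc s) = agg_A g *\<^sub>v X (t + s) + vec_suminf (dimX g) (\<lambda>n. agg_GX g n *\<^sub>v y (t + (s + n)))
            + agg_HX g p + agg_C g *\<^sub>v y (t + s) + mean_W g p"
        using eqs[of "t + s"] by (simp_all only: add.assoc add_Suc_right)
    qed (use X y in auto)
    then show ?thesis using sys_affine X(2) unfolding yhat_def by blast
  qed
  have yt: "y t = step_y (X t)" for t
  proof -
    have Xt: "dim_vec (X t) = dimX g" using X(2)[of t] by simp
    have "y t = agg_D g *\<^sub>v X t + vec_suminf (dimy g) (\<lambda>n. agg_Gp g n *\<^sub>v yhat (X t) n) + agg_Hp g p + mean_xi g p"
      using eqs[of t] by (simp only: shift)
    also have "\<dots> = agg_D g *\<^sub>v X t + (lim_Gp g a *\<^sub>v X t + lim_Hp g p b) + mean_xi g p"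
      unfolding lim_Gp_mult(1)[OF Xt]
      by (rule eq_vecI) (simp_all add: agg_Hp_def vec_sum_def vec_suminf_def mean_xi_def vec_mean_def)
    also have "\<dots> = step_y (X t)"
      unfolding step_y_def
      by (rule eq_vecI) (simp_all add: lim_Hp_def agg_Hp_def vec_sum_def vec_suminf_def mean_xi_def vec_mean_def)
    finally show ?thesis .
  qed
  have "X (Suc t) = step_x (X t)" for t
  proof -
    have Xt: "dim_vec (X t) = dimX g" using X(2)[of t] by simp
    have dW: "dim_vec (mean_W g p) = dimX g" by (simp add: mean_W_def vec_mean_def)
    have "X (Suc t) = agg_A g *\<^sub>v X t + vec_suminf (dimX g) (\<lambda>n. agg_GX g n *\<^sub>v yhat (X t) n) + agg_HX g p + agg_C g *\<^sub>v y t + mean_W g p"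
      using eqs[of t] by (simp only: shift)
    also have "\<dots> = agg_A g *\<^sub>v X t + (lim_GX g a *\<^sub>v X t + lim_HX g p b) + agg_C g *\<^sub>v y t + mean_W g p"
      unfolding lim_GX_mult[OF Xt]
      by (rule eq_vecI) (simp_all add: agg_HX_dim vec_suminf_def dW del: index_mult_mat_vec)
    also have "\<dots> = step_x (X t)"
      unfolding step_x_def yt
      by (rule eq_vecI) (simp_all add: lim_HX_def agg_HX_dim vec_suminf_def dW del: index_mult_mat_vec)
    finally show ?thesis .
  qed
  then have Xn: "X n = (step_x ^^ n) e" for n by (induction n) (simp_all add: X(1))
  show "(step_x ^^ n) e \<in> carrier_vec (dimX g)" using X(2)[of n] by (simp only: Xn)
  show "step_y ((step_x ^^ n) e) = yhat e n"
    using yt[of n] shift[of 0 n] by (simp only: Xn[symmetric] X(1) add_0)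
qed

section \<open>The closed loop of the game\<close>

definition eq_strat :: "nat \<Rightarrow> strategy" where
  "eq_strat = (\<lambda>i t x u y. opt_F g i *\<^sub>v x t + lim_G g i a *\<^sub>v est t y + lim_H g p i b)"

lemma est_measurable: "est t \<in> seq_borel {..<t} (dimy g) \<rightarrow>\<^sub>M vec_borel (dimX g)"
  using estimator by (simp add: state_estimator_def)

lemma lim_H_dim: "i \<in> {1..nd} \<Longrightarrow> dim_vec (lim_H g p i b) = dimu g i"
  using opt_carrier(3) by (simp add: lim_H_def)

lemma eq_strat_strategy:
  assumes i: "i \<in> {1..nd}"
  shows "eq_strat i \<in> strategies g i"
  unfolding strategies_def
proof (intro CollectI allI)
  fix t
  let ?N = "seq_borel {..t} (dimx g i) \<Otimes>\<^sub>M seq_borel {..<t} (dimu g i) \<Otimes>\<^sub>M seq_borel {..<t} (dimy g)"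
  have x: "(\<lambda>q. fst q t) \<in> ?N \<rightarrow>\<^sub>M vec_borel (dimx g i)"
    by (rule measurable_compose[OF measurable_fst measurable_seq_component]) simp
  have e: "(\<lambda>q. est t (snd (snd q))) \<in> ?N \<rightarrow>\<^sub>M vec_borel (dimX g)"
    by (rule measurable_compose[OF measurable_compose[OF measurable_snd measurable_snd] est_measurable])
  have "(\<lambda>q. opt_F g i *\<^sub>v fst q t + lim_G g i a *\<^sub>v est t (snd (snd q)) + lim_H g p i b) \<in> ?N \<rightarrow>\<^sub>M vec_borel (dimu g i)"
    by (intro measurable_vec_add measurable_mult_mat_vec[OF opt_carrier(1)[OF i] x]
        measurable_mult_mat_vec[OF _ e] measurable_vec_const lim_H_dim i) auto
  then show "(\<lambda>(x, u, y). eq_strat i t x u y) \<in> ?N \<rightarrow>\<^sub>M vec_borel (dimu g i)"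
    by (simp add: eq_strat_def split_beta')
qed

lemma sum_atMost_split: "(\<Sum>j\<in>{..n}. f j) = f 0 + (\<Sum>j\<in>{1..n::nat}. f j :: real)"
proof -
  have "{..n} = insert 0 {1..n}" by auto
  then show ?thesis by simp
qed

context
  fixes x0 :: "nat \<Rightarrow> real vec" and w :: "nat \<Rightarrow> nat \<Rightarrow> real vec" and \<xi> :: "nat \<Rightarrow> real vec"
  assumes dims: "\<And>i. i \<le> nd \<Longrightarrow> dim_vec (x0 i) = dimx g i" "\<And>t i. i \<le> nd \<Longrightarrow> dim_vec (w t i) = dimx g i"
    "\<And>t. dim_vec (\<xi> t) = dimy g"
begin

abbreviation "gx \<equiv> game_x g eq_strat x0 w \<xi>"
abbreviation "gu \<equiv> game_u g eq_strat x0 w \<xi>"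
abbreviation "gy \<equiv> game_y g eq_strat x0 w \<xi>"
abbreviation "ge t \<equiv> est t (\<lambda>k\<in>{..<t}. gy k)"
abbreviation "gX t \<equiv> vec_stack (\<lambda>i. gx i t) nd"

lemma gy_dim: "dim_vec (gy t) = dimy g"
  by (simp add: game_y.simps[of _ _ _ _ _ t] dims)

lemma gx_dim: "i \<le> nd \<Longrightarrow> dim_vec (gx i t) = dimx g i"
  by (cases t) (simp_all add: dims)

lemma ge_dim: "dim_vec (ge t) = dimX g"
proof -
  have "(\<lambda>k\<in>{..<t}. gy k) \<in> space (seq_borel {..<t} (dimy g))"
    by (auto simp: space_seq_borel intro!: carrier_vecI gy_dim)
  then show ?thesis by (rule measurable_vec_dim[OF est_measurable])
qed

lemma gX_dim: "dim_vec (gX t) = dimX g"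
  unfolding dimX_eq by (rule vec_stack_dim) (rule gx_dim)

lemma gu_eq:
  assumes i: "i \<in> {1..nd}"
  shows "gu i t = opt_F g i *\<^sub>v gx i t + resp i (ge t)"
  unfolding game_u.simps[of _ _ _ _ _ _ t] resp_def
  by (rule eq_vecI) (use i lim_H_dim[OF i] in \<open>simp_all add: eq_strat_def del: index_mult_mat_vec\<close>)

lemma mult_gu:
  assumes i: "i \<in> {1..nd}" and E: "E \<in> carrier_mat nr (dimu g i)" and E': "E' \<in> carrier_mat nr (dimx g i)" and k: "k < nr"
  shows "(E *\<^sub>v gu i t + E' *\<^sub>v gx i t) $ k = ((E * opt_F g i + E') *\<^sub>v gx i t) $ k + (E *\<^sub>v resp i (ge t)) $ k"
proof -
  have F: "opt_F g i \<in> carrier_mat (dimu g i) (dimx g i)" by (rule opt_carrier(1)[OF i])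
  have "E *\<^sub>v gu i t = E *\<^sub>v (opt_F g i *\<^sub>v gx i t) + E *\<^sub>v resp i (ge t)"
    unfolding gu_eq[OF i] using E F i by (intro mult_mat_add) auto
  moreover have "(E * opt_F g i + E') *\<^sub>v gx i t = E *\<^sub>v (opt_F g i *\<^sub>v gx i t) + E' *\<^sub>v gx i t"
    using E E' F i gx_dim[of i t] by (auto simp: linear_simps)
  ultimately show ?thesis using E E' k by (simp del: index_mult_mat_vec)
qed

lemma closed_loop_y:
  "gy t = agg_D g *\<^sub>v gX t + (lim_Gp g a *\<^sub>v ge t + lim_Hp g p b) + \<xi> t"
proof (rule eq_vecI)
  fix k assume "k < dim_vec (agg_D g *\<^sub>v gX t + (lim_Gp g a *\<^sub>v ge t + lim_Hp g p b) + \<xi> t)"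
  then have k: "k < dimy g" by (simp add: dims)
  let ?b = "\<lambda>j. if j = 0 then Dmat g else E1mat g j * opt_F g j + E2mat g j"
  have "agg_D g *\<^sub>v gX t = vec_sum (dimy g) (\<lambda>j. ?b j *\<^sub>v gx j t) {..nd}"
    unfolding agg_D_def
    by (rule row_stack_mult[where d = "dimx g"])
      (use gx_dim mult_opt_F_carrier(3) game_dims(2,9)[OF game] in \<open>auto intro!: add_carrier_mat\<close>)
  then have 1: "(agg_D g *\<^sub>v gX t) $ k = (Dmat g *\<^sub>v gx 0 t) $ k
      + (\<Sum>j\<in>{1..nd}. ((E1mat g j * opt_F g j + E2mat g j) *\<^sub>v gx j t) $ k)"
    using k by (simp add: vec_sum_def sum_atMost_split del: index_mult_mat_vec)
  have 2: "(lim_Gp g a *\<^sub>v ge t + lim_Hp g p b) $ k = (\<Sum>j\<in>{1..nd}. (E1mat g j *\<^sub>v resp j (ge t)) $ k)"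
    unfolding lim_Gp_mult(2)[OF ge_dim] using k by (simp add: vec_sum_def del: index_mult_mat_vec)
  have "(\<Sum>j\<in>{1..nd}. (E1mat g j *\<^sub>v gu j t + E2mat g j *\<^sub>v gx j t) $ k)
      = (\<Sum>j\<in>{1..nd}. ((E1mat g j * opt_F g j + E2mat g j) *\<^sub>v gx j t) $ k + (E1mat g j *\<^sub>v resp j (ge t)) $ k)"
    by (rule sum.cong[OF refl], rule mult_gu[where nr = "dimy g"]) (use game_dims[OF game] k in auto)
  then show "gy t $ k = (agg_D g *\<^sub>v gX t + (lim_Gp g a *\<^sub>v ge t + lim_Hp g p b) + \<xi> t) $ k"
    unfolding game_y.simps[of _ _ _ _ _ t]
    using k 1 2 dims(3)[of t] game_dims(2)[OF game]
    by (simp add: vec_sum_def sum.distrib del: index_mult_mat_vec)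
qed (simp add: gy_dim dims)

text \<open>The block row of each component is compared with the dynamics of that component; the feedback on
  the own state goes into the aggregate matrix and the response to the estimate into \<open>lim_GX\<close> and \<open>lim_HX\<close>.\<close>

lemma closed_loop_x:
  "gX (Suc t) = agg_A g *\<^sub>v gX t + (lim_GX g a *\<^sub>v ge t + lim_HX g p b) + agg_C g *\<^sub>v gy t + vec_stack (w t) nd"
proof (rule slice_eqI[where n = nd and d = "dimx g"])
  have wd: "dim_vec (vec_stack (w t) nd) = (\<Sum>j<Suc nd. dimx g j)" by (rule vec_stack_dim) (rule dims)
  show "dim_vec (gX (Suc t)) = (\<Sum>j<Suc nd. dimx g j)" unfolding gX_dim by (rule dimX_eq)
  show "dim_vec (agg_A g *\<^sub>v gX t + (lim_GX g a *\<^sub>v ge t + lim_HX g p b) + agg_C g *\<^sub>v gy t + vec_stack (w t) nd)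
      = (\<Sum>j<Suc nd. dimx g j)" using wd by simp
  fix i assume i: "i \<le> nd"
  let ?blk = "\<lambda>i j. if i = 0 then (if j = 0 then Amat g 0 else B1mat g j * opt_F g j + B2mat g j)
     else if j = i then Amat g i + Bmat g i * opt_F g i else 0\<^sub>m (dimx g i) (dimx g j)"
  have blk: "?blk i j \<in> carrier_mat (dimx g i) (dimx g j)" if "i \<le> nd" "j \<le> nd" for i j
    using that mult_opt_F_carrier(1,2) game_dims(1,3,7)[OF game] by (auto intro!: add_carrier_mat)
  have rows: "row_stack (?blk i) nd \<in> carrier_mat (dimx g i) (dimX g)" if "i \<le> nd" for i
    unfolding dimX_eq by (rule row_stack_dims) (use blk that in auto)
  have A: "sl i (agg_A g *\<^sub>v gX t) = vec_sum (dimx g i) (\<lambda>j. ?blk i j *\<^sub>v gx j t) {..nd}"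
  proof -
    have "sl i (agg_A g *\<^sub>v gX t) = row_stack (?blk i) nd *\<^sub>v gX t"
      unfolding agg_A_def by (rule slice_col_stack_mult[OF rows gX_dim i])
    also have "\<dots> = vec_sum (dimx g i) (\<lambda>j. ?blk i j *\<^sub>v gx j t) {..nd}"
      by (rule row_stack_mult[where d = "dimx g"]) (use blk i gx_dim in auto)
    finally show ?thesis .
  qed
  have C: "sl i (agg_C g *\<^sub>v gy t) = (if i = 0 then 0\<^sub>m (dimx g 0) (dimy g) else Cmat g i) *\<^sub>v gy t"
    unfolding agg_C_def
    by (rule slice_col_stack_mult[OF _ gy_dim i]) (use game_dims(5)[OF game] in auto)
  have W: "sl i (vec_stack (w t) nd) = w t i" by (rule slice_vec_stack) (use dims i in auto)
  have rhs: "sl i (agg_A g *\<^sub>v gX t + (lim_GX g a *\<^sub>v ge t + lim_HX g p b) + agg_C g *\<^sub>v gy t + vec_stack (w t) nd)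
     = sl i (agg_A g *\<^sub>v gX t) + sl i (lim_GX g a *\<^sub>v ge t + lim_HX g p b) + sl i (agg_C g *\<^sub>v gy t) + w t i"
    using wd i dims(2)[of _ t] unfolding W[symmetric]
    by (simp add: slice_add[where n = nd and d = "dimx g"] dimX_eq[symmetric] del: sum.lessThan_Suc)
  have lhs: "sl i (gX (Suc t)) = gx i (Suc t)" by (rule slice_vec_stack[OF gx_dim i])
  show "sl i (gX (Suc t)) = sl i (agg_A g *\<^sub>v gX t + (lim_GX g a *\<^sub>v ge t + lim_HX g p b) + agg_C g *\<^sub>v gy t + vec_stack (w t) nd)"
    unfolding lhs rhs A C slice_lim_GX_mult[OF ge_dim i]
  proof (rule eq_vecI, goal_cases)
    case (1 k)
    then have k: "k < dimx g i" using dims(2)[OF i] by simp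
    show ?case
    proof (cases "i = 0")
      case True
      have k0: "k < dimx g 0" using k True by simp
      have "(\<Sum>j\<in>{1..nd}. (B1mat g j *\<^sub>v gu j t + B2mat g j *\<^sub>v gx j t) $ k)
          = (\<Sum>j\<in>{1..nd}. ((B1mat g j * opt_F g j + B2mat g j) *\<^sub>v gx j t) $ k + (B1mat g j *\<^sub>v resp j (ge t)) $ k)"
        by (rule sum.cong[OF refl], rule mult_gu[where nr = "dimx g 0"]) (use game_dims[OF game] k0 in auto)
      moreover have "(0\<^sub>m (dimx g 0) (dimy g) *\<^sub>v gy t) $ k = 0" using k0 gy_dim by (simp add: scalar_prod_def)
      ultimately show ?thesis
        using k0 dims(2)[of 0 t] True game_dims(1)[OF game]
        by (simp add: vec_sum_def sum_atMost_split sum.distrib del: index_mult_mat_vec)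
    next
      case False
      then have i': "i \<in> {1..nd}" using i by simp
      have "(Bmat g i *\<^sub>v gu i t + Amat g i *\<^sub>v gx i t) $ k
          = ((Bmat g i * opt_F g i + Amat g i) *\<^sub>v gx i t) $ k + (Bmat g i *\<^sub>v resp i (ge t)) $ k"
        by (rule mult_gu[where nr = "dimx g i"]) (use game_dims[OF game] i' k in auto)
      moreover have "Bmat g i * opt_F g i + Amat g i = Amat g i + Bmat g i * opt_F g i"
        by (rule comm_add_mat[OF mult_opt_F_carrier(1)[OF i'] game_dims(3)[OF game i']])
      moreover have "(\<Sum>j\<le>nd. (?blk i j *\<^sub>v gx j t) $ k) = ((Amat g i + Bmat g i * opt_F g i) *\<^sub>v gx i t) $ k"
      proof -
        have "(?blk i j *\<^sub>v gx j t) $ k = (if j = i then ((Amat g i + Bmat g i * opt_F g i) *\<^sub>v gx i t) $ k else 0)" if "j \<le> nd" for j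
          using False k gx_dim[OF that, of t] by (auto simp: scalar_prod_def)
        then show ?thesis using i by (simp add: sum.delta del: index_mult_mat_vec)
      qed
      ultimately show ?thesis
        using k dims(2)[OF i, of t] False game_dims(3,4,5)[OF game i']
        by (simp add: vec_sum_def del: index_mult_mat_vec)
    qed
  qed (simp add: dims i gx_dim[OF i, of "Suc t", simplified])
qed

end

end

section \<open>The law of the equilibrium play\<close>

type_synonym noise_path = "real vec \<times> (nat \<Rightarrow> real vec) \<times> (nat \<Rightarrow> real vec)"

text \<open>The components of a realization \<open>(X0, \<xi>, W)\<close> of the primitive random variables.\<close>

primrec coord :: "source \<Rightarrow> noise_path \<Rightarrow> real vec" where
  "coord Init q = fst q"
| "coord (Dist t) q = snd (snd q) t"
| "coord (Obs t) q = fst (snd q) t"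

text \<open>The primitive variables that determine the observations before \<open>t\<close>.\<close>

definition past_sources :: "nat \<Rightarrow> source set" where
  "past_sources t = insert Init (Dist ` {..<t} \<union> Obs ` {..<t})"

context sebeu_setting
begin

definition source_dim :: "source \<Rightarrow> nat" where
  "source_dim r = (case r of Init \<Rightarrow> dimX g | Dist t \<Rightarrow> dimX g | Obs t \<Rightarrow> dimy g)"

lemma source_dim_simps [simp]: "source_dim Init = dimX g" "source_dim (Dist t) = dimX g" "source_dim (Obs t) = dimy g"
  by (simp_all add: source_dim_def)

definition noise_space :: "(noise_path) measure" where
  "noise_space = vec_borel (dimX g) \<Otimes>\<^sub>M seq_borel UNIV (dimy g) \<Otimes>\<^sub>M seq_borel UNIV (dimX g)"

definition noise :: "'w \<Rightarrow> noise_path" where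
  "noise \<omega> = (init_X g p \<omega>, \<lambda>t. obs_xi p t \<omega>, \<lambda>t. dist_W g p t \<omega>)"

definition aux_noise :: "'v \<Rightarrow> noise_path" where
  "aux_noise \<omega> = (Xbar 0 \<omega>, \<lambda>t. xibar t \<omega>, \<lambda>t. Wbar t \<omega>)"

definition noise_law where "noise_law = distr (prob_sp p) noise_space noise"

lemma prob_p: "prob_space (prob_sp p)"
  using prims by (simp add: primitive_data_def)

lemma prob_P: "prob_space P"
  using aux by (simp add: aux_process_def)

lemma family_eq: "(\<lambda>r. case r of Init \<Rightarrow> vec_borel (dimX g) | Dist t \<Rightarrow> vec_borel (dimX g)
                    | Obs t \<Rightarrow> vec_borel (dimy g)) = (\<lambda>r. vec_borel (source_dim r))"
  "(\<lambda>r. case r of Init \<Rightarrow> init_X g p | Dist t \<Rightarrow> dist_W g p t | Obs t \<Rightarrow> obs_xi p t) = (\<lambda>r \<omega>. coord r (noise \<omega>))"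
  by (auto simp: fun_eq_iff source_dim_def noise_def split: source.split)

lemma indep_coord: "prob_space.indep_vars (prob_sp p) (\<lambda>r. vec_borel (source_dim r)) (\<lambda>r \<omega>. coord r (noise \<omega>)) UNIV"
  using indep unfolding primitives_independent_def family_eq .

lemma coord_noise_measurable: "(\<lambda>\<omega>. coord r (noise \<omega>)) \<in> prob_sp p \<rightarrow>\<^sub>M vec_borel (source_dim r)"
  using indep_coord unfolding prob_space.indep_vars_def[OF prob_p] by blast

lemma noise_measurable: "noise \<in> prob_sp p \<rightarrow>\<^sub>M noise_space"
  unfolding noise_space_def noise_def[abs_def]
  using coord_noise_measurable[of Init] coord_noise_measurable[of "Obs _"] coord_noise_measurable[of "Dist _"]
  by (intro measurable_Pair measurable_seq_UNIV) (auto simp: noise_def)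

lemma prob_noise_law: "prob_space noise_law"
  unfolding noise_law_def by (rule prob_space.prob_space_distr[OF prob_p noise_measurable])

lemma sets_noise_law [measurable_cong]: "sets noise_law = sets noise_space"
  by (simp add: noise_law_def)

lemma aux_noise_measurable: "aux_noise \<in> P \<rightarrow>\<^sub>M noise_space"
  unfolding noise_space_def aux_noise_def[abs_def]
  using aux by (intro measurable_Pair measurable_seq_UNIV) (auto simp: aux_process_def)

lemma distr_aux_noise: "distr P noise_space aux_noise = noise_law"
  using aux by (simp add: aux_process_def noise_law_def noise_space_def noise_def[abs_def] aux_noise_def[abs_def])

lemma coord_measurable: "coord r \<in> noise_space \<rightarrow>\<^sub>M vec_borel (source_dim r)"
proof (cases r)
  case Init
  have "coord Init = fst" by (simp add: fun_eq_iff)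
  then show ?thesis unfolding Init by (simp add: noise_space_def)
next
  case (Dist t)
  have "coord (Dist t) = (\<lambda>q. snd (snd q) t)" by (simp add: fun_eq_iff)
  then show ?thesis
    unfolding Dist noise_space_def source_dim_simps
    by (simp only:) (rule measurable_compose[OF measurable_compose[OF measurable_snd measurable_snd] measurable_seq_component[OF UNIV_I]])
next
  case (Obs t)
  have "coord (Obs t) = (\<lambda>q. fst (snd q) t)" by (simp add: fun_eq_iff)
  then show ?thesis
    unfolding Obs noise_space_def source_dim_simps
    by (simp only:) (rule measurable_compose[OF measurable_compose[OF measurable_snd measurable_fst] measurable_seq_component[OF UNIV_I]])
qed

text \<open>The environment variables that realize under the candidates, as a function of the primitive random
  variables.\<close>

definition play_of :: "noise_path \<Rightarrow> nat \<Rightarrow> real vec" where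
  "play_of q t = game_y g eq_strat (\<lambda>i. sl i (coord Init q)) (\<lambda>t i. sl i (coord (Dist t) q)) (\<lambda>t. coord (Obs t) q) t"

lemma slice_coord_measurable:
  assumes i: "i \<le> nd" and r: "r = Init \<or> r = Dist t"
  shows "(\<lambda>q. sl i (coord r q)) \<in> noise_space \<rightarrow>\<^sub>M vec_borel (dimx g i)"
proof -
  have "source_dim r = (\<Sum>j<Suc nd. dimx g j)" using r by (auto simp: dimX_eq simp del: sum.lessThan_Suc)
  then show ?thesis using measurable_slice[where n = nd and d = "dimx g" and i = i] coord_measurable[of r] i by metis
qed

lemma play_of_measurable: "(\<lambda>q. play_of q t) \<in> noise_space \<rightarrow>\<^sub>M vec_borel (dimy g)"
  unfolding play_of_def
  using coord_measurable[of "Obs _"]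
  by (intro measurable_game(3)[OF game eq_strat_strategy]) (auto simp only: source_dim_simps intro!: slice_coord_measurable)

lemma play_of_past:
  assumes "\<And>r. r \<in> past_sources t \<Longrightarrow> coord r q = coord r q'" "k < t"
  shows "play_of q k = play_of q' k"
  unfolding play_of_def by (rule game_cong) (use assms in \<open>auto simp: past_sources_def simp del: coord.simps\<close>)

definition belief where "belief = distr noise_law (seq_borel UNIV (dimy g)) play_of"

lemma play_of_seq_measurable: "play_of \<in> noise_space \<rightarrow>\<^sub>M seq_borel UNIV (dimy g)"
  using measurable_seq_UNIV[of "\<lambda>t q. play_of q t", OF play_of_measurable] by simp

lemma prob_belief: "prob_space belief"
  unfolding belief_def by (rule prob_space.prob_space_distr[OF prob_noise_law]) (use play_of_seq_measurable sets_noise_law in \<open>simp cong: measurable_cong_sets\<close>)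

lemma sets_belief [measurable_cong]: "sets belief = sets (seq_borel UNIV (dimy g))"
  by (simp add: belief_def)

lemma play_law_eq: "play_law g p eq_strat = belief"
proof -
  have "play_of (noise \<omega>) t = game_y g eq_strat (\<lambda>i. init_x p i \<omega>) (\<lambda>t i. dist_w p t i \<omega>) (\<lambda>t. obs_xi p t \<omega>) t"
    if \<omega>: "\<omega> \<in> space (prob_sp p)" for \<omega> t
  proof -
    have "dim_vec (init_x p i \<omega>) = dimx g i" "dim_vec (dist_w p t i \<omega>) = dimx g i" if "i \<le> nd" for i t
      using prims that \<omega> by (auto simp: primitive_data_def intro!: measurable_vec_dim[of _ "prob_sp p"])
    then have "sl i (init_X g p \<omega>) = init_x p i \<omega>" "sl i (dist_W g p t \<omega>) = dist_w p t i \<omega>" if "i \<le> nd" for i t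
      using that by (simp_all add: init_X_def dist_W_def slice_vec_stack)
    then show ?thesis unfolding play_of_def by (intro game_cong) (auto simp: noise_def)
  qed
  then have "play_law g p eq_strat = distr (prob_sp p) (seq_borel UNIV (dimy g)) (\<lambda>\<omega>. play_of (noise \<omega>))"
    unfolding play_law_def by (intro distr_cong refl) (auto simp: fun_eq_iff)
  also have "\<dots> = belief"
    unfolding belief_def noise_law_def using distr_distr[OF play_of_seq_measurable noise_measurable] by (simp add: o_def)
  finally show ?thesis .
qed

lemma ybar_measurable: "ybar t \<in> P \<rightarrow>\<^sub>M vec_borel (dimy g)"
  and Xbar_measurable: "Xbar t \<in> P \<rightarrow>\<^sub>M vec_borel (dimX g)"
  and xibar_measurable: "xibar t \<in> P \<rightarrow>\<^sub>M vec_borel (dimy g)"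
  and Wbar_measurable: "Wbar t \<in> P \<rightarrow>\<^sub>M vec_borel (dimX g)"
  using aux by (auto simp: aux_process_def)

definition hist :: "nat \<Rightarrow> 'v \<Rightarrow> nat \<Rightarrow> real vec" where
  "hist t \<omega> = (\<lambda>k\<in>{..<t}. ybar k \<omega>)"

lemma hist_measurable: "hist t \<in> P \<rightarrow>\<^sub>M seq_borel {..<t} (dimy g)"
  unfolding hist_def[abs_def] by (intro measurable_seq_restrict ybar_measurable)

lemma est_hist_AE: "AE \<omega> in P. cond_state g P Xbar ybar t \<omega> = est t (hist t \<omega>)"
proof -
  have "AE \<omega> in P. est t (\<lambda>k\<in>{..<t}. ybar k \<omega>) = cond_state g P Xbar ybar t \<omega>"
    using estimator by (simp add: state_estimator_def)
  then show ?thesis by eventually_elim (simp add: hist_def)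
qed

lemma est_hist_measurable: "(\<lambda>\<omega>. est t (hist t \<omega>)) \<in> P \<rightarrow>\<^sub>M vec_borel (dimX g)"
  by (rule measurable_compose[OF hist_measurable est_measurable])

lemma ybar_AE: "AE \<omega> in P. ybar t \<omega> = agg_D g *\<^sub>v Xbar t \<omega> + lim_Gp g a *\<^sub>v est t (hist t \<omega>) + lim_Hp g p b + xibar t \<omega>"
proof -
  have "AE \<omega> in P. ybar t \<omega> = agg_D g *\<^sub>v Xbar t \<omega> + lim_Gp g a *\<^sub>v cond_state g P Xbar ybar t \<omega> + lim_Hp g p b + xibar t \<omega>"
    using aux by (simp add: aux_process_def)
  with est_hist_AE[of t] show ?thesis by eventually_elim simp
qed

lemma Xbar_AE: "AE \<omega> in P. Xbar (Suc t) \<omega> = agg_A g *\<^sub>v Xbar t \<omega> + lim_GX g a *\<^sub>v est t (hist t \<omega>) + lim_HX g p b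
    + agg_C g *\<^sub>v ybar t \<omega> + Wbar t \<omega>"
proof -
  have "AE \<omega> in P. Xbar (Suc t) \<omega> = agg_A g *\<^sub>v Xbar t \<omega> + lim_GX g a *\<^sub>v cond_state g P Xbar ybar t \<omega> + lim_HX g p b
    + agg_C g *\<^sub>v ybar t \<omega> + Wbar t \<omega>"
    using aux by (simp add: aux_process_def)
  with est_hist_AE[of t] show ?thesis by eventually_elim simp
qed

text \<open>The auxiliary process is the play of the game under the candidate strategies, driven by the
  auxiliary noise.\<close>

lemma ybar_eq_play_of: "AE \<omega> in P. \<forall>t. ybar t \<omega> = play_of (aux_noise \<omega>) t"
proof -
  have y: "AE \<omega> in P. \<forall>t. ybar t \<omega> = agg_D g *\<^sub>v Xbar t \<omega> + lim_Gp g a *\<^sub>v est t (hist t \<omega>) + lim_Hp g p b + xibar t \<omega>"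
    unfolding AE_all_countable using ybar_AE by blast
  have x: "AE \<omega> in P. \<forall>t. Xbar (Suc t) \<omega> = agg_A g *\<^sub>v Xbar t \<omega> + lim_GX g a *\<^sub>v est t (hist t \<omega>) + lim_HX g p b
    + agg_C g *\<^sub>v ybar t \<omega> + Wbar t \<omega>"
    unfolding AE_all_countable using Xbar_AE by blast
  show ?thesis
    using AE_space x y
  proof eventually_elim
    case (elim \<omega>)
    let ?x0 = "\<lambda>i. sl i (Xbar 0 \<omega>)" and ?w = "\<lambda>t i. sl i (Wbar t \<omega>)" and ?xi = "\<lambda>t. xibar t \<omega>"
    have dims: "\<And>i. i \<le> nd \<Longrightarrow> dim_vec (?x0 i) = dimx g i" "\<And>t i. i \<le> nd \<Longrightarrow> dim_vec (?w t i) = dimx g i"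
      "\<And>t. dim_vec (?xi t) = dimy g"
      using measurable_vec_dim[OF xibar_measurable elim(1)] by auto
    have W: "vec_stack (?w t) nd = Wbar t \<omega>" "vec_stack ?x0 nd = Xbar 0 \<omega>" for t
      using measurable_vec_dim[OF Wbar_measurable elim(1)] measurable_vec_dim[OF Xbar_measurable elim(1)]
      by (auto simp: dimX_eq intro!: vec_stack_slice simp del: sum.lessThan_Suc)
    let ?gy = "game_y g eq_strat ?x0 ?w ?xi"
    let ?gX = "\<lambda>t. vec_stack (\<lambda>i. game_x g eq_strat ?x0 ?w ?xi i t) nd"
    have dX: "dim_vec (Xbar t \<omega>) = dimX g" and dxi: "dim_vec (xibar t \<omega>) = dimy g" and dW: "dim_vec (Wbar t \<omega>) = dimX g" for t
      using measurable_vec_dim[OF Xbar_measurable elim(1)] measurable_vec_dim[OF xibar_measurable elim(1)]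
        measurable_vec_dim[OF Wbar_measurable elim(1)] by auto
    have step: "?gy t = ybar t \<omega>" if "?gX t = Xbar t \<omega>" "\<And>k. k < t \<Longrightarrow> ?gy k = ybar k \<omega>" for t
    proof -
      have h: "(\<lambda>k\<in>{..<t}. ?gy k) = hist t \<omega>" unfolding hist_def using that by (intro restrict_ext) auto
      have "?gy t = agg_D g *\<^sub>v Xbar t \<omega> + (lim_Gp g a *\<^sub>v est t (hist t \<omega>) + lim_Hp g p b) + xibar t \<omega>"
        using closed_loop_y[of ?x0 ?w ?xi t, OF dims] by (simp only: h that(1))
      also have "\<dots> = ybar t \<omega>"
        unfolding elim(3)[rule_format, of t]
        by (rule eq_vecI) (simp_all add: dxi del: index_mult_mat_vec)
      finally show ?thesis .
    qed
    have "?gX t = Xbar t \<omega> \<and> (\<forall>k<t. ?gy k = ybar k \<omega>)" for t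
    proof (induction t)
      case 0
      then show ?case using W by simp
    next
      case (Suc t)
      have h: "(\<lambda>k\<in>{..<t}. ?gy k) = hist t \<omega>" unfolding hist_def using Suc by (intro restrict_ext) auto
      have gy: "?gy t = ybar t \<omega>" using step Suc by blast
      have "?gX (Suc t) = agg_A g *\<^sub>v Xbar t \<omega> + (lim_GX g a *\<^sub>v est t (hist t \<omega>) + lim_HX g p b) + agg_C g *\<^sub>v ybar t \<omega> + Wbar t \<omega>"
        using closed_loop_x[of ?x0 ?w ?xi t, OF dims] Suc by (simp only: h gy W)
      also have "\<dots> = Xbar (Suc t) \<omega>"
        unfolding elim(2)[rule_format, of t]
        by (rule eq_vecI) (simp_all add: dW del: index_mult_mat_vec)
      finally show ?case using Suc gy by (auto simp: less_Suc_eq)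
    qed
    then have "?gy t = ybar t \<omega>" for t by blast
    then show ?case by (simp add: play_of_def aux_noise_def)
  qed
qed

lemma belief_eq_ybar: "belief = distr P (seq_borel UNIV (dimy g)) (\<lambda>\<omega> t. ybar t \<omega>)"
proof -
  have "belief = distr P (seq_borel UNIV (dimy g)) (\<lambda>\<omega>. play_of (aux_noise \<omega>))"
    unfolding belief_def distr_aux_noise[symmetric] using distr_distr[OF play_of_seq_measurable aux_noise_measurable] by (simp add: o_def)
  also have "\<dots> = distr P (seq_borel UNIV (dimy g)) (\<lambda>\<omega> t. ybar t \<omega>)"
  proof (rule distr_cong_AE)
    show "AE \<omega> in P. play_of (aux_noise \<omega>) = (\<lambda>t. ybar t \<omega>)" using ybar_eq_play_of by eventually_elim auto
    show "(\<lambda>\<omega>. play_of (aux_noise \<omega>)) \<in> P \<rightarrow>\<^sub>M seq_borel UNIV (dimy g)" by (rule measurable_compose[OF aux_noise_measurable play_of_seq_measurable])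
    show "(\<lambda>\<omega> t. ybar t \<omega>) \<in> P \<rightarrow>\<^sub>M seq_borel UNIV (dimy g)" by (intro measurable_seq_UNIV ybar_measurable)
  qed simp_all
  finally show ?thesis .
qed

section \<open>Independence of past and future\<close>

lemma past_independent:
  assumes f: "f \<in> borel_measurable noise_space" "integrable noise_law (f :: _ \<Rightarrow> real)"
    and past: "\<And>q q'. (\<And>r. r \<in> past_sources t \<Longrightarrow> coord r q = coord r q') \<Longrightarrow> f q = f q'"
    and r: "r \<notin> past_sources t" and k: "k < source_dim r" and int: "integrable noise_law (\<lambda>q. coord r q $ k)"
  shows "(\<integral>q. f q * coord r q $ k \<partial>noise_law) = (\<integral>q. f q \<partial>noise_law) * (\<integral>q. coord r q $ k \<partial>noise_law)"
proof -
  interpret prob_space "prob_sp p" by (rule prob_p)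
  let ?M = "\<lambda>r. vec_borel (source_dim r)" and ?J = "past_sources t"
  have iv: "indep_var (PiM ?J ?M) (\<lambda>\<omega>. restrict (\<lambda>r. coord r (noise \<omega>)) ?J) (PiM {r} ?M) (\<lambda>\<omega>. restrict (\<lambda>r. coord r (noise \<omega>)) {r})"
    using r by (intro indep_var_restrict[OF indep_coord]) auto
  \<comment> \<open>The function factors through the past coordinates, so the other coordinates may be set to zero.\<close>
  define recon where "recon \<rho> = (\<rho> Init, \<lambda>k. if k < t then \<rho> (Obs k) else 0\<^sub>v (dimy g), \<lambda>k. if k < t then \<rho> (Dist k) else 0\<^sub>v (dimX g))"
    for \<rho> :: "source \<Rightarrow> real vec"
  have c: "(\<lambda>\<rho>. \<rho> s) \<in> PiM ?J ?M \<rightarrow>\<^sub>M vec_borel (source_dim s)" if "s \<in> ?J" for s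
    by (rule measurable_component_singleton[OF that])
  have "recon \<in> PiM ?J ?M \<rightarrow>\<^sub>M noise_space"
    unfolding recon_def[abs_def] noise_space_def
  proof (intro measurable_Pair measurable_seq_UNIV)
    show "(\<lambda>\<rho>. \<rho> Init) \<in> PiM ?J ?M \<rightarrow>\<^sub>M vec_borel (dimX g)" using c[of Init] by (simp add: past_sources_def)
    fix k
    show "(\<lambda>\<rho>. if k < t then \<rho> (Obs k) else 0\<^sub>v (dimy g)) \<in> PiM ?J ?M \<rightarrow>\<^sub>M vec_borel (dimy g)"
      using c[of "Obs k"] by (cases "k < t") (auto simp: past_sources_def intro!: measurable_vec_const)
    show "(\<lambda>\<rho>. if k < t then \<rho> (Dist k) else 0\<^sub>v (dimX g)) \<in> PiM ?J ?M \<rightarrow>\<^sub>M vec_borel (dimX g)"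
      using c[of "Dist k"] by (cases "k < t") (auto simp: past_sources_def intro!: measurable_vec_const)
  qed
  then have m1: "(\<lambda>\<rho>. f (recon \<rho>)) \<in> borel_measurable (PiM ?J ?M)" by (rule measurable_compose[OF _ f(1)])
  have m2: "(\<lambda>\<rho>. \<rho> r $ k) \<in> borel_measurable (PiM {r} ?M)"
  proof -
    have "(\<lambda>\<rho>. \<rho> r) \<in> PiM {r} ?M \<rightarrow>\<^sub>M vec_borel (source_dim r)" by (rule measurable_component_singleton) simp
    then show ?thesis by (rule measurable_vec_index[OF _ k])
  qed
  have eq1: "(\<lambda>\<rho>. f (recon \<rho>)) \<circ> (\<lambda>\<omega>. restrict (\<lambda>r. coord r (noise \<omega>)) ?J) = (\<lambda>\<omega>. f (noise \<omega>))"
  proof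
    fix \<omega>
    show "((\<lambda>\<rho>. f (recon \<rho>)) \<circ> (\<lambda>\<omega>. restrict (\<lambda>r. coord r (noise \<omega>)) ?J)) \<omega> = f (noise \<omega>)"
      unfolding o_def by (rule past) (auto simp: past_sources_def recon_def)
  qed
  have eq2: "(\<lambda>\<rho>. \<rho> r $ k) \<circ> (\<lambda>\<omega>. restrict (\<lambda>r. coord r (noise \<omega>)) {r}) = (\<lambda>\<omega>. coord r (noise \<omega>) $ k)"
    by (auto simp: fun_eq_iff)
  have iv2: "indep_var borel (\<lambda>\<omega>. f (noise \<omega>)) borel (\<lambda>\<omega>. coord r (noise \<omega>) $ k)"
    using indep_var_compose[OF iv m1 m2] unfolding eq1 eq2 .
  have mr: "(\<lambda>q. coord r q $ k) \<in> borel_measurable noise_space" by (rule measurable_vec_index[OF coord_measurable k])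
  have i1: "integrable (prob_sp p) (\<lambda>\<omega>. f (noise \<omega>))" and i2: "integrable (prob_sp p) (\<lambda>\<omega>. coord r (noise \<omega>) $ k)"
    using f(2) int unfolding noise_law_def integrable_distr_eq[OF noise_measurable f(1)] integrable_distr_eq[OF noise_measurable mr] .
  have "(\<integral>q. f q * coord r q $ k \<partial>noise_law) = (\<integral>\<omega>. f (noise \<omega>) * coord r (noise \<omega>) $ k \<partial>prob_sp p)"
    unfolding noise_law_def by (rule integral_distr[OF noise_measurable]) (intro borel_measurable_times f(1) mr)
  also have "\<dots> = (\<integral>\<omega>. f (noise \<omega>) \<partial>prob_sp p) * (\<integral>\<omega>. coord r (noise \<omega>) $ k \<partial>prob_sp p)"
    by (rule indep_var_lebesgue_integral[OF iv2 i1 i2])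
  finally show ?thesis
    unfolding noise_law_def by (simp add: integral_distr[OF noise_measurable f(1)] integral_distr[OF noise_measurable mr])
qed

lemma coord_square_integrable: "k < source_dim r \<Longrightarrow> integrable noise_law (\<lambda>q. (coord r q $ k)\<^sup>2)"
proof -
  assume k: "k < source_dim r"
  have "(\<lambda>q. (coord r q $ k)\<^sup>2) \<in> borel_measurable noise_space"
    by (intro borel_measurable_power measurable_vec_index[OF coord_measurable k])
  moreover have "integrable (prob_sp p) (\<lambda>\<omega>. (coord r (noise \<omega>) $ k)\<^sup>2)"
    using moments k by (cases r) (auto simp: primitives_second_moments_def finite_second_moment_def noise_def)
  ultimately show ?thesis unfolding noise_law_def by (simp add: integrable_distr_eq[OF noise_measurable])
qed

lemma coord_integrable: "k < source_dim r \<Longrightarrow> integrable noise_law (\<lambda>q. coord r q $ k)"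
proof -
  assume k: "k < source_dim r"
  interpret prob_space noise_law by (rule prob_noise_law)
  have m: "(\<lambda>q. coord r q $ k) \<in> borel_measurable noise_law"
    using measurable_vec_index[OF coord_measurable k] by (simp add: sets_noise_law cong: measurable_cong_sets)
  show ?thesis by (rule square_integrable_imp_integrable[OF m coord_square_integrable[OF k]])
qed

text \<open>Identical distribution makes the means constant in time.\<close>

lemma coord_mean:
  "k < dimy g \<Longrightarrow> (\<integral>q. coord (Obs t) q $ k \<partial>noise_law) = mean_xi g p $ k"
  "k < dimX g \<Longrightarrow> (\<integral>q. coord (Dist t) q $ k \<partial>noise_law) = mean_W g p $ k"
proof -
  have vi: "(\<lambda>v. v $ k) \<in> borel_measurable (vec_borel n)" if "k < n" for n
    by (rule measurable_vec_index[where f = "\<lambda>v. v", OF _ that]) simp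
  have e: "(\<integral>q. coord r q $ k \<partial>noise_law) = (\<integral>v. v $ k \<partial>distr (prob_sp p) (vec_borel (source_dim r)) (\<lambda>\<omega>. coord r (noise \<omega>)))"
    if k: "k < source_dim r" for r
    unfolding noise_law_def
    by (simp add: integral_distr[OF noise_measurable measurable_vec_index[OF coord_measurable k]]
        integral_distr[OF coord_noise_measurable vi[OF k]])
  show "(\<integral>q. coord (Obs t) q $ k \<partial>noise_law) = mean_xi g p $ k" if k: "k < dimy g"
  proof -
    have o: "obs_xi p t \<in> prob_sp p \<rightarrow>\<^sub>M vec_borel (dimy g)" for t using prims by (simp add: primitive_data_def)
    have "distr (prob_sp p) (vec_borel (dimy g)) (obs_xi p t) = distr (prob_sp p) (vec_borel (dimy g)) (obs_xi p 0)"
      using ident by (simp add: primitives_identically_distributed_def)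
    then have "(\<integral>\<omega>. obs_xi p t \<omega> $ k \<partial>prob_sp p) = (\<integral>\<omega>. obs_xi p 0 \<omega> $ k \<partial>prob_sp p)"
      using integral_distr[OF o[of t] vi[OF k]] integral_distr[OF o[of 0] vi[OF k]] by simp
    then show ?thesis
      using e[of "Obs t"] k integral_distr[OF o[of t] vi[OF k]] by (simp add: mean_xi_def vec_mean_def noise_def)
  qed
  show "(\<integral>q. coord (Dist t) q $ k \<partial>noise_law) = mean_W g p $ k" if k: "k < dimX g"
  proof -
    have o: "dist_W g p t \<in> prob_sp p \<rightarrow>\<^sub>M vec_borel (dimX g)" for t using coord_noise_measurable[of "Dist t"] by (simp add: noise_def)
    have "distr (prob_sp p) (vec_borel (dimX g)) (dist_W g p t) = distr (prob_sp p) (vec_borel (dimX g)) (dist_W g p 0)"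
      using ident by (simp add: primitives_identically_distributed_def)
    then have "(\<integral>\<omega>. dist_W g p t \<omega> $ k \<partial>prob_sp p) = (\<integral>\<omega>. dist_W g p 0 \<omega> $ k \<partial>prob_sp p)"
      using integral_distr[OF o[of t] vi[OF k]] integral_distr[OF o[of 0] vi[OF k]] by simp
    then show ?thesis
      using e[of "Dist t"] k integral_distr[OF o[of t] vi[OF k]] by (simp add: mean_W_def vec_mean_def noise_def)
  qed
qed

section \<open>Forecasts of the environment variables\<close>

definition sigma_y :: "nat \<Rightarrow> 'v measure" where "sigma_y t = past_sigma g P ybar t"

lemma hist_space: "hist t \<in> space P \<rightarrow> space (seq_borel {..<t} (dimy g))"
  using measurable_space[OF hist_measurable] by auto

lemma sigma_y_eq: "sigma_y t = vimage_algebra (space P) (hist t) (seq_borel {..<t} (dimy g))"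
  by (simp add: sigma_y_def past_sigma_def hist_def[abs_def])

lemma sets_sigma_y: "sets (sigma_y t) = {hist t -` B \<inter> space P | B. B \<in> sets (seq_borel {..<t} (dimy g))}"
  unfolding sigma_y_eq by (rule sets_vimage_algebra2[OF hist_space])

lemma subalgebra_sigma_y: "subalgebra P (sigma_y t)"
  unfolding subalgebra_def using hist_measurable
  by (auto simp: sets_sigma_y) (simp_all add: sigma_y_eq measurable_sets)

lemma hist_sigma_y_measurable: "hist t \<in> sigma_y t \<rightarrow>\<^sub>M seq_borel {..<t} (dimy g)"
  unfolding sigma_y_eq by (rule measurable_vimage_algebra1[OF hist_space])

lemma sigma_y_mono: "A \<in> sets (sigma_y t) \<Longrightarrow> A \<in> sets (sigma_y (t + n))"
proof -
  assume "A \<in> sets (sigma_y t)"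
  then obtain B where B: "B \<in> sets (seq_borel {..<t} (dimy g))" "A = hist t -` B \<inter> space P" by (auto simp: sets_sigma_y)
  have m: "(\<lambda>z. \<lambda>k\<in>{..<t}. z k) \<in> seq_borel {..<t + n} (dimy g) \<rightarrow>\<^sub>M seq_borel {..<t} (dimy g)"
    by (intro measurable_seq_restrict measurable_seq_component) auto
  have "(\<lambda>k\<in>{..<t}. hist (t + n) \<omega> k) = hist t \<omega>" for \<omega>
    unfolding hist_def by (intro restrict_ext) auto
  then have h: "hist t = (\<lambda>\<omega>. (\<lambda>z. \<lambda>k\<in>{..<t}. z k) (hist (t + n) \<omega>))" by auto
  have "hist t \<in> sigma_y (t + n) \<rightarrow>\<^sub>M seq_borel {..<t} (dimy g)"
    by (subst h) (rule measurable_compose[OF hist_sigma_y_measurable m])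
  from measurable_sets[OF this B(1)] show ?thesis by (simp add: B(2) sigma_y_eq)
qed

lemma cond_exp_space: "finite_measure_subalgebra P (sigma_y t)"
  using prob_P subalgebra_sigma_y by (simp add: finite_measure_subalgebra_def finite_measure_subalgebra_axioms_def prob_space_def)

definition integrable_vec :: "nat \<Rightarrow> ('v \<Rightarrow> real vec) \<Rightarrow> bool" where
  "integrable_vec n X \<longleftrightarrow> X \<in> P \<rightarrow>\<^sub>M vec_borel n \<and> (\<forall>k<n. integrable P (\<lambda>\<omega>. X \<omega> $ k))"

text \<open>The mean on an event. Conditional means are treated through these integrals over the events of
  the past, for which linear recursions can be carried out without exceptional sets.\<close>

definition event_mean :: "'v set \<Rightarrow> nat \<Rightarrow> ('v \<Rightarrow> real vec) \<Rightarrow> real vec" where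
  "event_mean A n X = vec n (\<lambda>k. \<integral>\<omega>. indicator A \<omega> * X \<omega> $ k \<partial>P)"

lemma event_mean_dim [simp]: "dim_vec (event_mean A n X) = n"
  by (simp add: event_mean_def)

lemma integrable_vec_add: "integrable_vec n X \<Longrightarrow> integrable_vec n Y \<Longrightarrow> integrable_vec n (\<lambda>\<omega>. X \<omega> + Y \<omega>)"
  unfolding integrable_vec_def
proof (intro conjI allI impI)
  assume XY: "X \<in> P \<rightarrow>\<^sub>M vec_borel n \<and> (\<forall>k<n. integrable P (\<lambda>\<omega>. X \<omega> $ k))" "Y \<in> P \<rightarrow>\<^sub>M vec_borel n \<and> (\<forall>k<n. integrable P (\<lambda>\<omega>. Y \<omega> $ k))"
  show "(\<lambda>\<omega>. X \<omega> + Y \<omega>) \<in> P \<rightarrow>\<^sub>M vec_borel n" using XY by (intro measurable_vec_add) auto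
  fix k assume k: "k < n"
  have "integrable P (\<lambda>\<omega>. X \<omega> $ k + Y \<omega> $ k)" using XY k by simp
  then show "integrable P (\<lambda>\<omega>. (X \<omega> + Y \<omega>) $ k)"
    by (rule Bochner_Integration.integrable_cong[THEN iffD1, rotated 2]) (use XY k in \<open>auto dest: measurable_vec_dim\<close>)
qed

lemma integrable_vec_mult: "integrable_vec nc X \<Longrightarrow> Z \<in> carrier_mat nr nc \<Longrightarrow> integrable_vec nr (\<lambda>\<omega>. Z *\<^sub>v X \<omega>)"
  unfolding integrable_vec_def
proof (intro conjI allI impI)
  assume X: "X \<in> P \<rightarrow>\<^sub>M vec_borel nc \<and> (\<forall>k<nc. integrable P (\<lambda>\<omega>. X \<omega> $ k))" and Z: "Z \<in> carrier_mat nr nc"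
  show "(\<lambda>\<omega>. Z *\<^sub>v X \<omega>) \<in> P \<rightarrow>\<^sub>M vec_borel nr" using X Z by (intro measurable_mult_mat_vec) auto
  fix k assume k: "k < nr"
  have "integrable P (\<lambda>\<omega>. \<Sum>l<nc. Z $$ (k, l) * X \<omega> $ l)" using X by auto
  then show "integrable P (\<lambda>\<omega>. (Z *\<^sub>v X \<omega>) $ k)"
    by (rule Bochner_Integration.integrable_cong[THEN iffD1, rotated 2])
      (use X Z k in \<open>auto dest: measurable_vec_dim simp: scalar_prod_def atLeast0LessThan\<close>)
qed

lemma integrable_vec_const: "dim_vec v = n \<Longrightarrow> integrable_vec n (\<lambda>_. v)"
proof -
  assume v: "dim_vec v = n"
  interpret prob_space P by (rule prob_P)
  show ?thesis unfolding integrable_vec_def by (simp add: measurable_vec_const[OF v])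
qed

lemma integrable_vec_cong_AE:
  assumes "integrable_vec n X" "Y \<in> P \<rightarrow>\<^sub>M vec_borel n" "AE \<omega> in P. X \<omega> = Y \<omega>"
  shows "integrable_vec n Y"
  unfolding integrable_vec_def
proof (intro conjI allI impI)
  fix k assume k: "k < n"
  have "AE \<omega> in P. X \<omega> $ k = Y \<omega> $ k" using assms(3) by eventually_elim simp
  moreover have "(\<lambda>\<omega>. X \<omega> $ k) \<in> borel_measurable P" "(\<lambda>\<omega>. Y \<omega> $ k) \<in> borel_measurable P"
    using assms k by (auto simp: integrable_vec_def intro: measurable_vec_index)
  ultimately show "integrable P (\<lambda>\<omega>. Y \<omega> $ k)"
    using assms(1) k integrable_cong_AE[of "\<lambda>\<omega>. X \<omega> $ k" P "\<lambda>\<omega>. Y \<omega> $ k"] by (auto simp: integrable_vec_def)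
qed (use assms in simp)

lemma indicator_integrable: "A \<in> sets P \<Longrightarrow> integrable P f \<Longrightarrow> integrable P (\<lambda>\<omega>. indicator A \<omega> * f \<omega> :: real)"
  using integrable_mult_indicator[of A P f] by simp

lemma event_mean_add:
  assumes A: "A \<in> sets P" and X: "integrable_vec n X" and Y: "integrable_vec n Y"
  shows "event_mean A n (\<lambda>\<omega>. X \<omega> + Y \<omega>) = event_mean A n X + event_mean A n Y"
proof (rule eq_vecI)
  fix k assume "k < dim_vec (event_mean A n X + event_mean A n Y)"
  then have k: "k < n" by simp
  have "(\<integral>\<omega>. indicator A \<omega> * (X \<omega> + Y \<omega>) $ k \<partial>P) = (\<integral>\<omega>. indicator A \<omega> * X \<omega> $ k + indicator A \<omega> * Y \<omega> $ k \<partial>P)"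
    by (rule Bochner_Integration.integral_cong) (use X Y k in \<open>auto simp: integrable_vec_def distrib_left dest: measurable_vec_dim\<close>)
  also have "\<dots> = (\<integral>\<omega>. indicator A \<omega> * X \<omega> $ k \<partial>P) + (\<integral>\<omega>. indicator A \<omega> * Y \<omega> $ k \<partial>P)"
    using X Y k by (intro Bochner_Integration.integral_add indicator_integrable[OF A]) (auto simp: integrable_vec_def)
  finally show "event_mean A n (\<lambda>\<omega>. X \<omega> + Y \<omega>) $ k = (event_mean A n X + event_mean A n Y) $ k" using k by (simp add: event_mean_def)
qed simp

lemma event_mean_mult:
  assumes A: "A \<in> sets P" and X: "integrable_vec nc X" and Z: "Z \<in> carrier_mat nr nc"
  shows "event_mean A nr (\<lambda>\<omega>. Z *\<^sub>v X \<omega>) = Z *\<^sub>v event_mean A nc X"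
proof (rule eq_vecI)
  fix k assume "k < dim_vec (Z *\<^sub>v event_mean A nc X)"
  then have k: "k < nr" using Z by simp
  have "(\<integral>\<omega>. indicator A \<omega> * (Z *\<^sub>v X \<omega>) $ k \<partial>P) = (\<integral>\<omega>. (\<Sum>l<nc. Z $$ (k, l) * (indicator A \<omega> * X \<omega> $ l)) \<partial>P)"
    by (rule Bochner_Integration.integral_cong)
      (use X Z k in \<open>auto simp: integrable_vec_def scalar_prod_def atLeast0LessThan sum_distrib_left mult_ac dest: measurable_vec_dim\<close>)
  also have "\<dots> = (\<Sum>l<nc. Z $$ (k, l) * (\<integral>\<omega>. indicator A \<omega> * X \<omega> $ l \<partial>P))"
    using X by (subst Bochner_Integration.integral_sum) (auto simp: integrable_vec_def intro!: integrable_mult_right indicator_integrable[OF A])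
  finally show "event_mean A nr (\<lambda>\<omega>. Z *\<^sub>v X \<omega>) $ k = (Z *\<^sub>v event_mean A nc X) $ k"
    using k Z by (simp add: event_mean_def scalar_prod_def atLeast0LessThan)
qed (use Z in simp)

lemma event_mean_const:
  assumes A: "A \<in> sets P" and v: "dim_vec v = n"
  shows "event_mean A n (\<lambda>_. v) = measure P A \<cdot>\<^sub>v v"
proof -
  interpret prob_space P by (rule prob_P)
  show ?thesis using A v by (intro eq_vecI) (auto simp: event_mean_def)
qed

lemma event_mean_cong_AE:
  assumes "integrable_vec n X" "integrable_vec n Y" "AE \<omega> in P. X \<omega> = Y \<omega>" "A \<in> sets P"
  shows "event_mean A n X = event_mean A n Y"
proof (rule eq_vecI)
  fix k assume "k < dim_vec (event_mean A n Y)"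
  then have k: "k < n" by simp
  have "(\<integral>\<omega>. indicator A \<omega> * X \<omega> $ k \<partial>P) = (\<integral>\<omega>. indicator A \<omega> * Y \<omega> $ k \<partial>P)"
  proof (rule integral_cong_AE)
    show "AE \<omega> in P. indicator A \<omega> * X \<omega> $ k = indicator A \<omega> * Y \<omega> $ k" using assms(3) by eventually_elim simp
  qed (use assms k in \<open>auto simp: integrable_vec_def intro!: borel_measurable_times measurable_vec_index borel_measurable_indicator\<close>)
  then show "event_mean A n X $ k = event_mean A n Y $ k" using k by (simp add: event_mean_def)
qed simp

lemma coord_aux_noise_integrable_vec: "integrable_vec (source_dim r) (\<lambda>\<omega>. coord r (aux_noise \<omega>))"
  unfolding integrable_vec_def
proof (intro conjI allI impI)
  show "(\<lambda>\<omega>. coord r (aux_noise \<omega>)) \<in> P \<rightarrow>\<^sub>M vec_borel (source_dim r)" by (rule measurable_compose[OF aux_noise_measurable coord_measurable])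
  fix k assume k: "k < source_dim r"
  show "integrable P (\<lambda>\<omega>. coord r (aux_noise \<omega>) $ k)"
    using coord_integrable[OF k] integrable_distr_eq[OF aux_noise_measurable measurable_vec_index[OF coord_measurable k]] by (simp add: distr_aux_noise)
qed

lemma noise_integrable_vec: "integrable_vec (dimX g) (Xbar 0)" "integrable_vec (dimy g) (xibar t)" "integrable_vec (dimX g) (Wbar t)"
  using coord_aux_noise_integrable_vec[of Init] coord_aux_noise_integrable_vec[of "Obs t"] coord_aux_noise_integrable_vec[of "Dist t"] by (simp_all add: aux_noise_def)

text \<open>The noise from time \<open>t\<close> on is independent of the observations before \<open>t\<close>, which are
  functions of the earlier noise.\<close>

lemma event_mean_noise:
  assumes A: "A \<in> sets (sigma_y t)" and r: "r \<notin> past_sources t"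
  shows "k < source_dim r \<Longrightarrow> (\<integral>\<omega>. indicator A \<omega> * coord r (aux_noise \<omega>) $ k \<partial>P) = measure P A * (\<integral>q. coord r q $ k \<partial>noise_law)"
proof -
  assume k: "k < source_dim r"
  obtain B where B: "B \<in> sets (seq_borel {..<t} (dimy g))" "A = hist t -` B \<inter> space P" using A by (auto simp: sets_sigma_y)
  define f :: "noise_path \<Rightarrow> real" where "f q = indicator B (\<lambda>k\<in>{..<t}. play_of q k)" for q
  have mP: "(\<lambda>q. \<lambda>k\<in>{..<t}. play_of q k) \<in> noise_space \<rightarrow>\<^sub>M seq_borel {..<t} (dimy g)"
    by (intro measurable_seq_restrict play_of_measurable)
  have fm: "f \<in> borel_measurable noise_space"
    unfolding f_def[abs_def] by (rule measurable_compose[OF mP borel_measurable_indicator[OF B(1)]])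
  interpret M: prob_space noise_law by (rule prob_noise_law)
  have fi: "integrable noise_law f"
    using fm by (intro M.integrable_const_bound[where B = 1]) (auto simp: f_def sets_noise_law cong: measurable_cong_sets)
  have past: "f q = f q'" if "\<And>r. r \<in> past_sources t \<Longrightarrow> coord r q = coord r q'" for q q'
  proof -
    have "(\<lambda>k\<in>{..<t}. play_of q k) = (\<lambda>k\<in>{..<t}. play_of q' k)"
      using play_of_past[OF that] by (intro restrict_ext) auto
    then show ?thesis by (simp only: f_def)
  qed
  have ind: "AE \<omega> in P. indicator A \<omega> = f (aux_noise \<omega>)"
    using AE_space ybar_eq_play_of
  proof eventually_elim
    case (elim \<omega>)
    then have "hist t \<omega> = (\<lambda>k\<in>{..<t}. play_of (aux_noise \<omega>) k)" by (simp add: hist_def)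
    then show ?case using elim by (simp add: f_def B(2) indicator_def)
  qed
  have AP: "A \<in> sets P" using A subalgebra_sigma_y[of t] by (auto simp: subalgebra_def)
  have mr: "(\<lambda>q. coord r q $ k) \<in> borel_measurable noise_space" by (rule measurable_vec_index[OF coord_measurable k])
  have fprb: "(\<lambda>\<omega>. f (aux_noise \<omega>)) \<in> borel_measurable P" by (rule measurable_compose[OF aux_noise_measurable fm])
  have "(\<integral>\<omega>. indicator A \<omega> * coord r (aux_noise \<omega>) $ k \<partial>P) = (\<integral>\<omega>. f (aux_noise \<omega>) * coord r (aux_noise \<omega>) $ k \<partial>P)"
  proof (rule integral_cong_AE)
    show "AE \<omega> in P. indicator A \<omega> * coord r (aux_noise \<omega>) $ k = f (aux_noise \<omega>) * coord r (aux_noise \<omega>) $ k" using ind by eventually_elim simp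
    show "(\<lambda>\<omega>. indicator A \<omega> * coord r (aux_noise \<omega>) $ k) \<in> borel_measurable P"
      using AP by (intro borel_measurable_times borel_measurable_indicator measurable_compose[OF aux_noise_measurable mr])
    show "(\<lambda>\<omega>. f (aux_noise \<omega>) * coord r (aux_noise \<omega>) $ k) \<in> borel_measurable P"
      by (intro borel_measurable_times fprb measurable_compose[OF aux_noise_measurable mr])
  qed
  also have "\<dots> = (\<integral>q. f q * coord r q $ k \<partial>noise_law)"
    unfolding distr_aux_noise[symmetric] by (rule integral_distr[OF aux_noise_measurable, symmetric]) (intro borel_measurable_times fm mr)
  also have "\<dots> = (\<integral>q. f q \<partial>noise_law) * (\<integral>q. coord r q $ k \<partial>noise_law)"
    by (rule past_independent[OF fm fi past r k coord_integrable[OF k]])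
  also have "(\<integral>q. f q \<partial>noise_law) = (\<integral>\<omega>. f (aux_noise \<omega>) \<partial>P)"
    unfolding distr_aux_noise[symmetric] by (rule integral_distr[OF aux_noise_measurable fm])
  also have "\<dots> = (\<integral>\<omega>. indicator A \<omega> \<partial>P)"
    by (rule integral_cong_AE) (use ind fprb AP in \<open>auto elim: AE_mp\<close>)
  also have "\<dots> = measure P A" using AP by (simp add: sets.Int_space_eq2)
  finally show ?thesis .
qed

lemma event_mean_xibar: "A \<in> sets (sigma_y t) \<Longrightarrow> event_mean A (dimy g) (xibar (t + n)) = measure P A \<cdot>\<^sub>v mean_xi g p"
  by (rule eq_vecI)
    (use event_mean_noise[of A t "Obs (t + n)"] coord_mean(1) in \<open>auto simp: event_mean_def aux_noise_def past_sources_def mean_xi_def vec_mean_def\<close>)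

lemma event_mean_Wbar: "A \<in> sets (sigma_y t) \<Longrightarrow> event_mean A (dimX g) (Wbar (t + n)) = measure P A \<cdot>\<^sub>v mean_W g p"
  by (rule eq_vecI)
    (use event_mean_noise[of A t "Dist (t + n)"] coord_mean(2) in \<open>auto simp: event_mean_def aux_noise_def past_sources_def mean_W_def vec_mean_def\<close>)

end

context sebeu_setting
begin

text \<open>One step of the auxiliary recursion in mean, on an event of probability \<open>\<pi>\<close>.\<close>

definition mean_step_y :: "real \<Rightarrow> real vec \<Rightarrow> real vec" where
  "mean_step_y \<pi> v = agg_D g *\<^sub>v v + lim_Gp g a *\<^sub>v v + \<pi> \<cdot>\<^sub>v lim_Hp g p b + \<pi> \<cdot>\<^sub>v mean_xi g p"

definition mean_step_x :: "real \<Rightarrow> real vec \<Rightarrow> real vec" where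
  "mean_step_x \<pi> v = agg_A g *\<^sub>v v + lim_GX g a *\<^sub>v v + \<pi> \<cdot>\<^sub>v lim_HX g p b + agg_C g *\<^sub>v mean_step_y \<pi> v + \<pi> \<cdot>\<^sub>v mean_W g p"

lemma lim_carrier: "lim_Gp g a \<in> carrier_mat (dimy g) (dimX g)" "lim_GX g a \<in> carrier_mat (dimX g) (dimX g)"
  by (auto intro!: carrier_matI)

lemma integrable_vec_combination:
  assumes "integrable_vec (dimX g) X" "integrable_vec (dimX g) E" "integrable_vec (dimy g) \<Xi>"
  shows "integrable_vec (dimy g) (\<lambda>\<omega>. agg_D g *\<^sub>v X \<omega> + lim_Gp g a *\<^sub>v E \<omega> + lim_Hp g p b + \<Xi> \<omega>)"
  by (intro integrable_vec_add integrable_vec_mult[OF _ agg_carrier(1)] integrable_vec_mult[OF _ lim_carrier(1)] integrable_vec_const assms) auto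

lemma integrable_vec_combination_x:
  assumes "integrable_vec (dimX g) X" "integrable_vec (dimX g) E" "integrable_vec (dimy g) Y" "integrable_vec (dimX g) W"
  shows "integrable_vec (dimX g) (\<lambda>\<omega>. agg_A g *\<^sub>v X \<omega> + lim_GX g a *\<^sub>v E \<omega> + lim_HX g p b + agg_C g *\<^sub>v Y \<omega> + W \<omega>)"
  by (intro integrable_vec_add integrable_vec_mult[OF _ agg_carrier(2)] integrable_vec_mult[OF _ lim_carrier(2)] integrable_vec_mult[OF _ agg_carrier(3)]
      integrable_vec_const assms) auto

lemma event_mean_combination:
  assumes A: "A \<in> sets P" and X: "integrable_vec (dimX g) X" and E: "integrable_vec (dimX g) E" and \<Xi>: "integrable_vec (dimy g) \<Xi>"
    and XE: "event_mean A (dimX g) E = event_mean A (dimX g) X" and xi: "event_mean A (dimy g) \<Xi> = measure P A \<cdot>\<^sub>v mean_xi g p"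
  shows "event_mean A (dimy g) (\<lambda>\<omega>. agg_D g *\<^sub>v X \<omega> + lim_Gp g a *\<^sub>v E \<omega> + lim_Hp g p b + \<Xi> \<omega>)
    = mean_step_y (measure P A) (event_mean A (dimX g) X)"
proof -
  note D = integrable_vec_mult[OF X agg_carrier(1)] and G = integrable_vec_mult[OF E lim_carrier(1)]
    and H = integrable_vec_const[OF lim_dims(3)]
  show ?thesis
    by (simp only: event_mean_add[OF A integrable_vec_add[OF integrable_vec_add[OF D G] H] \<Xi>] event_mean_add[OF A integrable_vec_add[OF D G] H] event_mean_add[OF A D G]
        event_mean_mult[OF A X agg_carrier(1)] event_mean_mult[OF A E lim_carrier(1)] event_mean_const[OF A lim_dims(3)] XE xi mean_step_y_def)
qed

lemma event_mean_combination_x: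
  assumes A: "A \<in> sets P" and X: "integrable_vec (dimX g) X" and E: "integrable_vec (dimX g) E" and Y: "integrable_vec (dimy g) Y" and W: "integrable_vec (dimX g) W"
    and XE: "event_mean A (dimX g) E = event_mean A (dimX g) X" and w: "event_mean A (dimX g) W = measure P A \<cdot>\<^sub>v mean_W g p"
    and y: "event_mean A (dimy g) Y = mean_step_y (measure P A) (event_mean A (dimX g) X)"
  shows "event_mean A (dimX g) (\<lambda>\<omega>. agg_A g *\<^sub>v X \<omega> + lim_GX g a *\<^sub>v E \<omega> + lim_HX g p b + agg_C g *\<^sub>v Y \<omega> + W \<omega>)
    = mean_step_x (measure P A) (event_mean A (dimX g) X)"
proof -
  note D = integrable_vec_mult[OF X agg_carrier(2)] and G = integrable_vec_mult[OF E lim_carrier(2)]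
    and H = integrable_vec_const[OF lim_HX_dim] and C = integrable_vec_mult[OF Y agg_carrier(3)]
  show ?thesis
    by (simp only: event_mean_add[OF A integrable_vec_add[OF integrable_vec_add[OF integrable_vec_add[OF D G] H] C] W] event_mean_add[OF A integrable_vec_add[OF integrable_vec_add[OF D G] H] C]
        event_mean_add[OF A integrable_vec_add[OF D G] H] event_mean_add[OF A D G]
        event_mean_mult[OF A X agg_carrier(2)] event_mean_mult[OF A E lim_carrier(2)] event_mean_mult[OF A Y agg_carrier(3)]
        event_mean_const[OF A lim_HX_dim] XE w y mean_step_x_def)
qed

lemma cond_state_integrable_vec:
  assumes X: "integrable_vec (dimX g) (Xbar t)"
  shows "integrable_vec (dimX g) (cond_state g P Xbar ybar t)"
  unfolding integrable_vec_def
proof (intro conjI allI impI)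
  interpret finite_measure_subalgebra P "sigma_y t" by (rule cond_exp_space)
  show "cond_state g P Xbar ybar t \<in> P \<rightarrow>\<^sub>M vec_borel (dimX g)"
    by (rule measurable_vecI) (simp_all add: cond_state_def vec_cond_exp_def)
  fix k assume "k < dimX g"
  then show "integrable P (\<lambda>\<omega>. cond_state g P Xbar ybar t \<omega> $ k)"
    using X real_cond_exp_int(1) by (simp add: cond_state_def vec_cond_exp_def integrable_vec_def sigma_y_def[symmetric])
qed

lemma est_integrable_vec: "integrable_vec (dimX g) (Xbar t) \<Longrightarrow> integrable_vec (dimX g) (\<lambda>\<omega>. est t (hist t \<omega>))"
  by (rule integrable_vec_cong_AE[OF cond_state_integrable_vec est_hist_measurable est_hist_AE])

lemma process_integrable_vec: "integrable_vec (dimX g) (Xbar t) \<and> integrable_vec (dimy g) (ybar t)"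
proof -
  have y: "integrable_vec (dimy g) (ybar t)" if "integrable_vec (dimX g) (Xbar t)" for t
  proof (rule integrable_vec_cong_AE[OF integrable_vec_combination[OF that est_integrable_vec[OF that] noise_integrable_vec(2)[of t]] ybar_measurable])
    show "AE \<omega> in P. agg_D g *\<^sub>v Xbar t \<omega> + lim_Gp g a *\<^sub>v est t (hist t \<omega>) + lim_Hp g p b + xibar t \<omega> = ybar t \<omega>"
      using ybar_AE[of t] by eventually_elim simp
  qed
  have "integrable_vec (dimX g) (Xbar t)"
  proof (induction t)
    case 0
    show ?case by (rule noise_integrable_vec)
  next
    case (Suc t)
    show ?case
    proof (rule integrable_vec_cong_AE[OF integrable_vec_combination_x[OF Suc est_integrable_vec[OF Suc] y[OF Suc] noise_integrable_vec(3)[of t]] Xbar_measurable])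
      show "AE \<omega> in P. agg_A g *\<^sub>v Xbar t \<omega> + lim_GX g a *\<^sub>v est t (hist t \<omega>) + lim_HX g p b + agg_C g *\<^sub>v ybar t \<omega> + Wbar t \<omega> = Xbar (Suc t) \<omega>"
        using Xbar_AE[of t] by eventually_elim simp
    qed
  qed
  then show ?thesis using y by blast
qed

lemmas Xbar_integrable_vec = process_integrable_vec[THEN conjunct1] and ybar_integrable_vec = process_integrable_vec[THEN conjunct2]

lemma sigma_y_sets: "A \<in> sets (sigma_y t) \<Longrightarrow> A \<in> sets P"
  using subalgebra_sigma_y[of t] by (auto simp: subalgebra_def)

lemma event_mean_est:
  assumes A: "A \<in> sets (sigma_y t)"
  shows "event_mean A (dimX g) (\<lambda>\<omega>. est t (hist t \<omega>)) = event_mean A (dimX g) (Xbar t)"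
proof -
  interpret finite_measure_subalgebra P "sigma_y t" by (rule cond_exp_space)
  have "event_mean A (dimX g) (\<lambda>\<omega>. est t (hist t \<omega>)) = event_mean A (dimX g) (cond_state g P Xbar ybar t)"
    by (rule event_mean_cong_AE[OF cond_state_integrable_vec est_integrable_vec est_hist_AE sigma_y_sets[OF A], symmetric]) (rule Xbar_integrable_vec)+
  also have "\<dots> = event_mean A (dimX g) (Xbar t)"
  proof (rule eq_vecI)
    fix k assume "k < dim_vec (event_mean A (dimX g) (Xbar t))"
    then have k: "k < dimX g" by simp
    have "integrable P (\<lambda>\<omega>. Xbar t \<omega> $ k)" using Xbar_integrable_vec[of t] k by (simp add: integrable_vec_def)
    from real_cond_exp_intA[OF this A] show "event_mean A (dimX g) (cond_state g P Xbar ybar t) $ k = event_mean A (dimX g) (Xbar t) $ k"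
      using k by (simp add: event_mean_def cond_state_def vec_cond_exp_def set_lebesgue_integral_def sigma_y_def[symmetric])
  qed simp
  finally show ?thesis .
qed

lemma event_mean_ybar:
  assumes A: "A \<in> sets (sigma_y t)"
  shows "event_mean A (dimy g) (ybar (t + n)) = mean_step_y (measure P A) (event_mean A (dimX g) (Xbar (t + n)))"
proof -
  note AP = sigma_y_sets[OF A] and X = Xbar_integrable_vec[of "t + n"]
  have "event_mean A (dimy g) (ybar (t + n)) = event_mean A (dimy g) (\<lambda>\<omega>. agg_D g *\<^sub>v Xbar (t + n) \<omega> + lim_Gp g a *\<^sub>v est (t + n) (hist (t + n) \<omega>) + lim_Hp g p b + xibar (t + n) \<omega>)"
    by (rule event_mean_cong_AE[OF ybar_integrable_vec integrable_vec_combination[OF X est_integrable_vec[OF X] noise_integrable_vec(2)] ybar_AE AP])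
  also have "\<dots> = mean_step_y (measure P A) (event_mean A (dimX g) (Xbar (t + n)))"
    by (rule event_mean_combination[OF AP X est_integrable_vec[OF X] noise_integrable_vec(2) event_mean_est[OF sigma_y_mono[OF A]] event_mean_xibar[OF A]])
  finally show ?thesis .
qed

lemma event_mean_Xbar_Suc:
  assumes A: "A \<in> sets (sigma_y t)"
  shows "event_mean A (dimX g) (Xbar (t + Suc n)) = mean_step_x (measure P A) (event_mean A (dimX g) (Xbar (t + n)))"
proof -
  note AP = sigma_y_sets[OF A] and X = Xbar_integrable_vec[of "t + n"]
  have "event_mean A (dimX g) (Xbar (Suc (t + n))) = event_mean A (dimX g) (\<lambda>\<omega>. agg_A g *\<^sub>v Xbar (t + n) \<omega> + lim_GX g a *\<^sub>v est (t + n) (hist (t + n) \<omega>) + lim_HX g p b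
      + agg_C g *\<^sub>v ybar (t + n) \<omega> + Wbar (t + n) \<omega>)"
    by (rule event_mean_cong_AE[OF Xbar_integrable_vec integrable_vec_combination_x[OF X est_integrable_vec[OF X] ybar_integrable_vec noise_integrable_vec(3)] Xbar_AE AP])
  also have "\<dots> = mean_step_x (measure P A) (event_mean A (dimX g) (Xbar (t + n)))"
    by (rule event_mean_combination_x[OF AP X est_integrable_vec[OF X] ybar_integrable_vec noise_integrable_vec(3) event_mean_est[OF sigma_y_mono[OF A]] event_mean_Wbar[OF A] event_mean_ybar[OF A]])
  finally show ?thesis by simp
qed

abbreviation est_path :: "nat \<Rightarrow> nat \<Rightarrow> 'v \<Rightarrow> real vec" where
  "est_path t n \<omega> \<equiv> (step_x ^^ n) (est t (hist t \<omega>))"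

lemma mean_dims [simp]: "dim_vec (mean_xi g p) = dimy g" "dim_vec (mean_W g p) = dimX g"
  by (simp_all add: mean_xi_def mean_W_def vec_mean_def)

lemma step_y_integrable_vec: "integrable_vec (dimX g) X \<Longrightarrow> integrable_vec (dimy g) (\<lambda>\<omega>. step_y (X \<omega>))"
  unfolding step_y_def by (intro integrable_vec_combination integrable_vec_const mean_dims)

lemma step_x_integrable_vec: "integrable_vec (dimX g) X \<Longrightarrow> integrable_vec (dimX g) (\<lambda>\<omega>. step_x (X \<omega>))"
  unfolding step_x_def by (intro integrable_vec_combination_x step_y_integrable_vec integrable_vec_const mean_dims)

lemma event_mean_step_y:
  assumes A: "A \<in> sets P" and X: "integrable_vec (dimX g) X"
  shows "event_mean A (dimy g) (\<lambda>\<omega>. step_y (X \<omega>)) = mean_step_y (measure P A) (event_mean A (dimX g) X)"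
  unfolding step_y_def by (rule event_mean_combination[OF A X X integrable_vec_const[OF mean_dims(1)] refl event_mean_const[OF A mean_dims(1)]])

lemma event_mean_step_x:
  assumes A: "A \<in> sets P" and X: "integrable_vec (dimX g) X"
  shows "event_mean A (dimX g) (\<lambda>\<omega>. step_x (X \<omega>)) = mean_step_x (measure P A) (event_mean A (dimX g) X)"
  unfolding step_x_def
  by (rule event_mean_combination_x[OF A X X step_y_integrable_vec[OF X] integrable_vec_const[OF mean_dims(2)] refl event_mean_const[OF A mean_dims(2)] event_mean_step_y[OF A X]])

lemma est_path_integrable_vec: "integrable_vec (dimX g) (est_path t n)"
proof (induction n)
  case 0
  show ?case using est_integrable_vec[OF Xbar_integrable_vec] by simp
next
  case (Suc n)
  from step_x_integrable_vec[OF this] show ?case by simp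
qed

text \<open>The means of the process and of its forward recursion from the estimate agree on every
  event of the past: the estimate may replace the state inside the recursion because later
  estimates have the same mean as the states they estimate.\<close>

lemma event_mean_est_path:
  assumes A: "A \<in> sets (sigma_y t)"
  shows "event_mean A (dimX g) (est_path t n) = event_mean A (dimX g) (Xbar (t + n))"
proof (induction n)
  case 0
  show ?case using event_mean_est[OF A] by simp
next
  case (Suc n)
  have "event_mean A (dimX g) (\<lambda>\<omega>. step_x (est_path t n \<omega>)) = mean_step_x (measure P A) (event_mean A (dimX g) (est_path t n))"
    by (rule event_mean_step_x[OF sigma_y_sets[OF A] est_path_integrable_vec])
  then show ?case using event_mean_Xbar_Suc[OF A, of n] Suc by simp
qed

definition forecast :: "nat \<Rightarrow> nat \<Rightarrow> (nat \<Rightarrow> real vec) \<Rightarrow> real vec" where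
  "forecast t n z = yhat (est t (\<lambda>k\<in>{..<t}. z k)) n"

lemma forecast_dim [simp]: "dim_vec (forecast t n z) = dimy g"
  by (simp add: forecast_def)

lemma forecast_ybar: "forecast t n (\<lambda>k. ybar k \<omega>) = yhat (est t (hist t \<omega>)) n"
  by (simp add: forecast_def hist_def)

lemma yhat_measurable:
  assumes "X \<in> N \<rightarrow>\<^sub>M vec_borel (dimX g)"
  shows "(\<lambda>x. yhat (X x) n) \<in> N \<rightarrow>\<^sub>M vec_borel (dimy g)"
  unfolding yhat_def using a_dim b_dim
  by (intro measurable_vec_add measurable_mult_mat_vec[OF _ assms] measurable_vec_const) auto

text \<open>Both sides have the same mean on every event of the past: the process by
  \<open>event_mean_est_path\<close>, and the right-hand side because the solution of the linear system is the forward
  recursion started at the estimate.\<close>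

lemma forecast_AE:
  assumes k: "k < dimy g"
  shows "AE \<omega> in P. real_cond_exp P (sigma_y t) (\<lambda>\<omega>. ybar (t + n) \<omega> $ k) \<omega> = yhat (est t (hist t \<omega>)) n $ k"
proof -
  interpret finite_measure_subalgebra P "sigma_y t" by (rule cond_exp_space)
  have eqy: "step_y (est_path t n \<omega>) = yhat (est t (hist t \<omega>)) n" if "\<omega> \<in> space P" for \<omega>
    by (rule forward_recursion(2)) (use measurable_space[OF est_hist_measurable that] in simp)
  have vy: "integrable_vec (dimy g) (\<lambda>\<omega>. yhat (est t (hist t \<omega>)) n)"
    by (rule integrable_vec_cong_AE[OF step_y_integrable_vec[OF est_path_integrable_vec[where t = t and n = n]] yhat_measurable[OF est_hist_measurable]]) (use eqy in auto)
  show ?thesis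
  proof (rule real_cond_exp_charact)
    show "integrable P (\<lambda>\<omega>. ybar (t + n) \<omega> $ k)" "integrable P (\<lambda>\<omega>. yhat (est t (hist t \<omega>)) n $ k)"
      using ybar_integrable_vec vy k by (auto simp: integrable_vec_def)
    have "(\<lambda>\<omega>. est t (hist t \<omega>)) \<in> sigma_y t \<rightarrow>\<^sub>M vec_borel (dimX g)"
      by (rule measurable_compose[OF hist_sigma_y_measurable est_measurable])
    then show "(\<lambda>\<omega>. yhat (est t (hist t \<omega>)) n $ k) \<in> borel_measurable (sigma_y t)"
      by (intro measurable_vec_index[OF yhat_measurable k])
    fix A assume A: "A \<in> sets (sigma_y t)"
    note AP = sigma_y_sets[OF A] and E = est_path_integrable_vec[where t = t and n = n]
    have "event_mean A (dimy g) (\<lambda>\<omega>. yhat (est t (hist t \<omega>)) n) = event_mean A (dimy g) (\<lambda>\<omega>. step_y (est_path t n \<omega>))"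
      by (rule event_mean_cong_AE[OF vy step_y_integrable_vec[OF E] _ AP]) (use eqy in auto)
    also have "\<dots> = mean_step_y (measure P A) (event_mean A (dimX g) (est_path t n))"
      by (rule event_mean_step_y[OF AP E])
    also have "\<dots> = event_mean A (dimy g) (ybar (t + n))"
      unfolding event_mean_est_path[OF A] by (rule event_mean_ybar[OF A, symmetric])
    finally have "event_mean A (dimy g) (\<lambda>\<omega>. yhat (est t (hist t \<omega>)) n) $ k = event_mean A (dimy g) (ybar (t + n)) $ k" by (rule arg_cong)
    then show "(\<integral>\<omega>\<in>A. ybar (t + n) \<omega> $ k \<partial>P) = (\<integral>\<omega>\<in>A. yhat (est t (hist t \<omega>)) n $ k \<partial>P)"
      using k by (simp add: event_mean_def set_lebesgue_integral_def)
  qed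
qed

lemma ybar_second_moment:
  obtains c where "c \<ge> 0" "\<And>t k. k < dimy g \<Longrightarrow> integrable P (\<lambda>\<omega>. (ybar t \<omega> $ k)\<^sup>2)"
    "\<And>t k. k < dimy g \<Longrightarrow> (\<integral>\<omega>. (ybar t \<omega> $ k)\<^sup>2 \<partial>P) \<le> c"
proof -
  define s where "s = (SUP t. \<integral>\<^sup>+\<omega>. ennreal (ybar t \<omega> \<bullet> ybar t \<omega>) \<partial>P)"
  have s: "s < \<infinity>" using y_bounded by (simp add: s_def)
  have nn: "(\<integral>\<^sup>+\<omega>. ennreal ((ybar t \<omega> $ k)\<^sup>2) \<partial>P) \<le> s" if k: "k < dimy g" for t k
  proof -
    have "(\<integral>\<^sup>+\<omega>. ennreal ((ybar t \<omega> $ k)\<^sup>2) \<partial>P) \<le> (\<integral>\<^sup>+\<omega>. ennreal (ybar t \<omega> \<bullet> ybar t \<omega>) \<partial>P)"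
      by (intro nn_integral_mono ennreal_leI square_index_le_sprod_self) (use k measurable_vec_dim[OF ybar_measurable] in auto)
    also have "\<dots> \<le> s" unfolding s_def by (rule SUP_upper) simp
    finally show ?thesis .
  qed
  have m: "(\<lambda>\<omega>. (ybar t \<omega> $ k)\<^sup>2) \<in> borel_measurable P" if "k < dimy g" for t k
    by (intro borel_measurable_power measurable_vec_index[OF ybar_measurable that])
  have i: "integrable P (\<lambda>\<omega>. (ybar t \<omega> $ k)\<^sup>2)" if "k < dimy g" for t k
    using nn[OF that, of t] s m[OF that, of t] by (intro integrableI_nonneg) (auto intro: le_less_trans)
  have "(\<integral>\<omega>. (ybar t \<omega> $ k)\<^sup>2 \<partial>P) \<le> enn2real s" if k: "k < dimy g" for t k
    using nn[OF k, of t] s m[OF k, of t] by (subst integral_eq_nn_integral) (auto intro!: enn2real_mono)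
  then show ?thesis using that[of "enn2real s"] i by simp
qed

text \<open>By Jensen's inequality for the conditional expectation that the forecast represents.\<close>

lemma yhat_second_moment:
  assumes k: "k < dimy g"
  shows "integrable P (\<lambda>\<omega>. (yhat (est t (hist t \<omega>)) n $ k)\<^sup>2)"
    "(\<integral>\<omega>. (yhat (est t (hist t \<omega>)) n $ k)\<^sup>2 \<partial>P) \<le> (\<integral>\<omega>. (ybar (t + n) \<omega> $ k)\<^sup>2 \<partial>P)"
proof -
  interpret finite_measure_subalgebra P "sigma_y t" by (rule cond_exp_space)
  let ?X = "\<lambda>\<omega>. ybar (t + n) \<omega> $ k"
  have c: "integrable P (\<lambda>\<omega>. (ybar (t + n) \<omega> $ k)\<^sup>2)" by (rule ybar_second_moment) (use k in blast)
  have X: "integrable P ?X" using ybar_integrable_vec k by (simp add: integrable_vec_def)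
  have 1: "integrable P (\<lambda>\<omega>. (real_cond_exp P (sigma_y t) ?X \<omega>)\<^sup>2)"
    using integrable_convex_cond_exp[OF X, where I = UNIV and q = "\<lambda>x. x\<^sup>2"] c convex_power2 emeasure_finite by auto
  have 2: "AE \<omega> in P. (real_cond_exp P (sigma_y t) ?X \<omega>)\<^sup>2 \<le> real_cond_exp P (sigma_y t) (\<lambda>\<omega>. (?X \<omega>)\<^sup>2) \<omega>"
    using real_cond_exp_jensens_inequality(2)[OF X, where I = UNIV and q = "\<lambda>x. x\<^sup>2"] c convex_power2 by auto
  have eq: "AE \<omega> in P. (real_cond_exp P (sigma_y t) ?X \<omega>)\<^sup>2 = (yhat (est t (hist t \<omega>)) n $ k)\<^sup>2"
    using forecast_AE[OF k, of t n] by eventually_elim simp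
  have m: "(\<lambda>\<omega>. (yhat (est t (hist t \<omega>)) n $ k)\<^sup>2) \<in> borel_measurable P"
    by (intro borel_measurable_power measurable_vec_index[OF yhat_measurable[OF est_hist_measurable] k])
  show "integrable P (\<lambda>\<omega>. (yhat (est t (hist t \<omega>)) n $ k)\<^sup>2)"
    using integrable_cong_AE[OF _ m eq] 1 by simp
  have "(\<integral>\<omega>. (yhat (est t (hist t \<omega>)) n $ k)\<^sup>2 \<partial>P) = (\<integral>\<omega>. (real_cond_exp P (sigma_y t) ?X \<omega>)\<^sup>2 \<partial>P)"
    by (rule integral_cong_AE[OF m _ AE_symmetric[OF eq]]) simp
  also have "\<dots> \<le> (\<integral>\<omega>. real_cond_exp P (sigma_y t) (\<lambda>\<omega>. (?X \<omega>)\<^sup>2) \<omega> \<partial>P)"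
    by (rule integral_mono_AE[OF 1 real_cond_exp_int(1)[OF c] 2])
  also have "\<dots> = (\<integral>\<omega>. (?X \<omega>)\<^sup>2 \<partial>P)" by (rule real_cond_exp_int(2)[OF c])
  finally show "(\<integral>\<omega>. (yhat (est t (hist t \<omega>)) n $ k)\<^sup>2 \<partial>P) \<le> (\<integral>\<omega>. (ybar (t + n) \<omega> $ k)\<^sup>2 \<partial>P)" .
qed

subsection \<open>Transfer to the belief\<close>

abbreviation "ypath \<equiv> \<lambda>\<omega> t. ybar t \<omega>"

lemma ypath_measurable: "ypath \<in> P \<rightarrow>\<^sub>M seq_borel UNIV (dimy g)"
  by (intro measurable_seq_UNIV ybar_measurable)

lemma zcoord_measurable: "(\<lambda>z. z t) \<in> seq_borel UNIV (dimy g) \<rightarrow>\<^sub>M vec_borel (dimy g)"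
  by (rule measurable_seq_component) simp

lemma zhist_measurable: "(\<lambda>z. \<lambda>k\<in>{..<t}. z k) \<in> seq_borel UNIV (dimy g) \<rightarrow>\<^sub>M seq_borel {..<t} (dimy g)"
  by (intro measurable_seq_restrict zcoord_measurable)

lemma zest_measurable: "(\<lambda>z. est t (\<lambda>k\<in>{..<t}. z k)) \<in> seq_borel UNIV (dimy g) \<rightarrow>\<^sub>M vec_borel (dimX g)"
  by (rule measurable_compose[OF zhist_measurable est_measurable])

lemma forecast_measurable: "forecast t n \<in> seq_borel UNIV (dimy g) \<rightarrow>\<^sub>M vec_borel (dimy g)"
  unfolding forecast_def[abs_def] by (intro yhat_measurable zest_measurable)

lemma belief_second_moments:
  obtains c where "c \<ge> 0"
    "\<And>t k. k < dimy g \<Longrightarrow> integrable belief (\<lambda>z. (z t $ k)\<^sup>2)" "\<And>t k. k < dimy g \<Longrightarrow> (\<integral>z. (z t $ k)\<^sup>2 \<partial>belief) \<le> c"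
    "\<And>t n k. k < dimy g \<Longrightarrow> integrable belief (\<lambda>z. (forecast t n z $ k)\<^sup>2)"
    "\<And>t n k. k < dimy g \<Longrightarrow> (\<integral>z. (forecast t n z $ k)\<^sup>2 \<partial>belief) \<le> c"
proof -
  obtain c where c: "c \<ge> 0" "\<And>t k. k < dimy g \<Longrightarrow> integrable P (\<lambda>\<omega>. (ybar t \<omega> $ k)\<^sup>2)"
    "\<And>t k. k < dimy g \<Longrightarrow> (\<integral>\<omega>. (ybar t \<omega> $ k)\<^sup>2 \<partial>P) \<le> c" using ybar_second_moment by blast
  have m1: "(\<lambda>z. (z t $ k)\<^sup>2) \<in> borel_measurable (seq_borel UNIV (dimy g))" if "k < dimy g" for t k
    by (intro borel_measurable_power measurable_vec_index[OF zcoord_measurable that])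
  have m2: "(\<lambda>z. (forecast t n z $ k)\<^sup>2) \<in> borel_measurable (seq_borel UNIV (dimy g))" if "k < dimy g" for t n k
    by (intro borel_measurable_power measurable_vec_index[OF forecast_measurable that])
  show ?thesis
  proof (rule that[OF c(1)])
    fix t n k assume k: "k < dimy g"
    show "integrable belief (\<lambda>z. (z t $ k)\<^sup>2)" "(\<integral>z. (z t $ k)\<^sup>2 \<partial>belief) \<le> c"
      unfolding belief_eq_ybar integrable_distr_eq[OF ypath_measurable m1[OF k]] integral_distr[OF ypath_measurable m1[OF k]]
      by (rule c(2)[OF k], rule c(3)[OF k])
    show "integrable belief (\<lambda>z. (forecast t n z $ k)\<^sup>2)" "(\<integral>z. (forecast t n z $ k)\<^sup>2 \<partial>belief) \<le> c"
      unfolding belief_eq_ybar integrable_distr_eq[OF ypath_measurable m2[OF k]] integral_distr[OF ypath_measurable m2[OF k]] forecast_ybar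
      by (rule yhat_second_moment(1)[OF k], rule order_trans[OF yhat_second_moment(2)[OF k] c(3)[OF k]])
  qed
qed

lemma belief_forecast:
  assumes k: "k < dimy g" and \<phi>: "\<phi> \<in> borel_measurable (seq_borel {..<t} (dimy g))"
    and int: "integrable belief (\<lambda>z. \<phi> (\<lambda>k\<in>{..<t}. z k) * z (t + n) $ k)"
  shows "(\<integral>z. \<phi> (\<lambda>k\<in>{..<t}. z k) * z (t + n) $ k \<partial>belief) = (\<integral>z. \<phi> (\<lambda>k\<in>{..<t}. z k) * forecast t n z $ k \<partial>belief)"
proof -
  interpret finite_measure_subalgebra P "sigma_y t" by (rule cond_exp_space)
  have mp: "(\<lambda>z. \<phi> (\<lambda>k\<in>{..<t}. z k)) \<in> borel_measurable (seq_borel UNIV (dimy g))" by (rule measurable_compose[OF zhist_measurable \<phi>])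
  have m1: "(\<lambda>z. \<phi> (\<lambda>k\<in>{..<t}. z k) * z (t + n) $ k) \<in> borel_measurable (seq_borel UNIV (dimy g))"
    by (intro borel_measurable_times mp measurable_vec_index[OF zcoord_measurable k])
  have m2: "(\<lambda>z. \<phi> (\<lambda>k\<in>{..<t}. z k) * forecast t n z $ k) \<in> borel_measurable (seq_borel UNIV (dimy g))"
    by (intro borel_measurable_times mp measurable_vec_index[OF forecast_measurable k])
  have h: "(\<lambda>k\<in>{..<t}. ybar k \<omega>) = hist t \<omega>" for \<omega> by (simp add: hist_def)
  have i: "integrable P (\<lambda>\<omega>. \<phi> (hist t \<omega>) * ybar (t + n) \<omega> $ k)"
    using int unfolding belief_eq_ybar integrable_distr_eq[OF ypath_measurable m1] h .
  have mh: "(\<lambda>\<omega>. \<phi> (hist t \<omega>)) \<in> borel_measurable (sigma_y t)" by (rule measurable_compose[OF hist_sigma_y_measurable \<phi>])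
  have my: "(\<lambda>\<omega>. ybar (t + n) \<omega> $ k) \<in> borel_measurable P" by (rule measurable_vec_index[OF ybar_measurable k])
  have mhP: "(\<lambda>\<omega>. \<phi> (hist t \<omega>)) \<in> borel_measurable P" by (rule measurable_compose[OF hist_measurable \<phi>])
  have "(\<integral>z. \<phi> (\<lambda>k\<in>{..<t}. z k) * z (t + n) $ k \<partial>belief) = (\<integral>\<omega>. \<phi> (hist t \<omega>) * ybar (t + n) \<omega> $ k \<partial>P)"
    unfolding belief_eq_ybar integral_distr[OF ypath_measurable m1] h ..
  also have "\<dots> = (\<integral>\<omega>. \<phi> (hist t \<omega>) * real_cond_exp P (sigma_y t) (\<lambda>\<omega>. ybar (t + n) \<omega> $ k) \<omega> \<partial>P)"
    by (rule real_cond_exp_intg(2)[OF i mh my, symmetric])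
  also have "\<dots> = (\<integral>\<omega>. \<phi> (hist t \<omega>) * yhat (est t (hist t \<omega>)) n $ k \<partial>P)"
  proof (rule integral_cong_AE)
    show "AE \<omega> in P. \<phi> (hist t \<omega>) * real_cond_exp P (sigma_y t) (\<lambda>\<omega>. ybar (t + n) \<omega> $ k) \<omega> = \<phi> (hist t \<omega>) * yhat (est t (hist t \<omega>)) n $ k"
      using forecast_AE[OF k, of t n] by eventually_elim simp
    show "(\<lambda>\<omega>. \<phi> (hist t \<omega>) * real_cond_exp P (sigma_y t) (\<lambda>\<omega>. ybar (t + n) \<omega> $ k) \<omega>) \<in> borel_measurable P"
      by (intro borel_measurable_times mhP borel_measurable_cond_exp2)
    show "(\<lambda>\<omega>. \<phi> (hist t \<omega>) * yhat (est t (hist t \<omega>)) n $ k) \<in> borel_measurable P"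
      by (intro borel_measurable_times mhP measurable_vec_index[OF yhat_measurable[OF est_hist_measurable] k])
  qed
  also have "\<dots> = (\<integral>z. \<phi> (\<lambda>k\<in>{..<t}. z k) * forecast t n z $ k \<partial>belief)"
    unfolding belief_eq_ybar integral_distr[OF ypath_measurable m2] h forecast_ybar ..
  finally show ?thesis .
qed

end

section \<open>Square-integrable random vectors\<close>

definition L2 :: "'a measure \<Rightarrow> nat \<Rightarrow> ('a \<Rightarrow> real vec) \<Rightarrow> bool" where
  "L2 N n V \<longleftrightarrow> V \<in> N \<rightarrow>\<^sub>M vec_borel n \<and> finite_second_moment N n V"

lemma L2_measurable: "L2 N n V \<Longrightarrow> V \<in> N \<rightarrow>\<^sub>M vec_borel n"
  by (simp add: L2_def)

lemma L2_square: "L2 N n V \<Longrightarrow> k < n \<Longrightarrow> integrable N (\<lambda>x. (V x $ k)\<^sup>2)"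
  by (simp add: L2_def finite_second_moment_def)

lemma L2_index: "L2 N n V \<Longrightarrow> k < n \<Longrightarrow> (\<lambda>x. V x $ k) \<in> borel_measurable N"
  by (rule measurable_vec_index[OF L2_measurable])

lemma square_integrable_product:
  fixes f h :: "'a \<Rightarrow> real"
  assumes "f \<in> borel_measurable N" "h \<in> borel_measurable N" "integrable N (\<lambda>x. (f x)\<^sup>2)" "integrable N (\<lambda>x. (h x)\<^sup>2)"
  shows "integrable N (\<lambda>x. f x * h x)"
proof (rule Bochner_Integration.integrable_bound)
  show "integrable N (\<lambda>x. (f x)\<^sup>2 + (h x)\<^sup>2)" using assms by simp
  have "norm (f x * h x) \<le> norm ((f x)\<^sup>2 + (h x)\<^sup>2)" for x
  proof -
    have "0 \<le> (\<bar>f x\<bar> - \<bar>h x\<bar>)\<^sup>2" by simp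
    then have "2 * \<bar>f x * h x\<bar> \<le> (f x)\<^sup>2 + (h x)\<^sup>2" by (simp add: power2_diff abs_mult)
    moreover have "\<bar>f x * h x\<bar> \<ge> 0" by simp
    ultimately show ?thesis by simp
  qed
  then show "AE x in N. norm (f x * h x) \<le> norm ((f x)\<^sup>2 + (h x)\<^sup>2)" by simp
qed (use assms in simp)

lemma L2_product: "L2 N n V \<Longrightarrow> L2 N m U \<Longrightarrow> k < n \<Longrightarrow> l < m \<Longrightarrow> integrable N (\<lambda>x. V x $ k * U x $ l)"
  by (intro square_integrable_product L2_index L2_square)

lemma L2I:
  assumes "V \<in> N \<rightarrow>\<^sub>M vec_borel n" "\<And>k. k < n \<Longrightarrow> integrable N (\<lambda>x. (V x $ k)\<^sup>2)"
  shows "L2 N n V"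
  using assms by (simp add: L2_def finite_second_moment_def)

lemma L2_add:
  assumes V: "L2 N n V" and U: "L2 N n U"
  shows "L2 N n (\<lambda>x. V x + U x)"
proof (rule L2I)
  show "(\<lambda>x. V x + U x) \<in> N \<rightarrow>\<^sub>M vec_borel n" by (intro measurable_vec_add L2_measurable V U)
  fix k assume k: "k < n"
  have "integrable N (\<lambda>x. (V x $ k)\<^sup>2 + (U x $ k)\<^sup>2 + 2 * (V x $ k * U x $ k))"
    by (intro Bochner_Integration.integrable_add integrable_mult_right L2_square[OF V k] L2_square[OF U k] L2_product[OF V U k k])
  then show "integrable N (\<lambda>x. ((V x + U x) $ k)\<^sup>2)"
    by (rule Bochner_Integration.integrable_cong[THEN iffD1, rotated 2])
      (use measurable_vec_dim[OF L2_measurable[OF V]] measurable_vec_dim[OF L2_measurable[OF U]] k in \<open>auto simp: power2_sum\<close>)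
qed

lemma L2_minus:
  assumes V: "L2 N n V" and U: "L2 N n U"
  shows "L2 N n (\<lambda>x. V x - U x)"
proof (rule L2I)
  show "(\<lambda>x. V x - U x) \<in> N \<rightarrow>\<^sub>M vec_borel n" by (intro measurable_vec_minus L2_measurable V U)
  fix k assume k: "k < n"
  have "integrable N (\<lambda>x. (V x $ k)\<^sup>2 + (U x $ k)\<^sup>2 - 2 * (V x $ k * U x $ k))"
    by (intro Bochner_Integration.integrable_add Bochner_Integration.integrable_diff integrable_mult_right L2_square[OF V k] L2_square[OF U k] L2_product[OF V U k k])
  then show "integrable N (\<lambda>x. ((V x - U x) $ k)\<^sup>2)"
    by (rule Bochner_Integration.integrable_cong[THEN iffD1, rotated 2])
      (use measurable_vec_dim[OF L2_measurable[OF V]] measurable_vec_dim[OF L2_measurable[OF U]] k in \<open>auto simp: power2_diff\<close>)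
qed

lemma L2_mult:
  assumes V: "L2 N nc V" and Z: "Z \<in> carrier_mat nr nc"
  shows "L2 N nr (\<lambda>x. Z *\<^sub>v V x)"
proof (rule L2I)
  show "(\<lambda>x. Z *\<^sub>v V x) \<in> N \<rightarrow>\<^sub>M vec_borel nr" by (intro measurable_mult_mat_vec[OF Z] L2_measurable V)
  fix k assume k: "k < nr"
  have "integrable N (\<lambda>x. \<Sum>l<nc. \<Sum>m<nc. (Z $$ (k, l) * Z $$ (k, m)) * (V x $ l * V x $ m))"
    by (intro Bochner_Integration.integrable_sum integrable_mult_right L2_product[OF V V]) auto
  then show "integrable N (\<lambda>x. ((Z *\<^sub>v V x) $ k)\<^sup>2)"
    by (rule Bochner_Integration.integrable_cong[THEN iffD1, rotated 2])
      (use measurable_vec_dim[OF L2_measurable[OF V]] Z k in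
        \<open>auto simp: scalar_prod_def atLeast0LessThan power2_eq_square sum_product mult_ac\<close>)
qed

lemma L2_const: "finite_measure N \<Longrightarrow> dim_vec v = n \<Longrightarrow> L2 N n (\<lambda>_. v)"
  by (rule L2I) (auto simp: measurable_vec_const finite_measure.integrable_const)

lemma L2_sprod:
  assumes V: "L2 N n V" and U: "L2 N n U"
  shows "integrable N (\<lambda>x. V x \<bullet> U x)"
proof -
  have "integrable N (\<lambda>x. \<Sum>k<n. V x $ k * U x $ k)"
    by (intro Bochner_Integration.integrable_sum L2_product[OF V U]) auto
  then show ?thesis
    by (rule Bochner_Integration.integrable_cong[THEN iffD1, rotated 2])
      (use measurable_vec_dim[OF L2_measurable[OF U]] in \<open>auto simp: scalar_prod_def atLeast0LessThan\<close>)
qed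

lemma L2_quad_form:
  assumes "A \<in> carrier_mat n n" "L2 N n V"
  shows "integrable N (\<lambda>x. quad_form A (V x))"
  unfolding quad_form_def by (rule L2_sprod[OF assms(2) L2_mult[OF assms(2,1)]])

lemma integral_sprod_eqI:
  assumes V: "L2 N n V" and U: "L2 N n U" and U': "L2 N n U'"
    and eq: "\<And>k. k < n \<Longrightarrow> (\<integral>x. V x $ k * U x $ k \<partial>N) = (\<integral>x. V x $ k * U' x $ k \<partial>N)"
  shows "(\<integral>x. V x \<bullet> U x \<partial>N) = (\<integral>x. V x \<bullet> U' x \<partial>N)"
proof -
  have sp: "(\<integral>x. V x \<bullet> U x \<partial>N) = (\<Sum>k<n. \<integral>x. V x $ k * U x $ k \<partial>N)" if "L2 N n U" for U
  proof -
    have "(\<integral>x. V x \<bullet> U x \<partial>N) = (\<integral>x. (\<Sum>k<n. V x $ k * U x $ k) \<partial>N)"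
      by (rule Bochner_Integration.integral_cong) (use measurable_vec_dim[OF L2_measurable[OF that]] in \<open>auto simp: scalar_prod_def atLeast0LessThan\<close>)
    also have "\<dots> = (\<Sum>k<n. \<integral>x. V x $ k * U x $ k \<partial>N)"
      by (intro Bochner_Integration.integral_sum L2_product[OF V that]) auto
    finally show ?thesis .
  qed
  show ?thesis unfolding sp[OF U] sp[OF U'] using eq by simp
qed

text \<open>A geometrically weighted tail in mean square, by Cauchy-Schwarz with the geometric
  weights.\<close>

lemma geometric_tail_second_moment:
  fixes f s :: "nat \<Rightarrow> 'a \<Rightarrow> real"
  assumes f: "\<And>n. f n \<in> borel_measurable N" and s: "\<And>n. s n \<in> borel_measurable N" "\<And>n. integrable N (\<lambda>x. (s n x)\<^sup>2)"
    and bound: "\<And>n x. x \<in> space N \<Longrightarrow> \<bar>f n x\<bar> \<le> r^n * s n x" and C: "\<And>n. (\<integral>x. (s n x)\<^sup>2 \<partial>N) \<le> C" "C \<ge> 0"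
    and r: "0 \<le> r" "r < 1" and summable: "\<And>x. x \<in> space N \<Longrightarrow> summable (\<lambda>n. f n x)"
  shows "integrable N (\<lambda>x. (\<Sum>n. f (n + K) x)\<^sup>2)" "(\<integral>x. (\<Sum>n. f (n + K) x)\<^sup>2 \<partial>N) \<le> (r^K / (1 - r))\<^sup>2 * C"
proof -
  define \<tau> where "\<tau> = r^K / (1 - r)"
  have tau: "(\<lambda>n. r^(n + K)) sums \<tau>" "\<tau> \<ge> 0"
    using sums_mult2[OF geometric_sums[of r], of "r^K"] r by (auto simp: \<tau>_def power_add)
  have pt: "ennreal ((\<Sum>n. f (n + K) x)\<^sup>2) \<le> ennreal \<tau> * (\<Sum>n. ennreal (r^(n + K) * (s (n + K) x)\<^sup>2))" if x: "x \<in> space N" for x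
  proof -
    have s0: "r^n * s n x \<ge> 0" for n using order_trans[OF abs_ge_zero bound[OF x]] .
    have fin: "(\<Sum>n<m. f (n + K) x)\<^sup>2 \<le> \<tau> * (\<Sum>n<m. r^(n + K) * (s (n + K) x)\<^sup>2)" for m
    proof -
      have "\<bar>\<Sum>n<m. f (n + K) x\<bar> \<le> (\<Sum>n<m. r^(n + K) * s (n + K) x)"
        by (rule order_trans[OF sum_abs]) (intro sum_mono bound x)
      then have "(\<Sum>n<m. f (n + K) x)\<^sup>2 \<le> (\<Sum>n<m. r^(n + K) * s (n + K) x)\<^sup>2"
        by (simp add: abs_le_square_iff[symmetric] sum_nonneg s0)
      also have "\<dots> = (\<Sum>n<m. sqrt (r^(n + K)) * (sqrt (r^(n + K)) * s (n + K) x))\<^sup>2"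
        using r by (simp add: mult.assoc[symmetric])
      also have "\<dots> \<le> (\<Sum>n<m. (sqrt (r^(n + K)))\<^sup>2) * (\<Sum>n<m. (sqrt (r^(n + K)) * s (n + K) x)\<^sup>2)"
        by (rule Cauchy_Schwarz_ineq_sum)
      also have "\<dots> = (\<Sum>n<m. r^(n + K)) * (\<Sum>n<m. r^(n + K) * (s (n + K) x)\<^sup>2)"
        using r by (simp add: power_mult_distrib)
      also have "\<dots> \<le> \<tau> * (\<Sum>n<m. r^(n + K) * (s (n + K) x)\<^sup>2)"
        using tau(1) r by (intro mult_right_mono sum_le_suminf[OF sums_summable[OF tau(1)], unfolded sums_unique[OF tau(1), symmetric]] sum_nonneg) auto
      finally show ?thesis .
    qed
    have le: "ennreal ((\<Sum>n<m. f (n + K) x)\<^sup>2) \<le> ennreal \<tau> * (\<Sum>n. ennreal (r^(n + K) * (s (n + K) x)\<^sup>2))" for m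
    proof -
      have "ennreal ((\<Sum>n<m. f (n + K) x)\<^sup>2) \<le> ennreal \<tau> * (\<Sum>n<m. ennreal (r^(n + K) * (s (n + K) x)\<^sup>2))"
        using fin[of m] tau r by (simp add: ennreal_mult[symmetric] sum_nonneg ennreal_leI)
      also have "\<dots> \<le> ennreal \<tau> * (\<Sum>n. ennreal (r^(n + K) * (s (n + K) x)\<^sup>2))"
        by (intro mult_left_mono sum_le_suminf) auto
      finally show ?thesis .
    qed
    have lim: "(\<lambda>m. ennreal ((\<Sum>n<m. f (n + K) x)\<^sup>2)) \<longlonglongrightarrow> ennreal ((\<Sum>n. f (n + K) x)\<^sup>2)"
    proof (intro tendsto_ennrealI tendsto_power summable_LIMSEQ)
      show "summable (\<lambda>n. f (n + K) x)" using summable_iff_shift[of "\<lambda>n. f n x" K] summable[OF x] by simp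
    qed
    show ?thesis by (rule LIMSEQ_le_const2[OF lim]) (use le in blast)
  qed
  have nnle: "(\<integral>\<^sup>+x. ennreal ((\<Sum>n. f (n + K) x)\<^sup>2) \<partial>N) \<le> ennreal (\<tau>\<^sup>2 * C)"
  proof -
    have "(\<integral>\<^sup>+x. ennreal ((\<Sum>n. f (n + K) x)\<^sup>2) \<partial>N) \<le> (\<integral>\<^sup>+x. ennreal \<tau> * (\<Sum>n. ennreal (r^(n + K) * (s (n + K) x)\<^sup>2)) \<partial>N)"
      by (intro nn_integral_mono pt)
    also have "\<dots> = ennreal \<tau> * (\<Sum>n. \<integral>\<^sup>+x. ennreal (r^(n + K) * (s (n + K) x)\<^sup>2) \<partial>N)"
      using s(1) by (subst nn_integral_cmult, measurable) (subst nn_integral_suminf, auto)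
    also have "\<dots> \<le> ennreal \<tau> * (\<Sum>n. ennreal (r^(n + K) * C))"
    proof (intro mult_left_mono suminf_le)
      fix n
      have "(\<integral>\<^sup>+x. ennreal (r^(n + K) * (s (n + K) x)\<^sup>2) \<partial>N) = ennreal (\<integral>x. r^(n + K) * (s (n + K) x)\<^sup>2 \<partial>N)"
        using s r by (intro nn_integral_eq_integral) auto
      also have "\<dots> \<le> ennreal (r^(n + K) * C)" using C r by (intro ennreal_leI) (simp add: mult_left_mono)
      finally show "(\<integral>\<^sup>+x. ennreal (r^(n + K) * (s (n + K) x)\<^sup>2) \<partial>N) \<le> ennreal (r^(n + K) * C)" .
    qed auto
    also have "(\<Sum>n. ennreal (r^(n + K) * C)) = ennreal (\<tau> * C)"
      using sums_mult2[OF tau(1), of C] r C by (intro suminf_ennreal_eq) auto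
    also have "ennreal \<tau> * ennreal (\<tau> * C) = ennreal (\<tau>\<^sup>2 * C)"
      using tau C by (simp add: ennreal_mult[symmetric] power2_eq_square mult.assoc)
    finally show ?thesis .
  qed
  have m: "(\<lambda>x. (\<Sum>n. f (n + K) x)\<^sup>2) \<in> borel_measurable N"
    using f by measurable
  show "integrable N (\<lambda>x. (\<Sum>n. f (n + K) x)\<^sup>2)"
    using nnle m by (intro integrableI_nonneg) (auto intro: le_less_trans)
  show "(\<integral>x. (\<Sum>n. f (n + K) x)\<^sup>2 \<partial>N) \<le> (r^K / (1 - r))\<^sup>2 * C"
    using nnle m C tau unfolding \<tau>_def[symmetric]
    by (subst integral_eq_nn_integral) (auto intro!: enn2real_leI)
qed

section \<open>The decision problem under the belief\<close>

context sebeu_setting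
begin

definition joint_space where "joint_space = noise_space \<Otimes>\<^sub>M seq_borel UNIV (dimy g)"
text \<open>For a decision maker who regards the environment variables as exogenous, they are independent of the
  own noise; this is the law of the pair.\<close>

definition joint_law where "joint_law = noise_law \<Otimes>\<^sub>M belief"

lemma measurable_joint_law: "(joint_law \<rightarrow>\<^sub>M K) = (joint_space \<rightarrow>\<^sub>M K)"
  unfolding joint_law_def joint_space_def by (intro measurable_cong_sets sets_pair_measure_cong sets_noise_law sets_belief refl)

lemma pair_ps: "pair_prob_space noise_law belief"
  using prob_noise_law prob_belief by (simp add: pair_prob_space_def pair_sigma_finite_def prob_space_imp_sigma_finite)

lemma prob_joint_law: "prob_space joint_law"
proof -
  interpret pair_prob_space noise_law belief by (rule pair_ps)
  show ?thesis unfolding joint_law_def by (rule P.prob_space_axioms)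
qed

lemma finite_joint_law: "finite_measure joint_law"
  using prob_joint_law by (simp add: prob_space_def)

lemma distr_fst: "distr joint_law noise_law fst = noise_law"
  unfolding joint_law_def by (rule prob_space.distr_pair_fst[OF prob_belief])

lemma distr_snd: "distr joint_law belief snd = belief"
proof (rule measure_eqI)
  interpret Z: prob_space belief by (rule prob_belief)
  interpret M: prob_space noise_law by (rule prob_noise_law)
  fix A assume "A \<in> sets (distr joint_law belief snd)"
  then have A: "A \<in> sets belief" by simp
  have "emeasure (distr joint_law belief snd) A = emeasure joint_law (space noise_law \<times> A)"
    using A sets.sets_into_space[OF A] unfolding joint_law_def
    by (subst emeasure_distr) (auto simp: space_pair_measure intro!: arg_cong2[where f = emeasure])
  also have "\<dots> = emeasure belief A"
    unfolding joint_law_def using A by (subst Z.emeasure_pair_measure_Times) (auto simp: M.emeasure_space_1)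
  finally show "emeasure (distr joint_law belief snd) A = emeasure belief A" .
qed simp

lemma L2_fst:
  assumes "X \<in> noise_space \<rightarrow>\<^sub>M vec_borel n" "\<And>k. k < n \<Longrightarrow> integrable noise_law (\<lambda>q. (X q $ k)\<^sup>2)"
  shows "L2 joint_law n (\<lambda>x. X (fst x))"
proof (rule L2I)
  show "(\<lambda>x. X (fst x)) \<in> joint_law \<rightarrow>\<^sub>M vec_borel n"
    unfolding measurable_joint_law joint_space_def by (rule measurable_compose[OF measurable_fst assms(1)])
  fix k assume k: "k < n"
  have "(\<lambda>q. (X q $ k)\<^sup>2) \<in> borel_measurable noise_law"
    using borel_measurable_integrable[OF assms(2)[OF k]] .
  moreover have "fst \<in> joint_law \<rightarrow>\<^sub>M noise_law" by (simp add: joint_law_def)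
  ultimately show "integrable joint_law (\<lambda>x. (X (fst x) $ k)\<^sup>2)"
    using assms(2)[OF k] integrable_distr_eq[of fst joint_law noise_law "\<lambda>q. (X q $ k)\<^sup>2"] by (simp add: distr_fst)
qed

lemma L2_snd:
  assumes "X \<in> seq_borel UNIV (dimy g) \<rightarrow>\<^sub>M vec_borel n" "\<And>k. k < n \<Longrightarrow> integrable belief (\<lambda>z. (X z $ k)\<^sup>2)"
  shows "L2 joint_law n (\<lambda>x. X (snd x))"
proof (rule L2I)
  show "(\<lambda>x. X (snd x)) \<in> joint_law \<rightarrow>\<^sub>M vec_borel n"
    unfolding measurable_joint_law joint_space_def by (rule measurable_compose[OF measurable_snd assms(1)])
  fix k assume k: "k < n"
  have "(\<lambda>z. (X z $ k)\<^sup>2) \<in> borel_measurable belief"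
    using borel_measurable_integrable[OF assms(2)[OF k]] .
  moreover have "snd \<in> joint_law \<rightarrow>\<^sub>M belief" by (simp add: joint_law_def)
  ultimately show "integrable joint_law (\<lambda>x. (X (snd x) $ k)\<^sup>2)"
    using assms(2)[OF k] integrable_distr_eq[of snd joint_law belief "\<lambda>z. (X z $ k)\<^sup>2"] by (simp add: distr_snd)
qed

lemma L2_coord: "L2 joint_law (source_dim r) (\<lambda>x. coord r (fst x))"
  by (intro L2_fst coord_measurable coord_square_integrable)

lemma L2_z: "L2 joint_law (dimy g) (\<lambda>x. snd x t)"
proof -
  have "\<And>t k. k < dimy g \<Longrightarrow> integrable belief (\<lambda>z. (z t $ k)\<^sup>2)" by (rule belief_second_moments) blast
  then show ?thesis by (intro L2_snd[of "\<lambda>z. z t"] zcoord_measurable)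
qed

lemma L2_forecast: "L2 joint_law (dimy g) (\<lambda>x. forecast t n (snd x))"
proof -
  have "\<And>t n k. k < dimy g \<Longrightarrow> integrable belief (\<lambda>z. (forecast t n z $ k)\<^sup>2)" by (rule belief_second_moments) blast
  then show ?thesis by (intro L2_snd forecast_measurable)
qed

type_synonym outcome = "noise_path \<times> (nat \<Rightarrow> real vec)"

text \<open>Random vectors determined by the noise and the environment variables before \<open>t\<close>.\<close>

definition adapted :: "nat \<Rightarrow> nat \<Rightarrow> (outcome \<Rightarrow> real vec) \<Rightarrow> bool" where
  "adapted t n V \<longleftrightarrow> V \<in> joint_space \<rightarrow>\<^sub>M vec_borel n \<and>
     (\<forall>q q' z z'. (\<forall>r\<in>past_sources t. coord r q = coord r q') \<longrightarrow> (\<forall>k<t. z k = z' k) \<longrightarrow> V (q, z) = V (q', z'))"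

lemma adapted_mult: "adapted t nc V \<Longrightarrow> Z \<in> carrier_mat nr nc \<Longrightarrow> adapted t nr (\<lambda>x. Z *\<^sub>v V x)"
  unfolding adapted_def
proof (elim conjE, intro conjI)
  assume "V \<in> joint_space \<rightarrow>\<^sub>M vec_borel nc" "Z \<in> carrier_mat nr nc"
  then show "(\<lambda>x. Z *\<^sub>v V x) \<in> joint_space \<rightarrow>\<^sub>M vec_borel nr" by (intro measurable_mult_mat_vec)
next
  assume a: "\<forall>q q' z z'. (\<forall>r\<in>past_sources t. coord r q = coord r q') \<longrightarrow> (\<forall>k<t. z k = z' k) \<longrightarrow> V (q, z) = V (q', z')"
  show "\<forall>q q' z z'. (\<forall>r\<in>past_sources t. coord r q = coord r q') \<longrightarrow> (\<forall>k<t. z k = z' k) \<longrightarrow> Z *\<^sub>v V (q, z) = Z *\<^sub>v V (q', z')"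
  proof (intro allI impI)
    fix q q' z z' assume "\<forall>r\<in>past_sources t. coord r q = coord r q'" "\<forall>k<t. z k = (z' k :: real vec)"
    then have "V (q, z) = V (q', z')" using a by blast
    then show "Z *\<^sub>v V (q, z) = Z *\<^sub>v V (q', z')" by simp
  qed
qed

lemma adapted_minus: "adapted t n V \<Longrightarrow> adapted t n U \<Longrightarrow> adapted t n (\<lambda>x. V x - U x)"
  unfolding adapted_def
proof (elim conjE, intro conjI)
  assume "V \<in> joint_space \<rightarrow>\<^sub>M vec_borel n" "U \<in> joint_space \<rightarrow>\<^sub>M vec_borel n"
  then show "(\<lambda>x. V x - U x) \<in> joint_space \<rightarrow>\<^sub>M vec_borel n" by (intro measurable_vec_minus)
next
  assume a: "\<forall>q q' z z'. (\<forall>r\<in>past_sources t. coord r q = coord r q') \<longrightarrow> (\<forall>k<t. z k = z' k) \<longrightarrow> V (q, z) = V (q', z')"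
    "\<forall>q q' z z'. (\<forall>r\<in>past_sources t. coord r q = coord r q') \<longrightarrow> (\<forall>k<t. z k = z' k) \<longrightarrow> U (q, z) = U (q', z')"
  show "\<forall>q q' z z'. (\<forall>r\<in>past_sources t. coord r q = coord r q') \<longrightarrow> (\<forall>k<t. z k = z' k) \<longrightarrow> V (q, z) - U (q, z) = V (q', z') - U (q', z')"
  proof (intro allI impI)
    fix q q' z z' assume "\<forall>r\<in>past_sources t. coord r q = coord r q'" "\<forall>k<t. z k = (z' k :: real vec)"
    then have "V (q, z) = V (q', z')" "U (q, z) = U (q', z')" using a by blast+
    then show "V (q, z) - U (q, z) = V (q', z') - U (q', z')" by simp
  qed
qed

text \<open>Against an adapted vector, a future environment variable may be replaced by its forecast:
  for a fixed realization of the noise, the vector is a function of the observed past.\<close>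

lemma adapted_forecast_z:
  assumes V: "adapted t n V" "L2 joint_law n V" and k: "k < n" and l: "l < dimy g"
  shows "(\<integral>x. V x $ k * snd x (t + j) $ l \<partial>joint_law) = (\<integral>x. V x $ k * forecast t j (snd x) $ l \<partial>joint_law)"
proof -
  interpret pair_prob_space noise_law belief by (rule pair_ps)
  have Vm: "V \<in> joint_space \<rightarrow>\<^sub>M vec_borel n" using V(1) by (simp add: adapted_def)
  let ?f = "\<lambda>q z. V (q, z) $ k * z (t + j) $ l" and ?h = "\<lambda>q z. V (q, z) $ k * forecast t j z $ l"
  have i1: "integrable (noise_law \<Otimes>\<^sub>M belief) (case_prod ?f)"
    using L2_product[OF V(2) L2_z k l] unfolding joint_law_def by (simp add: split_beta')
  have i2: "integrable (noise_law \<Otimes>\<^sub>M belief) (case_prod ?h)"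
    using L2_product[OF V(2) L2_forecast k l] unfolding joint_law_def by (simp add: split_beta')
  have "AE q in noise_law. (\<integral>z. ?f q z \<partial>belief) = (\<integral>z. ?h q z \<partial>belief)"
    using AE_integrable_fst[OF i1] AE_space
  proof eventually_elim
    case (elim q)
    have q: "q \<in> space noise_space" using elim(2) sets_eq_imp_space_eq[OF sets_noise_law] by simp
    \<comment> \<open>Adaptedness allows the values from \<open>t\<close> on to be replaced by zero, which leaves a function of the history.\<close>
    define \<phi> where "\<phi> h = V (q, \<lambda>k. if k < t then h k else 0\<^sub>v (dimy g)) $ k" for h
    have "(\<lambda>h k. if k < t then h k else 0\<^sub>v (dimy g)) \<in> seq_borel {..<t} (dimy g) \<rightarrow>\<^sub>M seq_borel UNIV (dimy g)"
    proof (rule measurable_seq_UNIV)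
      fix k show "(\<lambda>h. if k < t then h k else 0\<^sub>v (dimy g)) \<in> seq_borel {..<t} (dimy g) \<rightarrow>\<^sub>M vec_borel (dimy g)"
        by (cases "k < t") (auto intro: measurable_seq_component measurable_vec_const)
    qed
    then have "(\<lambda>h. (q, \<lambda>k. if k < t then h k else 0\<^sub>v (dimy g))) \<in> seq_borel {..<t} (dimy g) \<rightarrow>\<^sub>M joint_space"
      unfolding joint_space_def using q by (intro measurable_Pair measurable_const)
    then have m: "\<phi> \<in> borel_measurable (seq_borel {..<t} (dimy g))"
      unfolding \<phi>_def[abs_def] by (intro measurable_vec_index[OF measurable_compose[OF _ Vm] k])
    have eq: "V (q, z) $ k = \<phi> (\<lambda>k\<in>{..<t}. z k)" for z
    proof -
      have "V (q, z) = V (q, \<lambda>k. if k < t then (\<lambda>k\<in>{..<t}. z k) k else 0\<^sub>v (dimy g))"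
        using V(1) unfolding adapted_def by (elim conjE allE impE) auto
      then show ?thesis by (simp only: \<phi>_def)
    qed
    have "integrable belief (\<lambda>z. \<phi> (\<lambda>k\<in>{..<t}. z k) * z (t + j) $ l)" using elim(1) by (simp only: eq)
    from belief_forecast[OF l m this] show ?case by (simp only: eq)
  qed
  then have "(\<integral>q. (\<integral>z. ?f q z \<partial>belief) \<partial>noise_law) = (\<integral>q. (\<integral>z. ?h q z \<partial>belief) \<partial>noise_law)"
    by (intro integral_cong_AE borel_measurable_integrable[OF integrable_fst[OF i1]] borel_measurable_integrable[OF integrable_fst[OF i2]])
  then show ?thesis
    unfolding integral_fst[OF i1] integral_fst[OF i2] joint_law_def by (simp add: split_beta')
qed

text \<open>For a fixed path of the environment variables, the vector depends on the earlier noise only, of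
  which the disturbance is independent.\<close>

lemma adapted_mean_w:
  assumes V: "adapted t n V" "L2 joint_law n V" and k: "k < n" and l: "l < dimX g"
  shows "(\<integral>x. V x $ k * coord (Dist (t + j)) (fst x) $ l \<partial>joint_law) = (\<integral>x. V x $ k * mean_W g p $ l \<partial>joint_law)"
proof -
  interpret pair_prob_space noise_law belief by (rule pair_ps)
  have Vm: "V \<in> joint_space \<rightarrow>\<^sub>M vec_borel n" using V(1) by (simp add: adapted_def)
  let ?f = "\<lambda>q z. V (q, z) $ k * coord (Dist (t + j)) q $ l" and ?h = "\<lambda>q z. V (q, z) $ k * mean_W g p $ l"
  have i1: "integrable (noise_law \<Otimes>\<^sub>M belief) (case_prod ?f)"
    using L2_product[OF V(2) L2_coord k, of l "Dist (t + j)"] l unfolding joint_law_def by (simp add: split_beta')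
  have i2: "integrable (noise_law \<Otimes>\<^sub>M belief) (case_prod ?h)"
    using L2_product[OF V(2) L2_const[OF finite_joint_law mean_dims(2)] k l] unfolding joint_law_def by (simp add: split_beta')
  have "integrable joint_law (\<lambda>x. V x $ k)"
    using finite_measure.square_integrable_imp_integrable[OF finite_joint_law L2_index[OF V(2) k] L2_square[OF V(2) k]] .
  then have i3: "integrable (noise_law \<Otimes>\<^sub>M belief) (case_prod (\<lambda>q z. V (q, z) $ k))"
    unfolding joint_law_def by (simp add: split_beta')
  have "AE z in belief. (\<integral>q. ?f q z \<partial>noise_law) = (\<integral>q. ?h q z \<partial>noise_law)"
    using AE_integrable_snd[OF i3] AE_space
  proof eventually_elim
    case (elim z)
    have z: "z \<in> space (seq_borel UNIV (dimy g))" using elim(2) sets_eq_imp_space_eq[OF sets_belief] by simp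
    have "(\<lambda>q. (q, z)) \<in> noise_space \<rightarrow>\<^sub>M joint_space" unfolding joint_space_def using z by (intro measurable_Pair measurable_const) auto
    then have m: "(\<lambda>q. V (q, z) $ k) \<in> borel_measurable noise_space"
      by (intro measurable_vec_index[OF measurable_compose[OF _ Vm] k])
    have "(\<integral>q. V (q, z) $ k * coord (Dist (t + j)) q $ l \<partial>noise_law) = (\<integral>q. V (q, z) $ k \<partial>noise_law) * (\<integral>q. coord (Dist (t + j)) q $ l \<partial>noise_law)"
    proof (rule past_independent[OF m elim(1)])
      fix q q' assume "\<And>r. r \<in> past_sources t \<Longrightarrow> coord r q = coord r q'"
      then have "V (q, z) = V (q', z)" using V(1) unfolding adapted_def by blast
      then show "V (q, z) $ k = V (q', z) $ k" by simp
    qed (use l in \<open>auto simp: past_sources_def intro: coord_integrable[of l "Dist (t + j)", simplified]\<close>)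
    then show ?case using coord_mean(2)[OF l, of "t + j"] by simp
  qed
  then have "(\<integral>z. (\<integral>q. ?f q z \<partial>noise_law) \<partial>belief) = (\<integral>z. (\<integral>q. ?h q z \<partial>noise_law) \<partial>belief)"
    by (intro integral_cong_AE borel_measurable_integrable[OF integrable_snd[OF i1]] borel_measurable_integrable[OF integrable_snd[OF i2]])
  then show ?thesis
    unfolding integral_snd[OF i1] integral_snd[OF i2] joint_law_def by (simp add: split_beta')
qed

end

lemma integral_add3:
  fixes f h e :: "'a \<Rightarrow> real"
  assumes "integrable N f" "integrable N h" "integrable N e"
  shows "(\<integral>x. f x + h x + e x \<partial>N) = (\<integral>x. f x \<partial>N) + (\<integral>x. h x \<partial>N) + (\<integral>x. e x \<partial>N)"
  using assms by simp

context lq_response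
begin

text \<open>The adjoints of the costate and the gradient: matrices that move the data to the other
  side of the scalar product.\<close>

lemma costate_sprod:
  assumes v: "dim_vec v = n" and z: "dim_vec (z t) = d" and w: "dim_vec (w t) = n"
  shows "v \<bullet> costate z w (Suc k) t = ((K * F + L + \<beta> \<cdot>\<^sub>m (C\<^sup>T * (M * P))) *\<^sub>v v) \<bullet> z t
    + ((\<beta> \<cdot>\<^sub>m (M * P)) *\<^sub>v v) \<bullet> w t + ((\<beta> \<cdot>\<^sub>m P) *\<^sub>v v) \<bullet> costate z w k (Suc t)"
proof -
  have "(P *\<^sub>v v) \<bullet> (M *\<^sub>v (C *\<^sub>v z t)) = (C\<^sup>T *\<^sub>v (M *\<^sub>v (P *\<^sub>v v))) \<bullet> z t"
    using v z M_sym[of "P *\<^sub>v v" "C *\<^sub>v z t"] by (simp add: transpose_sprod sprod_comm[of "C *\<^sub>v z t"])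
  moreover have "(P *\<^sub>v v) \<bullet> (M *\<^sub>v w t) = (M *\<^sub>v (P *\<^sub>v v)) \<bullet> w t"
    using v w M_sym[of "P *\<^sub>v v" "w t"] by (simp add: sprod_comm[of "w t"])
  ultimately show ?thesis
    using v z w by (simp add: linear_simps sprod_transpose algebra_simps)
qed

lemma gradient_sprod:
  assumes v: "dim_vec v = m" and z: "dim_vec (z t) = d" and w: "dim_vec (w t) = n"
  shows "v \<bullet> gradient z w k t = ((K + \<beta> \<cdot>\<^sub>m (C\<^sup>T * (M * B))) *\<^sub>v v) \<bullet> z t
    + ((\<beta> \<cdot>\<^sub>m (M * B)) *\<^sub>v v) \<bullet> w t + ((\<beta> \<cdot>\<^sub>m B) *\<^sub>v v) \<bullet> costate z w k (Suc t)"
proof -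
  have "(B *\<^sub>v v) \<bullet> (M *\<^sub>v (C *\<^sub>v z t)) = (C\<^sup>T *\<^sub>v (M *\<^sub>v (B *\<^sub>v v))) \<bullet> z t"
    using v z M_sym[of "B *\<^sub>v v" "C *\<^sub>v z t"] by (simp add: transpose_sprod sprod_comm[of "C *\<^sub>v z t"])
  moreover have "(B *\<^sub>v v) \<bullet> (M *\<^sub>v w t) = (M *\<^sub>v (B *\<^sub>v v)) \<bullet> w t"
    using v w M_sym[of "B *\<^sub>v v" "w t"] by (simp add: sprod_comm[of "w t"])
  ultimately show ?thesis
    using v z w by (simp add: gradient_def linear_simps sprod_transpose algebra_simps)
qed

lemma L2_costate:
  assumes z: "\<And>j. L2 N d (\<lambda>x. z x j)" and w: "\<And>j. L2 N n (\<lambda>x. w x j)" and N: "finite_measure N"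
  shows "L2 N n (\<lambda>x. costate (z x) (w x) k t)"
proof (induction k arbitrary: t)
  case 0
  show ?case unfolding costate.simps by (rule L2_const[OF N]) simp
next
  case (Suc k)
  have 1: "L2 N n (\<lambda>x. F\<^sup>T *\<^sub>v (K\<^sup>T *\<^sub>v z x t))"
    by (rule L2_mult[OF L2_mult[OF z]]) (auto intro!: carrier_matI)
  have 2: "L2 N n (\<lambda>x. L\<^sup>T *\<^sub>v z x t)" by (rule L2_mult[OF z]) (auto intro!: carrier_matI)
  have 3: "L2 N n (\<lambda>x. M *\<^sub>v (C *\<^sub>v z x t + w x t) + costate (z x) (w x) k (Suc t))"
    by (intro L2_add Suc L2_mult[OF L2_add[OF L2_mult[OF z] w]]) (auto intro!: carrier_matI)
  have 4: "L2 N n (\<lambda>x. \<beta> \<cdot>\<^sub>v (P\<^sup>T *\<^sub>v (M *\<^sub>v (C *\<^sub>v z x t + w x t) + costate (z x) (w x) k (Suc t))))"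
    using L2_mult[OF 3, of "\<beta> \<cdot>\<^sub>m P\<^sup>T" n] by (simp add: smult_mat_mult carrier_matI)
  show ?case unfolding costate.simps by (intro L2_add 1 2 4)
qed

lemma L2_gradient:
  assumes z: "\<And>j. L2 N d (\<lambda>x. z x j)" and w: "\<And>j. L2 N n (\<lambda>x. w x j)" and N: "finite_measure N"
  shows "L2 N m (\<lambda>x. gradient (z x) (w x) k t)"
proof -
  have 1: "L2 N m (\<lambda>x. K\<^sup>T *\<^sub>v z x t)" by (rule L2_mult[OF z]) (auto intro!: carrier_matI)
  have 3: "L2 N n (\<lambda>x. M *\<^sub>v (C *\<^sub>v z x t + w x t) + costate (z x) (w x) k (Suc t))"
    by (intro L2_add L2_costate z w N L2_mult[OF L2_add[OF L2_mult[OF z] w]]) (auto intro!: carrier_matI)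
  have 4: "L2 N m (\<lambda>x. \<beta> \<cdot>\<^sub>v (B\<^sup>T *\<^sub>v (M *\<^sub>v (C *\<^sub>v z x t + w x t) + costate (z x) (w x) k (Suc t))))"
    using L2_mult[OF 3, of "\<beta> \<cdot>\<^sub>m B\<^sup>T" m] by (simp add: smult_mat_mult carrier_matI)
  show ?thesis unfolding gradient_def by (intro L2_add 1 4)
qed

end

locale sebeu_dm = sebeu_setting +
  fixes i :: nat
  assumes i: "i \<in> {1..nd}"

sublocale sebeu_dm \<subseteq> dm: lq_response "dimx g i" "dimu g i" "Amat g i" "Bmat g i" "Qmat g i" "Rmat g i" "disc g i"
    "dimy g" "Cmat g i" "Kmat g i" "Lmat g i" "ric_M g i"
  by (rule dm_response[OF i])

context sebeu_dm
begin

lemma i_le: "i \<le> nd"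
  using i by simp

abbreviation "\<beta> \<equiv> disc g i"
abbreviation "mw \<equiv> mean_w g p i"

definition dm_w :: "outcome \<Rightarrow> nat \<Rightarrow> real vec" where
  "dm_w x t = sl i (coord (Dist t) (fst x))"

definition dm_forecast :: "nat \<Rightarrow> outcome \<Rightarrow> nat \<Rightarrow> real vec" where
  "dm_forecast t x j = forecast t j (snd x)"

lemma mw_dim [simp]: "dim_vec mw = dimx g i"
  by (simp add: mean_w_def vec_mean_def)

lemma dm_w_dim [simp]: "dim_vec (dm_w x t) = dimx g i"
  by (simp add: dm_w_def)

lemma dm_forecast_dim [simp]: "dim_vec (dm_forecast t x j) = dimy g"
  by (simp add: dm_forecast_def)

lemma slice_index: "k < dimx g i \<Longrightarrow> sl i v $ k = v $ ((\<Sum>j<i. dimx g j) + k)"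
  by (simp add: slice_def)

lemma slice_index_bound: "k < dimx g i \<Longrightarrow> (\<Sum>j<i. dimx g j) + k < dimX g"
  using slice_bound[of i nd k "dimx g", OF i_le] by (simp add: dimX_eq)

lemma L2_dm_w: "L2 joint_law (dimx g i) (\<lambda>x. dm_w x t)"
  unfolding dm_w_def
proof (rule L2_fst)
  show "(\<lambda>q. sl i (coord (Dist t) q)) \<in> noise_space \<rightarrow>\<^sub>M vec_borel (dimx g i)" using i_le by (intro slice_coord_measurable) auto
  show "integrable noise_law (\<lambda>q. (sl i (coord (Dist t) q) $ k)\<^sup>2)" if "k < dimx g i" for k
    unfolding slice_index[OF that] using slice_index_bound[OF that] by (intro coord_square_integrable) simp
qed

lemma L2_dm_forecast: "L2 joint_law (dimy g) (\<lambda>x. dm_forecast t x j)"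
  unfolding dm_forecast_def by (rule L2_forecast)

lemma mw_eq: "mw = sl i (mean_W g p)"
proof (rule eq_vecI)
  fix k assume "k < dim_vec (sl i (mean_W g p))"
  then have k: "k < dimx g i" by simp
  have "dist_W g p 0 \<omega> $ ((\<Sum>j<i. dimx g j) + k) = dist_w p 0 i \<omega> $ k" if \<omega>: "\<omega> \<in> space (prob_sp p)" for \<omega>
  proof -
    have "dim_vec (dist_w p 0 j \<omega>) = dimx g j" if "j \<le> nd" for j
      using prims that \<omega> by (auto simp: primitive_data_def intro!: measurable_vec_dim[of _ "prob_sp p"])
    then have "sl i (dist_W g p 0 \<omega>) = dist_w p 0 i \<omega>" using i_le by (simp add: dist_W_def slice_vec_stack)
    then show ?thesis using slice_index[OF k, of "dist_W g p 0 \<omega>"] by simp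
  qed
  then show "mw $ k = sl i (mean_W g p) $ k"
    unfolding slice_index[OF k] using k slice_index_bound[OF k]
    by (simp add: mean_w_def mean_W_def vec_mean_def cong: Bochner_Integration.integral_cong)
qed simp

lemma forecast_z:
  assumes V: "adapted t (dimy g) V" "L2 joint_law (dimy g) V"
  shows "(\<integral>x. V x \<bullet> snd x (t + j) \<partial>joint_law) = (\<integral>x. V x \<bullet> dm_forecast t x j \<partial>joint_law)"
  by (rule integral_sprod_eqI[OF V(2) L2_z L2_dm_forecast]) (simp add: dm_forecast_def adapted_forecast_z[OF V])

lemma forecast_w:
  assumes V: "adapted t (dimx g i) V" "L2 joint_law (dimx g i) V"
  shows "(\<integral>x. V x \<bullet> dm_w x (t + j) \<partial>joint_law) = (\<integral>x. V x \<bullet> mw \<partial>joint_law)"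
proof (rule integral_sprod_eqI[OF V(2) L2_dm_w L2_const[OF finite_joint_law mw_dim]])
  fix k assume k: "k < dimx g i"
  show "(\<integral>x. V x $ k * dm_w x (t + j) $ k \<partial>joint_law) = (\<integral>x. V x $ k * mw $ k \<partial>joint_law)"
    unfolding mw_eq dm_w_def slice_index[OF k] by (rule adapted_mean_w[OF V k slice_index_bound[OF k]])
qed

text \<open>The costate is linear in the data, so each term may be replaced by its forecast from the same date
  \<open>t\<close>; the test vector stays adapted when the adjoint matrices are applied to it.\<close>

lemma costate_forecast:
  assumes "adapted t (dimx g i) V" "L2 joint_law (dimx g i) V"
  shows "(\<integral>x. V x \<bullet> dm.costate (snd x) (dm_w x) k (t + j) \<partial>joint_law)
    = (\<integral>x. V x \<bullet> dm.costate (dm_forecast t x) (\<lambda>_. mw) k j \<partial>joint_law)"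
  using assms
proof (induction k arbitrary: V j)
  case 0
  show ?case by simp
next
  case (Suc k)
  note V = Suc.prems
  let ?T1 = "Kmat g i * dm.F + Lmat g i + \<beta> \<cdot>\<^sub>m ((Cmat g i)\<^sup>T * (ric_M g i * dm.P))"
  let ?T2 = "\<beta> \<cdot>\<^sub>m (ric_M g i * dm.P)" and ?T3 = "\<beta> \<cdot>\<^sub>m dm.P"
  have T1: "?T1 \<in> carrier_mat (dimy g) (dimx g i)" and T2: "?T2 \<in> carrier_mat (dimx g i) (dimx g i)"
    and T3: "?T3 \<in> carrier_mat (dimx g i) (dimx g i)" by (auto intro!: carrier_matI)
  note a1 = adapted_mult[OF V(1) T1] L2_mult[OF V(2) T1] and a2 = adapted_mult[OF V(1) T2] L2_mult[OF V(2) T2]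
    and a3 = adapted_mult[OF V(1) T3] L2_mult[OF V(2) T3]
  have vd: "dim_vec (V x) = dimx g i" and zd: "dim_vec (snd x s) = dimy g" if "x \<in> space joint_law" for x s
    using measurable_vec_dim[OF L2_measurable[OF V(2)] that] measurable_vec_dim[OF L2_measurable[OF L2_z] that] by auto
  note Lc = dm.L2_costate[OF L2_z L2_dm_w finite_joint_law] dm.L2_costate[OF L2_dm_forecast L2_const[OF finite_joint_law mw_dim] finite_joint_law]
  have "(\<integral>x. V x \<bullet> dm.costate (snd x) (dm_w x) (Suc k) (t + j) \<partial>joint_law)
      = (\<integral>x. (?T1 *\<^sub>v V x) \<bullet> snd x (t + j) + (?T2 *\<^sub>v V x) \<bullet> dm_w x (t + j)
          + (?T3 *\<^sub>v V x) \<bullet> dm.costate (snd x) (dm_w x) k (t + Suc j) \<partial>joint_law)"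
    unfolding add_Suc_right
    by (rule Bochner_Integration.integral_cong[OF refl], rule dm.costate_sprod) (rule vd zd dm_w_dim; assumption?)+
  also have "\<dots> = (\<integral>x. (?T1 *\<^sub>v V x) \<bullet> dm_forecast t x j \<partial>joint_law) + (\<integral>x. (?T2 *\<^sub>v V x) \<bullet> mw \<partial>joint_law)
      + (\<integral>x. (?T3 *\<^sub>v V x) \<bullet> dm.costate (dm_forecast t x) (\<lambda>_. mw) k (Suc j) \<partial>joint_law)"
    unfolding Suc.IH[OF a3, symmetric] forecast_z[OF a1, symmetric] forecast_w[OF a2, of j, symmetric]
    by (rule integral_add3[OF L2_sprod[OF a1(2) L2_z] L2_sprod[OF a2(2) L2_dm_w] L2_sprod[OF a3(2) Lc(1)]])
  also have "\<dots> = (\<integral>x. (?T1 *\<^sub>v V x) \<bullet> dm_forecast t x j + (?T2 *\<^sub>v V x) \<bullet> mw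
      + (?T3 *\<^sub>v V x) \<bullet> dm.costate (dm_forecast t x) (\<lambda>_. mw) k (Suc j) \<partial>joint_law)"
    by (rule integral_add3[OF L2_sprod[OF a1(2) L2_dm_forecast] L2_sprod[OF a2(2) L2_const[OF finite_joint_law mw_dim]]
        L2_sprod[OF a3(2) Lc(2)], symmetric])
  also have "\<dots> = (\<integral>x. V x \<bullet> dm.costate (dm_forecast t x) (\<lambda>_. mw) (Suc k) j \<partial>joint_law)"
    by (rule Bochner_Integration.integral_cong[OF refl], rule dm.costate_sprod[symmetric]) (rule vd dm_forecast_dim mw_dim; assumption?)+
  finally show ?case .
qed

text \<open>The optimal deviation from the feedback at \<open>t\<close> with \<open>Suc k\<close> periods to go, given the forecasts made at \<open>t\<close>.\<close>

definition dm_finite_opt :: "nat \<Rightarrow> nat \<Rightarrow> outcome \<Rightarrow> real vec" where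
  "dm_finite_opt k t x = dm.finite_response (dm_forecast t x) mw k"

lemma dm_finite_opt_dim [simp]: "dim_vec (dm_finite_opt k t x) = dimu g i"
  by (simp add: dm_finite_opt_def)

text \<open>The first-order condition: tested against adapted vectors, the pathwise gradient is
  represented by the finite-horizon response to the forecasts.\<close>

lemma gradient_forecast:
  assumes V: "adapted t (dimu g i) V" "L2 joint_law (dimu g i) V"
  shows "(\<integral>x. V x \<bullet> dm.gradient (snd x) (dm_w x) k t \<partial>joint_law) = - (\<integral>x. V x \<bullet> (dm.S *\<^sub>v dm_finite_opt k t x) \<partial>joint_law)"
proof -
  let ?T1 = "Kmat g i + \<beta> \<cdot>\<^sub>m ((Cmat g i)\<^sup>T * (ric_M g i * Bmat g i))"
  let ?T2 = "\<beta> \<cdot>\<^sub>m (ric_M g i * Bmat g i)" and ?T3 = "\<beta> \<cdot>\<^sub>m Bmat g i"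
  have T1: "?T1 \<in> carrier_mat (dimy g) (dimu g i)" and T2: "?T2 \<in> carrier_mat (dimx g i) (dimu g i)"
    and T3: "?T3 \<in> carrier_mat (dimx g i) (dimu g i)" by (auto intro!: carrier_matI)
  note a1 = adapted_mult[OF V(1) T1] L2_mult[OF V(2) T1] and a2 = adapted_mult[OF V(1) T2] L2_mult[OF V(2) T2]
    and a3 = adapted_mult[OF V(1) T3] L2_mult[OF V(2) T3]
  have vd: "dim_vec (V x) = dimu g i" and zd: "dim_vec (snd x s) = dimy g" if "x \<in> space joint_law" for x s
    using measurable_vec_dim[OF L2_measurable[OF V(2)] that] measurable_vec_dim[OF L2_measurable[OF L2_z] that] by auto
  note Lc = dm.L2_costate[OF L2_z L2_dm_w finite_joint_law] dm.L2_costate[OF L2_dm_forecast L2_const[OF finite_joint_law mw_dim] finite_joint_law]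
  have c: "(\<integral>x. (?T3 *\<^sub>v V x) \<bullet> dm.costate (snd x) (dm_w x) k (Suc t) \<partial>joint_law)
      = (\<integral>x. (?T3 *\<^sub>v V x) \<bullet> dm.costate (dm_forecast t x) (\<lambda>_. mw) k (Suc 0) \<partial>joint_law)"
    using costate_forecast[OF a3, of k "Suc 0"] by simp
  have z: "(\<integral>x. (?T1 *\<^sub>v V x) \<bullet> snd x t \<partial>joint_law) = (\<integral>x. (?T1 *\<^sub>v V x) \<bullet> dm_forecast t x 0 \<partial>joint_law)"
    using forecast_z[OF a1, of 0] by simp
  have w: "(\<integral>x. (?T2 *\<^sub>v V x) \<bullet> dm_w x t \<partial>joint_law) = (\<integral>x. (?T2 *\<^sub>v V x) \<bullet> mw \<partial>joint_law)"
    using forecast_w[OF a2, of 0] by simp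
  have "(\<integral>x. V x \<bullet> dm.gradient (snd x) (dm_w x) k t \<partial>joint_law)
      = (\<integral>x. (?T1 *\<^sub>v V x) \<bullet> snd x t + (?T2 *\<^sub>v V x) \<bullet> dm_w x t
          + (?T3 *\<^sub>v V x) \<bullet> dm.costate (snd x) (dm_w x) k (Suc t) \<partial>joint_law)"
    by (rule Bochner_Integration.integral_cong[OF refl], rule dm.gradient_sprod) (rule vd zd dm_w_dim; assumption?)+
  also have "\<dots> = (\<integral>x. (?T1 *\<^sub>v V x) \<bullet> dm_forecast t x 0 \<partial>joint_law) + (\<integral>x. (?T2 *\<^sub>v V x) \<bullet> mw \<partial>joint_law)
      + (\<integral>x. (?T3 *\<^sub>v V x) \<bullet> dm.costate (dm_forecast t x) (\<lambda>_. mw) k (Suc 0) \<partial>joint_law)"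
    unfolding c[symmetric] z[symmetric] w[symmetric]
    by (rule integral_add3[OF L2_sprod[OF a1(2) L2_z] L2_sprod[OF a2(2) L2_dm_w] L2_sprod[OF a3(2) Lc(1)]])
  also have "\<dots> = (\<integral>x. (?T1 *\<^sub>v V x) \<bullet> dm_forecast t x 0 + (?T2 *\<^sub>v V x) \<bullet> mw
      + (?T3 *\<^sub>v V x) \<bullet> dm.costate (dm_forecast t x) (\<lambda>_. mw) k (Suc 0) \<partial>joint_law)"
    by (rule integral_add3[OF L2_sprod[OF a1(2) L2_dm_forecast] L2_sprod[OF a2(2) L2_const[OF finite_joint_law mw_dim]]
        L2_sprod[OF a3(2) Lc(2)], symmetric])
  also have "\<dots> = (\<integral>x. - (V x \<bullet> (dm.S *\<^sub>v dm_finite_opt k t x)) \<partial>joint_law)"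
  proof (rule Bochner_Integration.integral_cong[OF refl])
    fix x assume x: "x \<in> space joint_law"
    have "V x \<bullet> dm.gradient (dm_forecast t x) (\<lambda>_. mw) k 0 = - (V x \<bullet> (dm.S *\<^sub>v dm_finite_opt k t x))"
      unfolding dm_finite_opt_def dm.S_finite_response using vd[OF x] by simp
    moreover have "V x \<bullet> dm.gradient (dm_forecast t x) (\<lambda>_. mw) k 0 = (?T1 *\<^sub>v V x) \<bullet> dm_forecast t x 0 + (?T2 *\<^sub>v V x) \<bullet> mw
        + (?T3 *\<^sub>v V x) \<bullet> dm.costate (dm_forecast t x) (\<lambda>_. mw) k (Suc 0)"
      by (rule dm.gradient_sprod) (rule vd[OF x] dm_forecast_dim mw_dim)+
    ultimately show "(?T1 *\<^sub>v V x) \<bullet> dm_forecast t x 0 + (?T2 *\<^sub>v V x) \<bullet> mw + (?T3 *\<^sub>v V x) \<bullet> dm.costate (dm_forecast t x) (\<lambda>_. mw) k (Suc 0)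
        = - (V x \<bullet> (dm.S *\<^sub>v dm_finite_opt k t x))"
      by (simp only:)
  qed
  finally show ?thesis by simp
qed

lemma L2_dm_finite_opt: "L2 joint_law (dimu g i) (dm_finite_opt k t)"
proof -
  have "L2 joint_law (dimu g i) (\<lambda>x. dm.gradient (dm_forecast t x) (\<lambda>_. mw) k 0)"
    by (rule dm.L2_gradient[OF L2_dm_forecast L2_const[OF finite_joint_law mw_dim] finite_joint_law])
  then have "L2 joint_law (dimu g i) (\<lambda>x. (- mat_inv dm.S) *\<^sub>v dm.gradient (dm_forecast t x) (\<lambda>_. mw) k 0)"
    by (rule L2_mult) (auto intro!: carrier_matI)
  then show ?thesis by (simp add: dm_finite_opt_def[abs_def] dm.finite_response_def)
qed

subsection \<open>The error of the finite-horizon responses\<close>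

definition dm_opt :: "nat \<Rightarrow> outcome \<Rightarrow> real vec" where
  "dm_opt t x = resp i (est t (\<lambda>k\<in>{..<t}. snd x k))"

lemma dm_opt_dim [simp]: "dim_vec (dm_opt t x) = dimu g i"
  using i by (simp add: dm_opt_def)

lemma dm_opt_measurable: "dm_opt t \<in> joint_law \<rightarrow>\<^sub>M vec_borel (dimu g i)"
  unfolding measurable_joint_law dm_opt_def[abs_def] resp_def joint_space_def
  by (intro measurable_vec_add measurable_mult_mat_vec[OF _ measurable_compose[OF measurable_snd zest_measurable]]
      measurable_vec_const lim_H_dim i) (auto intro!: carrier_matI)

text \<open>Pathwise the error is the tail of the gain series, applied to the forecasts, and a remainder; both
  are of order $\beta^{(k+1)/2}$ because the forecasts are bounded in mean square.\<close>

lemma response_error: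
  obtains c where "c \<ge> 0"
    "\<And>k t m. m < dimu g i \<Longrightarrow> integrable joint_law (\<lambda>x. (dm_opt t x $ m - dm_finite_opt k t x $ m)\<^sup>2)"
    "\<And>k t m. m < dimu g i \<Longrightarrow> (\<integral>x. (dm_opt t x $ m - dm_finite_opt k t x $ m)\<^sup>2 \<partial>joint_law) \<le> c * \<beta>^Suc k"
proof -
  obtain cg where cg: "cg \<ge> 0" "\<And>n. norm_bound (dm.gain_G n) (cg * dm.\<theta>^n)" using dm.gain_G_bound by blast
  obtain cr \<rho> where cr: "cr \<ge> 0" "\<And>k m. m < dimu g i \<Longrightarrow> \<bar>\<rho> k m\<bar> \<le> cr * dm.\<theta>^Suc k"
    and fr: "\<And>z k m. (\<And>j. dim_vec (z j) = dimy g) \<Longrightarrow> m < dimu g i \<Longrightarrow>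
      dm.finite_response z mw k $ m = (\<Sum>j<Suc k. (dm.gain_G j *\<^sub>v z j) $ m) + dm.gain_H mw $ m - \<rho> k m"
    using dm.finite_response_tail[OF mw_dim] by blast
  obtain cz where cz: "cz \<ge> 0" "\<And>t n k. k < dimy g \<Longrightarrow> integrable belief (\<lambda>z. (forecast t n z $ k)\<^sup>2)"
    "\<And>t n k. k < dimy g \<Longrightarrow> (\<integral>z. (forecast t n z $ k)\<^sup>2 \<partial>belief) \<le> cz" by (rule belief_second_moments) blast
  have G: "dm.gain_G n = opt_G g i n" for n using dm_gains(2)[OF i] by simp
  define s where "s t n x = cg * (\<Sum>l<dimy g. \<bar>dm_forecast t x n $ l\<bar>)" for t n x
  have fm: "(\<lambda>x. dm_forecast t x n $ l) \<in> borel_measurable joint_law" if "l < dimy g" for t n l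
    using L2_index[OF L2_dm_forecast that] .
  have s_sq: "(s t n x)\<^sup>2 = cg\<^sup>2 * (\<Sum>l<dimy g. \<Sum>l'<dimy g. \<bar>dm_forecast t x n $ l * dm_forecast t x n $ l'\<bar>)" for t n x
    by (simp add: s_def power_mult_distrib power2_eq_square[of "sum _ _"] sum_product abs_mult)
  have s_int: "integrable joint_law (\<lambda>x. (s t n x)\<^sup>2)" for t n
    unfolding s_sq by (intro integrable_mult_right Bochner_Integration.integrable_sum integrable_abs L2_product[OF L2_dm_forecast L2_dm_forecast]) auto
  have fc2: "(\<integral>x. (dm_forecast t x n $ l)\<^sup>2 \<partial>joint_law) \<le> cz" if l: "l < dimy g" for t n l
  proof -
    have m: "(\<lambda>z. (forecast t n z $ l)\<^sup>2) \<in> borel_measurable belief" using borel_measurable_integrable[OF cz(2)[OF l]] .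
    have "(\<integral>x. (dm_forecast t x n $ l)\<^sup>2 \<partial>joint_law) = (\<integral>z. (forecast t n z $ l)\<^sup>2 \<partial>distr joint_law belief snd)"
      unfolding dm_forecast_def by (rule integral_distr[OF _ m, symmetric]) (simp add: joint_law_def)
    then show ?thesis using cz(3)[OF l] by (simp add: distr_snd)
  qed
  define cs where "cs = cg\<^sup>2 * (real (dimy g) * (real (dimy g) * cz))"
  have cs0: "cs \<ge> 0" using cz by (simp add: cs_def)
  have s_le: "(\<integral>x. (s t n x)\<^sup>2 \<partial>joint_law) \<le> cs" for t n
  proof -
    have "(s t n x)\<^sup>2 \<le> cg\<^sup>2 * (real (dimy g) * (\<Sum>l<dimy g. (dm_forecast t x n $ l)\<^sup>2))" for x
    proof -
      have "(\<Sum>l<dimy g. \<bar>dm_forecast t x n $ l\<bar>)\<^sup>2 \<le> (\<Sum>l<dimy g. 1\<^sup>2) * (\<Sum>l<dimy g. \<bar>dm_forecast t x n $ l\<bar>\<^sup>2)"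
        using Cauchy_Schwarz_ineq_sum[of "\<lambda>_. 1" "\<lambda>l. \<bar>dm_forecast t x n $ l\<bar>" "{..<dimy g}"] by simp
      then show ?thesis unfolding s_def power_mult_distrib by (intro mult_left_mono) auto
    qed
    then have "(\<integral>x. (s t n x)\<^sup>2 \<partial>joint_law) \<le> (\<integral>x. cg\<^sup>2 * (real (dimy g) * (\<Sum>l<dimy g. (dm_forecast t x n $ l)\<^sup>2)) \<partial>joint_law)"
      by (intro integral_mono s_int integrable_mult_right Bochner_Integration.integrable_sum L2_square[OF L2_dm_forecast]) auto
    also have "\<dots> = cg\<^sup>2 * (real (dimy g) * (\<Sum>l<dimy g. \<integral>x. (dm_forecast t x n $ l)\<^sup>2 \<partial>joint_law))"
      using L2_square[OF L2_dm_forecast] by (simp add: Bochner_Integration.integral_sum)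
    also have "\<dots> \<le> cg\<^sup>2 * (real (dimy g) * (\<Sum>l<dimy g. cz))"
      using fc2 by (intro mult_left_mono sum_mono) auto
    also have "\<dots> = cs" by (simp add: cs_def)
    finally show ?thesis .
  qed
  define f where "f t m n x = (dm.gain_G n *\<^sub>v dm_forecast t x n) $ m" for t m n x
  have Gc: "dm.gain_G n \<in> carrier_mat (dimu g i) (dimy g)" for n by (auto intro!: carrier_matI)
  have f_meas: "f t m n \<in> borel_measurable joint_law" if "m < dimu g i" for t m n
    unfolding f_def[abs_def] by (rule L2_index[OF L2_mult[OF L2_dm_forecast Gc] that])
  have f_bound: "\<bar>f t m n x\<bar> \<le> dm.\<theta>^n * s t n x" if m: "m < dimu g i" for t m n x
  proof -
    have eq: "f t m n x = (\<Sum>l<dimy g. dm.gain_G n $$ (m, l) * dm_forecast t x n $ l)"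
      using m by (simp add: f_def scalar_prod_def atLeast0LessThan)
    have "\<bar>f t m n x\<bar> \<le> (\<Sum>l<dimy g. \<bar>dm.gain_G n $$ (m, l)\<bar> * \<bar>dm_forecast t x n $ l\<bar>)"
      unfolding eq by (rule order_trans[OF sum_abs]) (simp add: abs_mult)
    also have "\<dots> \<le> (\<Sum>l<dimy g. (cg * dm.\<theta>^n) * \<bar>dm_forecast t x n $ l\<bar>)"
    proof (intro sum_mono mult_right_mono)
      fix l assume "l \<in> {..<dimy g}"
      then show "\<bar>dm.gain_G n $$ (m, l)\<bar> \<le> cg * dm.\<theta>^n"
        using cg(2)[of n] m unfolding norm_bound_def by (simp only: dm.gain_dims2 real_norm_def lessThan_iff)
    qed simp
    also have "\<dots> = dm.\<theta>^n * s t n x" unfolding s_def sum_distrib_left[symmetric] by simp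
    finally show ?thesis .
  qed
  have ed: "dim_vec (est t (\<lambda>k\<in>{..<t}. snd x k)) = dimX g" if "x \<in> space joint_law" for t x
  proof -
    have "(\<lambda>x. est t (\<lambda>k\<in>{..<t}. snd x k)) \<in> joint_law \<rightarrow>\<^sub>M vec_borel (dimX g)"
      unfolding measurable_joint_law joint_space_def by (rule measurable_compose[OF measurable_snd zest_measurable])
    then show ?thesis using that by (rule measurable_vec_dim)
  qed
  have f_sum: "summable (\<lambda>n. f t m n x)" if "x \<in> space joint_law" "m < dimu g i" for t m x
    using yhat_series(1)[OF opt_G_summable[OF i] ed[OF that(1)] that(2)] by (simp add: f_def G dm_forecast_def forecast_def)
  have diff: "dm_opt t x $ m - dm_finite_opt k t x $ m = (\<Sum>n. f t m (n + Suc k) x) + \<rho> k m" if x: "x \<in> space joint_law" and m: "m < dimu g i" for t m k x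
  proof -
    have "dm_opt t x $ m = (\<Sum>n. f t m n x) + dm.gain_H mw $ m"
      using resp_eq[OF i ed[OF x]] m by (simp add: dm_opt_def vec_suminf_def f_def G dm_forecast_def forecast_def dm_gains(3)[OF i] del: index_mult_mat_vec)
    moreover have "dm_finite_opt k t x $ m = (\<Sum>n<Suc k. f t m n x) + dm.gain_H mw $ m - \<rho> k m"
      unfolding dm_finite_opt_def f_def by (rule fr[OF dm_forecast_dim m])
    moreover have "(\<Sum>n. f t m n x) = (\<Sum>n. f t m (n + Suc k) x) + (\<Sum>n<Suc k. f t m n x)"
      by (rule suminf_split_initial_segment[OF f_sum[OF x m]])
    ultimately show ?thesis by simp
  qed
  note th = dm.theta
  have s_meas: "s t n \<in> borel_measurable joint_law" for t n
    unfolding s_def[abs_def] by (intro borel_measurable_times borel_measurable_const borel_measurable_sum borel_measurable_abs fm) auto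
  define c where "c = 2 * ((1 / (1 - dm.\<theta>))\<^sup>2 * cs) + 2 * cr\<^sup>2"
  have c0: "c \<ge> 0" using cs0 by (simp add: c_def)
  have main: "integrable joint_law (\<lambda>x. (dm_opt t x $ m - dm_finite_opt k t x $ m)\<^sup>2) \<and>
      (\<integral>x. (dm_opt t x $ m - dm_finite_opt k t x $ m)\<^sup>2 \<partial>joint_law) \<le> c * \<beta>^Suc k" if m: "m < dimu g i" for k t m
  proof -
    interpret PP: prob_space joint_law by (rule prob_joint_law)
    define q where "q x = (\<Sum>n. f t m (n + Suc k) x)" for x
    have q1: "integrable joint_law (\<lambda>x. (q x)\<^sup>2)" and q2: "(\<integral>x. (q x)\<^sup>2 \<partial>joint_law) \<le> (dm.\<theta>^Suc k / (1 - dm.\<theta>))\<^sup>2 * cs"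
      unfolding q_def
      using geometric_tail_second_moment[where N = joint_law and f = "f t m" and s = "s t" and r = dm.\<theta> and C = cs and K = "Suc k",
          OF f_meas[OF m] s_meas s_int f_bound[OF m] s_le cs0 th(1,2) f_sum[OF _ m]] by blast+
    have ub: "(dm_opt t x $ m - dm_finite_opt k t x $ m)\<^sup>2 \<le> 2 * (q x)\<^sup>2 + 2 * (\<rho> k m)\<^sup>2" if "x \<in> space joint_law" for x
    proof -
      have "0 \<le> (q x - \<rho> k m)\<^sup>2" by simp
      then show ?thesis unfolding diff[OF that m] q_def[symmetric] by (simp add: power2_sum power2_diff)
    qed
    have rhs: "integrable joint_law (\<lambda>x. 2 * (q x)\<^sup>2 + 2 * (\<rho> k m)\<^sup>2)" using q1 by simp
    have mm: "(\<lambda>x. (dm_opt t x $ m - dm_finite_opt k t x $ m)\<^sup>2) \<in> borel_measurable joint_law"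
      by (intro borel_measurable_power borel_measurable_diff measurable_vec_index[OF dm_opt_measurable m] L2_index[OF L2_dm_finite_opt m])
    have int: "integrable joint_law (\<lambda>x. (dm_opt t x $ m - dm_finite_opt k t x $ m)\<^sup>2)"
      by (rule Bochner_Integration.integrable_bound[OF rhs mm]) (use ub in auto)
    have "(\<rho> k m)\<^sup>2 \<le> (cr * dm.\<theta>^Suc k)\<^sup>2" using cr(2)[OF m, of k] cr(1) th(1) by (simp add: abs_le_square_iff[symmetric] abs_mult)
    moreover have "(dm.\<theta>^Suc k)\<^sup>2 = \<beta>^Suc k" using th(3) by (metis power_mult mult.commute)
    ultimately have rho: "(\<rho> k m)\<^sup>2 \<le> cr\<^sup>2 * \<beta>^Suc k" by (simp only: power_mult_distrib)
    have "(\<integral>x. (dm_opt t x $ m - dm_finite_opt k t x $ m)\<^sup>2 \<partial>joint_law) \<le> (\<integral>x. 2 * (q x)\<^sup>2 + 2 * (\<rho> k m)\<^sup>2 \<partial>joint_law)"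
      by (rule integral_mono[OF int rhs ub])
    also have "\<dots> = 2 * (\<integral>x. (q x)\<^sup>2 \<partial>joint_law) + 2 * (\<rho> k m)\<^sup>2" using q1 by (simp add: PP.prob_space)
    also have "\<dots> \<le> 2 * ((dm.\<theta>^Suc k / (1 - dm.\<theta>))\<^sup>2 * cs) + 2 * (cr\<^sup>2 * \<beta>^Suc k)" using q2 rho by simp
    also have "\<dots> = c * \<beta>^Suc k"
      using \<open>(dm.\<theta>^Suc k)\<^sup>2 = \<beta>^Suc k\<close> by (simp only: c_def power_divide) (simp add: algebra_simps)
    finally show ?thesis using int by simp
  qed
  then show ?thesis using that[OF c0] by blast
qed

lemma L2_dm_opt: "L2 joint_law (dimu g i) (dm_opt t)"
proof -
  have "\<And>m. m < dimu g i \<Longrightarrow> integrable joint_law (\<lambda>x. (dm_opt t x $ m - dm_finite_opt 0 t x $ m)\<^sup>2)"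
    by (rule response_error) blast
  then have "L2 joint_law (dimu g i) (\<lambda>x. dm_opt t x - dm_finite_opt 0 t x)"
    by (intro L2I measurable_vec_minus dm_opt_measurable L2_measurable[OF L2_dm_finite_opt]) simp
  from L2_add[OF this L2_dm_finite_opt[of 0 t]] have "L2 joint_law (dimu g i) (\<lambda>x. (dm_opt t x - dm_finite_opt 0 t x) + dm_finite_opt 0 t x)" .
  moreover have "(dm_opt t x - dm_finite_opt 0 t x) + dm_finite_opt 0 t x = dm_opt t x" for x by (rule eq_vecI) auto
  ultimately show ?thesis by simp
qed

end

section \<open>Optimality of the candidate strategies\<close>

context sebeu_dm
begin

definition dm_x :: "strategy \<Rightarrow> outcome \<Rightarrow> nat \<Rightarrow> real vec" where
  "dm_x s x t = subj_x g i s (sl i (coord Init (fst x))) (dm_w x) (snd x) t"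

definition dm_u :: "strategy \<Rightarrow> outcome \<Rightarrow> nat \<Rightarrow> real vec" where
  "dm_u s x t = subj_u g i s (sl i (coord Init (fst x))) (dm_w x) (snd x) t"

definition dm_v :: "strategy \<Rightarrow> nat \<Rightarrow> outcome \<Rightarrow> real vec" where
  "dm_v s t x = dm_u s x t - dm.F *\<^sub>v dm_x s x t"

lemma dm_x_0: "dm_x s x 0 = sl i (coord Init (fst x))"
  by (simp add: dm_x_def)

lemma dm_x_Suc: "dm_x s x (Suc t) = Amat g i *\<^sub>v dm_x s x t + Bmat g i *\<^sub>v dm_u s x t + Cmat g i *\<^sub>v snd x t + dm_w x t"
  by (simp add: dm_x_def dm_u_def)

lemma dm_xu_measurable:
  assumes s: "s \<in> strategies g i"
  shows "(\<lambda>x. dm_x s x t) \<in> joint_space \<rightarrow>\<^sub>M vec_borel (dimx g i)" "(\<lambda>x. dm_u s x t) \<in> joint_space \<rightarrow>\<^sub>M vec_borel (dimu g i)"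
proof -
  have x0: "(\<lambda>x. sl i (coord Init (fst x))) \<in> joint_space \<rightarrow>\<^sub>M vec_borel (dimx g i)"
    unfolding joint_space_def by (rule measurable_compose[OF measurable_fst slice_coord_measurable]) (use i_le in auto)
  have w: "(\<lambda>x. dm_w x t) \<in> joint_space \<rightarrow>\<^sub>M vec_borel (dimx g i)" for t
    using L2_measurable[OF L2_dm_w] unfolding measurable_joint_law .
  have z: "(\<lambda>x. snd x t) \<in> joint_space \<rightarrow>\<^sub>M vec_borel (dimy g)" for t
    using L2_measurable[OF L2_z] unfolding measurable_joint_law .
  show "(\<lambda>x. dm_x s x t) \<in> joint_space \<rightarrow>\<^sub>M vec_borel (dimx g i)" "(\<lambda>x. dm_u s x t) \<in> joint_space \<rightarrow>\<^sub>M vec_borel (dimu g i)"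
    using measurable_subj[OF game i s x0 w z] unfolding dm_x_def dm_u_def by simp_all
qed

lemma dm_xu_adapted:
  assumes s: "s \<in> strategies g i"
  shows "adapted t (dimx g i) (\<lambda>x. dm_x s x t)" "adapted t (dimu g i) (\<lambda>x. dm_u s x t)"
proof -
  have eq: "dm_x s (q, z) t = dm_x s (q', z') t \<and> dm_u s (q, z) t = dm_u s (q', z') t"
    if "\<forall>r\<in>past_sources t. coord r q = coord r q'" "\<forall>k<t. z k = z' k" for q q' z z'
  proof -
    have "coord Init q = coord Init q'" using that(1) by (simp add: past_sources_def del: coord.simps)
    moreover have "dm_w (q, z) k = dm_w (q', z') k" if "k < t" for k
    proof -
      have "Dist k \<in> past_sources t" using that by (simp add: past_sources_def)
      then have "coord (Dist k) q = coord (Dist k) q'" using \<open>\<forall>r\<in>past_sources t. coord r q = coord r q'\<close> by blast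
      then show ?thesis by (simp only: dm_w_def fst_conv)
    qed
    ultimately show ?thesis
      unfolding dm_x_def dm_u_def fst_conv snd_conv using subj_cong[of t "dm_w (q, z)" "dm_w (q', z')" z z' g i s] that(2) by metis
  qed
  then show "adapted t (dimx g i) (\<lambda>x. dm_x s x t)" "adapted t (dimu g i) (\<lambda>x. dm_u s x t)"
    unfolding adapted_def using dm_xu_measurable[OF s] by blast+
qed

lemma F_carrier: "dm.F \<in> carrier_mat (dimu g i) (dimx g i)"
  by (auto intro!: carrier_matI)

lemma dm_v_adapted: "s \<in> strategies g i \<Longrightarrow> adapted t (dimu g i) (dm_v s t)"
  unfolding dm_v_def[abs_def] by (intro adapted_minus adapted_mult[OF _ F_carrier] dm_xu_adapted)

lemma dm_dims:
  assumes "s \<in> strategies g i" "x \<in> space joint_law"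
  shows "dim_vec (dm_x s x t) = dimx g i" "dim_vec (dm_u s x t) = dimu g i" "dim_vec (snd x t) = dimy g" "dim_vec (dm_v s t x) = dimu g i"
proof -
  have "x \<in> space joint_space" using assms(2) unfolding joint_space_def joint_law_def space_pair_measure
    using sets_eq_imp_space_eq[OF sets_noise_law] sets_eq_imp_space_eq[OF sets_belief] by simp
  show 1: "dim_vec (dm_x s x t) = dimx g i"
    by (rule measurable_vec_dim[OF dm_xu_measurable(1)[OF assms(1)] \<open>x \<in> space joint_space\<close>])
  show 2: "dim_vec (dm_u s x t) = dimu g i"
    by (rule measurable_vec_dim[OF dm_xu_measurable(2)[OF assms(1)] \<open>x \<in> space joint_space\<close>])
  show "dim_vec (snd x t) = dimy g" using measurable_vec_dim[OF L2_measurable[OF L2_z] assms(2)] .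
  show "dim_vec (dm_v s t x) = dimu g i" by (simp add: dm_v_def)
qed

lemma L2_dm_x_0: "L2 joint_law (dimx g i) (\<lambda>x. dm_x s x 0)"
  unfolding dm_x_0
proof (rule L2_fst)
  show "(\<lambda>q. sl i (coord Init q)) \<in> noise_space \<rightarrow>\<^sub>M vec_borel (dimx g i)" using i_le by (intro slice_coord_measurable) auto
  show "integrable noise_law (\<lambda>q. (sl i (coord Init q) $ k)\<^sup>2)" if "k < dimx g i" for k
    unfolding slice_index[OF that] using slice_index_bound[OF that] by (intro coord_square_integrable) simp
qed

lemma L2_dm_x_Suc:
  assumes "L2 joint_law (dimx g i) (\<lambda>x. dm_x s x t)" "L2 joint_law (dimu g i) (\<lambda>x. dm_u s x t)"
  shows "L2 joint_law (dimx g i) (\<lambda>x. dm_x s x (Suc t))"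
  unfolding dm_x_Suc
  by (intro L2_add L2_mult[OF assms(1)] L2_mult[OF assms(2)] L2_mult[OF L2_z] L2_dm_w) (auto intro!: carrier_matI)

lemma L2_dm_v:
  assumes "L2 joint_law (dimx g i) (\<lambda>x. dm_x s x t)" "L2 joint_law (dimu g i) (\<lambda>x. dm_u s x t)"
  shows "L2 joint_law (dimu g i) (dm_v s t)"
  unfolding dm_v_def[abs_def] by (intro L2_minus assms L2_mult[OF assms(1) F_carrier])

lemma dm_u_eq_strat: "dm_u (eq_strat i) x t = dm.F *\<^sub>v dm_x (eq_strat i) x t + dm_opt t x"
  unfolding dm_u_def subj_u.simps[of _ _ _ _ _ _ t]
  by (rule eq_vecI)
    (simp_all add: eq_strat_def dm_x_def dm_opt_def resp_def dm_gains(1)[OF i] lim_H_dim[OF i] del: index_mult_mat_vec)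

lemma L2_eq_strat:
  "L2 joint_law (dimx g i) (\<lambda>x. dm_x (eq_strat i) x t)" "L2 joint_law (dimu g i) (\<lambda>x. dm_u (eq_strat i) x t)"
proof -
  have u: "L2 joint_law (dimu g i) (\<lambda>x. dm_u (eq_strat i) x t)" if "L2 joint_law (dimx g i) (\<lambda>x. dm_x (eq_strat i) x t)" for t
    unfolding dm_u_eq_strat by (intro L2_add L2_mult[OF that F_carrier] L2_dm_opt)
  show x: "L2 joint_law (dimx g i) (\<lambda>x. dm_x (eq_strat i) x t)"
    by (induction t) (use L2_dm_x_0 L2_dm_x_Suc u in auto)
  show "L2 joint_law (dimu g i) (\<lambda>x. dm_u (eq_strat i) x t)" by (rule u[OF x])
qed

lemma dm_v_eq_strat: "x \<in> space joint_law \<Longrightarrow> dm_v (eq_strat i) t x = dm_opt t x"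
  unfolding dm_v_def dm_u_eq_strat by (rule eq_vecI) (simp_all del: index_mult_mat_vec)

lemma stage_eq: "dm.stage x u y = stage_cost g i x u y"
  by (simp add: dm.stage_def stage_cost_def)

definition dm_cost :: "strategy \<Rightarrow> nat \<Rightarrow> real" where
  "dm_cost s t = (\<integral>x. stage_cost g i (dm_x s x t) (dm_u s x t) (snd x t) \<partial>joint_law)"

lemma stage_integrable:
  assumes "L2 joint_law (dimx g i) (\<lambda>x. dm_x s x t)" "L2 joint_law (dimu g i) (\<lambda>x. dm_u s x t)"
  shows "integrable joint_law (\<lambda>x. stage_cost g i (dm_x s x t) (dm_u s x t) (snd x t))"
proof -
  have "L2 joint_law (dimy g) (\<lambda>x. Kmat g i *\<^sub>v dm_u s x t + Lmat g i *\<^sub>v dm_x s x t)"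
    by (intro L2_add L2_mult[OF assms(1)] L2_mult[OF assms(2)]) (auto intro!: carrier_matI)
  from L2_sprod[OF L2_z this] show ?thesis
    unfolding stage_cost_def
    using L2_quad_form[OF dm.QR_carrier(1) assms(1)] L2_quad_form[OF dm.QR_carrier(2) assms(2)] by simp
qed

lemma S_symmetric: "dm.S\<^sup>T = dm.S" "dm.S \<in> carrier_mat (dimu g i) (dimu g i)"
  using dm.S_of_pos_def[OF dm.M] by (auto simp: pos_def_def)

text \<open>What the completion of squares leaves of the finite-horizon cost when the terms in the deviation from
  the feedback are removed; it is the same for all strategies.\<close>

definition common_cost :: "nat \<Rightarrow> strategy \<Rightarrow> outcome \<Rightarrow> real" where
  "common_cost T s x = (\<Sum>j<T. \<beta>^j * stage_cost g i (dm_x s x j) (dm_u s x j) (snd x j)) + \<beta>^T * quad_form (ric_M g i) (dm_x s x T)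
     - (\<Sum>j<T. \<beta>^j * (quad_form dm.S (dm_v s j x) + 2 * (dm_v s j x \<bullet> dm.gradient (snd x) (dm_w x) (T - Suc j) j)))"

lemma common_cost_eq:
  assumes s: "s \<in> strategies g i" and s': "s' \<in> strategies g i" and x: "x \<in> space joint_law"
  shows "common_cost T s x = common_cost T s' x"
proof -
  have "dim_vec (dm_x s' x 0) = dimx g i" "dm_x s x 0 = dm_x s' x 0" by (simp_all add: dm_x_0)
  note c = dm.finite_horizon_comparison[of "snd x" "dm_w x" "dm_u s' x" "dm_u s x" "dm_x s' x" "dm_x s x" T,
      OF dm_dims(3)[OF s x] dm_w_dim dm_dims(2)[OF s' x] dm_dims(2)[OF s x] this dm_x_Suc dm_x_Suc]
  show ?thesis using c unfolding stage_eq dm_v_def[symmetric] common_cost_def .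
qed

text \<open>With the gradient represented by the response \<open>r\<close>, the control-dependent terms become
  \<open>v'Sv - 2 v'Sr = (v - r)'S(v - r) - r'Sr\<close>. The subtracted part is the same for all strategies.\<close>

lemma common_cost_integral:
  assumes s: "s \<in> strategies g i"
    and sq: "\<And>t. t < T \<Longrightarrow> L2 joint_law (dimx g i) (\<lambda>x. dm_x s x t)" "\<And>t. t < T \<Longrightarrow> L2 joint_law (dimu g i) (\<lambda>x. dm_u s x t)"
    and sqT: "L2 joint_law (dimx g i) (\<lambda>x. dm_x s x T)"
  shows "(\<integral>x. common_cost T s x \<partial>joint_law) = (\<Sum>j<T. \<beta>^j * dm_cost s j) + \<beta>^T * (\<integral>x. quad_form (ric_M g i) (dm_x s x T) \<partial>joint_law)
     - (\<Sum>j<T. \<beta>^j * ((\<integral>x. quad_form dm.S (dm_v s j x - dm_finite_opt (T - Suc j) j x) \<partial>joint_law)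
          - (\<integral>x. quad_form dm.S (dm_finite_opt (T - Suc j) j x) \<partial>joint_law)))"
proof -
  let ?gr = "\<lambda>j x. dm.gradient (snd x) (dm_w x) (T - Suc j) j"
  let ?r = "\<lambda>j. dm_finite_opt (T - Suc j) j"
  have v: "L2 joint_law (dimu g i) (dm_v s j)" if "j < T" for j using L2_dm_v[OF sq[OF that]] .
  have gr: "L2 joint_law (dimu g i) (?gr j)" for j by (rule dm.L2_gradient[OF L2_z L2_dm_w finite_joint_law])
  have Mc: "ric_M g i \<in> carrier_mat (dimx g i) (dimx g i)" using dm.psd_dims[OF dm.M] by blast
  note i1 = stage_integrable[OF sq] and i2 = L2_quad_form[OF Mc sqT]
    and i3 = L2_quad_form[OF S_symmetric(2) v] and i4 = L2_sprod[OF v gr]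
  have one: "(\<integral>x. quad_form dm.S (dm_v s j x) + 2 * (dm_v s j x \<bullet> ?gr j x) \<partial>joint_law)
      = (\<integral>x. quad_form dm.S (dm_v s j x - ?r j x) \<partial>joint_law) - (\<integral>x. quad_form dm.S (?r j x) \<partial>joint_law)" if j: "j < T" for j
  proof -
    note Sr = L2_mult[OF L2_dm_finite_opt[of "T - Suc j" j] S_symmetric(2)]
    note i5 = L2_quad_form[OF S_symmetric(2) L2_dm_finite_opt[of "T - Suc j" j]]
      and i6 = L2_quad_form[OF S_symmetric(2) L2_minus[OF v[OF j] L2_dm_finite_opt[of "T - Suc j" j]]]
      and i7 = L2_sprod[OF v[OF j] Sr]
    have "(\<integral>x. quad_form dm.S (dm_v s j x) + 2 * (dm_v s j x \<bullet> ?gr j x) \<partial>joint_law)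
        = (\<integral>x. quad_form dm.S (dm_v s j x) \<partial>joint_law) - 2 * (\<integral>x. dm_v s j x \<bullet> (dm.S *\<^sub>v ?r j x) \<partial>joint_law)"
      using gradient_forecast[OF dm_v_adapted[OF s] v[OF j], of "T - Suc j"] i3[OF j] i4[OF j] by simp
    also have "\<dots> = (\<integral>x. quad_form dm.S (dm_v s j x) - 2 * (dm_v s j x \<bullet> (dm.S *\<^sub>v ?r j x)) \<partial>joint_law)"
      using i3[OF j] i7 by simp
    also have "\<dots> = (\<integral>x. quad_form dm.S (dm_v s j x - ?r j x) - quad_form dm.S (?r j x) \<partial>joint_law)"
    proof (rule Bochner_Integration.integral_cong[OF refl])
      fix x assume x: "x \<in> space joint_law"
      have "?r j x \<bullet> (dm.S *\<^sub>v dm_v s j x) = dm_v s j x \<bullet> (dm.S *\<^sub>v ?r j x)"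
        by (rule symmetric_sprod[OF S_symmetric(1)]) (simp_all add: dm_dims(4)[OF s x])
      then show "quad_form dm.S (dm_v s j x) - 2 * (dm_v s j x \<bullet> (dm.S *\<^sub>v ?r j x)) = quad_form dm.S (dm_v s j x - ?r j x) - quad_form dm.S (?r j x)"
        by (simp add: quad_form_def linear_simps dm_dims(4)[OF s x])
    qed
    also have "\<dots> = (\<integral>x. quad_form dm.S (dm_v s j x - ?r j x) \<partial>joint_law) - (\<integral>x. quad_form dm.S (?r j x) \<partial>joint_law)"
      by (rule Bochner_Integration.integral_diff[OF i6 i5])
    finally show ?thesis .
  qed
  let ?a = "\<lambda>x. \<Sum>j<T. \<beta>^j * stage_cost g i (dm_x s x j) (dm_u s x j) (snd x j)"
  let ?b = "\<lambda>x. \<beta>^T * quad_form (ric_M g i) (dm_x s x T)"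
  let ?c = "\<lambda>x. \<Sum>j<T. \<beta>^j * (quad_form dm.S (dm_v s j x) + 2 * (dm_v s j x \<bullet> ?gr j x))"
  have ia: "integrable joint_law ?a" by (intro Bochner_Integration.integrable_sum integrable_mult_right i1) auto
  have ib: "integrable joint_law ?b" by (intro integrable_mult_right i2)
  have ic1: "integrable joint_law (\<lambda>x. quad_form dm.S (dm_v s j x) + 2 * (dm_v s j x \<bullet> ?gr j x))" if "j < T" for j
    using i3[OF that] i4[OF that] by simp
  have ic: "integrable joint_law ?c" by (intro Bochner_Integration.integrable_sum integrable_mult_right ic1) auto
  have "(\<integral>x. common_cost T s x \<partial>joint_law) = (\<integral>x. ?a x \<partial>joint_law) + (\<integral>x. ?b x \<partial>joint_law) - (\<integral>x. ?c x \<partial>joint_law)"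
    unfolding common_cost_def using ia ib ic by simp
  moreover have "(\<integral>x. ?a x \<partial>joint_law) = (\<Sum>j<T. \<beta>^j * dm_cost s j)"
    by (subst Bochner_Integration.integral_sum) (auto simp: dm_cost_def intro!: integrable_mult_right i1)
  moreover have "(\<integral>x. ?c x \<partial>joint_law) = (\<Sum>j<T. \<beta>^j * ((\<integral>x. quad_form dm.S (dm_v s j x - ?r j x) \<partial>joint_law) - (\<integral>x. quad_form dm.S (?r j x) \<partial>joint_law)))"
    by (subst Bochner_Integration.integral_sum) (auto simp: one intro!: integrable_mult_right ic1)
  ultimately show ?thesis by simp
qed

text \<open>In period \<open>j\<close> the candidate deviates from the optimal response over the remaining
  \<open>T - j\<close> periods by an error of order \<open>\<beta>^(T - j)\<close> in mean square; discounted to date 0 this is of order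
  \<open>\<beta>^T\<close> in each of the \<open>T\<close> periods.\<close>

lemma finite_horizon_optimality:
  obtains c where "c \<ge> 0"
    "\<And>T s. s \<in> strategies g i \<Longrightarrow> (\<And>t. t < T \<Longrightarrow> L2 joint_law (dimx g i) (\<lambda>x. dm_x s x t)) \<Longrightarrow>
      (\<And>t. t < T \<Longrightarrow> L2 joint_law (dimu g i) (\<lambda>x. dm_u s x t)) \<Longrightarrow>
      (\<Sum>j<T. \<beta>^j * dm_cost (eq_strat i) j) \<le> (\<Sum>j<T. \<beta>^j * dm_cost s j)
        + \<beta>^T * (\<integral>x. quad_form (ric_M g i) (dm_x s x T) \<partial>joint_law) + c * (real T * \<beta>^T)"
proof -
  obtain c1 where c1: "c1 \<ge> 0"
    "\<And>k t m. m < dimu g i \<Longrightarrow> integrable joint_law (\<lambda>x. (dm_opt t x $ m - dm_finite_opt k t x $ m)\<^sup>2)"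
    "\<And>k t m. m < dimu g i \<Longrightarrow> (\<integral>x. (dm_opt t x $ m - dm_finite_opt k t x $ m)\<^sup>2 \<partial>joint_law) \<le> c1 * \<beta>^Suc k"
    using response_error by blast
  obtain cS where cS: "cS \<ge> 0" "\<And>v. dim_vec v = dimu g i \<Longrightarrow> \<bar>quad_form dm.S v\<bar> \<le> cS * (v \<bullet> v)"
    using quad_form_bound[OF S_symmetric(2)] by blast
  define c where "c = cS * (real (dimu g i) * c1)"
  have c0: "c \<ge> 0" using cS c1 by (simp add: c_def)
  have err: "(\<integral>x. quad_form dm.S (dm_opt t x - dm_finite_opt k t x) \<partial>joint_law) \<le> c * \<beta>^Suc k" for k t
  proof -
    have "(\<integral>x. quad_form dm.S (dm_opt t x - dm_finite_opt k t x) \<partial>joint_law) \<le> (\<integral>x. cS * (\<Sum>m<dimu g i. (dm_opt t x $ m - dm_finite_opt k t x $ m)\<^sup>2) \<partial>joint_law)"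
    proof (rule integral_mono)
      show "integrable joint_law (\<lambda>x. quad_form dm.S (dm_opt t x - dm_finite_opt k t x))"
        by (intro L2_quad_form[OF S_symmetric(2)] L2_minus L2_dm_opt L2_dm_finite_opt)
      show "integrable joint_law (\<lambda>x. cS * (\<Sum>m<dimu g i. (dm_opt t x $ m - dm_finite_opt k t x $ m)\<^sup>2))"
        by (intro integrable_mult_right Bochner_Integration.integrable_sum c1(2)) auto
      show "quad_form dm.S (dm_opt t x - dm_finite_opt k t x) \<le> cS * (\<Sum>m<dimu g i. (dm_opt t x $ m - dm_finite_opt k t x $ m)\<^sup>2)" for x
        using cS(2)[of "dm_opt t x - dm_finite_opt k t x"] by (simp add: sprod_self_eq)
    qed
    also have "\<dots> = cS * (\<Sum>m<dimu g i. \<integral>x. (dm_opt t x $ m - dm_finite_opt k t x $ m)\<^sup>2 \<partial>joint_law)"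
      using c1(2) by (simp add: Bochner_Integration.integral_sum)
    also have "\<dots> \<le> cS * (\<Sum>m<dimu g i. c1 * \<beta>^Suc k)"
      using cS(1) c1(3) by (intro mult_left_mono sum_mono) auto
    also have "\<dots> = c * \<beta>^Suc k" by (simp add: c_def)
    finally show ?thesis .
  qed
  have "(\<Sum>j<T. \<beta>^j * dm_cost (eq_strat i) j) \<le> (\<Sum>j<T. \<beta>^j * dm_cost s j)
        + \<beta>^T * (\<integral>x. quad_form (ric_M g i) (dm_x s x T) \<partial>joint_law) + c * (real T * \<beta>^T)"
    if s: "s \<in> strategies g i" and sq: "\<And>t. t < T \<Longrightarrow> L2 joint_law (dimx g i) (\<lambda>x. dm_x s x t)" "\<And>t. t < T \<Longrightarrow> L2 joint_law (dimu g i) (\<lambda>x. dm_u s x t)" for T s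
  proof -
    let ?r = "\<lambda>j. dm_finite_opt (T - Suc j) j"
    let ?q = "\<lambda>s. \<integral>x. quad_form (ric_M g i) (dm_x s x T) \<partial>joint_law"
    let ?e = "\<lambda>s j. \<integral>x. quad_form dm.S (dm_v s j x - ?r j x) \<partial>joint_law"
    let ?n = "\<lambda>j. \<integral>x. quad_form dm.S (?r j x) \<partial>joint_law"
    have sqT: "L2 joint_law (dimx g i) (\<lambda>x. dm_x s x T)"
      using L2_dm_x_0 L2_dm_x_Suc sq by (cases T) auto
    note es = eq_strat_strategy[OF i]
    have Pe: "(\<integral>x. common_cost T (eq_strat i) x \<partial>joint_law) = (\<Sum>j<T. \<beta>^j * dm_cost (eq_strat i) j) + \<beta>^T * ?q (eq_strat i)
        - (\<Sum>j<T. \<beta>^j * (?e (eq_strat i) j - ?n j))"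
      by (rule common_cost_integral[OF es]) (rule L2_eq_strat)+
    have Ps: "(\<integral>x. common_cost T s x \<partial>joint_law) = (\<Sum>j<T. \<beta>^j * dm_cost s j) + \<beta>^T * ?q s - (\<Sum>j<T. \<beta>^j * (?e s j - ?n j))"
      by (rule common_cost_integral[OF s]) (rule sqT sq; assumption?)+
    have "(\<integral>x. common_cost T (eq_strat i) x \<partial>joint_law) = (\<integral>x. common_cost T s x \<partial>joint_law)"
      by (rule Bochner_Integration.integral_cong[OF refl common_cost_eq[OF es s]])
    then have id: "(\<Sum>j<T. \<beta>^j * dm_cost (eq_strat i) j) + \<beta>^T * ?q (eq_strat i) - (\<Sum>j<T. \<beta>^j * (?e (eq_strat i) j - ?n j))
        = (\<Sum>j<T. \<beta>^j * dm_cost s j) + \<beta>^T * ?q s - (\<Sum>j<T. \<beta>^j * (?e s j - ?n j))"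
      unfolding Pe Ps .
    have b0: "0 \<le> \<beta>^j" for j using dm.beta by simp
    have q0: "0 \<le> ?q (eq_strat i)"
      by (rule Bochner_Integration.integral_nonneg) (use quad_form_nonneg[OF dm.M] dm_dims(1)[OF es] L2_eq_strat in \<open>auto intro!: integral_nonneg_AE\<close>)
    have e0: "0 \<le> ?e s j" for j
      by (rule integral_nonneg_AE, rule AE_I2, rule quad_form_nonneg[OF pos_def_imp_semidef[OF dm.S_of_pos_def[OF dm.M]]]) simp
    have e1: "\<beta>^j * ?e (eq_strat i) j \<le> c * \<beta>^T" if j: "j < T" for j
    proof -
      have "?e (eq_strat i) j = (\<integral>x. quad_form dm.S (dm_opt j x - ?r j x) \<partial>joint_law)"
        by (rule Bochner_Integration.integral_cong[OF refl]) (simp add: dm_v_eq_strat)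
      also have "\<dots> \<le> c * \<beta>^Suc (T - Suc j)" by (rule err)
      finally have "\<beta>^j * ?e (eq_strat i) j \<le> \<beta>^j * (c * \<beta>^Suc (T - Suc j))" by (rule mult_left_mono[OF _ b0])
      also have "\<dots> = c * \<beta>^(j + Suc (T - Suc j))" by (simp add: power_add)
      also have "j + Suc (T - Suc j) = T" using j by simp
      finally show ?thesis .
    qed
    have "(\<Sum>j<T. \<beta>^j * (?e (eq_strat i) j - ?n j)) = (\<Sum>j<T. \<beta>^j * ?e (eq_strat i) j) - (\<Sum>j<T. \<beta>^j * ?n j)"
      and "(\<Sum>j<T. \<beta>^j * (?e s j - ?n j)) = (\<Sum>j<T. \<beta>^j * ?e s j) - (\<Sum>j<T. \<beta>^j * ?n j)"
      by (simp_all add: right_diff_distrib sum_subtractf)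
    moreover have "(\<Sum>j<T. \<beta>^j * ?e (eq_strat i) j) \<le> (\<Sum>j<T. c * \<beta>^T)" by (rule sum_mono) (use e1 in auto)
    moreover have "0 \<le> (\<Sum>j<T. \<beta>^j * ?e s j)" by (intro sum_nonneg mult_nonneg_nonneg b0 e0)
    moreover have "0 \<le> \<beta>^T * ?q (eq_strat i)" by (intro mult_nonneg_nonneg b0 q0)
    ultimately show ?thesis using id by (simp add: algebra_simps)
  qed
  then show ?thesis using that c0 by blast
qed

end

section \<open>Costs in the extended reals\<close>

text \<open>The upper limit is a limit: the subtracted series converges, so \<open>\<infinity> - \<infinity>\<close> does not occur.\<close>

lemma limsup_partial_sums_diff:
  fixes h k :: "nat \<Rightarrow> real"
  assumes h: "\<And>t. h t \<ge> 0" and k: "summable k"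
  shows "limsup (\<lambda>T. ereal (\<Sum>t<T. h t - k t)) = enn2ereal (\<Sum>t. ennreal (h t)) - ereal (suminf k)"
proof -
  have "(\<lambda>T. enn2ereal (\<Sum>t<T. ennreal (h t))) \<longlonglongrightarrow> enn2ereal (\<Sum>t. ennreal (h t))"
    by (intro tendsto_enn2erealI summable_LIMSEQ summableI)
  moreover have "enn2ereal (\<Sum>t<T. ennreal (h t)) = ereal (\<Sum>t<T. h t)" for T
    using h by (simp add: sum_ennreal sum_nonneg enn2ereal_ennreal)
  ultimately have "(\<lambda>T. ereal (\<Sum>t<T. h t)) \<longlonglongrightarrow> enn2ereal (\<Sum>t. ennreal (h t))" by simp
  moreover have "(\<lambda>T. ereal (\<Sum>t<T. k t)) \<longlonglongrightarrow> ereal (suminf k)"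
    using summable_LIMSEQ[OF k] by simp
  ultimately have "(\<lambda>T. ereal (\<Sum>t<T. h t) - ereal (\<Sum>t<T. k t)) \<longlonglongrightarrow> enn2ereal (\<Sum>t. ennreal (h t)) - ereal (suminf k)"
    by (intro tendsto_diff_ereal_general) auto
  then have "(\<lambda>T. ereal (\<Sum>t<T. h t - k t)) \<longlonglongrightarrow> enn2ereal (\<Sum>t. ennreal (h t)) - ereal (suminf k)"
    by (simp add: sum_subtractf)
  then show ?thesis by (intro lim_imp_Limsup) auto
qed

text \<open>The positive part \<open>f\<^sup>+\<close> and the negative part \<open>f\<^sup>-\<close> of \<open>f\<close> satisfy
  \<open>f\<^sup>+ + h = G + f\<^sup>-\<close>, where \<open>f\<^sup>- \<le> h\<close> is integrable, so the integrals can be rearranged.\<close>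

lemma ereal_expectation_diff:
  assumes G: "G \<in> borel_measurable N" and h: "integrable N h" "\<And>x. 0 \<le> h x"
    and f: "AE x in N. f x = enn2ereal (G x) - ereal (h x)"
  shows "ereal_expectation N f = enn2ereal (\<integral>\<^sup>+x. G x \<partial>N) - ereal (\<integral>x. h x \<partial>N)"
proof -
  let ?p = "\<lambda>x. G x - ennreal (h x)" and ?m = "\<lambda>x. ennreal (h x) - G x"
  have hm: "(\<lambda>x. ennreal (h x)) \<in> borel_measurable N" using h(1) by measurable
  have eq: "enn2ereal e - ereal r = enn2ereal e - enn2ereal (ennreal r)" "- (enn2ereal e - ereal r) = enn2ereal (ennreal r) - enn2ereal e"
    if "0 \<le> r" for e r
    using that by (simp_all add: enn2ereal_ennreal minus_ereal_def) (cases "enn2ereal e"; simp)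
  have p: "(\<integral>\<^sup>+x. e2ennreal (f x) \<partial>N) = (\<integral>\<^sup>+x. ?p x \<partial>N)"
    using f by (intro nn_integral_cong_AE) (auto elim!: eventually_mono simp: eq(1)[OF h(2)] e2eenreal_enn2ereal_diff)
  have m: "(\<integral>\<^sup>+x. e2ennreal (- f x) \<partial>N) = (\<integral>\<^sup>+x. ?m x \<partial>N)"
    using f by (intro nn_integral_cong_AE) (auto elim!: eventually_mono simp: eq(2)[OF h(2)] e2eenreal_enn2ereal_diff)
  have pt: "?p x + ennreal (h x) = G x + ?m x" for x
  proof (cases "G x")
    case (real r)
    then show ?thesis using h(2)[of x]
      by (cases "h x \<le> r") (simp_all add: ennreal_minus ennreal_plus[symmetric] ennreal_neg del: ennreal_plus)
  qed (simp add: ennreal_top_minus)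
  have hi: "(\<integral>\<^sup>+x. ennreal (h x) \<partial>N) = ennreal (\<integral>x. h x \<partial>N)" using h by (intro nn_integral_eq_integral) auto
  have "(\<integral>\<^sup>+x. ?p x \<partial>N) + (\<integral>\<^sup>+x. ennreal (h x) \<partial>N) = (\<integral>\<^sup>+x. ?p x + ennreal (h x) \<partial>N)"
    using G hm by (intro nn_integral_add[symmetric]) auto
  also have "\<dots> = (\<integral>\<^sup>+x. G x \<partial>N) + (\<integral>\<^sup>+x. ?m x \<partial>N)"
    unfolding pt using G hm by (intro nn_integral_add) auto
  finally have sum: "(\<integral>\<^sup>+x. ?p x \<partial>N) + ennreal (\<integral>x. h x \<partial>N) = (\<integral>\<^sup>+x. G x \<partial>N) + (\<integral>\<^sup>+x. ?m x \<partial>N)" unfolding hi .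
  have "(\<integral>\<^sup>+x. ?m x \<partial>N) \<le> (\<integral>\<^sup>+x. ennreal (h x) \<partial>N)" by (intro nn_integral_mono diff_le_self_ennreal)
  then have "(\<integral>\<^sup>+x. ?m x \<partial>N) < \<infinity>" unfolding hi by (auto intro: le_less_trans)
  then obtain r where r: "0 \<le> r" "(\<integral>\<^sup>+x. ?m x \<partial>N) = ennreal r" by (cases "\<integral>\<^sup>+x. ?m x \<partial>N") auto
  define c where "c = (\<integral>x. h x \<partial>N)"
  have c: "0 \<le> c" using h(2) by (simp add: c_def)
  show ?thesis
    using sum r c unfolding ereal_expectation_def p m c_def[symmetric]
  proof (cases "\<integral>\<^sup>+x. ?p x \<partial>N")
    case (real e)
    then have "(\<integral>\<^sup>+x. G x \<partial>N) + ennreal r = ennreal (e + c)"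
      using sum r c unfolding c_def[symmetric] by (simp add: ennreal_plus)
    then obtain e' where "0 \<le> e'" "(\<integral>\<^sup>+x. G x \<partial>N) = ennreal e'" by (cases "\<integral>\<^sup>+x. G x \<partial>N") auto
    then show "enn2ereal (\<integral>\<^sup>+x. ?p x \<partial>N) - enn2ereal (\<integral>\<^sup>+x. ?m x \<partial>N) = enn2ereal (\<integral>\<^sup>+x. G x \<partial>N) - ereal c"
      using \<open>(\<integral>\<^sup>+x. G x \<partial>N) + ennreal r = ennreal (e + c)\<close> real r c
      by (simp add: enn2ereal_ennreal ennreal_plus[symmetric] del: ennreal_plus)
  next
    case top
    then have "(\<integral>\<^sup>+x. G x \<partial>N) = \<infinity>" using sum r by (cases "\<integral>\<^sup>+x. G x \<partial>N") (auto simp: ennreal_plus[symmetric] simp del: ennreal_plus)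
    then show "enn2ereal (\<integral>\<^sup>+x. ?p x \<partial>N) - enn2ereal (\<integral>\<^sup>+x. ?m x \<partial>N) = enn2ereal (\<integral>\<^sup>+x. G x \<partial>N) - ereal c"
      using top r by (simp add: enn2ereal_ennreal)
  qed
qed

lemma cross_term_bound:
  fixes c :: real
  assumes "c > 0" "dim_vec (y :: real vec) = dim_vec v"
  shows "2 * \<bar>y \<bullet> v\<bar> \<le> c * (y \<bullet> y) + (v \<bullet> v) / c"
proof -
  \<comment> \<open>Scaling by \<open>r\<close> and \<open>1 / r\<close> leaves the product unchanged.\<close>
  define r where "r = sqrt c"
  have r: "r > 0" "r * r = c" using assms by (simp_all add: r_def)
  have "2 * \<bar>(r \<cdot>\<^sub>v y) \<bullet> ((1 / r) \<cdot>\<^sub>v v)\<bar> \<le> (r \<cdot>\<^sub>v y) \<bullet> (r \<cdot>\<^sub>v y) + ((1 / r) \<cdot>\<^sub>v v) \<bullet> ((1 / r) \<cdot>\<^sub>v v)"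
    by (rule abs_sprod_le) (use assms in simp)
  moreover have "(r \<cdot>\<^sub>v y) \<bullet> ((1 / r) \<cdot>\<^sub>v v) = y \<bullet> v" using assms r(1) by (simp add: linear_simps)
  moreover have "(r \<cdot>\<^sub>v y) \<bullet> (r \<cdot>\<^sub>v y) = c * (y \<bullet> y)" unfolding r(2)[symmetric] by (simp add: linear_simps)
  moreover have "((1 / r) \<cdot>\<^sub>v v) \<bullet> ((1 / r) \<cdot>\<^sub>v v) = (v \<bullet> v) / c" unfolding r(2)[symmetric] by (simp add: linear_simps)
  ultimately show ?thesis by linarith
qed

context sebeu_dm
begin

text \<open>The cross term between the environment variable and the state and control is at most half of the
  coercive part plus a multiple of $|y|^2$.\<close>

lemma stage_coercive:
  obtains \<epsilon> \<kappa> where "\<epsilon> > 0" "\<kappa> \<ge> 0"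
    "\<And>x u y. dim_vec x = dimx g i \<Longrightarrow> dim_vec u = dimu g i \<Longrightarrow> dim_vec y = dimy g \<Longrightarrow>
      \<epsilon> * (x \<bullet> x + u \<bullet> u) \<le> stage_cost g i x u y + \<kappa> * (y \<bullet> y)"
proof -
  obtain cQ where cQ: "cQ > 0" "\<And>x. dim_vec x = dimx g i \<Longrightarrow> x \<bullet> x \<le> cQ * quad_form (Qmat g i) x"
    using pos_def_coercive[OF dm.Q] by blast
  obtain cR where cR: "cR > 0" "\<And>u. dim_vec u = dimu g i \<Longrightarrow> u \<bullet> u \<le> cR * quad_form (Rmat g i) u"
    using pos_def_coercive[OF dm.R] by blast
  obtain cK where cK: "cK \<ge> 0" "\<And>x. dim_vec x = dim_col (Kmat g i) \<Longrightarrow> (Kmat g i *\<^sub>v x) \<bullet> (Kmat g i *\<^sub>v x) \<le> cK * (x \<bullet> x)"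
    using mult_mat_vec_sq_bound by blast
  obtain cL where cL: "cL \<ge> 0" "\<And>x. dim_vec x = dim_col (Lmat g i) \<Longrightarrow> (Lmat g i *\<^sub>v x) \<bullet> (Lmat g i *\<^sub>v x) \<le> cL * (x \<bullet> x)"
    using mult_mat_vec_sq_bound by blast
  define c1 where "c1 = cQ + cR"
  define c2 where "c2 = cK + cL + 1"
  define \<kappa> where "\<kappa> = 4 * c2 * c1"
  have c1: "c1 > 0" and c2: "c2 > 0" and \<kappa>: "\<kappa> > 0" using cQ(1) cR(1) cK(1) cL(1) by (simp_all add: c1_def c2_def \<kappa>_def)
  have "1 / (2 * c1) * (x \<bullet> x + u \<bullet> u) \<le> stage_cost g i x u y + \<kappa> * (y \<bullet> y)"
    if x: "dim_vec x = dimx g i" and u: "dim_vec u = dimu g i" and y: "dim_vec y = dimy g" for x u y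
  proof -
    let ?n = "x \<bullet> x + u \<bullet> u" and ?q = "quad_form (Qmat g i) x + quad_form (Rmat g i) u"
    let ?v = "Kmat g i *\<^sub>v u + Lmat g i *\<^sub>v x"
    have q0: "0 \<le> quad_form (Qmat g i) x" "0 \<le> quad_form (Rmat g i) u"
      using quad_form_nonneg[OF pos_def_imp_semidef[OF dm.Q] x] quad_form_nonneg[OF pos_def_imp_semidef[OF dm.R] u] .
    have "x \<bullet> x \<le> c1 * quad_form (Qmat g i) x"
      using cQ(2)[OF x] mult_nonneg_nonneg[OF less_imp_le[OF cR(1)] q0(1)] by (simp add: c1_def distrib_right)
    moreover have "u \<bullet> u \<le> c1 * quad_form (Rmat g i) u"
      using cR(2)[OF u] mult_nonneg_nonneg[OF less_imp_le[OF cQ(1)] q0(2)] by (simp add: c1_def distrib_right)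
    ultimately have n: "?n \<le> c1 * ?q" by (simp add: distrib_left)
    have "?v \<bullet> ?v \<le> 2 * ((Kmat g i *\<^sub>v u) \<bullet> (Kmat g i *\<^sub>v u)) + 2 * ((Lmat g i *\<^sub>v x) \<bullet> (Lmat g i *\<^sub>v x))"
      by (rule sprod_add_self_le) simp
    also have "\<dots> \<le> 2 * (cK * (u \<bullet> u)) + 2 * (cL * (x \<bullet> x))" using cK(2)[of u] cL(2)[of x] x u by simp
    also have "\<dots> \<le> 2 * (c2 * (u \<bullet> u)) + 2 * (c2 * (x \<bullet> x))"
      using cK(1) cL(1) by (intro add_mono mult_left_mono mult_right_mono) (simp_all add: c2_def)
    finally have v: "?v \<bullet> ?v \<le> 2 * c2 * ?n" by (simp add: algebra_simps)
    have "2 * \<bar>y \<bullet> ?v\<bar> \<le> \<kappa> * (y \<bullet> y) + (?v \<bullet> ?v) / \<kappa>"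
      by (rule cross_term_bound[OF \<kappa>]) (simp add: y)
    also have "(?v \<bullet> ?v) / \<kappa> \<le> 2 * c2 * ?n / \<kappa>" using v \<kappa> by (simp add: divide_right_mono)
    also have "2 * c2 * ?n / \<kappa> = 1 / (2 * c1) * ?n" using c2 c1 by (simp add: \<kappa>_def divide_simps)
    finally have "2 * \<bar>y \<bullet> ?v\<bar> \<le> \<kappa> * (y \<bullet> y) + 1 / (2 * c1) * ?n" by simp
    moreover have "1 / c1 * ?n \<le> ?q" using n c1 by (simp add: field_simps)
    moreover have "1 / c1 * ?n = 1 / (2 * c1) * ?n + 1 / (2 * c1) * ?n" using c1 by (simp add: field_simps)
    ultimately show ?thesis unfolding stage_cost_def by linarith
  qed
  then show ?thesis using that[of "1 / (2 * c1)" \<kappa>] c1 \<kappa> by simp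
qed

end

text \<open>Adding a multiple of $|y_t|^2$ makes the stage costs nonnegative; the total added cost is a
  finite constant that does not depend on the strategy.\<close>

locale sebeu_cost = sebeu_dm +
  fixes \<epsilon> \<kappa> :: real
  assumes eps: "\<epsilon> > 0" and kappa: "\<kappa> \<ge> 0"
    and coercive: "\<And>x u y. dim_vec x = dimx g i \<Longrightarrow> dim_vec u = dimu g i \<Longrightarrow> dim_vec y = dimy g \<Longrightarrow>
      \<epsilon> * (x \<bullet> x + u \<bullet> u) \<le> stage_cost g i x u y + \<kappa> * (y \<bullet> y)"
begin

definition shifted_cost :: "strategy \<Rightarrow> nat \<Rightarrow> outcome \<Rightarrow> real" where
  "shifted_cost s t x = \<beta>^t * (stage_cost g i (dm_x s x t) (dm_u s x t) (snd x t) + \<kappa> * (snd x t \<bullet> snd x t))"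

definition offset :: "(nat \<Rightarrow> real vec) \<Rightarrow> nat \<Rightarrow> real" where
  "offset z t = \<beta>^t * (\<kappa> * (z t \<bullet> z t))"

lemma beta_power: "0 \<le> \<beta>^t"
  using dm.beta by simp

lemma shifted_cost_lower:
  assumes "s \<in> strategies g i" "x \<in> space joint_law"
  shows "\<beta>^t * (\<epsilon> * (dm_x s x t \<bullet> dm_x s x t + dm_u s x t \<bullet> dm_u s x t)) \<le> shifted_cost s t x"
  unfolding shifted_cost_def using coercive[OF dm_dims(1-3)[OF assms]] by (intro mult_left_mono beta_power)

lemma shifted_cost_nonneg:
  assumes "s \<in> strategies g i" "x \<in> space joint_law"
  shows "0 \<le> shifted_cost s t x"
  by (rule order_trans[OF _ shifted_cost_lower[OF assms]])
    (intro mult_nonneg_nonneg beta_power add_nonneg_nonneg less_imp_le[OF eps] sprod_self_nonneg)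

lemma offset_nonneg: "0 \<le> offset z t"
  unfolding offset_def by (intro mult_nonneg_nonneg beta_power kappa sprod_self_nonneg)

lemma shifted_cost_measurable:
  assumes s: "s \<in> strategies g i"
  shows "shifted_cost s t \<in> borel_measurable joint_law"
proof -
  note m = dm_xu_measurable[OF s, folded measurable_joint_law] and mz = L2_measurable[OF L2_z]
  have K: "(\<lambda>x. Kmat g i *\<^sub>v dm_u s x t + Lmat g i *\<^sub>v dm_x s x t) \<in> joint_law \<rightarrow>\<^sub>M vec_borel (dimy g)"
    by (intro measurable_vec_add measurable_mult_mat_vec[OF _ m(1)] measurable_mult_mat_vec[OF _ m(2)]) (auto intro!: carrier_matI)
  show ?thesis
    unfolding shifted_cost_def[abs_def] stage_cost_def
    by (intro borel_measurable_times borel_measurable_const borel_measurable_add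
        measurable_quad_form[OF dm.QR_carrier(1) m(1)] measurable_quad_form[OF dm.QR_carrier(2) m(2)]
        measurable_sprod[OF mz mz] measurable_sprod[OF mz K])
qed

definition shifted_cost_sum :: "strategy \<Rightarrow> outcome \<Rightarrow> ennreal" where
  "shifted_cost_sum s x = (\<Sum>t. ennreal (shifted_cost s t x))"

lemma shifted_cost_sum_measurable: "s \<in> strategies g i \<Longrightarrow> shifted_cost_sum s \<in> borel_measurable joint_law"
  unfolding shifted_cost_sum_def[abs_def] using shifted_cost_measurable by measurable

text \<open>The second moments of the environment variables are bounded, so their discounted sum is integrable.
  On the exceptional null set where it diverges, \<open>k\<close> takes the value 0.\<close>

lemma offset_integral:
  obtains k where "integrable belief k" "\<And>z. 0 \<le> k z" "AE z in belief. summable (offset z) \<and> k z = suminf (offset z)"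
proof -
  obtain c where c: "c \<ge> 0" "\<And>t k. k < dimy g \<Longrightarrow> integrable belief (\<lambda>z. (z t $ k)\<^sup>2)"
    "\<And>t k. k < dimy g \<Longrightarrow> (\<integral>z. (z t $ k)\<^sup>2 \<partial>belief) \<le> c" by (rule belief_second_moments) blast
  have zd: "z t \<bullet> z t = (\<Sum>k<dimy g. (z t $ k)\<^sup>2)" if "z \<in> space belief" for z t
    using seq_borel_dim[of z "dimy g" t] that sets_eq_imp_space_eq[OF sets_belief] by (simp add: sprod_self_eq)
  have int: "integrable belief (\<lambda>z. offset z t)" and le: "(\<integral>z. offset z t \<partial>belief) \<le> \<beta>^t * (\<kappa> * (dimy g * c))" for t
  proof -
    have i: "integrable belief (\<lambda>z. \<beta>^t * (\<kappa> * (\<Sum>k<dimy g. (z t $ k)\<^sup>2)))"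
      by (intro integrable_mult_right Bochner_Integration.integrable_sum c(2)) auto
    then show "integrable belief (\<lambda>z. offset z t)"
      using Bochner_Integration.integrable_cong[of belief belief "\<lambda>z. offset z t" "\<lambda>z. \<beta>^t * (\<kappa> * (\<Sum>k<dimy g. (z t $ k)\<^sup>2))"] zd by (simp add: offset_def)
    have "(\<integral>z. offset z t \<partial>belief) = (\<integral>z. \<beta>^t * (\<kappa> * (\<Sum>k<dimy g. (z t $ k)\<^sup>2)) \<partial>belief)"
      by (rule Bochner_Integration.integral_cong) (simp_all add: offset_def zd)
    also have "\<dots> = \<beta>^t * (\<kappa> * (\<Sum>k<dimy g. \<integral>z. (z t $ k)\<^sup>2 \<partial>belief))"
      using c(2) by (simp add: Bochner_Integration.integral_sum)
    also have "\<dots> \<le> \<beta>^t * (\<kappa> * (\<Sum>k<dimy g. c))"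
      by (intro mult_left_mono beta_power kappa sum_mono c(3)) simp
    finally show "(\<integral>z. offset z t \<partial>belief) \<le> \<beta>^t * (\<kappa> * (dimy g * c))" by simp
  qed
  have om: "(\<lambda>z. offset z t) \<in> borel_measurable belief" for t using int by (rule borel_measurable_integrable)
  have oe: "(\<lambda>z. ennreal (offset z t)) \<in> borel_measurable belief" for t by (rule measurable_compose[OF om measurable_ennreal])
  let ?S = "\<lambda>z. \<Sum>t. ennreal (offset z t)"
  have "(\<integral>\<^sup>+z. ?S z \<partial>belief) = (\<Sum>t. \<integral>\<^sup>+z. ennreal (offset z t) \<partial>belief)"
    by (rule nn_integral_suminf[OF oe])
  also have "\<dots> = (\<Sum>t. ennreal (\<integral>z. offset z t \<partial>belief))"
    using int offset_nonneg by (simp add: nn_integral_eq_integral)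
  also have "\<dots> \<le> (\<Sum>t. ennreal (\<beta>^t * (\<kappa> * (dimy g * c))))"
    using le by (intro suminf_le summableI ennreal_leI)
  also have "\<dots> = ennreal ((1 / (1 - \<beta>)) * (\<kappa> * (dimy g * c)))"
    using dm.beta c(1) kappa by (intro suminf_ennreal_eq sums_mult2 geometric_sums) auto
  finally have fin: "(\<integral>\<^sup>+z. ?S z \<partial>belief) < \<infinity>" by (simp add: le_less_trans)
  have Sm: "?S \<in> borel_measurable belief" by (rule borel_measurable_suminf_order[OF oe])
  have ae: "AE z in belief. ?S z \<noteq> \<infinity>" using nn_integral_PInf_AE[OF Sm] fin by auto
  show ?thesis
  proof (rule that[of "\<lambda>z. enn2real (?S z)"])
    show "AE z in belief. summable (offset z) \<and> enn2real (?S z) = suminf (offset z)"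
      using ae
    proof eventually_elim
      case (elim z)
      have "summable (offset z)" by (rule summable_suminf_not_top[OF offset_nonneg]) (use elim in simp)
      moreover have "?S z = ennreal (suminf (offset z))" using elim by (intro suminf_ennreal offset_nonneg) simp
      moreover have "0 \<le> suminf (offset z)" using calculation(1) offset_nonneg by (rule suminf_nonneg)
      ultimately show ?case by simp
    qed
    show "integrable belief (\<lambda>z. enn2real (?S z))"
    proof (rule integrableI_nonneg)
      show "(\<lambda>z. enn2real (?S z)) \<in> borel_measurable belief" using Sm by measurable
      have "(\<integral>\<^sup>+z. ennreal (enn2real (?S z)) \<partial>belief) = (\<integral>\<^sup>+z. ?S z \<partial>belief)"
        using ae by (intro nn_integral_cong_AE) (auto elim!: eventually_mono simp: less_top)
      then show "(\<integral>\<^sup>+z. ennreal (enn2real (?S z)) \<partial>belief) < \<infinity>" using fin by simp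
    qed simp
  qed simp
qed

text \<open>The costs shifted to be nonnegative may be integrated in any order; the sum of the shifts is
  deducted as a constant.\<close>

lemma expected_cost:
  obtains K where "\<And>s. s \<in> strategies g i \<Longrightarrow>
    ereal_expectation belief (subj_cost g p i s) = enn2ereal (\<integral>\<^sup>+x. shifted_cost_sum s x \<partial>joint_law) - ereal K"
proof -
  interpret M: prob_space noise_law by (rule prob_noise_law)
  interpret Z: prob_space belief by (rule prob_belief)
  interpret Q: prob_space "prob_sp p" by (rule prob_p)
  interpret pair_prob_space noise_law belief by (rule pair_ps)
  obtain k where k: "integrable belief k" "\<And>z. 0 \<le> k z" "AE z in belief. summable (offset z) \<and> k z = suminf (offset z)"
    by (rule offset_integral) blast
  show ?thesis
  proof (rule that[of "\<integral>z. k z \<partial>belief"])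
    fix s assume s: "s \<in> strategies g i"
    have gm: "(\<lambda>x. shifted_cost_sum s x) \<in> borel_measurable (noise_law \<Otimes>\<^sub>M belief)" using shifted_cost_sum_measurable[OF s] by (simp add: joint_law_def)
    have "AE z in belief. subj_cost g p i s z = enn2ereal (\<integral>\<^sup>+q. shifted_cost_sum s (q, z) \<partial>noise_law) - ereal (k z)"
      using k(3) AE_space
    proof eventually_elim
      case (elim z)
      have gz: "(\<lambda>q. shifted_cost_sum s (q, z)) \<in> borel_measurable noise_law"
        by (rule measurable_Pair2'[THEN measurable_compose, OF _ gm]) (rule elim(2))
      have prm: "noise \<in> prob_sp p \<rightarrow>\<^sub>M noise_law" using noise_measurable sets_noise_law by (simp cong: measurable_cong_sets)
      have limsup: "limsup (\<lambda>T. ereal (\<Sum>t<T. \<beta>^t * stage_cost g i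
             (subj_x g i s (init_x p i \<omega>) (\<lambda>t. dist_w p t i \<omega>) z t)
             (subj_u g i s (init_x p i \<omega>) (\<lambda>t. dist_w p t i \<omega>) z t) (z t)))
          = enn2ereal (shifted_cost_sum s (noise \<omega>, z)) - ereal (k z)" if \<omega>: "\<omega> \<in> space (prob_sp p)" for \<omega>
      proof -
        have d: "dim_vec (init_x p j \<omega>) = dimx g j" "dim_vec (dist_w p t j \<omega>) = dimx g j" if "j \<le> nd" for j t
          using prims that \<omega> by (auto simp: primitive_data_def intro!: measurable_vec_dim[of _ "prob_sp p"])
        have x0: "init_x p i \<omega> = sl i (coord Init (noise \<omega>))" and w: "(\<lambda>t. dist_w p t i \<omega>) = dm_w (noise \<omega>, z)"
          using d i_le by (auto simp: noise_def init_X_def dist_W_def slice_vec_stack dm_w_def)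
        have x: "(noise \<omega>, z) \<in> space joint_law"
          using measurable_space[OF prm \<omega>] elim(2) by (simp add: joint_law_def space_pair_measure)
        have eq: "\<beta>^t * stage_cost g i (subj_x g i s (init_x p i \<omega>) (\<lambda>t. dist_w p t i \<omega>) z t)
             (subj_u g i s (init_x p i \<omega>) (\<lambda>t. dist_w p t i \<omega>) z t) (z t) = shifted_cost s t (noise \<omega>, z) - offset z t" for t
          unfolding x0 w by (simp only: shifted_cost_def offset_def dm_x_def dm_u_def fst_conv snd_conv) (simp add: algebra_simps)
        show ?thesis
          unfolding eq using limsup_partial_sums_diff[of "\<lambda>t. shifted_cost s t (noise \<omega>, z)" "offset z", OF shifted_cost_nonneg[OF s x]] elim(1)
          by (simp add: shifted_cost_sum_def)
      qed
      have "subj_cost g p i s z = enn2ereal (\<integral>\<^sup>+\<omega>. shifted_cost_sum s (noise \<omega>, z) \<partial>prob_sp p) - ereal (\<integral>\<omega>. k z \<partial>prob_sp p)"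
        unfolding subj_cost_def
      proof (rule ereal_expectation_diff)
        show "(\<lambda>\<omega>. shifted_cost_sum s (noise \<omega>, z)) \<in> borel_measurable (prob_sp p)"
          by (rule measurable_compose[OF prm gz])
        show "AE \<omega> in prob_sp p. limsup (\<lambda>T. ereal (\<Sum>t<T. \<beta>^t * stage_cost g i
             (subj_x g i s (init_x p i \<omega>) (\<lambda>t. dist_w p t i \<omega>) z t)
             (subj_u g i s (init_x p i \<omega>) (\<lambda>t. dist_w p t i \<omega>) z t) (z t)))
          = enn2ereal (shifted_cost_sum s (noise \<omega>, z)) - ereal (k z)"
          by (rule AE_I2) (rule limsup)
      qed (simp_all add: k(2))
      also have "(\<integral>\<^sup>+\<omega>. shifted_cost_sum s (noise \<omega>, z) \<partial>prob_sp p) = (\<integral>\<^sup>+q. shifted_cost_sum s (q, z) \<partial>distr (prob_sp p) noise_law noise)"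
        by (rule nn_integral_distr[OF prm, symmetric]) (use gz in simp)
      also have "distr (prob_sp p) noise_law noise = noise_law"
        unfolding noise_law_def by (rule distr_cong) simp_all
      finally show ?case by (simp add: Q.prob_space)
    qed
    moreover have "(\<lambda>z. \<integral>\<^sup>+q. shifted_cost_sum s (q, z) \<partial>noise_law) \<in> borel_measurable belief"
      using gm by measurable
    ultimately have "ereal_expectation belief (subj_cost g p i s) = enn2ereal (\<integral>\<^sup>+z. \<integral>\<^sup>+q. shifted_cost_sum s (q, z) \<partial>noise_law \<partial>belief) - ereal (\<integral>z. k z \<partial>belief)"
      using ereal_expectation_diff[OF _ k(1,2)] by blast
    also have "(\<integral>\<^sup>+z. \<integral>\<^sup>+q. shifted_cost_sum s (q, z) \<partial>noise_law \<partial>belief) = (\<integral>\<^sup>+x. shifted_cost_sum s x \<partial>joint_law)"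
      unfolding joint_law_def by (rule nn_integral_snd[of "\<lambda>x. shifted_cost_sum s x", OF gm])
    finally show "ereal_expectation belief (subj_cost g p i s) = enn2ereal (\<integral>\<^sup>+x. shifted_cost_sum s x \<partial>joint_law) - ereal (\<integral>z. k z \<partial>belief)" .
  qed
qed

end

section \<open>Optimality over the infinite horizon\<close>

lemma L2_dominated:
  assumes V: "V \<in> N \<rightarrow>\<^sub>M vec_borel n" and h: "integrable N h"
    and le: "\<And>x. x \<in> space N \<Longrightarrow> V x \<bullet> V x \<le> h x"
  shows "L2 N n V"
proof (rule L2I[OF V])
  fix k assume k: "k < n"
  show "integrable N (\<lambda>x. (V x $ k)\<^sup>2)"
  proof (rule Bochner_Integration.integrable_bound[OF h])
    show "(\<lambda>x. (V x $ k)\<^sup>2) \<in> borel_measurable N"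
      by (intro borel_measurable_power measurable_vec_index[OF V k])
    have "(V x $ k)\<^sup>2 \<le> h x" if x: "x \<in> space N" for x
      using square_index_le_sprod_self[of k "V x", unfolded measurable_vec_dim[OF V x], OF k] le[OF x] by linarith
    then show "AE x in N. norm ((V x $ k)\<^sup>2) \<le> norm (h x)"
      unfolding real_norm_def abs_power2 by (intro AE_I2 order_trans[OF _ abs_ge_self])
  qed
qed

context sebeu_cost
begin

text \<open>This is where coercivity enters: a period of positive weight has finite cost only if state and control are square integrable.\<close>

lemma shifted_cost_integrable_L2:
  assumes s: "s \<in> strategies g i" and int: "integrable joint_law (shifted_cost s t)" and pos: "\<beta>^t > 0"
  shows "L2 joint_law (dimx g i) (\<lambda>x. dm_x s x t)" "L2 joint_law (dimu g i) (\<lambda>x. dm_u s x t)"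
proof -
  note m = dm_xu_measurable[OF s, folded measurable_joint_law]
  have int': "integrable joint_law (\<lambda>x. 1 / (\<beta>^t * \<epsilon>) * shifted_cost s t x)" by (intro integrable_mult_right int)
  have b: "dm_x s x t \<bullet> dm_x s x t + dm_u s x t \<bullet> dm_u s x t \<le> 1 / (\<beta>^t * \<epsilon>) * shifted_cost s t x" if "x \<in> space joint_law" for x
  proof -
    have "\<beta>^t * \<epsilon> * (dm_x s x t \<bullet> dm_x s x t + dm_u s x t \<bullet> dm_u s x t) \<le> shifted_cost s t x"
      using shifted_cost_lower[OF s that, of t] by (simp only: mult.assoc)
    then show ?thesis unfolding times_divide_eq_left mult_1 pos_le_divide_eq[OF mult_pos_pos[OF pos eps]] by (simp only: mult.commute)
  qed
  show "L2 joint_law (dimx g i) (\<lambda>x. dm_x s x t)"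
  proof (rule L2_dominated[OF m(1) int'])
    fix x assume "x \<in> space joint_law"
    from b[OF this] sprod_self_nonneg[of "dm_u s x t"] show "dm_x s x t \<bullet> dm_x s x t \<le> 1 / (\<beta>^t * \<epsilon>) * shifted_cost s t x" by linarith
  qed
  show "L2 joint_law (dimu g i) (\<lambda>x. dm_u s x t)"
  proof (rule L2_dominated[OF m(2) int'])
    fix x assume "x \<in> space joint_law"
    from b[OF this] sprod_self_nonneg[of "dm_x s x t"] show "dm_u s x t \<bullet> dm_u s x t \<le> 1 / (\<beta>^t * \<epsilon>) * shifted_cost s t x" by linarith
  qed
qed

lemma shifted_cost_integral:
  assumes "L2 joint_law (dimx g i) (\<lambda>x. dm_x s x t)" "L2 joint_law (dimu g i) (\<lambda>x. dm_u s x t)"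
  shows "integrable joint_law (shifted_cost s t)"
    "(\<integral>x. shifted_cost s t x \<partial>joint_law) = \<beta>^t * dm_cost s t + \<beta>^t * (\<kappa> * (\<integral>x. snd x t \<bullet> snd x t \<partial>joint_law))"
  unfolding shifted_cost_def[abs_def] dm_cost_def using stage_integrable[OF assms] L2_sprod[OF L2_z L2_z]
  by (simp_all add: distrib_left)

lemma shifted_cost_cost:
  assumes "s \<in> strategies g i" "integrable joint_law (shifted_cost s t)"
  shows "(\<integral>\<^sup>+x. ennreal (shifted_cost s t x) \<partial>joint_law) = ennreal (\<integral>x. shifted_cost s t x \<partial>joint_law)" "0 \<le> (\<integral>x. shifted_cost s t x \<partial>joint_law)"
  using assms by (auto intro!: nn_integral_eq_integral integral_nonneg_AE AE_I2 shifted_cost_nonneg)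

lemma shifted_cost_sum_integral:
  assumes "s \<in> strategies g i"
  shows "(\<integral>\<^sup>+x. shifted_cost_sum s x \<partial>joint_law) = (\<Sum>t. \<integral>\<^sup>+x. ennreal (shifted_cost s t x) \<partial>joint_law)"
  unfolding shifted_cost_sum_def by (rule nn_integral_suminf[OF measurable_compose[OF shifted_cost_measurable[OF assms] measurable_ennreal]])

text \<open>The terminal term at \<open>t\<close> is bounded by the cost in period \<open>t\<close>, which tends to zero when the total
  cost is finite.\<close>

lemma terminal_cost_le:
  assumes s: "s \<in> strategies g i"
    and sq: "L2 joint_law (dimx g i) (\<lambda>x. dm_x s x t)" "L2 joint_law (dimu g i) (\<lambda>x. dm_u s x t)"
    and cM: "cM \<ge> 0" "\<And>x. dim_vec x = dimx g i \<Longrightarrow> \<bar>quad_form (ric_M g i) x\<bar> \<le> cM * (x \<bullet> x)"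
  shows "\<beta>^t * (\<integral>x. quad_form (ric_M g i) (dm_x s x t) \<partial>joint_law) \<le> cM / \<epsilon> * (\<integral>x. shifted_cost s t x \<partial>joint_law)"
proof -
  have Mc: "ric_M g i \<in> carrier_mat (dimx g i) (dimx g i)" using dm.psd_dims[OF dm.M] by blast
  have "\<beta>^t * (\<integral>x. quad_form (ric_M g i) (dm_x s x t) \<partial>joint_law) = (\<integral>x. \<beta>^t * quad_form (ric_M g i) (dm_x s x t) \<partial>joint_law)"
    by simp
  also have "\<dots> \<le> (\<integral>x. cM / \<epsilon> * shifted_cost s t x \<partial>joint_law)"
  proof (rule integral_mono)
    show "integrable joint_law (\<lambda>x. \<beta>^t * quad_form (ric_M g i) (dm_x s x t))"
      by (intro integrable_mult_right L2_quad_form[OF Mc sq(1)])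
    show "integrable joint_law (\<lambda>x. cM / \<epsilon> * shifted_cost s t x)" by (intro integrable_mult_right shifted_cost_integral(1)[OF sq])
    fix x assume x: "x \<in> space joint_law"
    let ?n = "dm_x s x t \<bullet> dm_x s x t"
    have "quad_form (ric_M g i) (dm_x s x t) \<le> cM * ?n" using cM(2)[OF dm_dims(1)[OF s x], of t] by linarith
    then have "\<beta>^t * quad_form (ric_M g i) (dm_x s x t) \<le> \<beta>^t * (cM * ?n)" by (rule mult_left_mono[OF _ beta_power])
    also have "\<dots> = cM / \<epsilon> * (\<beta>^t * (\<epsilon> * ?n))" using eps by simp
    also have "\<dots> \<le> cM / \<epsilon> * (\<beta>^t * (\<epsilon> * (?n + dm_u s x t \<bullet> dm_u s x t)))"
      using cM(1) eps by (intro mult_left_mono beta_power) auto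
    also have "\<dots> \<le> cM / \<epsilon> * shifted_cost s t x"
      using cM(1) eps by (intro mult_left_mono shifted_cost_lower[OF s x]) auto
    finally show "\<beta>^t * quad_form (ric_M g i) (dm_x s x t) \<le> cM / \<epsilon> * shifted_cost s t x" .
  qed
  also have "\<dots> = cM / \<epsilon> * (\<integral>x. shifted_cost s t x \<partial>joint_law)" by simp
  finally show ?thesis .
qed

text \<open>A competitor of infinite cost is no better. For one of finite cost the comparison over finite
  horizons applies, and both of its error terms vanish in the limit. For \<open>\<beta> = 0\<close>, a finite cost
  says nothing about the later periods, and the comparison over one period is used, which then is exact.\<close>

lemma candidate_optimal:
  assumes s: "s \<in> strategies g i"
  shows "(\<integral>\<^sup>+x. shifted_cost_sum (eq_strat i) x \<partial>joint_law) \<le> (\<integral>\<^sup>+x. shifted_cost_sum s x \<partial>joint_law)"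
proof (cases "(\<integral>\<^sup>+x. shifted_cost_sum s x \<partial>joint_law) = \<infinity>")
  case False
  note es = eq_strat_strategy[OF i]
  define r where "r t = (\<integral>x. shifted_cost s t x \<partial>joint_law)" for t
  define r' where "r' t = (\<integral>x. shifted_cost (eq_strat i) t x \<partial>joint_law)" for t
  note int' = shifted_cost_integral(1)[OF L2_eq_strat] and eq' = shifted_cost_integral(2)[OF L2_eq_strat]
  have fin: "(\<Sum>t. \<integral>\<^sup>+x. ennreal (shifted_cost s t x) \<partial>joint_law) \<noteq> \<infinity>" using False unfolding shifted_cost_sum_integral[OF s] .
  have int: "integrable joint_law (shifted_cost s t)" for t
  proof (rule integrableI_nonneg)
    show "(\<integral>\<^sup>+x. ennreal (shifted_cost s t x) \<partial>joint_law) < \<infinity>"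
      using ennreal_suminf_lessD[of "\<lambda>t. \<integral>\<^sup>+x. ennreal (shifted_cost s t x) \<partial>joint_law" \<infinity> t] fin by (simp add: less_top)
  qed (use shifted_cost_measurable[OF s] shifted_cost_nonneg[OF s] in auto)
  have J: "(\<integral>\<^sup>+x. shifted_cost_sum s x \<partial>joint_law) = (\<Sum>t. ennreal (r t))" and J': "(\<integral>\<^sup>+x. shifted_cost_sum (eq_strat i) x \<partial>joint_law) = (\<Sum>t. ennreal (r' t))"
    unfolding shifted_cost_sum_integral[OF s] shifted_cost_sum_integral[OF es] r_def r'_def shifted_cost_cost(1)[OF s int] shifted_cost_cost(1)[OF es int'] by (rule refl)+
  have r0: "0 \<le> r t" "0 \<le> r' t" for t unfolding r_def r'_def by (rule shifted_cost_cost(2)[OF s int] shifted_cost_cost(2)[OF es int'])+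
  have fin2: "(\<Sum>t. ennreal (r t)) \<noteq> \<infinity>" using False unfolding J .
  have r_sum: "summable r" by (rule summable_suminf_not_top) (use r0 fin2 in simp_all)
  obtain c where c: "c \<ge> 0"
    "\<And>T s. s \<in> strategies g i \<Longrightarrow> (\<And>t. t < T \<Longrightarrow> L2 joint_law (dimx g i) (\<lambda>x. dm_x s x t)) \<Longrightarrow>
      (\<And>t. t < T \<Longrightarrow> L2 joint_law (dimu g i) (\<lambda>x. dm_u s x t)) \<Longrightarrow>
      (\<Sum>j<T. \<beta>^j * dm_cost (eq_strat i) j) \<le> (\<Sum>j<T. \<beta>^j * dm_cost s j)
        + \<beta>^T * (\<integral>x. quad_form (ric_M g i) (dm_x s x T) \<partial>joint_law) + c * (real T * \<beta>^T)"
    by (rule finite_horizon_optimality) blast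
  have step: "(\<Sum>j<T. r' j) \<le> (\<Sum>j<T. r j) + \<beta>^T * (\<integral>x. quad_form (ric_M g i) (dm_x s x T) \<partial>joint_law) + c * (real T * \<beta>^T)"
    if pos: "\<And>t. t < T \<Longrightarrow> \<beta>^t > 0" for T
  proof -
    note sq = shifted_cost_integrable_L2[OF s int pos]
    let ?e = "\<lambda>t. \<beta>^t * (\<kappa> * (\<integral>x. snd x t \<bullet> snd x t \<partial>joint_law))"
    have "(\<Sum>j<T. r j) = (\<Sum>j<T. \<beta>^j * dm_cost s j) + (\<Sum>j<T. ?e j)"
      unfolding r_def sum.distrib[symmetric] by (rule sum.cong[OF refl]) (rule shifted_cost_integral(2)[OF sq]; simp)
    moreover have "(\<Sum>j<T. r' j) = (\<Sum>j<T. \<beta>^j * dm_cost (eq_strat i) j) + (\<Sum>j<T. ?e j)"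
      unfolding r'_def eq' by (rule sum.distrib)
    moreover note c(2)[OF s sq, of T]
    ultimately show ?thesis by linarith
  qed
  show ?thesis
  proof (cases "\<beta> = 0")
    case True
    have z: "r t = 0" "r' t = 0" if "t \<notin> {0}" for t
      using that True by (simp_all add: r_def r'_def shifted_cost_def)
    have "r' 0 \<le> r 0" using step[of 1] True by simp
    moreover have "(\<Sum>t. ennreal (r t)) = ennreal (r 0)" "(\<Sum>t. ennreal (r' t)) = ennreal (r' 0)"
      using suminf_finite[of "{0}" "\<lambda>t. ennreal (r t)"] suminf_finite[of "{0}" "\<lambda>t. ennreal (r' t)"] z by simp_all
    ultimately show ?thesis unfolding J J' by (simp add: ennreal_leI)
  next
    case False
    then have pos: "\<beta>^t > 0" for t using dm.beta by simp
    note sq = shifted_cost_integrable_L2[OF s int pos]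
    obtain cM where cM: "cM \<ge> 0" "\<And>x. dim_vec x = dimx g i \<Longrightarrow> \<bar>quad_form (ric_M g i) x\<bar> \<le> cM * (x \<bullet> x)"
      using quad_form_bound[of "ric_M g i" "dimx g i"] dm.psd_dims[OF dm.M] by blast
    have step2: "(\<Sum>j<T. r' j) \<le> (\<Sum>j<T. r j) + cM / \<epsilon> * r T + c * (real T * \<beta>^T)" for T
      using step[of T, OF pos] terminal_cost_le[OF s sq cM, of T] unfolding r_def by linarith
    have "(\<lambda>T. (\<Sum>j<T. r j) + cM / \<epsilon> * r T + c * (real T * \<beta>^T)) \<longlonglongrightarrow> suminf r + cM / \<epsilon> * 0 + c * 0"
      using dm.beta by (intro tendsto_add tendsto_mult tendsto_const summable_LIMSEQ summable_LIMSEQ_zero r_sum powser_times_n_limit_0) simp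
    then have lim: "(\<lambda>T. (\<Sum>j<T. r j) + cM / \<epsilon> * r T + c * (real T * \<beta>^T)) \<longlonglongrightarrow> suminf r" by simp
    have le: "(\<Sum>j<T0. r' j) \<le> suminf r" for T0
    proof (rule LIMSEQ_le_const[OF lim], intro exI allI impI)
      fix T assume "T0 \<le> T"
      then have "(\<Sum>j<T0. r' j) \<le> (\<Sum>j<T. r' j)" by (intro sum_mono2) (use r0 in auto)
      then show "(\<Sum>j<T0. r' j) \<le> (\<Sum>j<T. r j) + cM / \<epsilon> * r T + c * (real T * \<beta>^T)" using step2[of T] by linarith
    qed
    have r'_sum: "summable r'" by (rule summableI_nonneg_bounded[OF r0(2) le])
    have "suminf r' \<le> suminf r" by (rule suminf_le_const[OF r'_sum le])
    then show ?thesis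
      unfolding J J' suminf_ennreal_eq[OF r0(1) summable_sums[OF r_sum]] suminf_ennreal_eq[OF r0(2) summable_sums[OF r'_sum]]
      by (rule ennreal_leI)
  qed
qed simp

end

lemma (in sebeu_dm) candidate_best_response:
  assumes s: "s \<in> strategies g i"
  shows "ereal_expectation belief (subj_cost g p i (eq_strat i)) \<le> ereal_expectation belief (subj_cost g p i s)"
proof -
  obtain \<epsilon> \<kappa> where c: "\<epsilon> > 0" "\<kappa> \<ge> 0"
    "\<And>x u y. dim_vec x = dimx g i \<Longrightarrow> dim_vec u = dimu g i \<Longrightarrow> dim_vec y = dimy g \<Longrightarrow>
      \<epsilon> * (x \<bullet> x + u \<bullet> u) \<le> stage_cost g i x u y + \<kappa> * (y \<bullet> y)"
    by (rule stage_coercive) blast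
  interpret sebeu_cost g p a b P Xbar ybar xibar Wbar est i \<epsilon> \<kappa>
    by unfold_locales (use c in auto)
  obtain K where K: "\<And>s. s \<in> strategies g i \<Longrightarrow>
    ereal_expectation belief (subj_cost g p i s) = enn2ereal (\<integral>\<^sup>+x. shifted_cost_sum s x \<partial>joint_law) - ereal K"
    by (rule expected_cost) blast
  show ?thesis
    unfolding K[OF s] K[OF eq_strat_strategy[OF i]]
    by (rule ereal_minus_mono) (use candidate_optimal[OF s] in \<open>simp_all add: less_eq_ennreal.rep_eq\<close>)
qed

section \<open>The equilibrium\<close>

theorem theorem3p2p3:
  fixes g :: lq_game and p :: "'w primitives"
    and a :: "nat \<Rightarrow> real mat" and b :: "nat \<Rightarrow> real vec"
    and P :: "'v measure"
    and Xbar ybar xibar Wbar :: "nat \<Rightarrow> 'v \<Rightarrow> real vec"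
    and est :: "nat \<Rightarrow> (nat \<Rightarrow> real vec) \<Rightarrow> real vec"
  assumes game: "lq_game_data g"
    and prims: "primitive_data g p"
    and stable_env: "schur_stable (Amat g 0)"
    and stabilizable: "\<forall>i\<in>{1..nDM g}. stabilizable (Amat g i) (Bmat g i)"
    and indep: "primitives_independent g p"
    and moments: "primitives_second_moments g p"
    and ident: "primitives_identically_distributed g p"
    and a_dim: "\<forall>t. a t \<in> carrier_mat (dimy g) (dimX g)"
    and b_dim: "\<forall>t. b t \<in> carrier_vec (dimy g)"
    and sys_unique: "\<forall>X0\<in>carrier_vec (dimX g). \<exists>!y. lin_sys_solution g p X0 y"
    and sys_affine: "\<forall>X0\<in>carrier_vec (dimX g). \<forall>y. lin_sys_solution g p X0 y \<longrightarrow> (\<forall>t. y t = a t *\<^sub>v X0 + b t)"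
    and a_bounded: "\<exists>c. \<forall>t. \<forall>k<dimy g. \<forall>l<dimX g. \<bar>a t $$ (k, l)\<bar> \<le> c"
    and b_bounded: "\<exists>c. \<forall>t. \<forall>k<dimy g. \<bar>b t $ k\<bar> \<le> c"
    and aux: "aux_process g p a b P Xbar ybar xibar Wbar"
    and estimator: "state_estimator g P Xbar ybar est"
    and y_bounded: "(SUP t. \<integral>\<^sup>+\<omega>. ennreal (ybar t \<omega> \<bullet> ybar t \<omega>) \<partial>P) < \<infinity>"
  shows "sebeu g p (\<lambda>i t x u y. opt_F g i *\<^sub>v x t + lim_G g i a *\<^sub>v est t y + lim_H g p i b)"
proof -
  interpret sebeu_setting g p a b P Xbar ybar xibar Wbar est
    by unfold_locales fact+
  have "sebeu g p eq_strat"
    unfolding sebeu_def play_law_eq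
  proof (intro conjI ballI exI[of _ "\<lambda>_. belief"])
    fix i assume i: "i \<in> {1..nDM g}"
    show "eq_strat i \<in> strategies g i" by (rule eq_strat_strategy[OF i])
    show "belief \<in> beliefs g" using prob_belief sets_belief by (simp add: beliefs_def)
    interpret sebeu_dm g p a b P Xbar ybar xibar Wbar est i
      by unfold_locales (rule i)
    fix s' assume "s' \<in> strategies g i"
    then show "ereal_expectation belief (subj_cost g p i (eq_strat i)) \<le> ereal_expectation belief (subj_cost g p i s')"
      by (rule candidate_best_response)
  qed simp
  then show ?thesis unfolding eq_strat_def[abs_def] .
qed

end
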